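(* Let $A=\mathcal{A}(E,\sigma)$ be a $3$-dimensional non-exceptional standard AS-regular algebra. If $\sigma^6\neq{\rm id}$ or $\sigma^2={\rm id}$, then $Z(E,\sigma)=M(E,\sigma)$, and consequently ${\rm Twist}_{\rm alg}(A)={\rm Twist}(A)$.
   Context: $k$ is an algebraically closed field of characteristic zero; graded algebras are $\mathbb{N}$-graded $k$-algebras. Twists. A twisting system on a graded algebra $A$ is a family $\theta=\{\theta_n\}_{n\in\mathbb{Z}}$ of graded $k$-linear automorphisms of $A$ with $\theta_n(a\,\theta_m(b))=\theta_n(a)\,\theta_{n+m}(b)$ for all $l,m,n$, $a\in A_m$, $b\in A_l$. $A^\theta$ is $A$ with multiplication $a\ast b=a\,\theta_m(b)$ ($a\in A_m$). $\theta$ is algebraic if $\theta_{m+n}=\theta_m\circ\theta_n$ for all $m,n$. ${\rm Twist}(A)$ is the set of isomorphism classes of graded algebras $A^\theta$ for all twisting systems $\theta$; ${\rm Twist}_{\rm alg}(A)$ is the set of isomorphism classes of $A^\theta$ for algebraic $\theta$ with $\theta_0={\rm id}_A$ (i.e. $\theta_n=\phi^n$ for a graded algebra automorphism $\phi$ of $A$). For a projective variety $E\subset\mathbb{P}^2$ (reduced, not necessarily irreducible) and $\sigma\in{\rm Aut}_kE$: ${\rm Aut}_k(E\uparrow\mathbb{P}^2)=\{\tau\in{\rm Aut}_kE\mid\tau=\overline{\tau}|_E\text{ for some }\overline{\tau}\in{\rm Aut}_k\mathbb{P}^2\}$; ${\rm Aut}_k(\mathbb{P}^2\downarrow E)=\{\tau\in{\rm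 Aut}_k\mathbb{P}^2\mid\tau|_E\in{\rm Aut}_kE\}$; $Z(E,\sigma)=\{\tau\in{\rm Aut}_k(\mathbb{P}^2\downarrow E)\mid\sigma\tau|_E\sigma^{-1}=\tau|_E\}$; $M(E,\sigma)=\{\tau\in{\rm Aut}_k(\mathbb{P}^2\downarrow E)\mid(\tau|_E\sigma)^i\sigma^{-i}\in{\rm Aut}_k(E\uparrow\mathbb{P}^2)\ \forall i\in\mathbb{Z}\}$. $\mathcal{A}(E,\sigma)$ denotes $k\langle x,y,z\rangle/(R)$, where $R$ is the space of degree-two elements $g$ (viewed as bilinear forms) with $g(p,\sigma(p))=0$ for all $p\in E$. The $3$-dimensional standard AS-regular algebras are the algebras $\mathcal{A}(E,\sigma)$ for the following pairs ($\varepsilon$ a primitive cube root of unity): - Type P: $E=\mathbb{P}^2$, $\sigma={\rm id}$. - Type S ($\alpha^3\neq0,1$): $E=\mathcal{V}(x)\cup\mathcal{V}(y)\cup\mathcal{V}(z)$, $\sigma(0,b,c)=(0,b,\alpha c)$, $\sigma(a,0,c)=(\alpha a,0,c)$, $\sigma(a,b,0)=(a,\alpha b,0)$. - Type S' ($\alpha^3\neq0,1$, $\lambda=\frac{\alpha^3-1}{\alpha}$): $E=\mathcal{V}(x)\cup\mathcal{V}(x^2-\lambda yz)$, $\sigma(0,b,c)=(0,b,\alpha c)$ on $\mathcal{V}(x)$, $\sigma(a,b,c)=(a,\alpha b,\alpha^{-1}c)$ on $\mathcal{V}(x^2-\lambda yz)$. - Type T: $E=\mathcal{V}(x+y)\cup\mathcal{V}(\varepsilon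 x+y)\cup\mathcal{V}(\varepsilon^2x+y)$, $\sigma(a,-a,c)=(a,-a,a+c)$, $\sigma(a,-\varepsilon a,c)=(a,-\varepsilon a,\varepsilon^2a+c)$, $\sigma(a,-\varepsilon^2a,c)=(a,-\varepsilon^2a,\varepsilon a+c)$. - Type T': $E=\mathcal{V}(x)\cup\mathcal{V}(y^2-xz)$, $\sigma(0,b,c)=(0,b,b+c)$ on $\mathcal{V}(x)$, $\sigma(a,b,c)=(a,-a+b,a-2b+c)$ on $\mathcal{V}(y^2-xz)$. - Type NC ($\alpha^3\neq0,1$, $\lambda=\frac{\alpha^3-1}{\alpha}$): $E=\mathcal{V}(x^3+y^3-\lambda xyz)$, $\sigma(a,b,c)=(a,\alpha b,-\frac{a^2}{b}+\alpha^2c)$ for $b\neq0$, $\sigma(0,0,1)=(0,0,1)$. - Type CC: $E=\mathcal{V}(x^3-y^2z)$, $\sigma(a,b,c)=(a-b,b,-3\frac{a^2}{b}+3a-b+c)$ for $b\neq0$, $\sigma(0,0,1)=(0,0,1)$. - Type EC: $E=\mathcal{V}(x^3+y^3+z^3-3\lambda xyz)$, $\lambda^3\neq1$, an elliptic curve with zero element $o=(1,-1,0)$, and $\sigma=\sigma_p$ the translation $q\mapsto p+q$ by a point $p=(\alpha,\beta,\gamma)\in E$ with $\alpha\beta\gamma\neq0$ (i.e. $3p\neq o$). By convention $\lambda=0$ when $j(E)=0$ and $\lambda=1+\sqrt3$ when $j(E)=12^3$. Two graded algebras are graded Morita equivalent if their categories of graded right modules are equivalent. A $3$-dimensional quadratic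 AS-regular algebra is exceptional if it is graded Morita equivalent to $\mathcal{A}(E_0,\sigma_p)$, where $E_0=\mathcal{V}(x^3+y^3+z^3)$ and $p\in\mathcal{E}=\{(a,b,c)\in E_0\mid a^9=b^9=c^9\}$; otherwise it is non-exceptional. *)

theory Defs
  imports
    "HOL-Analysis.Analysis"
    "HOL-Algebra.Bij"
    "HOL-Algebra.Module"
    "HOL-Algebra.QuotRing"
    "HOL-Library.Poly_Mapping"
    "HOL-Computational_Algebra.Polynomial"
begin

section \<open>The projective plane and its subvarieties\<close>

text \<open>A point of the projective plane is the set of its homogeneous coordinate vectors.
  The zero vector is not excluded by \<open>pnt\<close>; it is excluded by \<open>P2\<close> and by \<open>locus\<close>.\<close>

definition proj :: "('k::field)^3 \<Rightarrow> ('k^3) set" where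
  "proj v = {c *s v | c. c \<noteq> 0}"

abbreviation pnt :: "'k::field \<Rightarrow> 'k \<Rightarrow> 'k \<Rightarrow> ('k^3) set" where
  "pnt a b c \<equiv> proj (vector [a, b, c])"

definition P2 :: "(('k::field)^3) set set" where
  "P2 = {proj v | v. v \<noteq> 0}"

definition locus :: "('k::field \<Rightarrow> 'k \<Rightarrow> 'k \<Rightarrow> 'k) \<Rightarrow> ('k^3) set set" where
  "locus F = {proj v | v. v \<noteq> 0 \<and> F (v $ 1) (v $ 2) (v $ 3) = 0}"

text \<open>Ternary forms of degree \<open>d\<close>, as functions (the field will be infinite).\<close>

definition form :: "nat \<Rightarrow> (('k::field)^3 \<Rightarrow> 'k) \<Rightarrow> bool" where
  "form d f \<longleftrightarrow> (\<exists>c. \<forall>v. f v = (\<Sum>i\<le>d. \<Sum>j\<le>d - i.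
      c i j * (v $ 1) ^ i * (v $ 2) ^ j * (v $ 3) ^ (d - i - j)))"

text \<open>Around each point there is a principal open set \<open>G \<noteq> 0\<close> of \<open>X\<close> on which the map is given
  by three forms of the same degree without common zero there.  The target carries the reduced
  structure, so no condition on it beyond the set-theoretic one is needed.\<close>

definition regular_map ::
  "(('k::field)^3) set set \<Rightarrow> (('k^3) set \<Rightarrow> ('k^3) set) \<Rightarrow> bool" where
  "regular_map X f \<longleftrightarrow> (\<forall>p\<in>X. \<exists>d F e G.
      (\<forall>i. form d (\<lambda>v. (F v :: 'k^3) $ i)) \<and> form e G \<and> (\<forall>v\<in>p. G v \<noteq> 0) \<and>
      (\<forall>v. v \<noteq> 0 \<and> proj v \<in> X \<and> G v \<noteq> 0 \<longrightarrow> F v \<noteq> 0 \<and> f (proj v) = proj (F v)))"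

definition isomorphic_varieties :: "(('k::field)^3) set set \<Rightarrow> ('k^3) set set \<Rightarrow> bool" where
  "isomorphic_varieties X Y \<longleftrightarrow>
     (\<exists>f. bij_betw f X Y \<and> regular_map X f \<and> regular_map Y (inv_into X f))"

text \<open>Automorphisms are extensional functions, and the group structure is that of \<open>BijGroup\<close>.\<close>

definition Aut :: "(('k::field)^3) set set \<Rightarrow> (('k^3) set \<Rightarrow> ('k^3) set) set" where
  "Aut E = {f \<in> Bij E. regular_map E f \<and> regular_map E (inv_into E f)}"

definition Aut_up :: "(('k::field)^3) set set \<Rightarrow> (('k^3) set \<Rightarrow> ('k^3) set) set" where
  "Aut_up E = {\<tau> \<in> Aut E. \<exists>\<tau>'\<in>Aut P2. \<tau> = restrict \<tau>' E}"

definition Aut_down :: "(('k::field)^3) set set \<Rightarrow> (('k^3) set \<Rightarrow> ('k^3) set) set" where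
  "Aut_down E = {\<tau> \<in> Aut P2. restrict \<tau> E \<in> Aut E}"

definition Z_set :: "(('k::field)^3) set set \<Rightarrow> (('k^3) set \<Rightarrow> ('k^3) set)
    \<Rightarrow> (('k^3) set \<Rightarrow> ('k^3) set) set" where
  "Z_set E \<sigma> = {\<tau> \<in> Aut_down E.
     \<sigma> \<otimes>\<^bsub>BijGroup E\<^esub> restrict \<tau> E \<otimes>\<^bsub>BijGroup E\<^esub> inv\<^bsub>BijGroup E\<^esub> \<sigma> = restrict \<tau> E}"

definition M_set :: "(('k::field)^3) set set \<Rightarrow> (('k^3) set \<Rightarrow> ('k^3) set)
    \<Rightarrow> (('k^3) set \<Rightarrow> ('k^3) set) set" where
  "M_set E \<sigma> = {\<tau> \<in> Aut_down E. \<forall>i::int.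
     (restrict \<tau> E \<otimes>\<^bsub>BijGroup E\<^esub> \<sigma>) [^]\<^bsub>BijGroup E\<^esub> i
       \<otimes>\<^bsub>BijGroup E\<^esub> (\<sigma> [^]\<^bsub>BijGroup E\<^esub> (- i)) \<in> Aut_up E}"


section \<open>Elliptic curves in Hesse form\<close>

text \<open>\<open>cuts_line F p q r\<close>: some line meets the curve \<open>F = 0\<close> exactly in the divisor \<open>p + q + r\<close>.
  In coordinates \<open>(s, t)\<close> on the line, the restriction of \<open>F\<close> is a nonzero multiple of the
  product of the linear forms vanishing at the three points.\<close>

definition cuts_line :: "('k::field \<Rightarrow> 'k \<Rightarrow> 'k \<Rightarrow> 'k)
    \<Rightarrow> ('k^3) set \<Rightarrow> ('k^3) set \<Rightarrow> ('k^3) set \<Rightarrow> bool" where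
  "cuts_line F p q r \<longleftrightarrow> {p, q, r} \<subseteq> P2 \<and>
     (\<exists>u v s1 t1 s2 t2 s3 t3 c. (\<forall>s t. s *s u + t *s v = 0 \<longrightarrow> s = 0 \<and> t = 0) \<and> c \<noteq> 0 \<and>
        p = proj (s1 *s u + t1 *s v) \<and> q = proj (s2 *s u + t2 *s v) \<and>
        r = proj (s3 *s u + t3 *s v) \<and>
        (\<forall>s t. let w = s *s u + t *s v in F (w $ 1) (w $ 2) (w $ 3) =
           c * (s * t1 - t * s1) * (s * t2 - t * s2) * (s * t3 - t * s3)))"

text \<open>The chord-tangent group law of a smooth cubic with zero element \<open>e\<close>.\<close>

definition cubic_add :: "('k::field \<Rightarrow> 'k \<Rightarrow> 'k \<Rightarrow> 'k)
    \<Rightarrow> ('k^3) set \<Rightarrow> ('k^3) set \<Rightarrow> ('k^3) set \<Rightarrow> ('k^3) set" where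
  "cubic_add F e p q = (THE r. \<exists>w. cuts_line F p q w \<and> cuts_line F e w r)"

definition hesse :: "'k::field \<Rightarrow> 'k \<Rightarrow> 'k \<Rightarrow> 'k \<Rightarrow> 'k" where
  "hesse l x y z = x ^ 3 + y ^ 3 + z ^ 3 - 3 * l * x * y * z"

definition translation :: "'k::field \<Rightarrow> ('k^3) set \<Rightarrow> (('k^3) set \<Rightarrow> ('k^3) set)" where
  "translation l p = restrict (cubic_add (hesse l) (pnt 1 (-1) 0) p) (locus (hesse l))"

text \<open>The \<open>j\<close>-invariant, as a relation, read off any isomorphic Weierstrass cubic.\<close>

definition has_j_invariant :: "(('k::field)^3) set set \<Rightarrow> 'k \<Rightarrow> bool" where
  "has_j_invariant E J \<longleftrightarrow> (\<exists>a b. 4 * a ^ 3 + 27 * b ^ 2 \<noteq> 0 \<and>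
     isomorphic_varieties E (locus (\<lambda>x y z. y ^ 2 * z - x ^ 3 - a * x * z ^ 2 - b * z ^ 3)) \<and>
     J = 1728 * (4 * a ^ 3) / (4 * a ^ 3 + 27 * b ^ 2))"


section \<open>The standard pairs\<close>

definition type_P :: "(('k::field)^3) set set \<Rightarrow> (('k^3) set \<Rightarrow> ('k^3) set) \<Rightarrow> bool" where
  "type_P E \<sigma> \<longleftrightarrow> E = P2 \<and> \<sigma> = (\<lambda>p\<in>E. p)"

definition type_S :: "(('k::field)^3) set set \<Rightarrow> (('k^3) set \<Rightarrow> ('k^3) set) \<Rightarrow> bool" where
  "type_S E \<sigma> \<longleftrightarrow> \<sigma> \<in> extensional E \<and> (\<exists>\<alpha>. \<alpha> ^ 3 \<noteq> 0 \<and> \<alpha> ^ 3 \<noteq> 1 \<and>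
     E = locus (\<lambda>x y z. x) \<union> locus (\<lambda>x y z. y) \<union> locus (\<lambda>x y z. z) \<and>
     (\<forall>b c. pnt 0 b c \<in> E \<longrightarrow> \<sigma> (pnt 0 b c) = pnt 0 b (\<alpha> * c)) \<and>
     (\<forall>a c. pnt a 0 c \<in> E \<longrightarrow> \<sigma> (pnt a 0 c) = pnt (\<alpha> * a) 0 c) \<and>
     (\<forall>a b. pnt a b 0 \<in> E \<longrightarrow> \<sigma> (pnt a b 0) = pnt a (\<alpha> * b) 0))"

definition type_S' :: "(('k::field)^3) set set \<Rightarrow> (('k^3) set \<Rightarrow> ('k^3) set) \<Rightarrow> bool" where
  "type_S' E \<sigma> \<longleftrightarrow> \<sigma> \<in> extensional E \<and> (\<exists>\<alpha> l. \<alpha> ^ 3 \<noteq> 0 \<and> \<alpha> ^ 3 \<noteq> 1 \<and> l = (\<alpha> ^ 3 - 1) / \<alpha> \<and>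
     E = locus (\<lambda>x y z. x) \<union> locus (\<lambda>x y z. x ^ 2 - l * y * z) \<and>
     (\<forall>b c. pnt 0 b c \<in> locus (\<lambda>x y z. x) \<longrightarrow> \<sigma> (pnt 0 b c) = pnt 0 b (\<alpha> * c)) \<and>
     (\<forall>a b c. pnt a b c \<in> locus (\<lambda>x y z. x ^ 2 - l * y * z) \<longrightarrow>
        \<sigma> (pnt a b c) = pnt a (\<alpha> * b) (inverse \<alpha> * c)))"

definition type_T :: "(('k::field)^3) set set \<Rightarrow> (('k^3) set \<Rightarrow> ('k^3) set) \<Rightarrow> bool" where
  "type_T E \<sigma> \<longleftrightarrow> \<sigma> \<in> extensional E \<and> (\<exists>\<epsilon>. \<epsilon> ^ 3 = 1 \<and> \<epsilon> \<noteq> 1 \<and>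
     E = locus (\<lambda>x y z. x + y) \<union> locus (\<lambda>x y z. \<epsilon> * x + y) \<union> locus (\<lambda>x y z. \<epsilon> ^ 2 * x + y) \<and>
     (\<forall>a c. pnt a (- a) c \<in> E \<longrightarrow> \<sigma> (pnt a (- a) c) = pnt a (- a) (a + c)) \<and>
     (\<forall>a c. pnt a (- \<epsilon> * a) c \<in> E \<longrightarrow>
        \<sigma> (pnt a (- \<epsilon> * a) c) = pnt a (- \<epsilon> * a) (\<epsilon> ^ 2 * a + c)) \<and>
     (\<forall>a c. pnt a (- (\<epsilon> ^ 2) * a) c \<in> E \<longrightarrow>
        \<sigma> (pnt a (- (\<epsilon> ^ 2) * a) c) = pnt a (- (\<epsilon> ^ 2) * a) (\<epsilon> * a + c)))"

definition type_T' :: "(('k::field)^3) set set \<Rightarrow> (('k^3) set \<Rightarrow> ('k^3) set) \<Rightarrow> bool" where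
  "type_T' E \<sigma> \<longleftrightarrow> \<sigma> \<in> extensional E \<and>
     E = locus (\<lambda>x y z. x) \<union> locus (\<lambda>x y z. y ^ 2 - x * z) \<and>
     (\<forall>b c. pnt 0 b c \<in> locus (\<lambda>x y z. x) \<longrightarrow> \<sigma> (pnt 0 b c) = pnt 0 b (b + c)) \<and>
     (\<forall>a b c. pnt a b c \<in> locus (\<lambda>x y z. y ^ 2 - x * z) \<longrightarrow>
        \<sigma> (pnt a b c) = pnt a (- a + b) (a - 2 * b + c))"

definition type_NC :: "(('k::field)^3) set set \<Rightarrow> (('k^3) set \<Rightarrow> ('k^3) set) \<Rightarrow> bool" where
  "type_NC E \<sigma> \<longleftrightarrow> \<sigma> \<in> extensional E \<and> (\<exists>\<alpha> l. \<alpha> ^ 3 \<noteq> 0 \<and> \<alpha> ^ 3 \<noteq> 1 \<and> l = (\<alpha> ^ 3 - 1) / \<alpha> \<and>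
     E = locus (\<lambda>x y z. x ^ 3 + y ^ 3 - l * x * y * z) \<and>
     (\<forall>a b c. pnt a b c \<in> E \<and> b \<noteq> 0 \<longrightarrow>
        \<sigma> (pnt a b c) = pnt a (\<alpha> * b) (- (a ^ 2 / b) + \<alpha> ^ 2 * c)) \<and>
     \<sigma> (pnt 0 0 1) = pnt 0 0 1)"

definition type_CC :: "(('k::field)^3) set set \<Rightarrow> (('k^3) set \<Rightarrow> ('k^3) set) \<Rightarrow> bool" where
  "type_CC E \<sigma> \<longleftrightarrow> \<sigma> \<in> extensional E \<and>
     E = locus (\<lambda>x y z. x ^ 3 - y ^ 2 * z) \<and>
     (\<forall>a b c. pnt a b c \<in> E \<and> b \<noteq> 0 \<longrightarrow>
        \<sigma> (pnt a b c) = pnt (a - b) b (- 3 * (a ^ 2 / b) + 3 * a - b + c)) \<and>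
     \<sigma> (pnt 0 0 1) = pnt 0 0 1"

text \<open>The conditions on \<open>j\<close> normalise the Hesse parameter \<open>l\<close> of the curves with extra
  automorphisms; \<open>r\<close> is a square root of \<open>3\<close>.\<close>

definition type_EC :: "(('k::field)^3) set set \<Rightarrow> (('k^3) set \<Rightarrow> ('k^3) set) \<Rightarrow> bool" where
  "type_EC E \<sigma> \<longleftrightarrow> (\<exists>l \<alpha> \<beta> \<gamma> r. l ^ 3 \<noteq> 1 \<and> E = locus (hesse l) \<and>
     (has_j_invariant E 0 \<longrightarrow> l = 0) \<and>
     r ^ 2 = 3 \<and> (has_j_invariant E 1728 \<longrightarrow> l = 1 + r) \<and>
     pnt \<alpha> \<beta> \<gamma> \<in> E \<and> \<alpha> * \<beta> * \<gamma> \<noteq> 0 \<and> \<sigma> = translation l (pnt \<alpha> \<beta> \<gamma>))"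

definition standard_pair :: "(('k::field)^3) set set \<Rightarrow> (('k^3) set \<Rightarrow> ('k^3) set) \<Rightarrow> bool" where
  "standard_pair E \<sigma> \<longleftrightarrow> type_P E \<sigma> \<or> type_S E \<sigma> \<or> type_S' E \<sigma> \<or> type_T E \<sigma> \<or> type_T' E \<sigma> \<or>
     type_NC E \<sigma> \<or> type_CC E \<sigma> \<or> type_EC E \<sigma>"


section \<open>Graded algebras and their twists\<close>

definition direct_sum_decomposition :: "('a, 'x) ring_scheme \<Rightarrow> ('i \<Rightarrow> 'a set) \<Rightarrow> bool" where
  "direct_sum_decomposition M gr \<longleftrightarrow> (\<forall>i. additive_subgroup (gr i) M) \<and>
     (\<forall>x\<in>carrier M. \<exists>!f. (\<forall>i. f i \<in> gr i) \<and> finite {i. f i \<noteq> \<zero>\<^bsub>M\<^esub>} \<and>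
        x = finsum M f {i. f i \<noteq> \<zero>\<^bsub>M\<^esub>})"

record ('k, 'a) gralg = "('k, 'a) module" +
  grade :: "nat \<Rightarrow> 'a set"

definition graded_algebra :: "('k::field, 'a) gralg \<Rightarrow> bool" where
  "graded_algebra A \<longleftrightarrow> ring A \<and>
     (\<forall>c. \<forall>x\<in>carrier A. c \<odot>\<^bsub>A\<^esub> x \<in> carrier A) \<and>
     (\<forall>x\<in>carrier A. 1 \<odot>\<^bsub>A\<^esub> x = x) \<and>
     (\<forall>c d. \<forall>x\<in>carrier A. (c * d) \<odot>\<^bsub>A\<^esub> x = c \<odot>\<^bsub>A\<^esub> (d \<odot>\<^bsub>A\<^esub> x)) \<and>
     (\<forall>c d. \<forall>x\<in>carrier A. (c + d) \<odot>\<^bsub>A\<^esub> x = c \<odot>\<^bsub>A\<^esub> x \<oplus>\<^bsub>A\<^esub> d \<odot>\<^bsub>A\<^esub> x) \<and>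
     (\<forall>c. \<forall>x\<in>carrier A. \<forall>y\<in>carrier A. c \<odot>\<^bsub>A\<^esub> (x \<oplus>\<^bsub>A\<^esub> y) = c \<odot>\<^bsub>A\<^esub> x \<oplus>\<^bsub>A\<^esub> c \<odot>\<^bsub>A\<^esub> y) \<and>
     (\<forall>c. \<forall>x\<in>carrier A. \<forall>y\<in>carrier A. c \<odot>\<^bsub>A\<^esub> (x \<otimes>\<^bsub>A\<^esub> y) = (c \<odot>\<^bsub>A\<^esub> x) \<otimes>\<^bsub>A\<^esub> y) \<and>
     (\<forall>c. \<forall>x\<in>carrier A. \<forall>y\<in>carrier A. c \<odot>\<^bsub>A\<^esub> (x \<otimes>\<^bsub>A\<^esub> y) = x \<otimes>\<^bsub>A\<^esub> (c \<odot>\<^bsub>A\<^esub> y)) \<and>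
     direct_sum_decomposition A (grade A) \<and>
     (\<forall>n c. \<forall>x\<in>grade A n. c \<odot>\<^bsub>A\<^esub> x \<in> grade A n) \<and>
     \<one>\<^bsub>A\<^esub> \<in> grade A 0 \<and>
     (\<forall>m n. \<forall>x\<in>grade A m. \<forall>y\<in>grade A n. x \<otimes>\<^bsub>A\<^esub> y \<in> grade A (m + n))"

definition components :: "('k, 'a) gralg \<Rightarrow> 'a \<Rightarrow> nat \<Rightarrow> 'a" where
  "components A x = (THE f. (\<forall>i. f i \<in> grade A i) \<and> finite {i. f i \<noteq> \<zero>\<^bsub>A\<^esub>} \<and>
     x = finsum A f {i. f i \<noteq> \<zero>\<^bsub>A\<^esub>})"

definition gralg_iso :: "('k, 'a) gralg \<Rightarrow> ('k, 'b) gralg \<Rightarrow> ('a \<Rightarrow> 'b) \<Rightarrow> bool" where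
  "gralg_iso A B f \<longleftrightarrow> f \<in> ring_iso A B \<and>
     (\<forall>c. \<forall>x\<in>carrier A. f (c \<odot>\<^bsub>A\<^esub> x) = c \<odot>\<^bsub>B\<^esub> f x) \<and> (\<forall>n. f ` grade A n = grade B n)"

definition iso_class :: "('k::field, 'a) gralg \<Rightarrow> ('k, 'a) gralg set" where
  "iso_class A = {B. graded_algebra B \<and> (\<exists>f. gralg_iso A B f)}"

definition graded_linear_auto :: "('k, 'a) gralg \<Rightarrow> ('a \<Rightarrow> 'a) \<Rightarrow> bool" where
  "graded_linear_auto A f \<longleftrightarrow> bij_betw f (carrier A) (carrier A) \<and>
     (\<forall>x\<in>carrier A. \<forall>y\<in>carrier A. f (x \<oplus>\<^bsub>A\<^esub> y) = f x \<oplus>\<^bsub>A\<^esub> f y) \<and>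
     (\<forall>c. \<forall>x\<in>carrier A. f (c \<odot>\<^bsub>A\<^esub> x) = c \<odot>\<^bsub>A\<^esub> f x) \<and>
     (\<forall>n. f ` grade A n = grade A n)"

definition twisting_system :: "('k, 'a) gralg \<Rightarrow> (int \<Rightarrow> 'a \<Rightarrow> 'a) \<Rightarrow> bool" where
  "twisting_system A \<theta> \<longleftrightarrow> (\<forall>n. graded_linear_auto A (\<theta> n)) \<and>
     (\<forall>n (m::nat) (l::nat). \<forall>a\<in>grade A m. \<forall>b\<in>grade A l.
        \<theta> n (a \<otimes>\<^bsub>A\<^esub> \<theta> (int m) b) = \<theta> n a \<otimes>\<^bsub>A\<^esub> \<theta> (n + int m) b)"

definition algebraic :: "('k, 'a) gralg \<Rightarrow> (int \<Rightarrow> 'a \<Rightarrow> 'a) \<Rightarrow> bool" where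
  "algebraic A \<theta> \<longleftrightarrow> (\<forall>m n. \<forall>x\<in>carrier A. \<theta> (m + n) x = \<theta> m (\<theta> n x))"

text \<open>The product \<open>a \<otimes> \<theta> m b\<close>, for \<open>a\<close> of degree \<open>m\<close>, extended additively in \<open>a\<close>.
  Since \<open>\<theta> 0\<close> need not be the identity, the unit of the twist is the \<open>\<theta> 0\<close>-preimage of \<open>1\<close>.\<close>

definition twist :: "('k, 'a) gralg \<Rightarrow> (int \<Rightarrow> 'a \<Rightarrow> 'a) \<Rightarrow> ('k, 'a) gralg" where
  "twist A \<theta> = A\<lparr>
     mult := (\<lambda>a b. finsum A (\<lambda>m. components A a m \<otimes>\<^bsub>A\<^esub> \<theta> (int m) b)
        {m. components A a m \<noteq> \<zero>\<^bsub>A\<^esub>}),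
     one := inv_into (carrier A) (\<theta> 0) \<one>\<^bsub>A\<^esub>\<rparr>"

definition Twist :: "('k::field, 'a) gralg \<Rightarrow> ('k, 'a) gralg set set" where
  "Twist A = {iso_class (twist A \<theta>) | \<theta>. twisting_system A \<theta>}"

definition Twist_alg :: "('k::field, 'a) gralg \<Rightarrow> ('k, 'a) gralg set set" where
  "Twist_alg A = {iso_class (twist A \<theta>) | \<theta>. twisting_system A \<theta> \<and> algebraic A \<theta> \<and>
     (\<forall>x\<in>carrier A. \<theta> 0 x = x)}"


section \<open>The algebra of a pair\<close>

text \<open>The free algebra on three letters is the monoid algebra of the monoid of words, realised
  with the convolution product of \<open>Poly_Mapping\<close>.\<close>

instantiation list :: (type) monoid_add
begin

definition zero_list :: "'a list" where "0 = []"

definition plus_list :: "'a list \<Rightarrow> 'a list \<Rightarrow> 'a list" where "xs + ys = xs @ ys"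

instance
  by intro_classes (simp_all add: zero_list_def plus_list_def)

end

type_synonym 'k free3 = "3 list \<Rightarrow>\<^sub>0 'k"

definition free_ring :: "('k::field) free3 ring" where
  "free_ring = \<lparr>carrier = UNIV, mult = (*), one = 1, zero = 0, add = (+)\<rparr>"

definition free_grade :: "nat \<Rightarrow> ('k::field) free3 set" where
  "free_grade n = {f. \<forall>w\<in>Poly_Mapping.keys f. length w = n}"

text \<open>The letters are a basis of the linear forms, so an element of degree two with coefficients
  \<open>g\<^sub>i\<^sub>j\<close> is the bilinear form with matrix \<open>g\<^sub>i\<^sub>j\<close>.\<close>

definition relations ::
  "(('k::field)^3) set set \<Rightarrow> (('k^3) set \<Rightarrow> ('k^3) set) \<Rightarrow> 'k free3 set" where
  "relations E \<sigma> = {g \<in> free_grade 2. \<forall>p\<in>E. \<forall>v\<in>p. \<forall>w\<in>\<sigma> p.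
     (\<Sum>i\<in>UNIV. \<Sum>j\<in>UNIV. Poly_Mapping.lookup g [i, j] * v $ i * w $ j) = 0}"

definition quotient_gralg :: "('k::field) free3 set \<Rightarrow> ('k, 'k free3 set) gralg" where
  "quotient_gralg I = \<lparr>
     carrier = carrier (free_ring Quot I), mult = mult (free_ring Quot I),
     one = one (free_ring Quot I), zero = zero (free_ring Quot I), add = add (free_ring Quot I),
     smult = (\<lambda>c X. \<Union>f\<in>X. I +>\<^bsub>free_ring\<^esub> (Poly_Mapping.single [] c * f)),
     grade = (\<lambda>n. {I +>\<^bsub>free_ring\<^esub> f | f. f \<in> free_grade n})\<rparr>"

definition pair_algebra :: "(('k::field)^3) set set \<Rightarrow> (('k^3) set \<Rightarrow> ('k^3) set)
    \<Rightarrow> ('k, 'k free3 set) gralg" where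
  "pair_algebra E \<sigma> = quotient_gralg (Idl\<^bsub>free_ring\<^esub> (relations E \<sigma>))"


section \<open>Graded Morita equivalence\<close>

text \<open>Hom-sets need not be disjoint, so identities and composition are indexed by objects.\<close>

record ('o, 'h) category =
  Obj :: "'o set"
  Hom :: "'o \<Rightarrow> 'o \<Rightarrow> 'h set"
  Ident :: "'o \<Rightarrow> 'h"
  Comp :: "'o \<Rightarrow> 'o \<Rightarrow> 'o \<Rightarrow> 'h \<Rightarrow> 'h \<Rightarrow> 'h" \<comment> \<open>\<open>Comp X Y Z g f\<close> for \<open>f: X \<rightarrow> Y\<close>, \<open>g: Y \<rightarrow> Z\<close>\<close>

definition is_functor :: "('o, 'h) category \<Rightarrow> ('p, 'i) category
    \<Rightarrow> ('o \<Rightarrow> 'p) \<Rightarrow> ('o \<Rightarrow> 'o \<Rightarrow> 'h \<Rightarrow> 'i) \<Rightarrow> bool" where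
  "is_functor C D F0 F1 \<longleftrightarrow>
     (\<forall>X\<in>Obj C. F0 X \<in> Obj D) \<and>
     (\<forall>X\<in>Obj C. \<forall>Y\<in>Obj C. \<forall>f\<in>Hom C X Y. F1 X Y f \<in> Hom D (F0 X) (F0 Y)) \<and>
     (\<forall>X\<in>Obj C. F1 X X (Ident C X) = Ident D (F0 X)) \<and>
     (\<forall>X\<in>Obj C. \<forall>Y\<in>Obj C. \<forall>Z\<in>Obj C. \<forall>f\<in>Hom C X Y. \<forall>g\<in>Hom C Y Z.
        F1 X Z (Comp C X Y Z g f) = Comp D (F0 X) (F0 Y) (F0 Z) (F1 Y Z g) (F1 X Y f))"

text \<open>A natural isomorphism from the endofunctor \<open>(F0, F1)\<close> of \<open>C\<close> to the identity functor.\<close>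

definition nat_iso_to_id :: "('o, 'h) category
    \<Rightarrow> ('o \<Rightarrow> 'o) \<Rightarrow> ('o \<Rightarrow> 'o \<Rightarrow> 'h \<Rightarrow> 'h) \<Rightarrow> ('o \<Rightarrow> 'h) \<Rightarrow> bool" where
  "nat_iso_to_id C F0 F1 \<eta> \<longleftrightarrow>
     (\<forall>X\<in>Obj C. \<eta> X \<in> Hom C (F0 X) X \<and> (\<exists>g\<in>Hom C X (F0 X).
        Comp C (F0 X) X (F0 X) g (\<eta> X) = Ident C (F0 X) \<and>
        Comp C X (F0 X) X (\<eta> X) g = Ident C X)) \<and>
     (\<forall>X\<in>Obj C. \<forall>Y\<in>Obj C. \<forall>f\<in>Hom C X Y.
        Comp C (F0 X) (F0 Y) Y (\<eta> Y) (F1 X Y f) = Comp C (F0 X) X Y f (\<eta> X))"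

definition equivalent_categories :: "('o, 'h) category \<Rightarrow> ('p, 'i) category \<Rightarrow> bool" where
  "equivalent_categories C D \<longleftrightarrow> (\<exists>F0 F1 G0 G1 \<eta> \<epsilon>.
     is_functor C D F0 F1 \<and> is_functor D C G0 G1 \<and>
     nat_iso_to_id C (\<lambda>X. G0 (F0 X)) (\<lambda>X Y f. G1 (F0 X) (F0 Y) (F1 X Y f)) \<eta> \<and>
     nat_iso_to_id D (\<lambda>X. F0 (G0 X)) (\<lambda>X Y f. F1 (G0 X) (G0 Y) (G1 X Y f)) \<epsilon>)"

text \<open>As in \<open>HOL-Algebra.Module\<close>, modules extend the ring record and the multiplicative
  part of that record is ignored.\<close>

record ('a, 'm) grmod = "'m ring" +
  act :: "'m \<Rightarrow> 'a \<Rightarrow> 'm"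
  mgrade :: "int \<Rightarrow> 'm set"

definition graded_right_module :: "('k, 'a) gralg \<Rightarrow> ('a, 'm) grmod \<Rightarrow> bool" where
  "graded_right_module A M \<longleftrightarrow> abelian_group M \<and>
     (\<forall>x\<in>carrier M. \<forall>a\<in>carrier A. act M x a \<in> carrier M) \<and>
     (\<forall>x\<in>carrier M. act M x \<one>\<^bsub>A\<^esub> = x) \<and>
     (\<forall>x\<in>carrier M. \<forall>a\<in>carrier A. \<forall>b\<in>carrier A.
        act M x (a \<otimes>\<^bsub>A\<^esub> b) = act M (act M x a) b) \<and>
     (\<forall>x\<in>carrier M. \<forall>a\<in>carrier A. \<forall>b\<in>carrier A.
        act M x (a \<oplus>\<^bsub>A\<^esub> b) = act M x a \<oplus>\<^bsub>M\<^esub> act M x b) \<and>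
     (\<forall>x\<in>carrier M. \<forall>y\<in>carrier M. \<forall>a\<in>carrier A.
        act M (x \<oplus>\<^bsub>M\<^esub> y) a = act M x a \<oplus>\<^bsub>M\<^esub> act M y a) \<and>
     direct_sum_decomposition M (mgrade M) \<and>
     (\<forall>i n. \<forall>x\<in>mgrade M i. \<forall>a\<in>grade A n. act M x a \<in> mgrade M (i + int n))"

definition grmod_hom :: "('k, 'a) gralg \<Rightarrow> ('a, 'm) grmod \<Rightarrow> ('a, 'm) grmod \<Rightarrow> ('m \<Rightarrow> 'm) set" where
  "grmod_hom A M N = {f \<in> carrier M \<rightarrow>\<^sub>E carrier N.
     (\<forall>x\<in>carrier M. \<forall>y\<in>carrier M. f (x \<oplus>\<^bsub>M\<^esub> y) = f x \<oplus>\<^bsub>N\<^esub> f y) \<and>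
     (\<forall>x\<in>carrier M. \<forall>a\<in>carrier A. f (act M x a) = act N (f x) a) \<and>
     (\<forall>i. f ` mgrade M i \<subseteq> mgrade N i)}"

text \<open>The type \<open>'u\<close> plays the role of the universe containing the elements of all modules.\<close>

definition GrMod :: "'u itself \<Rightarrow> ('k, 'a) gralg \<Rightarrow> (('a, 'u) grmod, 'u \<Rightarrow> 'u) category" where
  "GrMod _ A = \<lparr>Obj = {M. graded_right_module A M}, Hom = grmod_hom A,
     Ident = (\<lambda>M. \<lambda>x\<in>carrier M. x), Comp = (\<lambda>L M N g f. compose (carrier L) g f)\<rparr>"

definition graded_Morita_equivalent ::
  "'u itself \<Rightarrow> ('k, 'a) gralg \<Rightarrow> ('k, 'b) gralg \<Rightarrow> bool" where
  "graded_Morita_equivalent U A B \<longleftrightarrow> equivalent_categories (GrMod U A) (GrMod U B)"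

definition exceptional_points :: "(('k::field)^3) set set" where
  "exceptional_points =
     {pnt a b c | a b c. pnt a b c \<in> locus (\<lambda>x y z. x ^ 3 + y ^ 3 + z ^ 3) \<and>
        a ^ 9 = b ^ 9 \<and> b ^ 9 = c ^ 9}"

definition exceptional :: "'u itself \<Rightarrow> ('k::field, 'a) gralg \<Rightarrow> bool" where
  "exceptional U A \<longleftrightarrow> (\<exists>p\<in>exceptional_points. graded_Morita_equivalent U A
     (pair_algebra (locus (\<lambda>x y z. x ^ 3 + y ^ 3 + z ^ 3)) (translation 0 p)))"

end

theory Submission
  imports "Berlekamp_Zassenhaus.Unique_Factorization_Poly" Defs
begin

text \<open>
  Automorphisms of the plane are linear, and the relations of the algebra recover the pair, because their common zeros
  form the graph of \<open>\<sigma>\<close>.  Hence both claims follow from a single property of the pair: if linear maps \<open>T\<close> and \<open>T'\<close>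
  preserve \<open>E\<close> and \<open>\<sigma> T = T' \<sigma>\<close> on \<open>E\<close>, then \<open>T' = T\<close> on \<open>E\<close>.  It identifies \<open>M(E, \<sigma>)\<close> with \<open>Z(E, \<sigma>)\<close>, and, applied to
  the matrices of a twisting system in degree one, it makes them scalar multiples of the powers of one matrix, so that
  rescaling the graded pieces turns the twist into an algebraic one.  For the singular types the property is a
  computation with parametrised components.  For a Hesse cubic, the Hessian shows that \<open>T\<close> is, modulo the
  Heisenberg group, diagonal, a transposition or a Fourier matrix; in each case \<open>T' T\<^sup>-\<^sup>1\<close> lies in the Heisenberg group,
  and the conditions on \<open>\<sigma>\<^sup>6\<close>, on \<open>j\<close> and on exceptional points force it to be trivial.
\<close>

text \<open>The property is about conjugation: on \<open>E\<close> the hypothesis says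
  \<open>T' = \<sigma> T \<sigma>^-1\<close>, so a linear map with a linear conjugate is asked to
  commute with \<sigma>. The exponent 2 in \<open>M_set\<close> already produces such a pair, since
  \<open>(\<tau> \<sigma>)^2 \<sigma>^-2 = \<tau> (\<sigma> \<tau> \<sigma>^-1)\<close>. For twists,
  the defining identity in degree two says that \<open>N_n\<close> on the left and
  \<open>N_{n+1} N_1^-1\<close> on the right preserve the relations; their transposes form such a
  pair.

  The obstacle is a symmetry that reverses \<sigma>, such as inversion on an elliptic curve. Its
  conjugate differs from it by \<open>\<sigma>^2\<close>; if the conjugate is linear, so is
  \<open>\<sigma>^2\<close>, which commutes with the translations by 3-torsion points and hence lies
  in the Heisenberg group modulo scalars. That group has exponent 3, so
  \<open>\<sigma>^6 = id\<close>: this is the origin of the exponents 6 and 2. For the singular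
  types the same role is played by the condition \<open>\<alpha>^6 = 1\<close>. On the Fermat cubic
  the extra symmetry of order three can have a linear conjugate only if the coordinates of the
  translating point have equal ninth powers, which is the exceptional case.\<close>

no_notation Matrix.vec_index (infixl "$" 100)

lemmas cubic_simps = power2_eq_square power3_eq_cube algebra_simps

section \<open>Points as classes of coordinate vectors, and the linear maps acting on them\<close>

lemma mem_proj: "w \<in> proj v \<longleftrightarrow> (\<exists>c. c \<noteq> 0 \<and> w = c *s v)"
 by (auto simp: proj_def)

lemma self_mem_proj [simp]: "v \<in> proj v"
 unfolding mem_proj by (intro exI[of _ 1]) simp

lemma proj_eq_iff: "proj v = proj w \<longleftrightarrow> (\<exists>c. c \<noteq> 0 \<and> w = c *s v)"
proof
 assume "proj v = proj w"
 then have "w \<in> proj v" by simp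
 then show "\<exists>c. c \<noteq> 0 \<and> w = c *s v" by (simp add: mem_proj)
next
 assume "\<exists>c. c \<noteq> 0 \<and> w = c *s v"
 then obtain c where c: "c \<noteq> 0" "w = c *s v" by blast
 have "x \<in> proj w" if "x \<in> proj v" for x
 proof -
  obtain d where "d \<noteq> 0" "x = d *s v" using \<open>x \<in> proj v\<close> by (auto simp: mem_proj)
  then have "x = (d*inverse c) *s w" "d*inverse c \<noteq> 0" using c by (simp_all add: vector_smult_assoc)
  then show ?thesis unfolding mem_proj by blast
 qed
 moreover have "x \<in> proj v" if "x \<in> proj w" for x
 proof -
  obtain d where "d \<noteq> 0" "x = d *s w" using \<open>x \<in> proj w\<close> by (auto simp: mem_proj)
  then have "x = (d * c) *s v" "d * c \<noteq> 0" using c by (simp_all add: vector_smult_assoc)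
  then show ?thesis unfolding mem_proj by blast
 qed
 ultimately show "proj v = proj w" by blast
qed

lemma proj_smult: "c \<noteq> 0 \<Longrightarrow> proj (c *s v) = proj v"
 using proj_eq_iff by metis

lemma proj_in_P2 [simp]: "proj v \<in> P2 \<longleftrightarrow> v \<noteq> 0"
 by (auto simp: P2_def) (auto simp: proj_eq_iff)

lemma P2_cases:
 assumes "p \<in> P2" obtains v where "v \<noteq> 0" "p = proj v"
 using assms by (auto simp: P2_def)

lemma proj_eqI:
 fixes v w :: "('k::field)^3"
 assumes "v \<noteq> 0" "w \<noteq> 0" "\<And>i j. v $ i * w $ j = v $ j * w $ i"
 shows "proj v = proj w"
proof -
 obtain i where i: "v $ i \<noteq> 0" using assms(1) by (metis vec_eq_iff zero_index)
 have w: "w = (w $ i / v $ i) *s v"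
  using i assms(3)[of i] by (simp add: vec_eq_iff field_simps)
 then have "w $ i / v $ i \<noteq> 0" using assms(2) by (metis vector_smult_lzero)
 then show ?thesis using w proj_eq_iff by blast
qed

lemma proj_eq_cross:
 assumes "proj v = proj w"
 shows "v $ i * w $ j = v $ j * w $ i"
 using assms by (auto simp: proj_eq_iff)

lemma vec3_eq_iff: "(v::'a^3) = w \<longleftrightarrow> v $ 1 = w $ 1 \<and> v $ 2 = w $ 2 \<and> v $ 3 = w $ 3"
 by (simp add: vec_eq_iff forall_3)

lemma vec3_eta: "vector [v $ 1, v $ 2, v $ 3] = (v::'a::zero^3)"
 by (simp add: vec3_eq_iff)

lemma vector_eq_0_iff [simp]: "vector [a, b, c] = (0::'a::zero^3) \<longleftrightarrow> a = 0 \<and> b = 0 \<and> c = 0"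
 by (simp add: vec3_eq_iff)

lemma pnt_eqI:
 fixes a b c a' b' c' :: "'k::field"
 assumes "a \<noteq> 0 \<or> b \<noteq> 0 \<or> c \<noteq> 0" "a' \<noteq> 0 \<or> b' \<noteq> 0 \<or> c' \<noteq> 0"
  and "a * b' = b * a'" "a * c' = c * a'" "b * c' = c * b'"
 shows "pnt a b c = pnt a' b' c'"
proof (rule proj_eqI)
 show "vector [a, b, c] $ i * vector [a', b', c'] $ j = vector [a, b, c] $ j*(vector [a', b', c'] :: 'k^3) $ i" for i j :: 3
  using assms(3-5) exhaust_3[of i] exhaust_3[of j] by (auto simp: mult.commute)
qed (use assms in auto)

lemma pnt_eqD:
 assumes "pnt a b c = pnt a' b' c'"
 shows "a * b' = b * a'" "a * c' = c * a'" "b * c' = c * b'"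
 using proj_eq_cross[OF assms, of 1 2] proj_eq_cross[OF assms, of 1 3] proj_eq_cross[OF assms, of 2 3]
 by (simp_all)

text \<open>Homogeneity makes the vanishing independent of the representative; \<open>locus\<close>
  itself asks only for some vector of the class that satisfies the equation.\<close>

lemma mem_locus:
 assumes hom: "\<And>t x y z. F (t * x) (t * y) (t * z) = t^n * F x y z"
 shows "proj v \<in> locus F \<longleftrightarrow> v \<noteq> 0 \<and> F (v $ 1) (v $ 2) (v $ 3) = (0::'k::field)"
proof
 assume "proj v \<in> locus F"
 then obtain w where w: "w \<noteq> 0" "F (w $ 1) (w $ 2) (w $ 3) = 0" "proj w = proj v"
  by (auto simp: locus_def)
 then obtain c where "c \<noteq> 0" "v = c *s w" by (auto simp: proj_eq_iff)
 then show "v \<noteq> 0 \<and> F (v $ 1) (v $ 2) (v $ 3) = 0" using w hom by simp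
qed (auto simp: locus_def)

lemma locus_subset_P2: "locus F \<subseteq> P2"
 by (auto simp: locus_def)

text \<open>The image of the whole class avoids choosing a representative. If \<open>T\<close> kills
  \<open>v\<close>, the value is \<open>proj 0\<close>, which lies outside \<open>P2\<close>; hence
  the invertibility hypotheses below.\<close>

definition pmap :: "('k::field)^3^3 \<Rightarrow> ('k^3) set \<Rightarrow> ('k^3) set" where
 "pmap T p = (\<lambda>v. T *v v) ` p"

lemma pmap_proj [simp]: "pmap T (proj v) = proj (T *v v)"
proof (rule equalityI; rule subsetI)
 fix x assume "x \<in> proj (T *v v)"
 then obtain c where c: "c \<noteq> 0" "x = c *s (T *v v)" unfolding mem_proj by blast
 then have "x = T *v (c *s v)" by (simp only: vector_scalar_commute)
 moreover have "c *s v \<in> proj v" using c unfolding mem_proj by blast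
 ultimately show "x \<in> pmap T (proj v)" unfolding pmap_def by (rule image_eqI)
next
 fix x assume "x \<in> pmap T (proj v)"
 then obtain w where w: "w \<in> proj v" "x = T *v w" unfolding pmap_def by (rule imageE)
 then obtain c where c: "c \<noteq> 0" "w = c *s v" by (auto simp: mem_proj)
 then have "x = c *s (T *v v)" using w by (simp only: vector_scalar_commute)
 then show "x \<in> proj (T *v v)" using c by (auto simp: mem_proj)
qed

lemma invertible_mult_nz:
 fixes T :: "('k::field)^3^3"
 assumes "invertible T"
 shows "T *v v = 0 \<longleftrightarrow> v = 0"
proof
 assume "T *v v = 0"
 obtain S where "S ** T = mat 1" using assms by (auto simp: invertible_def)
 then have "v = S *v (T *v v)" by (simp add: matrix_vector_mul_assoc)
 then show "v = 0" using \<open>T *v v = 0\<close> by simp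
qed simp

lemma invertibleI_nz:
 fixes T :: "('k::field)^3^3"
 assumes "\<And>v. T *v v = 0 \<Longrightarrow> v = 0"
 shows "invertible T"
proof -
 have "x = y" if "T *v x = T *v y" for x y
  using assms[of "x - y"] that by (simp add: matrix_vector_mult_diff_distrib)
 then show ?thesis
  unfolding invertible_left_inverse matrix_left_invertible_injective by (simp add: inj_on_def)
qed

lemma matrix_inv_props:
 fixes T :: "('k::field)^3^3"
 assumes "invertible T"
 shows "invertible (matrix_inv T)" "T ** matrix_inv T = mat 1" "matrix_inv T ** T = mat 1"
  "T *v (matrix_inv T *v v) = v" "matrix_inv T *v (T *v v) = v"
proof -
 have *: "T ** matrix_inv T = mat 1 \<and> matrix_inv T ** T = mat 1"
  using assms unfolding invertible_def matrix_inv_def by (rule someI_ex)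
 then show "invertible (matrix_inv T)" "T ** matrix_inv T = mat 1" "matrix_inv T ** T = mat 1"
  "T *v (matrix_inv T *v v) = v" "matrix_inv T *v (T *v v) = v"
  by (auto simp: matrix_vector_mul_assoc invertible_def)
qed

lemma pmap_P2: "invertible T \<Longrightarrow> p \<in> P2 \<Longrightarrow> pmap T p \<in> P2"
 by (auto elim!: P2_cases simp: invertible_mult_nz)

lemma pmap_mult: "pmap (S ** T) p = pmap S (pmap T p)"
 by (auto simp: pmap_def image_image matrix_vector_mul_assoc)

lemma pmap_id [simp]: "pmap (mat 1) p = p"
 by (simp add: pmap_def)

lemma pmap_inv:
 assumes "invertible T"
 shows "pmap (matrix_inv T) (pmap T p) = p" "pmap T (pmap (matrix_inv T) p) = p"
 by (simp_all flip: pmap_mult add: matrix_inv_props[OF assms])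

text \<open>Equality instead of inclusion makes these matrices closed under inversion without any
  argument about the curve.\<close>

definition preserves :: "('k::field)^3^3 \<Rightarrow> ('k^3) set set \<Rightarrow> bool" where
 "preserves T E \<longleftrightarrow> invertible T \<and> pmap T ` E = E"

lemma preserves_inv:
 assumes "preserves T E"
 shows "preserves (matrix_inv T) E"
proof -
 have T: "invertible T" "pmap T ` E = E" using assms by (simp_all add: preserves_def)
 have "pmap (matrix_inv T) ` (pmap T ` E) = E" by (simp add: image_image pmap_inv T(1))
 then have "pmap (matrix_inv T) ` E = E" by (simp only: T(2))
 then show ?thesis using T(1) by (simp add: preserves_def matrix_inv_props)
qed

lemma preserves_mult: "preserves S E \<Longrightarrow> preserves T E \<Longrightarrow> preserves (S ** T) E"
 by (auto simp: preserves_def invertible_mult pmap_mult image_image[symmetric])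

lemma preserves_mem: "preserves T E \<Longrightarrow> p \<in> E \<Longrightarrow> pmap T p \<in> E"
 by (auto simp: preserves_def)

lemma preserves_P2:
 fixes T :: "('k::field)^3^3"
 assumes T: "invertible T"
 shows "preserves T P2"
proof -
 have "p \<in> pmap T ` P2" if "p \<in> P2" for p :: "('k^3) set"
 proof -
  have "p = pmap T (pmap (matrix_inv T) p)" "pmap (matrix_inv T) p \<in> P2"
   using T that by (simp_all add: pmap_inv pmap_P2 matrix_inv_props)
  then show ?thesis by blast
 qed
 then show ?thesis using T by (auto simp: preserves_def pmap_P2)
qed

lemma restrict_pmap_Bij:
 assumes "preserves T E"
 shows "restrict (pmap T) E \<in> Bij E"
proof -
 have "inj_on (pmap T) E"
  using assms by (intro inj_on_inverseI[of _ "pmap (matrix_inv T)"]) (simp add: preserves_def pmap_inv)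
 then show ?thesis using assms by (auto simp: Bij_def bij_betw_def preserves_def inj_on_def image_iff)
qed

lemma inv_into_restrict_pmap:
 assumes "preserves T E" "p \<in> E"
 shows "inv_into E (restrict (pmap T) E) p = pmap (matrix_inv T) p"
proof (rule inv_into_f_eq)
 show "inj_on (restrict (pmap T) E) E"
  using restrict_pmap_Bij[OF assms(1)] by (simp add: Bij_def bij_betw_def)
 show m: "pmap (matrix_inv T) p \<in> E" using preserves_mem[OF preserves_inv] assms by blast
 show "restrict (pmap T) E (pmap (matrix_inv T) p) = p"
  using m assms by (simp add: pmap_inv preserves_def)
qed

lemma form_linear: "form 1 (\<lambda>v. a * v $ 1 + b * v $ 2 + c * v $ 3)"
 unfolding form_def
 by (intro exI[of _ "\<lambda>i j. if i = 1 then a else if j = 1 then b else c"]) (simp add: algebra_simps)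

lemma form_0: "form 0 (\<lambda>v. c)"
 unfolding form_def by (intro exI[of _ "\<lambda>i j. c"]) simp

lemma matrix_vector_mult_3:
 "((T::'a::semiring_1^3^3) *v v) $ i = T $ i $ 1 * v $ 1 + T $ i $ 2 * v $ 2 + T $ i $ 3 * v $ 3"
 by (simp add: matrix_vector_mult_def sum_3)

text \<open>One global representation suffices: coordinates of degree 1 and the denominator 1, a
  form of degree 0.\<close>

lemma regular_linear:
 fixes T :: "('k::field)^3^3"
 assumes "invertible T" "X \<subseteq> P2" "\<And>p. p \<in> X \<Longrightarrow> f p = pmap T p"
 shows "regular_map X f"
 unfolding regular_map_def
proof (intro ballI exI conjI allI impI)
 fix i show "form 1 (\<lambda>v. ((\<lambda>v. T *v v) v) $ i)"
  unfolding matrix_vector_mult_3 by (rule form_linear)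
next
 show "form 0 (\<lambda>v::'k^3. 1::'k)" by (rule form_0)
next
 fix v :: "'k^3" assume "v \<noteq> 0 \<and> proj v \<in> X \<and> (1::'k) \<noteq> 0"
 then show "T *v v \<noteq> 0" "f (proj v) = proj (T *v v)" using assms by (auto simp: invertible_mult_nz)
qed auto

lemma restrict_pmap_Aut:
 assumes "preserves T E" "E \<subseteq> P2"
 shows "restrict (pmap T) E \<in> Aut E"
 unfolding Aut_def
proof (intro CollectI conjI restrict_pmap_Bij assms)
 show "regular_map E (restrict (pmap T) E)"
  by (rule regular_linear[of T]) (use assms in \<open>auto simp: preserves_def\<close>)
 show "regular_map E (inv_into E (restrict (pmap T) E))"
  by (rule regular_linear[of "matrix_inv T"])
   (use assms in \<open>auto simp: preserves_def matrix_inv_props inv_into_restrict_pmap\<close>)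
qed

section \<open>Automorphisms of the projective plane\<close>

text \<open>Each prime factor of \<open>x\<close> fails to divide some \<open>A i\<close>, hence
  divides \<open>y\<close> and can be cancelled. With \<open>A\<close> the coordinates of a reduced
  representation of a morphism, this makes every other representation a polynomial multiple of that
  one.\<close>

lemma dvd_cancel_coprime_family:
 fixes x y :: "'a::ufd" and A :: "'i \<Rightarrow> 'a"
 assumes x: "x \<noteq> 0" and cop: "\<And>p. prime_elem p \<Longrightarrow> \<exists>i. \<not> p dvd A i"
  and dvd: "\<And>i. x dvd y * A i"
 shows "x dvd y"
proof (cases "x dvd 1")
 case True
 then show ?thesis using dvd_trans one_dvd by blast
next
 case False
 then obtain F where F: "mset_factors F x" using mset_factors_exist x by blast
 \<comment> \<open>The prime factors are consumed one at a time, each cancelled from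
   \<open>y\<close>, so \<open>y\<close> has to stay general.\<close>
 have *: "prod_mset F dvd y" if "\<forall>f. f \<in># F \<longrightarrow> irreducible f" "\<And>i. prod_mset F dvd y*A i" for F y
  using that
 proof (induction F arbitrary: y)
  case empty
  then show ?case by simp
 next
  case (add p F)
  have p: "prime_elem p" using add.prems(1) by (simp add: prime_elem_iff_irreducible)
  from cop[OF p] obtain i where i: "\<not> p dvd A i" by (rule exE)
  have "p*prod_mset F dvd y*A i" using add.prems(2)[of i] by (simp only: prod_mset.add_mset)
  then have "p dvd y * A i" by (rule dvd_mult_left)
  then have "p dvd y" using p i unfolding prime_elem_def by blast
  then obtain y' where y': "y = p * y'" by (rule dvdE)
  have p0: "p \<noteq> 0" using p unfolding prime_elem_def by (rule conjunct1)
  have sub: "prod_mset F dvd y' * A j" for j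
  proof -
   have "p*prod_mset F dvd p*(y'*A j)" using add.prems(2)[of j] by (simp add: y' ac_simps)
   then have "p = 0 \<or> prod_mset F dvd y' * A j" by (simp only: dvd_mult_cancel_left)
   then show ?thesis using p0 by simp
  qed
  have "\<forall>f. f \<in># F \<longrightarrow> irreducible f" using add.prems(1) by simp
  from add.IH[OF this sub] have "prod_mset F dvd y'" .
  then show ?case unfolding y' prod_mset.add_mset by (rule mult_dvd_mono[OF dvd_refl])
 qed
 have irr: "\<forall>f. f \<in># F \<longrightarrow> irreducible f" and xF: "x = prod_mset F"
  using F by (auto simp: mset_factors_def)
 show ?thesis unfolding xF by (rule *[OF irr]) (use dvd xF in simp)
qed

text \<open>Iterated univariate polynomials inherit unique factorisation from the field. The
  innermost variable is \<open>x\<close>, the outermost \<open>z\<close>.\<close>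

type_synonym 'k poly3 = "'k poly poly poly"

definition ev :: "('k::field) poly3 \<Rightarrow> 'k^3 \<Rightarrow> 'k" where
 "ev P v = poly (poly (poly P [:[:v $ 3:]:]) [:v $ 2:]) (v $ 1)"

definition PX :: "('k::field) poly3" where "PX = [:[:[:0, 1:]:]:]"
definition PY :: "('k::field) poly3" where "PY = [:[:0, 1:]:]"
definition PZ :: "('k::field) poly3" where "PZ = [:0, 1:]"

lemma ev_simps [simp]:
 "ev 0 v = 0" "ev (P + Q) v = ev P v + ev Q v" "ev (P * Q) v = ev P v * ev Q v"
 "ev (P - Q) v = ev P v - ev Q v" "ev (P^n) v = ev P v^n"
 "ev PX v = v $ 1" "ev PY v = v $ 2" "ev PZ v = v $ 3" "ev [:[:[:c:]:]:] v = c"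
 "ev (Polynomial.smult [:[:c:]:] P) v = c * ev P v"
 by (simp_all add: ev_def PX_def PY_def PZ_def)

lemma ev_sum [simp]: "ev (\<Sum>x\<in>S. P x) v = (\<Sum>x\<in>S. ev (P x) v)"
 by (induction S rule: infinite_finite_induct) auto

lemma poly_zero_if_infinite_roots:
 fixes p :: "'a::idom poly"
 assumes "infinite S" "\<And>x. x \<in> S \<Longrightarrow> poly p x = 0"
 shows "p = 0"
proof (rule ccontr)
 assume "p \<noteq> 0"
 then have "finite {x. poly p x = 0}" by (rule poly_roots_finite)
 moreover have "S \<subseteq> {x. poly p x = 0}" using assms(2) by auto
 ultimately show False using assms(1) finite_subset by blast
qed

lemma infinite_const: "infinite (range (\<lambda>c::'k::{field_char_0}. [:c:]))"
 and infinite_const2: "infinite (range (\<lambda>c::'k::{field_char_0}. [:[:c:]:]))"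
 by (auto simp: finite_image_iff inj_on_def infinite_UNIV_char_0)

text \<open>Multiplication by \<open>PX\<close> also kills the value at the zero vector, about which
  nothing is assumed. The field being infinite, the variables are then eliminated in the order
  \<open>x\<close>, \<open>y\<close>, \<open>z\<close>.\<close>

lemma ev_eq_0:
 fixes P :: "('k::field_char_0) poly3"
 assumes "\<And>v. v \<noteq> 0 \<Longrightarrow> ev P v = 0"
 shows "P = 0"
proof -
 have 1: "ev (PX * P) v = 0" for v
  using assms[of v] by (cases "v = 0") auto
 have "poly (poly (poly (PX * P) [:[:c:]:]) [:b:]) a = 0" for a b c
  using 1[of "vector [a, b, c]"] by (simp add: ev_def)
 then have "poly (poly (PX * P) [:[:c:]:]) [:b:] = 0" for b c
  using poly_all_0_iff_0 by blast
 then have "poly (PX * P) [:[:c:]:] = 0" for c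
  by (intro poly_zero_if_infinite_roots[OF infinite_const]) auto
 then have "PX * P = 0"
  by (intro poly_zero_if_infinite_roots[OF infinite_const2]) auto
 then show ?thesis by (simp add: PX_def)
qed

text \<open>Homogeneity is stated on values, which is equivalent over an infinite field. The zero
  polynomial is homogeneous of every degree.\<close>

definition hom :: "nat \<Rightarrow> ('k::field) poly3 \<Rightarrow> bool" where
 "hom d P \<longleftrightarrow> (\<forall>t v. ev P (t *s v) = t^d * ev P v)"

lemma form_imp_poly3:
 assumes "form d f"
 shows "\<exists>P. hom d P \<and> (\<forall>v. f v = ev P v)"
proof -
 obtain c where c: "\<And>v. f v = (\<Sum>i\<le>d. \<Sum>j\<le>d - i. c i j*(v $ 1)^i*(v $ 2)^j*(v $ 3)^(d - i - j))"
  using assms by (auto simp: form_def)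
 define P where "P = (\<Sum>i\<le>d. \<Sum>j\<le>d - i. [:[:[:c i j:]:]:]*PX^i*PY^j*PZ^(d - i - j))"
 have e: "f v = ev P v" for v by (simp add: P_def c mult.assoc)
 have "f (t *s v) = t^d * f v" for t v
  unfolding c sum_distrib_left
 proof (intro sum.cong refl)
  fix i j assume "i \<in> {..d}" "j \<in> {..d - i}"
  then have "t^d = t^i * t^j * t^(d - i - j)" by (simp flip: power_add)
  then show "c i j * (t *s v) $ 1^i * (t *s v) $ 2^j * (t *s v) $ 3^(d - i - j) =
   t^d * (c i j * v $ 1^i * v $ 2^j * v $ 3^(d - i - j))"
   by (simp add: power_mult_distrib algebra_simps)
 qed
 then show ?thesis using e by (auto simp: hom_def)
qed

text \<open>The second conjunct records that a form of degree one is linear.\<close>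

definition hl :: "nat \<Rightarrow> ('k::field) poly3 \<Rightarrow> bool" where
 "hl d P \<longleftrightarrow> hom d P \<and> (d = 1 \<longrightarrow> (\<exists>a b c. \<forall>v. ev P v = a * v $ 1 + b * v $ 2 + c * v $ 3))"

definition dec :: "('k::field) poly3 \<Rightarrow> bool" where
 "dec P \<longleftrightarrow> (\<exists>Q N. (\<forall>m. hl m (Q m)) \<and> (\<forall>m>N. Q m = 0) \<and> P = (\<Sum>m\<le>N. Q m))"

lemma hl_0: "hl m 0"
 unfolding hl_def hom_def by (auto intro!: exI[where x = 0])

lemma hl_add: "hl m P \<Longrightarrow> hl m Q \<Longrightarrow> hl m (P + Q)"
 unfolding hl_def hom_def
proof (elim conjE, intro conjI impI allI)
 assume "m = 1"
  and "m = 1 \<longrightarrow> (\<exists>a b c. \<forall>v. ev P v = a * v $ 1 + b * v $ 2 + c * v $ 3)"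
  and "m = 1 \<longrightarrow> (\<exists>a b c. \<forall>v. ev Q v = a * v $ 1 + b * v $ 2 + c * v $ 3)"
 then obtain a b c a' b' c' where "\<forall>v. ev P v = a * v $ 1 + b * v $ 2 + c * v $ 3"
  "\<forall>v. ev Q v = a' * v $ 1 + b' * v $ 2 + c' * v $ 3" by blast
 then have "\<forall>v. ev (P + Q) v = (a + a') * v $ 1 + (b + b') * v $ 2 + (c + c') * v $ 3"
  by (simp add: algebra_simps)
 then show "\<exists>a b c. \<forall>v. ev (P + Q) v = a * v $ 1 + b * v $ 2 + c * v $ 3" by blast
qed (simp add: algebra_simps)

lemma sum_atMost_extend:
 fixes Q :: "nat \<Rightarrow> 'a::comm_monoid_add"
 assumes "\<forall>m>N. Q m = 0" "N \<le> N'"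
 shows "(\<Sum>m\<le>N. Q m) = (\<Sum>m\<le>N'. Q m)"
 by (rule sum.mono_neutral_left) (use assms in auto)

lemma dec_add:
 assumes "dec P" "dec P'"
 shows "dec (P + P')"
proof -
 obtain Q N where Q: "\<forall>m. hl m (Q m)" "\<forall>m>N. Q m = 0" "P = (\<Sum>m\<le>N. Q m)"
  using assms(1) by (auto simp: dec_def)
 obtain Q' N' where Q': "\<forall>m. hl m (Q' m)" "\<forall>m>N'. Q' m = 0" "P' = (\<Sum>m\<le>N'. Q' m)"
  using assms(2) by (auto simp: dec_def)
 have "P + P' = (\<Sum>m\<le>max N N'. Q m + Q' m)"
  unfolding sum.distrib using Q(3) Q'(3) sum_atMost_extend[OF Q(2), of "max N N'"]
   sum_atMost_extend[OF Q'(2), of "max N N'"] by simp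
 then show ?thesis unfolding dec_def using Q Q'
  by (intro exI[of _ "\<lambda>m. Q m + Q' m"] exI[of _ "max N N'"]) (auto intro: hl_add)
qed

text \<open>When the product has degree one, \<open>P\<close> is homogeneous of degree 0, so its
  values are the constant \<open>ev P 0\<close> and the product is a multiple of the
  variable.\<close>

lemma hl_var:
 assumes "hl m P" and V: "V \<in> {PX, PY, PZ}"
 shows "hl (Suc m) (V * P)"
proof -
 obtain a b c where abc: "\<And>v. ev V v = a * v $ 1 + b * v $ 2 + c * v $ 3"
 proof -
  consider "V = PX" | "V = PY" | "V = PZ" using V by auto
  then show ?thesis
   using that[of 1 0 0] that[of 0 1 0] that[of 0 0 1] by cases simp_all
 qed
 have "hom (Suc m) (V * P)"
  using assms(1) by (simp add: hl_def hom_def abc algebra_simps)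
 moreover have "\<exists>a b c. \<forall>v. ev (V*P) v = a * v $ 1 + b * v $ 2 + c * v $ 3" if "Suc m = 1"
 proof -
  have "ev P v = ev P 0" for v using assms(1) that
   by (simp add: hl_def hom_def) (metis mult_1 power_0 vector_smult_lzero)
  then obtain k where k: "\<And>v. ev P v = k" by blast
  have "\<forall>v. ev (V * P) v = (k * a) * v $ 1 + (k * b) * v $ 2 + (k * c) * v $ 3"
   by (simp add: abc k algebra_simps)
  then show ?thesis by blast
 qed
 ultimately show ?thesis by (simp add: hl_def)
qed

lemma dec_var:
 assumes "dec P" and V: "V \<in> {PX, PY, PZ}"
 shows "dec (V * P)"
proof -
 obtain Q N where Q: "\<forall>m. hl m (Q m)" "\<forall>m>N. Q m = 0" "P = (\<Sum>m\<le>N. Q m)"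
  using assms(1) by (auto simp: dec_def)
 define R where "R = (\<lambda>m. case m of 0 \<Rightarrow> 0 | Suc n \<Rightarrow> V * Q n)"
 have "V * P = (\<Sum>m\<le>Suc N. R m)"
  unfolding sum.atMost_Suc_shift by (simp add: R_def Q(3) sum_distrib_left)
 moreover have "hl m (R m)" for m
  using Q(1) V by (auto simp: R_def hl_0 hl_var split: nat.split)
 moreover have "\<forall>m>Suc N. R m = 0" using Q(2) by (auto simp: R_def split: nat.split)
 ultimately show ?thesis unfolding dec_def by blast
qed

lemma dec_const: "dec [:[:[:c:]:]:]"
proof -
 let ?Q = "\<lambda>m::nat. if m = 0 then [:[:[:c:]:]:] else 0"
 have "hl m (?Q m)" for m
  by (cases "m = 0") (simp_all add: hl_0, simp add: hl_def hom_def)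
 moreover have "[:[:[:c:]:]:] = (\<Sum>m\<le>0. ?Q m)" "\<forall>m>0. ?Q m = 0" by simp_all
 ultimately show ?thesis unfolding dec_def by (intro exI[of _ ?Q] exI[of _ 0]) auto
qed

text \<open>Peels the three nested coefficient lists in turn, so that a property of
  \<open>poly3\<close> needs checking only for constants, sums and multiplication by a
  variable.\<close>

lemma poly3_induct [case_names const add var]:
 fixes P :: "('k::field) poly3"
 assumes const: "\<And>c. R [:[:[:c:]:]:]" and add: "\<And>P P'. R P \<Longrightarrow> R P' \<Longrightarrow> R (P + P')"
  and var: "\<And>V P. V \<in> {PX, PY, PZ} \<Longrightarrow> R P \<Longrightarrow> R (V * P)"
 shows "R P"
proof (induction P)
 case 0
 then show ?case using const[of 0] by simp
next
 case (pCons q P)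
 have "R [:q:]"
 proof (induction q)
  case 0
  then show ?case using const[of 0] by simp
 next
  case (pCons p q)
  have "R [:[:p:]:]"
  proof (induction p)
   case 0
   then show ?case using const[of 0] by simp
  next
   case (pCons a p)
   have "[:[:pCons a p:]:] = [:[:[:a:]:]:] + PX * [:[:p:]:]" by (simp add: PX_def)
   then show ?case using add[OF const var[OF _ pCons.IH, of PX]] by simp
  qed
  moreover have "[:pCons p q:] = [:[:p:]:] + PY * [:q:]" by (simp add: PY_def)
  ultimately show ?case using add[OF _ var[OF _ pCons.IH, of PY]] by simp
 qed
 moreover have "pCons q P = [:q:] + PZ * P" by (simp add: PZ_def)
 ultimately show ?case using add[OF _ var[OF _ pCons.IH, of PZ]] by simp
qed

lemma dec_all: "dec P"
 by (induction P rule: poly3_induct) (simp_all only: dec_const dec_add dec_var)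

text \<open>\<open>N\<close> is the largest degree occurring in any member of the family, so some
  top component is nonzero, though not necessarily every one.\<close>

lemma family_dec:
 fixes B :: "'i::finite \<Rightarrow> ('k::field) poly3"
 assumes "\<exists>i. B i \<noteq> 0"
 shows "\<exists>Q N. (\<forall>i m. hom m (Q i m)) \<and> (\<forall>i. B i = (\<Sum>m\<le>N. Q i m)) \<and> (\<exists>i. Q i N \<noteq> 0)"
proof -
 have "\<exists>Q N. (\<forall>m. hl m (Q m)) \<and> (\<forall>m>N. Q m = 0) \<and> B i = (\<Sum>m\<le>N. Q m)" for i
  using dec_all by (auto simp: dec_def)
 then obtain Q N where Q: "\<And>i m. hl m (Q i m)" "\<And>i. \<forall>m>N i. Q i m = 0" "\<And>i. B i = (\<Sum>m\<le>N i. Q i m)"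
  by metis
 let ?S = "{m. \<exists>i. Q i m \<noteq> 0}"
 have "?S \<subseteq> {..Max (range N)}"
  using Q(2) by (auto intro!: Max_ge_iff[THEN iffD2]) (meson linorder_not_le)
 then have fin: "finite ?S" using finite_subset by blast
 have ne: "?S \<noteq> {}" using Q(3) assms by (metis (mono_tags, lifting) empty_iff mem_Collect_eq sum.neutral)
 define M where "M = Max ?S"
 have M: "M \<in> ?S" "\<And>i m. M < m \<Longrightarrow> Q i m = 0"
  using Max_in[OF fin ne] Max_ge[OF fin] by (auto simp: M_def) (meson leD)
 have "B i = (\<Sum>m\<le>M. Q i m)" for i
  using sum_atMost_extend[OF Q(2), of i "max M (N i)"] sum_atMost_extend[of M "Q i" "max M (N i)"] M(2) Q(3)
  by simp
 then show ?thesis using Q(1) M(1) by (intro exI[of _ Q] exI[of _ M]) (auto simp: hl_def)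
qed

lemma hom_sum_unique:
 fixes c :: "nat \<Rightarrow> 'k::field_char_0"
 assumes "\<And>t. (\<Sum>m\<le>N. t^m * c m) = t^d * a" "d \<le> N"
 shows "c d = a"
proof -
 have "poly (\<Sum>m\<le>N. monom (c m) m) t = poly (monom a d) t" for t
  using assms(1)[of t] by (simp add: poly_sum poly_monom mult.commute)
 then have "(\<Sum>m\<le>N. monom (c m) m) = monom a d" by (intro poly_eq_poly_eq_iff[THEN iffD1] ext)
 then have "coeff (\<Sum>m\<le>N. monom (c m) m) d = a" by simp
 then show ?thesis using assms(2) by (simp add: coeff_sum sum.delta)
qed

lemma hom_1_linear:
 fixes P :: "('k::field_char_0) poly3"
 assumes "hom 1 P"
 shows "\<exists>a b c. \<forall>v. ev P v = a * v $ 1 + b * v $ 2 + c * v $ 3"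
proof -
 obtain Q N where Q: "\<forall>m. hl m (Q m)" "\<forall>m>N. Q m = 0" "P = (\<Sum>m\<le>N. Q m)"
  using dec_all[of P] by (auto simp: dec_def)
 have "P = (\<Sum>m\<le>Suc N. Q m)" using Q(2,3) by simp
 then have "ev P (t *s v) = (\<Sum>m\<le>Suc N. t^m * ev (Q m) v)" for t v
  using Q(1) by (simp add: hl_def hom_def)
 then have "ev (Q 1) v = ev P v" for v
  using assms hom_sum_unique[where N = "Suc N" and c = "\<lambda>m. ev (Q m) v" and d = 1 and a = "ev P v"] by (simp add: hom_def)
 then show ?thesis using Q(1) by (metis hl_def)
qed

text \<open>Along a ray \<open>t *s v\<close> the product of \<open>p\<close> and \<open>B i\<close>
  is a monomial of degree \<open>d\<close> in \<open>t\<close>, so it equals the product of the top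
  components: \<open>q\<close> is the top component of \<open>p\<close>, and \<open>C\<close>
  collects those of \<open>B\<close>. If the degree of \<open>q\<close> were 0, \<open>p\<close>
  would be a nonzero constant, hence a unit.\<close>

lemma hom_divide:
 fixes A B :: "'i::finite \<Rightarrow> ('k::field_char_0) poly3"
 assumes A: "\<And>i. hom d (A i)" "A i0 \<noteq> 0" and AB: "\<And>i. A i = p*B i" and p: "\<not> p dvd 1"
 shows "\<exists>m K q C. m > 0 \<and> m + K = d \<and> hom m q \<and> (\<forall>i. hom K (C i)) \<and> (\<forall>i. A i = q*C i)"
proof -
 have "p \<noteq> 0" using A(2) AB[of i0] by auto
 then obtain Q m where Q: "\<And>j. hom j (Q j)" "p = (\<Sum>j\<le>m. Q j)" "Q m \<noteq> 0"
  using family_dec[of "\<lambda>_::3. p"] by metis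
 have "B i0 \<noteq> 0" using A(2) AB[of i0] by auto
 then obtain R K where R: "\<And>i j. hom j (R i j)" "\<And>i. B i = (\<Sum>j\<le>K. R i j)" "\<exists>i. R i K \<noteq> 0"
  using family_dec[of B] by metis
 have top: "ev (Q m) v * ev (R i K) v = (if m + K = d then ev (A i) v else 0)" for v i
 proof -
  define r where "r = (\<Sum>j\<le>m. monom (ev (Q j) v) j)"
  define s where "s = (\<Sum>j\<le>K. monom (ev (R i j) v) j)"
  have "poly (r * s) t = poly (monom (ev (A i) v) d) t" for t
  proof -
   have "poly (r * s) t = ev p (t *s v) * ev (B i) (t *s v)"
    using Q(1) R(1) by (simp add: r_def s_def poly_sum poly_monom Q(2) R(2) hom_def mult.commute)
   also have "\<dots> = ev (A i) (t *s v)" by (simp add: AB)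
   finally show ?thesis using A(1)[of i] by (simp add: hom_def poly_monom mult.commute)
  qed
  then have "r * s = monom (ev (A i) v) d" by (intro poly_eq_poly_eq_iff[THEN iffD1] ext)
  then have "coeff (r * s) (m + K) = (if m + K = d then ev (A i) v else 0)" by simp
  moreover have "coeff (r * s) (m + K) = coeff r m * coeff s K"
  proof -
   have dr: "coeff r j = 0" if "j > m" for j using that by (auto simp: r_def coeff_sum)
   have ds: "coeff s j = 0" if "j > K" for j using that by (auto simp: s_def coeff_sum)
   have "coeff (r * s) (m + K) = (\<Sum>j\<le>m + K. coeff r j * coeff s (m + K - j))" by (rule coeff_mult)
   also have "\<dots> = (\<Sum>j\<in>{m}. coeff r j * coeff s (m + K - j))"
   proof (rule sum.mono_neutral_right)
    show "\<forall>j\<in>{..m + K} - {m}. coeff r j * coeff s (m + K - j) = 0"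
    proof
     fix j assume j: "j \<in> {..m + K} - {m}"
     show "coeff r j * coeff s (m + K - j) = 0"
      by (cases "j > m") (use j in \<open>auto simp: dr ds\<close>)
    qed
   qed auto
   finally show ?thesis by simp
  qed
  moreover have "coeff r m = ev (Q m) v" "coeff s K = ev (R i K) v"
   by (simp_all add: r_def s_def coeff_sum)
  ultimately show ?thesis by simp
 qed
 have deg: "m + K = d"
 proof (rule ccontr)
  assume "m + K \<noteq> d"
  then have "Q m * R i K = 0" for i using top by (intro ev_eq_0) auto
  then show False using Q(3) R(3) by auto
 qed
 have "A i - Q m * R i K = 0" for i using top deg by (intro ev_eq_0) auto
 then have eq: "A i = Q m * R i K" for i by (simp add: algebra_simps)
 have "m > 0"
 proof (rule ccontr)
  assume "\<not> m > 0"
  then have "hom 0 p" using Q by simp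
  then have c: "ev p v = ev p 0" for v
   by (metis hom_def mult_1 power_0 vector_smult_lzero)
  then have "p - [:[:[:ev p 0:]:]:] = 0" by (intro ev_eq_0) simp
  then obtain a where a: "p = [:[:[:a:]:]:]" by simp
  then have "a \<noteq> 0" using \<open>p \<noteq> 0\<close> by auto
  then have "p * [:[:[:inverse a:]:]:] = [:[:[:1:]:]:]" by (simp add: a)
  also have "\<dots> = 1" by (simp only: one_pCons)
  finally have "p * [:[:[:inverse a:]:]:] = 1" .
  then show False using p by (metis dvd_triv_left)
 qed
 then show ?thesis using deg Q(1) R(1) eq
  by (intro exI[of _ m] exI[of _ K] exI[of _ "Q m"] exI[of _ "\<lambda>i. R i K"]) simp
qed

definition evv :: "(3 \<Rightarrow> ('k::field) poly3) \<Rightarrow> 'k^3 \<Rightarrow> 'k^3" where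
 "evv A v = (\<chi> i. ev (A i) v)"

lemma evv_nth [simp]: "evv A v $ i = ev (A i) v"
 by (simp add: evv_def)

lemma evv_nz: "evv A v \<noteq> 0 \<longleftrightarrow> (\<exists>i. ev (A i) v \<noteq> 0)"
 by (simp add: vec_eq_iff)

lemma local_rep:
 assumes reg: "regular_map P2 f" and v0: "v0 \<noteq> 0"
 shows "\<exists>d F G. (\<forall>i. hom d (F i)) \<and> ev G v0 \<noteq> 0 \<and>
  (\<forall>v. v \<noteq> 0 \<and> ev G v \<noteq> 0 \<longrightarrow> evv F v \<noteq> 0 \<and> f (proj v) = proj (evv F v))"
proof -
 have "\<exists>d F e G. (\<forall>i. form d (\<lambda>v. (F v :: 'a^3) $ i)) \<and> form e G \<and> (\<forall>v\<in>proj v0. G v \<noteq> 0) \<and>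
   (\<forall>v. v \<noteq> 0 \<and> proj v \<in> P2 \<and> G v \<noteq> 0 \<longrightarrow> F v \<noteq> 0 \<and> f (proj v) = proj (F v))"
  using reg v0 unfolding regular_map_def by (metis proj_in_P2)
 then obtain d F e G where F: "\<And>i. form d (\<lambda>v. (F v :: 'a^3) $ i)" and G: "form e G" "G v0 \<noteq> 0"
  and f: "\<And>v. v \<noteq> 0 \<Longrightarrow> G v \<noteq> 0 \<Longrightarrow> F v \<noteq> 0 \<and> f (proj v) = proj (F v)"
  by (metis proj_in_P2 self_mem_proj)
 have "\<exists>P. hom d P \<and> (\<forall>v. F v $ i = ev P v)" for i using form_imp_poly3[OF F] .
 then obtain P where P: "\<And>i. hom d (P i)" "\<And>i v. F v $ i = ev (P i) v" by metis
 obtain Q where Q: "\<And>v. G v = ev Q v" using form_imp_poly3[OF G(1)] by blast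
 have "F v = evv P v" for v by (simp add: vec_eq_iff P)
 then show ?thesis using P(1) G(2) f Q
  by (intro exI[of _ d] exI[of _ P] exI[of _ Q]) simp
qed

text \<open>Among the homogeneous families proportional to one local representation, take one of
  least degree. A common prime factor could be divided out in homogeneous form, lowering the degree;
  so the components are coprime, every local representation is a polynomial multiple of the chosen
  one, and no point is a common zero.\<close>

lemma global_rep:
 fixes f :: "(('k::field_char_0)^3) set \<Rightarrow> ('k^3) set"
 assumes reg: "regular_map P2 f"
 shows "\<exists>d A. (\<forall>i. hom d (A i)) \<and> (\<forall>v. v \<noteq> 0 \<longrightarrow> evv A v \<noteq> 0 \<and> f (proj v) = proj (evv A v))"
proof -
 have "(vector [1, 0, 0] :: 'k^3) \<noteq> 0" by simp
 from local_rep[OF reg this] obtain d0 F0 G0 where F0: "\<forall>i. hom d0 (F0 i)" and G0: "ev G0 (vector [1, 0, 0] :: 'k^3) \<noteq> 0"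
  and f0': "\<forall>v. v \<noteq> 0 \<and> ev G0 v \<noteq> 0 \<longrightarrow> evv F0 v \<noteq> 0 \<and> f (proj v) = proj (evv F0 v)"
  by (elim exE conjE)
 have f0: "v \<noteq> 0 \<Longrightarrow> ev G0 v \<noteq> 0 \<Longrightarrow> evv F0 v \<noteq> 0 \<and> f (proj v) = proj (evv F0 v)" for v
  using f0' by simp
 have "evv F0 (vector [1, 0, 0]) \<noteq> 0" using f0[OF _ G0] by simp
 then obtain k0 where "ev (F0 k0) (vector [1, 0, 0]) \<noteq> 0" by (auto simp: evv_nz)
 then have k0: "F0 k0 \<noteq> 0" by auto
 have G0': "G0 \<noteq> 0" using G0 by auto
 define S where "S = {d. \<exists>A. (\<forall>i. hom d (A i)) \<and> (\<exists>i. A i \<noteq> 0) \<and> (\<forall>i j. A i*F0 j = A j*F0 i)}"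
 have "d0 \<in> S" using F0 k0 by (auto simp: S_def mult.commute)
 define d where "d = (LEAST d. d \<in> S)"
 have "d \<in> S" and least: "\<And>e. e \<in> S \<Longrightarrow> d \<le> e"
  unfolding d_def using \<open>d0 \<in> S\<close> by (auto intro: LeastI Least_le)
 then obtain A k where A: "\<And>i. hom d (A i)" "A k \<noteq> 0" "\<And>i j. A i*F0 j = A j*F0 i"
  by (auto simp: S_def)
 have cop: "\<exists>i. \<not> p dvd A i" if p: "prime_elem p" for p
 proof (rule ccontr)
  assume "\<nexists>i. \<not> p dvd A i"
  then have "\<exists>B. A i = p * B" for i by (auto elim: dvdE)
  then obtain B where B: "\<And>i. A i = p * B i" by metis
  have "\<not> p dvd 1" using p unfolding prime_elem_def by auto
  from hom_divide[where A = A and B = B and d = d and p = p, OF A(1,2) B this] obtain m K q C where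
   mK: "m > 0" "m + K = d" "\<forall>i. hom K (C i)" and C': "\<forall>i. A i = q*C i" by (elim exE conjE)
  have C: "A i = q * C i" for i using C' by simp
  have q: "q \<noteq> 0" using A(2) C[of k] by auto
  have "C i * F0 j = C j * F0 i" for i j
  proof -
   have "q * (C i * F0 j) = q * (C j * F0 i)" using A(3)[of i j] by (simp add: C mult.assoc)
   then show ?thesis using q by (simp only: mult_cancel_left) simp
  qed
  moreover have "C k \<noteq> 0" using A(2) C[of k] by auto
  ultimately have "K \<in> S" unfolding S_def using mK(3) by (intro CollectI exI[of _ C]) auto
  then show False using least[of K] mK by simp
 qed
 have "evv A v \<noteq> 0 \<and> f (proj v) = proj (evv A v)" if v: "v \<noteq> 0" for v
 proof -
  from local_rep[OF reg v] obtain e F G where G: "ev G v \<noteq> 0"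
   and f': "\<forall>v. v \<noteq> 0 \<and> ev G v \<noteq> 0 \<longrightarrow> evv F v \<noteq> 0 \<and> f (proj v) = proj (evv F v)"
   by (elim exE conjE)
  have f: "v \<noteq> 0 \<Longrightarrow> ev G v \<noteq> 0 \<Longrightarrow> evv F v \<noteq> 0 \<and> f (proj v) = proj (evv F v)" for v
   using f' by simp
  have G': "G \<noteq> 0" using G by auto
  \<comment> \<open>Two local representations agree where both denominators are nonzero;
    multiplication by \<open>G * G0\<close> turns this into an identity of polynomials.\<close>
  have F_F0: "F i * F0 j = F j * F0 i" for i j
  proof -
   have "G * G0 * (F i * F0 j - F j * F0 i) = 0"
   proof (rule ev_eq_0)
    fix w :: "'k^3" assume w: "w \<noteq> 0"
    show "ev (G * G0 * (F i * F0 j - F j * F0 i)) w = 0"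
    proof (cases "ev G w = 0 \<or> ev G0 w = 0")
     case False
     then have "proj (evv F w) = proj (evv F0 w)" using f f0 w by metis
     from proj_eq_cross[OF this, of i j] show ?thesis by simp
    qed auto
   qed
   then show ?thesis using G' G0' by simp
  qed
  have A_F: "F k * A i = A k * F i" for i
  proof -
   have "F0 k0 * F0 k0 * (F k * A i) = (F k * F0 k0) * (A i * F0 k0)" by (simp only: ac_simps)
   also have "\<dots> = (F k0*F0 k)*(A k0*F0 i)" by (simp only: F_F0[of k k0] A(3)[of i k0])
   also have "\<dots> = (F k0 * F0 i) * (A k0 * F0 k)" by (simp only: ac_simps)
   also have "\<dots> = (F i*F0 k0)*(A k*F0 k0)" by (simp only: F_F0[of i k0] A(3)[of k k0])
   also have "\<dots> = F0 k0 * F0 k0 * (A k * F i)" by (simp only: ac_simps)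
   finally show ?thesis using k0 by simp
  qed
  have "A k dvd F k"
   by (rule dvd_cancel_coprime_family[OF A(2) cop]) (simp_all add: A_F)
  then obtain h where h: "F k = A k * h" by (rule dvdE)
  have Fi: "F i = h * A i" for i
  proof -
   have "A k * F i = F k * A i" using A_F[of i] by (rule sym)
   also have "\<dots> = A k * (h * A i)" by (simp only: h mult.assoc)
   finally have "A k * F i = A k * (h * A i)" .
   then show ?thesis using A(2) by simp
  qed
  then have FA: "evv F v = ev h v *s evv A v" by (simp add: vec_eq_iff)
  then have "ev h v \<noteq> 0" "evv A v \<noteq> 0" using f[OF v G] by auto
  then show ?thesis using f[OF v G] FA proj_smult by metis
 qed
 then show ?thesis using A(1) by (intro exI[of _ d] exI[of _ A]) simp
qed

lemma ev_along_curve: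
 fixes a b c :: "('k::field) poly"
 shows "\<exists>p. \<forall>t. ev P (vector [poly a t, poly b t, poly c t]) = poly p t"
proof (induction P rule: poly3_induct)
 case (const c)
 show ?case by (intro exI[of _ "[:c:]"]) simp
next
 case (add P P')
 then obtain p q where "\<forall>t. ev P (vector [poly a t, poly b t, poly c t]) = poly p t"
  "\<forall>t. ev P' (vector [poly a t, poly b t, poly c t]) = poly q t" by (elim exE)
 then show ?case by (intro exI[of _ "p + q"]) simp
next
 case (var V P)
 then obtain p where "\<forall>t. ev P (vector [poly a t, poly b t, poly c t]) = poly p t" by (elim exE)
 moreover have "\<exists>q. \<forall>t. ev V (vector [poly a t, poly b t, poly c t]) = poly q t"
 proof -
  consider "V = PX" | "V = PY" | "V = PZ" using var(1) by auto
  then show ?thesis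
  proof cases
   case 1
   then show ?thesis by (intro exI[of _ a]) simp
  next
   case 2
   then show ?thesis by (intro exI[of _ b]) simp
  next
   case 3
   then show ?thesis by (intro exI[of _ c]) simp
  qed
 qed
 then obtain q where "\<forall>t. ev V (vector [poly a t, poly b t, poly c t]) = poly q t" by (elim exE)
 ultimately show ?case by (intro exI[of _ "q * p"]) simp
qed

lemma no_root_imp_const:
 fixes p :: "('k::alg_closed_field) poly"
 assumes "\<And>t. poly p t \<noteq> 0"
 shows "\<exists>c. p = [:c:]"
 using assms alg_closed_imp_poly_has_root[of p] degree_eq_zeroE by (metis gr0I)

text \<open>The composite of the two representations fixes every point of the line
  \<open>z = 0\<close>. In the chart \<open>(1, t, 0)\<close> its first coordinate is a polynomial
  without zeros, hence a constant \<mu>. Homogeneity carries this to the chart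
  \<open>(s, 1, 0)\<close>, where the coordinates are \<open>\<mu> s^(de)\<close> and
  \<open>\<mu> s^(de - 1)\<close>. At \<open>s = 0\<close> the first must vanish and the second must
  not, so \<open>d e = 1\<close>.\<close>

lemma regular_inverse_degree:
 fixes A C :: "3 \<Rightarrow> ('k::{alg_closed_field, field_char_0}) poly3"
 assumes A: "\<And>i. hom d (A i)" and C: "\<And>i. hom e (C i)"
  and inv: "\<And>v. v \<noteq> 0 \<Longrightarrow> proj (evv C (evv A v)) = proj v"
 shows "d = 1"
proof -
 let ?g = "\<lambda>v. evv C (evv A v)"
 have curve: "\<exists>p. \<forall>t. ?g (vector [poly a t, poly b t, poly c t]) $ i = poly p t" for a b c i
 proof -
  have "\<exists>q. \<forall>t. ev (A j) (vector [poly a t, poly b t, poly c t]) = poly q t" for j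
   by (rule ev_along_curve)
  then obtain q where q: "\<And>j t. ev (A j) (vector [poly a t, poly b t, poly c t]) = poly (q j) t" by metis
  obtain p where p: "\<forall>t. ev (C i) (vector [poly (q 1) t, poly (q 2) t, poly (q 3) t]) = poly p t"
   using ev_along_curve[of "C i" "q 1" "q 2" "q 3"] by blast
  have "evv A (vector [poly a t, poly b t, poly c t]) = vector [poly (q 1) t, poly (q 2) t, poly (q 3) t]" for t
   by (simp add: vec3_eq_iff q)
  then show ?thesis using p by (intro exI[of _ p]) simp
 qed
 have hom: "?g (t *s v) = t^(d * e) *s ?g v" for t v
 proof -
  have *: "evv A (t *s v) = t^d *s evv A v" using A by (simp add: vec_eq_iff hom_def)
  show ?thesis unfolding * using C by (simp add: vec_eq_iff hom_def power_mult)
 qed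
 obtain p1 where p1: "\<And>t. ?g (vector [1, t, 0]) $ 1 = poly p1 t"
  using curve[where a = "[:1:]" and b = "[:0, 1:]" and c = 0 and i = 1] by auto
 have par: "proj (?g (vector [1, t, 0])) = pnt 1 t 0" for t by (rule inv) simp
 have t2: "?g (vector [1, t, 0]) $ 2 = t * ?g (vector [1, t, 0]) $ 1" for t
  using proj_eq_cross[OF par[of t], of 1 2] by (simp add: mult.commute)
 have t3: "?g (vector [1, t, 0]) $ 3 = 0" for t
  using proj_eq_cross[OF par[of t], of 1 3] by simp
 have nz: "?g v \<noteq> 0" if "v \<noteq> 0" for v using inv[OF that] that by (metis proj_in_P2)
 have "poly p1 t \<noteq> 0" for t
  using nz[of "vector [1, t, 0]"] t2[of t] t3[of t] p1[of t] by (auto simp: vec3_eq_iff simp del: evv_nth)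
 then obtain \<mu> where mu: "p1 = [:\<mu>:]" "\<mu> \<noteq> 0" using no_root_imp_const[of p1] by auto
 have g1: "?g (vector [s, 1, 0]) $ 1 = s^(d*e)*\<mu>" and g2: "?g (vector [s, 1, 0]) $ 2 * s = s^(d*e)*\<mu>"
  if "s \<noteq> 0" for s
 proof -
  have s: "vector [s, 1, 0] = s *s (vector [1, inverse s, 0] :: 'k^3)" using that by (simp add: vec3_eq_iff)
  show "?g (vector [s, 1, 0]) $ 1 = s^(d * e) * \<mu>"
   unfolding s hom using p1[of "inverse s"] mu by simp
  show "?g (vector [s, 1, 0]) $ 2 * s = s^(d * e) * \<mu>"
   unfolding s hom using p1[of "inverse s"] t2[of "inverse s"] mu that by simp
 qed
 obtain q1 q2 where q: "\<And>s. ?g (vector [s, 1, 0]) $ 1 = poly q1 s" "\<And>s. ?g (vector [s, 1, 0]) $ 2 = poly q2 s"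
  using curve[where b = "[:1:]" and a = "[:0, 1:]" and c = 0 and i = 1]
   curve[where b = "[:1:]" and a = "[:0, 1:]" and c = 0 and i = 2] by auto
 have inf: "infinite (UNIV - {0::'k})" by (simp add: infinite_UNIV_char_0)
 have "q1 - monom \<mu> (d * e) = 0"
  by (rule poly_zero_if_infinite_roots[OF inf]) (use g1 q in \<open>simp add: poly_monom\<close>)
 then have q1: "q1 = monom \<mu> (d * e)" by simp
 have "q2 * [:0, 1:] - monom \<mu> (d * e) = 0"
  by (rule poly_zero_if_infinite_roots[OF inf]) (use g2 q in \<open>simp add: poly_monom mult.commute\<close>)
 then have q2: "pCons 0 q2 = monom \<mu> (d * e)" by simp
 have par0: "proj (?g (vector [0, 1, 0])) = pnt 0 1 0" by (rule inv) simp
 have "poly q1 0 = 0" using proj_eq_cross[OF par0, of 1 2] q by simp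
 then have "d * e \<noteq> 0" using q1 mu by (auto simp: poly_monom)
 moreover have "d * e \<le> 1"
 proof (rule ccontr)
  assume "\<not> d * e \<le> 1"
  then have "d * e = Suc (Suc (d * e - 2))" by linarith
  then obtain n where n: "d * e = Suc (Suc n)" by (rule that)
  have "pCons 0 q2 = pCons 0 (monom \<mu> (Suc n))"
   using q2 unfolding n monom_Suc[of \<mu> "Suc n"] .
  then have "q2 = monom \<mu> (Suc n)" by (rule pCons_eq_iff[THEN iffD1, THEN conjunct2])
  then have "?g (vector [0, 1, 0]) $ 2 = 0" using q by (simp add: poly_monom)
  moreover have "?g (vector [0, 1, 0]) $ 1 = 0" "?g (vector [0, 1, 0]) $ 3 = 0"
   using proj_eq_cross[OF par0, of 1 2] proj_eq_cross[OF par0, of 3 2] by simp_all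
  ultimately show False using nz[of "vector [0, 1, 0]"] by (auto simp: vec3_eq_iff simp del: evv_nth)
 qed
 ultimately have "d * e = 1" by linarith
 then show ?thesis by simp
qed

theorem Aut_P2_linear:
 fixes f :: "(('k::{alg_closed_field, field_char_0})^3) set \<Rightarrow> ('k^3) set"
 assumes "f \<in> Aut P2"
 shows "\<exists>T. invertible T \<and> f = restrict (pmap T) P2"
proof -
 have f: "bij_betw f P2 P2" "f \<in> extensional P2" "regular_map P2 f" "regular_map P2 (inv_into P2 f)"
  using assms by (auto simp: Aut_def Bij_def)
 obtain d A where A: "\<And>i. hom d (A i)" "\<And>v. v \<noteq> 0 \<Longrightarrow> evv A v \<noteq> 0 \<and> f (proj v) = proj (evv A v)"
  using global_rep[OF f(3)] by blast
 obtain e C where C: "\<And>i. hom e (C i)" "\<And>v. v \<noteq> 0 \<Longrightarrow> evv C v \<noteq> 0 \<and> inv_into P2 f (proj v) = proj (evv C v)"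
  using global_rep[OF f(4)] by blast
 have "proj (evv C (evv A v)) = proj v" if "v \<noteq> 0" for v
  using A(2)[OF that] C(2)[of "evv A v"] f(1) that
  by (metis bij_betw_inv_into_left proj_in_P2)
 then have "d = 1" by (rule regular_inverse_degree[OF A(1) C(1)])
 then have "\<exists>a b c. \<forall>v. ev (A i) v = a * v $ 1 + b * v $ 2 + c * v $ 3" for i
  using A(1)[of i] hom_1_linear[of "A i"] by simp
 then obtain a b c where abc: "\<And>i v. ev (A i) v = a i * v $ 1 + b i * v $ 2 + c i * v $ 3" by metis
 define T :: "'k^3^3" where "T = (\<chi> i. vector [a i, b i, c i])"
 have T: "T *v v = evv A v" for v
  by (simp add: vec_eq_iff matrix_vector_mult_3 T_def abc)
 have "invertible T" using A(2) T by (intro invertibleI_nz) metis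
 moreover have "f = restrict (pmap T) P2"
 proof (rule extensionalityI[OF f(2)])
  fix p :: "('k^3) set" assume "p \<in> P2"
  then show "f p = restrict (pmap T) P2 p" using A(2) T by (auto elim!: P2_cases)
 qed simp
 ultimately show ?thesis by blast
qed

section \<open>Rigid pairs\<close>

text \<open>\<open>T'\<close> plays the role of the conjugate of \<open>T\<close> by \<sigma>, whose
  existence as a linear map is the real restriction.\<close>

definition rigid :: "(('k::field)^3) set set \<Rightarrow> (('k^3) set \<Rightarrow> ('k^3) set) \<Rightarrow> bool" where
 "rigid E \<sigma> \<longleftrightarrow> (\<forall>T T'. preserves T E \<longrightarrow> preserves T' E \<longrightarrow>
   (\<forall>p\<in>E. \<sigma> (pmap T p) = pmap T' (\<sigma> p)) \<longrightarrow> (\<forall>p\<in>E. pmap T' p = pmap T p))"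

lemma rigidD:
 assumes "rigid E \<sigma>" "preserves T E" "preserves T' E" "\<And>p. p \<in> E \<Longrightarrow> \<sigma> (pmap T p) = pmap T' (\<sigma> p)"
  and "p \<in> E"
 shows "pmap T' p = pmap T p"
 using assms unfolding rigid_def by blast

lemma BijGroup_simps:
 "carrier (BijGroup E) = Bij E"
 "f \<in> Bij E \<Longrightarrow> g \<in> Bij E \<Longrightarrow> f \<otimes>\<^bsub>BijGroup E\<^esub> g = compose E f g"
 "\<one>\<^bsub>BijGroup E\<^esub> = (\<lambda>x\<in>E. x)"
 by (auto simp: BijGroup_def)

lemma Bij_mem: "f \<in> Bij E \<Longrightarrow> x \<in> E \<Longrightarrow> f x \<in> E"
 by (auto simp: Bij_def bij_betw_def)

lemma Bij_eqI: "f \<in> Bij E \<Longrightarrow> g \<in> Bij E \<Longrightarrow> (\<And>x. x \<in> E \<Longrightarrow> f x = g x) \<Longrightarrow> f = g"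
 by (auto simp: Bij_def intro: extensionalityI)

lemma Bij_nat_pow:
 assumes "f \<in> Bij E"
 shows "f [^]\<^bsub>BijGroup E\<^esub> (n::nat) \<in> Bij E"
  and "x \<in> E \<Longrightarrow> (f [^]\<^bsub>BijGroup E\<^esub> n) x = (f ^^ n) x"
proof -
 interpret group "BijGroup E" by (rule group_BijGroup)
 have f: "f \<in> carrier (BijGroup E)" using assms by (simp add: BijGroup_simps)
 show *: "f [^]\<^bsub>BijGroup E\<^esub> n \<in> Bij E" for n :: nat
  using nat_pow_closed[OF f] by (simp add: BijGroup_simps)
 show "x \<in> E \<Longrightarrow> (f [^]\<^bsub>BijGroup E\<^esub> n) x = (f ^^ n) x"
 proof (induction n arbitrary: x)
  case 0
  then show ?case by (simp add: BijGroup_simps)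
 next
  case (Suc n)
  have "(f [^]\<^bsub>BijGroup E\<^esub> Suc n) x = (f [^]\<^bsub>BijGroup E\<^esub> n) (f x)"
   using Suc.prems assms * by (simp add: BijGroup_simps compose_eq)
  then show ?case using Suc Bij_mem[OF assms] by (simp add: funpow_swap1)
 qed
qed

lemma pow_eq_one_iff:
 assumes "f \<in> Bij E"
 shows "f [^]\<^bsub>BijGroup E\<^esub> (n::nat) = \<one>\<^bsub>BijGroup E\<^esub> \<longleftrightarrow> (\<forall>x\<in>E. (f ^^ n) x = x)"
proof
 assume "\<forall>x\<in>E. (f ^^ n) x = x"
 then show "f [^]\<^bsub>BijGroup E\<^esub> n = \<one>\<^bsub>BijGroup E\<^esub>"
  by (intro Bij_eqI[of _ E] Bij_nat_pow assms) (auto simp: BijGroup_simps Bij_nat_pow assms id_Bij)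
next
 assume *: "f [^]\<^bsub>BijGroup E\<^esub> n = \<one>\<^bsub>BijGroup E\<^esub>"
 show "\<forall>x\<in>E. (f ^^ n) x = x"
 proof
  fix x assume x: "x \<in> E"
  then show "(f ^^ n) x = x" using Bij_nat_pow(2)[OF assms x, of n] by (simp add:*BijGroup_simps)
 qed
qed

lemma (in group) int_pow_in_subgroup:
 assumes "subgroup H G" "x \<in> H"
 shows "x [^] (i::int) \<in> H"
proof -
 interpret H: subgroup H G by (rule assms)
 have nat: "x [^] (n::nat) \<in> H" for n by (induction n) (use assms in \<open>auto simp: H.m_closed\<close>)
 show ?thesis
  by (cases i rule: int_cases2) (use nat assms H.mem_carrier in \<open>auto simp: int_pow_int int_pow_neg_int H.m_inv_closed\<close>)
qed

text \<open>Matrix form of \<open>Aut_up E\<close>. Being a subgroup, it allows products and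
  inverses to be taken without returning to regular maps.\<close>

definition linear_bijections :: "(('k::field)^3) set set \<Rightarrow> (('k^3) set \<Rightarrow> ('k^3) set) set" where
 "linear_bijections E = {restrict (pmap T) E | T. preserves T E}"

lemma linear_bijections_subgroup: "subgroup (linear_bijections E) (BijGroup E)"
proof -
 interpret group "BijGroup E" by (rule group_BijGroup)
 show ?thesis
 proof (rule subgroupI)
  show "linear_bijections E \<subseteq> carrier (BijGroup E)"
   by (auto simp: linear_bijections_def BijGroup_simps restrict_pmap_Bij)
  have "preserves (mat 1) E" by (simp add: preserves_def invertible_def)
  then show "linear_bijections E \<noteq> {}" by (auto simp: linear_bijections_def)
  fix f assume "f \<in> linear_bijections E"
  then obtain S where S: "preserves S E" "f = restrict (pmap S) E" by (auto simp: linear_bijections_def)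
  have f: "f \<in> Bij E" using S restrict_pmap_Bij by blast
  have "inv\<^bsub>BijGroup E\<^esub> f = restrict (pmap (matrix_inv S)) E"
   using f S by (simp add: inv_BijGroup inv_into_restrict_pmap cong: restrict_cong)
  then show "inv\<^bsub>BijGroup E\<^esub> f \<in> linear_bijections E"
   using S preserves_inv by (auto simp: linear_bijections_def)
  fix g assume "g \<in> linear_bijections E"
  then obtain T where T: "preserves T E" "g = restrict (pmap T) E" by (auto simp: linear_bijections_def)
  have g: "g \<in> Bij E" using T restrict_pmap_Bij by blast
  have "f \<otimes>\<^bsub>BijGroup E\<^esub> g = restrict (pmap (S ** T)) E"
  proof (rule Bij_eqI)
   show "f \<otimes>\<^bsub>BijGroup E\<^esub> g \<in> Bij E" using f g m_closed by (simp add: BijGroup_simps)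
   show "restrict (pmap (S ** T)) E \<in> Bij E"
    using S T preserves_mult restrict_pmap_Bij by blast
   show "(f \<otimes>\<^bsub>BijGroup E\<^esub> g) x = restrict (pmap (S ** T)) E x" if "x \<in> E" for x
    using that f g S T preserves_mem[OF T(1) that] by (simp add: BijGroup_simps compose_eq pmap_mult)
  qed
  then show "f \<otimes>\<^bsub>BijGroup E\<^esub> g \<in> linear_bijections E"
   using S T preserves_mult by (auto simp: linear_bijections_def)
 qed
qed

lemma Aut_up_eq:
 fixes E :: "(('k::{alg_closed_field, field_char_0})^3) set set"
 assumes E: "E \<subseteq> P2"
 shows "Aut_up E = linear_bijections E"
proof (rule equalityI; rule subsetI)
 fix f assume "f \<in> Aut_up E"
 then obtain g where f: "f \<in> Aut E" "g \<in> Aut P2" "f = restrict g E" by (auto simp: Aut_up_def)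
 then obtain T where T: "invertible T" "g = restrict (pmap T) P2" using Aut_P2_linear by blast
 have *: "f = restrict (pmap T) E" using f T E by (auto simp: fun_eq_iff restrict_def)
 have "f ` E = E" using f(1) by (auto simp: Aut_def Bij_def bij_betw_def)
 then have "pmap T ` E = E" by (simp add: *)
 then show "f \<in> linear_bijections E" using*T by (auto simp: linear_bijections_def preserves_def)
next
 fix f assume "f \<in> linear_bijections E"
 then obtain T where T: "preserves T E" "f = restrict (pmap T) E" by (auto simp: linear_bijections_def)
 have "f = restrict (restrict (pmap T) P2) E" using T E by (auto simp: fun_eq_iff restrict_def)
 moreover have "restrict (pmap T) P2 \<in> Aut P2"
  using T by (intro restrict_pmap_Aut preserves_P2) (auto simp: preserves_def)
 ultimately show "f \<in> Aut_up E" unfolding Aut_up_def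
  using restrict_pmap_Aut[OF T(1) E] T(2) by (intro CollectI conjI bexI[of _ "restrict (pmap T) P2"]) simp_all
qed

lemma Aut_down_cases:
 fixes E :: "(('k::{alg_closed_field, field_char_0})^3) set set"
 assumes "\<tau> \<in> Aut_down E" and E: "E \<subseteq> P2"
 obtains T where "preserves T E" "restrict \<tau> E = restrict (pmap T) E"
proof -
 have "restrict \<tau> E \<in> Aut_up E" using assms by (auto simp: Aut_down_def Aut_up_def)
 then show ?thesis using that by (auto simp: Aut_up_eq[OF E] linear_bijections_def)
qed

text \<open>One inclusion is \<open>(\<rho> \<sigma>)^i \<sigma>^-i = \<rho>^i\<close> for commuting
  maps. The other applies rigidity to the conjugate \<kappa> of \<rho>; its linearity comes from the
  exponent 2 after cancelling \<rho> inside the subgroup of linear bijections.\<close>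

theorem Z_set_eq_M_set:
 fixes E :: "(('k::{alg_closed_field, field_char_0})^3) set set"
 assumes E: "E \<subseteq> P2" and \<sigma>: "\<sigma> \<in> Bij E" and rig: "rigid E \<sigma>"
 shows "Z_set E \<sigma> = M_set E \<sigma>"
proof (rule equalityI; rule subsetI)
 interpret group "BijGroup E" by (rule group_BijGroup)
 interpret L: subgroup "linear_bijections E" "BijGroup E" by (rule linear_bijections_subgroup)
 have s: "\<sigma> \<in> carrier (BijGroup E)" using \<sigma> by (simp add: BijGroup_simps)
 {
  fix \<tau> assume \<tau>: "\<tau> \<in> Z_set E \<sigma>"
  then have down: "\<tau> \<in> Aut_down E" by (simp add: Z_set_def)
  then obtain T where T: "preserves T E" "restrict \<tau> E = restrict (pmap T) E" using Aut_down_cases E by blast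
  define \<rho> where "\<rho> = restrict \<tau> E"
  have rL: "\<rho> \<in> linear_bijections E" using T by (auto simp: \<rho>_def linear_bijections_def)
  then have r: "\<rho> \<in> carrier (BijGroup E)" by (rule L.mem_carrier)
  have eq: "\<sigma> \<otimes>\<^bsub>BijGroup E\<^esub> \<rho> \<otimes>\<^bsub>BijGroup E\<^esub> inv\<^bsub>BijGroup E\<^esub> \<sigma> = \<rho>"
   using \<tau> by (simp add: Z_set_def \<rho>_def)
  have comm: "\<rho> \<otimes>\<^bsub>BijGroup E\<^esub> \<sigma> = \<sigma> \<otimes>\<^bsub>BijGroup E\<^esub> \<rho>"
   using r s by (subst (1) eq[symmetric]) (simp add: m_assoc)
  have "(\<rho> \<otimes>\<^bsub>BijGroup E\<^esub> \<sigma>) [^]\<^bsub>BijGroup E\<^esub> i \<otimes>\<^bsub>BijGroup E\<^esub> \<sigma> [^]\<^bsub>BijGroup E\<^esub> (- i)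
   = \<rho> [^]\<^bsub>BijGroup E\<^esub> i" for i :: int
   unfolding int_pow_mult_distrib[OF comm r s] using r s by (simp add: int_pow_neg m_assoc)
  moreover have "\<rho> [^]\<^bsub>BijGroup E\<^esub> i \<in> Aut_up E" for i :: int
   unfolding Aut_up_eq[OF E] using int_pow_in_subgroup[OF linear_bijections_subgroup rL] .
  ultimately show "\<tau> \<in> M_set E \<sigma>" using down by (simp add: M_set_def \<rho>_def)
 }
 {
  fix \<tau> assume \<tau>: "\<tau> \<in> M_set E \<sigma>"
  then have down: "\<tau> \<in> Aut_down E" by (simp add: M_set_def)
  then obtain T where T: "preserves T E" "restrict \<tau> E = restrict (pmap T) E" using Aut_down_cases E by blast
  define \<rho> where "\<rho> = restrict \<tau> E"
  have rL: "\<rho> \<in> linear_bijections E" using T by (auto simp: \<rho>_def linear_bijections_def)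
  then have r: "\<rho> \<in> carrier (BijGroup E)" by (rule L.mem_carrier)
  define \<kappa> where "\<kappa> = \<sigma> \<otimes>\<^bsub>BijGroup E\<^esub> \<rho> \<otimes>\<^bsub>BijGroup E\<^esub> inv\<^bsub>BijGroup E\<^esub> \<sigma>"
  have k: "\<kappa> \<in> carrier (BijGroup E)" using r s by (simp add: \<kappa>_def)
  have "(\<rho> \<otimes>\<^bsub>BijGroup E\<^esub> \<sigma>) [^]\<^bsub>BijGroup E\<^esub> (2::int) \<otimes>\<^bsub>BijGroup E\<^esub> \<sigma> [^]\<^bsub>BijGroup E\<^esub> (- 2::int) \<in> linear_bijections E"
   using \<tau> unfolding Aut_up_eq[OF E, symmetric] by (auto simp: M_set_def \<rho>_def)
  moreover have "x [^]\<^bsub>BijGroup E\<^esub> (2::int) = x \<otimes>\<^bsub>BijGroup E\<^esub> x" if "x \<in> carrier (BijGroup E)" for x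
   using int_pow_mult[OF that, of 1 1] that by (simp add: int_pow_1)
  then have "(\<rho> \<otimes>\<^bsub>BijGroup E\<^esub> \<sigma>) [^]\<^bsub>BijGroup E\<^esub> (2::int) \<otimes>\<^bsub>BijGroup E\<^esub> \<sigma> [^]\<^bsub>BijGroup E\<^esub> (- 2::int) = \<rho> \<otimes>\<^bsub>BijGroup E\<^esub> \<kappa>"
   using r s by (simp add: \<kappa>_def int_pow_neg inv_mult_group m_assoc) (simp flip: m_assoc)
  ultimately have "\<rho> \<otimes>\<^bsub>BijGroup E\<^esub> \<kappa> \<in> linear_bijections E" by simp
  from L.m_closed[OF L.m_inv_closed[OF rL] this]
  have "\<kappa> \<in> linear_bijections E" using r k by (simp flip: m_assoc)
  then obtain T' where T': "preserves T' E" "\<kappa> = restrict (pmap T') E" by (auto simp: linear_bijections_def)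
  have ks: "\<kappa> \<otimes>\<^bsub>BijGroup E\<^esub> \<sigma> = \<sigma> \<otimes>\<^bsub>BijGroup E\<^esub> \<rho>" using r s by (simp add: \<kappa>_def m_assoc)
  have "\<sigma> (pmap T p) = pmap T' (\<sigma> p)" if p: "p \<in> E" for p
  proof -
   have "(\<kappa> \<otimes>\<^bsub>BijGroup E\<^esub> \<sigma>) p = \<kappa> (\<sigma> p)" "(\<sigma> \<otimes>\<^bsub>BijGroup E\<^esub> \<rho>) p = \<sigma> (\<rho> p)"
    using r s k p by (simp_all add: BijGroup_simps compose_eq)
   then show ?thesis using ks p T' T Bij_mem[OF \<sigma> p] by (simp add: \<rho>_def)
  qed
  then have "pmap T' p = pmap T p" if "p \<in> E" for p
   using rigidD[OF rig T(1) T'(1)] that by blast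
  then have "\<kappa> = \<rho>" using T T' by (simp add: \<rho>_def cong: restrict_cong)
  then show "\<tau> \<in> Z_set E \<sigma>" using down by (simp add: Z_set_def \<rho>_def \<kappa>_def)
 }
qed

section \<open>Presentation by three bilinear forms\<close>

definition bil :: "('k::field)^3^3 \<Rightarrow> 'k^3 \<Rightarrow> 'k^3 \<Rightarrow> 'k" where
 "bil G v w = (\<Sum>i\<in>UNIV. \<Sum>j\<in>UNIV. G $ i $ j * v $ i * w $ j)"

text \<open>Fixing one argument turns the three bilinear equations into a linear system for the
  other: \<open>lmat\<close> acts on the second argument, \<open>rmat\<close> on the first. Their
  determinants cut out the point scheme.\<close>

definition lmat :: "(3 \<Rightarrow> ('k::field)^3^3) \<Rightarrow> 'k^3 \<Rightarrow> 'k^3^3" where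
 "lmat B v = (\<chi> k j. \<Sum>i\<in>UNIV. B k $ i $ j * v $ i)"

definition rmat :: "(3 \<Rightarrow> ('k::field)^3^3) \<Rightarrow> 'k^3 \<Rightarrow> 'k^3^3" where
 "rmat B w = (\<chi> k i. \<Sum>j\<in>UNIV. B k $ i $ j * w $ j)"

lemma lmat_mult: "(lmat B v *v w) $ k = bil (B k) v w"
 by (simp add: lmat_def matrix_vector_mult_def bil_def sum_3 algebra_simps)

lemma rmat_mult: "(rmat B w *v v) $ k = bil (B k) v w"
 by (simp add: rmat_def matrix_vector_mult_def bil_def sum_3 algebra_simps)

lemma bil_smult: "bil G (c *s v) (d *s w) = c * d * bil G v w"
 by (simp add: bil_def sum_3 algebra_simps)

lemma det_0_imp_kernel:
 fixes N :: "('k::field)^3^3"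
 assumes "det N = 0"
 obtains w where "w \<noteq> 0" "N *v w = 0"
 using assms invertibleI_nz[of N] invertible_det_nz by blast

lemma kernel_imp_det_0:
 fixes N :: "('k::field)^3^3"
 assumes "N *v w = 0" "w \<noteq> 0"
 shows "det N = 0"
 using assms invertible_mult_nz[of N w] invertible_det_nz by blast

text \<open>The rank is at most one.\<close>

definition minors_zero :: "('k::field)^3^3 \<Rightarrow> bool" where
 "minors_zero N \<longleftrightarrow> (\<forall>k l i j. N $ k $ i*N $ l $ j = N $ k $ j*N $ l $ i)"

text \<open>A vector orthogonal to \<open>v\<close> and \<open>w\<close> is proportional to their
  cross product; this is one of the three coordinate equations of that proportionality.\<close>

lemma perp_cross:
 fixes n1 n2 n3 :: "'k::comm_ring_1"
 assumes "n1 * w1 + n2 * w2 + n3 * w3 = 0" "n1 * v1 + n2 * v2 + n3 * v3 = 0"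
 shows "n1 * (w3 * v1 - w1 * v3) = n2 * (w2 * v3 - w3 * v2)"
proof -
 have "n1 * (w3 * v1 - w1 * v3) - n2 * (w2 * v3 - w3 * v2) =
  w3 * (n1 * v1 + n2 * v2 + n3 * v3) - v3 * (n1 * w1 + n2 * w2 + n3 * w3)"
  by (simp add: algebra_simps)
 then show ?thesis by (simp add: assms)
qed

text \<open>Two independent kernel vectors have a nonzero cross product \<open>c\<close>, and every
  row of \<open>N\<close> is a multiple of \<open>c\<close>, which would make the rank at most
  one.\<close>

lemma kernel_unique:
 fixes N :: "('k::field)^3^3"
 assumes w: "N *v w = 0" "w \<noteq> 0" and w': "N *v w' = 0" "w' \<noteq> 0" and N: "\<not> minors_zero N"
 shows "proj w = proj w'"
proof (rule ccontr)
 assume ne: "proj w \<noteq> proj w'"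
 define c :: "'k^3" where "c = vector [w $ 2*w' $ 3 - w $ 3*w' $ 2, w $ 3*w' $ 1 - w $ 1*w' $ 3, w $ 1*w' $ 2 - w $ 2*w' $ 1]"
 have "c \<noteq> 0"
 proof
  assume "c = 0"
  then have "w $ i * w' $ j = w $ j * w' $ i" for i j
   using exhaust_3[of i] exhaust_3[of j] by (auto simp: c_def)
  then show False using ne proj_eqI w(2) w'(2) by blast
 qed
 then obtain m where m: "c $ m \<noteq> 0" by (auto simp: vec_eq_iff)
 have row: "N $ k $ i * c $ j = N $ k $ j * c $ i" for k i j
 proof -
  have 1: "N $ k $ 1 * w $ 1 + N $ k $ 2 * w $ 2 + N $ k $ 3 * w $ 3 = 0"
   using w(1) matrix_vector_mult_3[of N w k] by simp
  have 2: "N $ k $ 1 * w' $ 1 + N $ k $ 2 * w' $ 2 + N $ k $ 3 * w' $ 3 = 0"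
   using w'(1) matrix_vector_mult_3[of N w' k] by simp
  have a12: "N $ k $ 1 * c $ 2 = N $ k $ 2 * c $ 1"
   unfolding c_def vector_3 by (rule perp_cross[OF 1 2])
  have 3: "N $ k $ 2 * w $ 2 + N $ k $ 3 * w $ 3 + N $ k $ 1 * w $ 1 = 0"
   "N $ k $ 2 * w' $ 2 + N $ k $ 3 * w' $ 3 + N $ k $ 1 * w' $ 1 = 0"
   using 1 2 by (simp_all add: ac_simps)
  have a23: "N $ k $ 2 * c $ 3 = N $ k $ 3 * c $ 2"
   unfolding c_def vector_3 by (rule perp_cross[OF 3])
  have 4: "N $ k $ 3 * w $ 3 + N $ k $ 1 * w $ 1 + N $ k $ 2 * w $ 2 = 0"
   "N $ k $ 3 * w' $ 3 + N $ k $ 1 * w' $ 1 + N $ k $ 2 * w' $ 2 = 0"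
   using 1 2 by (simp_all add: ac_simps)
  have a31: "N $ k $ 3 * c $ 1 = N $ k $ 1 * c $ 3"
   unfolding c_def vector_3 by (rule perp_cross[OF 4])
  consider "i = 1" | "i = 2" | "i = 3" using exhaust_3[of i] by blast
  then show ?thesis
   by cases (use a12 a23 a31 exhaust_3[of j] in auto)
 qed
 define r where "r = (\<lambda>k. N $ k $ m / c $ m)"
 have N_r: "N $ k $ i = r k * c $ i" for k i using row[of k i m] m by (simp add: r_def field_simps)
 have "minors_zero N" unfolding minors_zero_def by (simp add: N_r ac_simps)
 then show False using N by simp
qed

definition relzero :: "(('k::field)^3) set set \<Rightarrow> (('k^3) set \<Rightarrow> ('k^3) set) \<Rightarrow> 'k^3 \<Rightarrow> 'k^3 \<Rightarrow> bool" where
 "relzero E \<sigma> v w \<longleftrightarrow> (\<forall>g\<in>relations E \<sigma>.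
   (\<Sum>i\<in>UNIV. \<Sum>j\<in>UNIV. Poly_Mapping.lookup g [i, j] * v $ i * w $ j) = 0)"

text \<open>The pair is recovered from its relations: their common zeros form the graph of \<open>\<sigma>\<close>.\<close>

definition geometric :: "(('k::field)^3) set set \<Rightarrow> (('k^3) set \<Rightarrow> ('k^3) set) \<Rightarrow> bool" where
 "geometric E \<sigma> \<longleftrightarrow> E \<subseteq> P2 \<and> \<sigma> \<in> Bij E \<and>
   (\<forall>v w. v \<noteq> 0 \<longrightarrow> w \<noteq> 0 \<longrightarrow> relzero E \<sigma> v w \<longrightarrow> proj v \<in> E \<and> \<sigma> (proj v) = proj w)"

text \<open>Computational interface to a pair: \<open>F\<close> is an equation of \<open>E\<close>,
  and the three forms are equations of the graph of \<sigma>. \<open>F\<close> enters through its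
  zero set, so the whole plane is presented by the zero function.\<close>

definition presents :: "(('k::field)^3) set set \<Rightarrow> (('k^3) set \<Rightarrow> ('k^3) set) \<Rightarrow> ('k^3 \<Rightarrow> 'k) \<Rightarrow> (3 \<Rightarrow> 'k^3^3) \<Rightarrow> bool" where
 "presents E \<sigma> F B \<longleftrightarrow> geometric E \<sigma> \<and> (\<forall>v. proj v \<in> E \<longleftrightarrow> v \<noteq> 0 \<and> F v = 0) \<and>
   (\<forall>v w. v \<noteq> 0 \<longrightarrow> w \<noteq> 0 \<longrightarrow> ((\<forall>k. bil (B k) v w = 0) \<longleftrightarrow> proj v \<in> E \<and> \<sigma> (proj v) = proj w))"

definition form_of_matrix :: "('k::field)^3^3 \<Rightarrow> 'k free3" where
 "form_of_matrix G = (\<Sum>i\<in>UNIV. \<Sum>j\<in>UNIV. Poly_Mapping.single [i, j] (G $ i $ j))"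

lemma lookup_sum: "Poly_Mapping.lookup (\<Sum>x\<in>S. f x) w = (\<Sum>x\<in>S. Poly_Mapping.lookup (f x) w)"
 by (induction S rule: infinite_finite_induct) (auto simp: lookup_add)

lemma lookup_form_of_matrix:
 "Poly_Mapping.lookup (form_of_matrix G) [i, j] = G $ i $ j"
proof -
 have "Poly_Mapping.lookup (form_of_matrix G) [i, j] =
  (\<Sum>i'\<in>UNIV. \<Sum>j'\<in>UNIV. if i' = i \<and> j' = j then G $ i' $ j' else 0)"
  unfolding form_of_matrix_def lookup_sum by (intro sum.cong refl) (auto simp: lookup_single when_def)
 also have "\<dots> = (\<Sum>i'\<in>UNIV. if i' = i then G $ i' $ j else 0)"
  by (intro sum.cong refl) (auto simp: sum.delta)
 finally show ?thesis by simp
qed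

lemma form_of_matrix_grade: "form_of_matrix G \<in> free_grade 2"
proof -
 have "Poly_Mapping.lookup (form_of_matrix G) w = 0" if "length w \<noteq> 2" for w
  using that unfolding form_of_matrix_def lookup_sum
  by (intro sum.neutral ballI) (auto simp: lookup_single when_def)
 then show ?thesis by (auto simp: free_grade_def in_keys_iff)
qed

text \<open>Both determinants vanish exactly on \<open>E\<close>, and at a nonzero vector neither
  matrix has rank below two. So over a point of \<open>E\<close> the solutions in the other argument
  form a single point, from either side, and the forms define a bijection of \<open>E\<close>. One
  solution per point identifies it with \<sigma>.\<close>

lemma presentsI:
 fixes E :: "(('k::field)^3) set set" and B :: "3 \<Rightarrow> 'k^3^3"
 assumes E: "\<And>v. proj v \<in> E \<longleftrightarrow> v \<noteq> 0 \<and> F v = 0" "E \<subseteq> P2" and ext: "\<sigma> \<in> extensional E"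
  and det: "\<And>v. det (lmat B v) = 0 \<longleftrightarrow> F v = 0" "\<And>v. det (rmat B v) = 0 \<longleftrightarrow> F v = 0"
  and minors: "\<And>v. v \<noteq> 0 \<Longrightarrow> minors_zero (lmat B v) \<Longrightarrow> False" "\<And>v. v \<noteq> 0 \<Longrightarrow> minors_zero (rmat B v) \<Longrightarrow> False"
  and \<sigma>: "\<And>v. v \<noteq> 0 \<Longrightarrow> F v = 0 \<Longrightarrow> \<exists>w. w \<noteq> 0 \<and> \<sigma> (proj v) = proj w \<and> (\<forall>k. bil (B k) v w = 0)"
 shows "presents E \<sigma> F B"
proof -
 have L: "lmat B v *v w = 0 \<longleftrightarrow> (\<forall>k. bil (B k) v w = 0)" for v w
  by (simp add: vec_eq_iff lmat_mult)
 have R: "rmat B w *v v = 0 \<longleftrightarrow> (\<forall>k. bil (B k) v w = 0)" for v w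
  by (simp add: vec_eq_iff rmat_mult)
 have graph: "proj v \<in> E \<and> \<sigma> (proj v) = proj w \<and> proj w \<in> E"
  if v: "v \<noteq> 0" and w: "w \<noteq> 0" and b: "\<forall>k. bil (B k) v w = 0" for v w
 proof -
  have Fv: "F v = 0" using kernel_imp_det_0[of "lmat B v" w] L b w det(1) by blast
  obtain w' where w': "w' \<noteq> 0" "\<sigma> (proj v) = proj w'" "\<forall>k. bil (B k) v w' = 0" using \<sigma>[OF v Fv] by blast
  have "proj w' = proj w"
   by (rule kernel_unique[of "lmat B v"]) (use L w' b w minors(1)[OF v] in auto)
  moreover have "F w = 0" using kernel_imp_det_0[of "rmat B w" v] R b v det(2) by blast
  ultimately show ?thesis using w' E Fv v w by simp
 qed
 have "\<forall>k. bil (B k) v w = 0" if v: "v \<noteq> 0" "w \<noteq> 0" "proj v \<in> E" "\<sigma> (proj v) = proj w" for v w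
 proof -
  have "F v = 0" using v E by simp
  then obtain w' where w': "w' \<noteq> 0" "\<sigma> (proj v) = proj w'" "\<forall>k. bil (B k) v w' = 0" using \<sigma>[OF v(1)] by blast
  then obtain c where c: "w = c *s w'" using v by (metis proj_eq_iff)
  then show ?thesis using w' bil_smult[of _ 1 v c w'] by simp
 qed
 then have iff: "\<And>v w. v \<noteq> 0 \<Longrightarrow> w \<noteq> 0 \<Longrightarrow> (\<forall>k. bil (B k) v w = 0) \<longleftrightarrow> proj v \<in> E \<and> \<sigma> (proj v) = proj w"
  using graph by blast
 have rep: "\<exists>v. v \<noteq> 0 \<and> p = proj v \<and> F v = 0" if "p \<in> E" for p
 proof -
  have "p \<in> P2" using that E(2) by blast
  then obtain v where "v \<noteq> 0" "p = proj v" by (rule P2_cases)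
  then show ?thesis using that E(1) by blast
 qed
 have maps: "\<exists>w. w \<noteq> 0 \<and> \<sigma> p = proj w \<and> proj w \<in> E \<and> (\<exists>v. v \<noteq> 0 \<and> p = proj v \<and> (\<forall>k. bil (B k) v w = 0))" if p: "p \<in> E" for p
 proof -
  obtain v where v: "v \<noteq> 0" "p = proj v" "F v = 0" using rep[OF p] by blast
  obtain w where w: "w \<noteq> 0" "\<sigma> (proj v) = proj w" "\<forall>k. bil (B k) v w = 0" using \<sigma>[OF v(1,3)] by blast
  then show ?thesis using graph[OF v(1) w(1,3)] v by blast
 qed
 have "bij_betw \<sigma> E E"
  unfolding bij_betw_def
 proof (intro conjI inj_onI)
  fix p q assume p: "p \<in> E" and q: "q \<in> E" and eq: "\<sigma> p = \<sigma> q"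
  obtain w v where w: "w \<noteq> 0" "\<sigma> p = proj w" "v \<noteq> 0" "p = proj v" "\<forall>k. bil (B k) v w = 0" using maps[OF p] by blast
  obtain v' where v': "v' \<noteq> 0" "q = proj v'" using rep[OF q] by blast
  have "\<forall>k. bil (B k) v' w = 0" using iff[OF v'(1) w(1)] v' q w eq by simp
  then have "proj v = proj v'"
   by (intro kernel_unique[of "rmat B w"]) (use R w v' minors(2)[OF w(1)] in auto)
  then show "p = q" using w v' by simp
 next
  have "p \<in> \<sigma> ` E" if p: "p \<in> E" for p
  proof -
   obtain w where w: "w \<noteq> 0" "p = proj w" "F w = 0" using rep[OF p] by blast
   then obtain v where v: "v \<noteq> 0" "rmat B w *v v = 0" using det(2) by (metis det_0_imp_kernel)
   then have "proj v \<in> E \<and> \<sigma> (proj v) = proj w" using graph[OF v(1) w(1)] R by blast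
   then show ?thesis using w by force
  qed
  moreover have "\<sigma> p \<in> E" if "p \<in> E" for p using maps[OF that] by auto
  ultimately show "\<sigma> ` E = E" by blast
 qed
 then have Bij: "\<sigma> \<in> Bij E" using ext by (simp add: Bij_def)
 have rel: "form_of_matrix (B k) \<in> relations E \<sigma>" for k
  unfolding relations_def
 proof (intro CollectI conjI ballI form_of_matrix_grade)
  fix p v w assume p: "p \<in> E" "v \<in> p" "w \<in> \<sigma> p"
  obtain w0 v0 where w0: "w0 \<noteq> 0" "\<sigma> p = proj w0" "v0 \<noteq> 0" "p = proj v0" "\<forall>k. bil (B k) v0 w0 = 0"
   using maps[OF p(1)] by blast
  obtain c d where "v = c *s v0" "w = d *s w0" using p w0 by (auto simp: mem_proj)
  then have "bil (B k) v w = 0" using w0(5) by (simp add: bil_smult)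
  then show "(\<Sum>i\<in>UNIV. \<Sum>j\<in>UNIV. Poly_Mapping.lookup (form_of_matrix (B k)) [i, j] * v $ i*w $ j) = 0"
   by (simp add: lookup_form_of_matrix bil_def)
 qed
 have "geometric E \<sigma>"
  unfolding geometric_def
 proof (intro conjI allI impI E(2) Bij)
  fix v w :: "'k^3" assume v: "v \<noteq> 0" and w: "w \<noteq> 0" and z: "relzero E \<sigma> v w"
  have "bil (B k) v w = 0" for k
   using z rel[of k] unfolding relzero_def by (auto simp: lookup_form_of_matrix bil_def)
  then show "proj v \<in> E" "\<sigma> (proj v) = proj w" using graph[OF v w] by blast+
 qed
 then show ?thesis unfolding presents_def using E(1) iff by (intro conjI allI impI) simp_all
qed

lemma presentsD:
 assumes "presents E \<sigma> F B"
 shows "geometric E \<sigma>" "E \<subseteq> P2" "\<sigma> \<in> Bij E" "\<And>v. proj v \<in> E \<longleftrightarrow> v \<noteq> 0 \<and> F v = 0"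
  "\<And>v w. v \<noteq> 0 \<Longrightarrow> w \<noteq> 0 \<Longrightarrow> (\<forall>k. bil (B k) v w = 0) \<longleftrightarrow> proj v \<in> E \<and> \<sigma> (proj v) = proj w"
proof -
 show g: "geometric E \<sigma>" using assms unfolding presents_def by (rule conjunct1)
 show "E \<subseteq> P2" using g unfolding geometric_def by (rule conjunct1)
 show "\<sigma> \<in> Bij E" using g[unfolded geometric_def, THEN conjunct2] by (rule conjunct1)
 show "proj v \<in> E \<longleftrightarrow> v \<noteq> 0 \<and> F v = 0" for v
  using assms[unfolded presents_def, THEN conjunct2, THEN conjunct1] by (rule spec)
 show "(\<forall>k. bil (B k) v w = 0) \<longleftrightarrow> proj v \<in> E \<and> \<sigma> (proj v) = proj w" if "v \<noteq> 0" "w \<noteq> 0" for v w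
  using assms[unfolded presents_def, THEN conjunct2, THEN conjunct2] that by simp
qed

lemma presents_step:
 assumes "presents E \<sigma> F B" "v \<noteq> 0" "w \<noteq> 0" "\<And>k. bil (B k) v w = 0"
 shows "proj v \<in> E" "\<sigma> (proj v) = proj w"
 using presentsD(5)[OF assms(1-3)] assms(4) by simp_all

text \<open>\<gamma> is an orbit given by coordinate vectors; on a parametrised component this
  computes all powers of \<sigma> at once.\<close>

lemma presents_funpow:
 assumes "presents E \<sigma> F B" "\<And>n. \<gamma> n \<noteq> 0" "\<And>n k. bil (B k) (\<gamma> n) (\<gamma> (Suc n)) = 0"
 shows "(\<sigma> ^^ n) (proj (\<gamma> 0)) = proj (\<gamma> n)"
proof (induction n)
 case (Suc n)
 then show ?case using presents_step(2)[OF assms(1) assms(2) assms(2) assms(3)] by simp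
qed simp

abbreviation m33 :: "'a \<Rightarrow> 'a \<Rightarrow> 'a \<Rightarrow> 'a \<Rightarrow> 'a \<Rightarrow> 'a \<Rightarrow> 'a \<Rightarrow> 'a \<Rightarrow> 'a \<Rightarrow> ('a::zero)^3^3" where
 "m33 a b c d e f g h i \<equiv> vector [vector [a, b, c], vector [d, e, f], vector [g, h, i]]"

definition sel3 :: "'a \<Rightarrow> 'a \<Rightarrow> 'a \<Rightarrow> 3 \<Rightarrow> 'a" where
 "sel3 a b c k = (if k = 1 then a else if k = 2 then b else c)"

lemma sel3_simps [simp]: "sel3 a b c 1 = a" "sel3 a b c 2 = b" "sel3 a b c 3 = c"
 by (simp_all add: sel3_def)

lemma minors_zeroD:
 assumes "minors_zero N"
 shows "N $ 1 $ 1*N $ 2 $ 2 = N $ 1 $ 2*N $ 2 $ 1" "N $ 1 $ 1*N $ 2 $ 3 = N $ 1 $ 3*N $ 2 $ 1"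
  "N $ 1 $ 2*N $ 2 $ 3 = N $ 1 $ 3*N $ 2 $ 2" "N $ 1 $ 1*N $ 3 $ 2 = N $ 1 $ 2*N $ 3 $ 1"
  "N $ 1 $ 1*N $ 3 $ 3 = N $ 1 $ 3*N $ 3 $ 1" "N $ 1 $ 2*N $ 3 $ 3 = N $ 1 $ 3*N $ 3 $ 2"
  "N $ 2 $ 1*N $ 3 $ 2 = N $ 2 $ 2*N $ 3 $ 1" "N $ 2 $ 1*N $ 3 $ 3 = N $ 2 $ 3*N $ 3 $ 1"
  "N $ 2 $ 2 * N $ 3 $ 3 = N $ 2 $ 3 * N $ 3 $ 2"
 using assms unfolding minors_zero_def by blast+

lemma vec3_nz_iff: "(v::'a::zero^3) \<noteq> 0 \<longleftrightarrow> v $ 1 \<noteq> 0 \<or> v $ 2 \<noteq> 0 \<or> v $ 3 \<noteq> 0"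
 by (simp add: vec3_eq_iff)

lemma vec3_cases:
 obtains x y z where "(v::'a::zero^3) = vector [x, y, z]"
 using vec3_eta by metis

text \<open>The matrices are the relations \<open>x^2 + yz - \<alpha> zy\<close>,
  \<open>zx - \<alpha> xz\<close>, \<open>xy - \<alpha> yx\<close>. Both determinants are \<alpha>
  times the cubic, by \<open>\<alpha> l = \<alpha>^3 - 1\<close>.\<close>

lemma presents_S':
 fixes \<sigma> :: "(('k::field_char_0)^3) set \<Rightarrow> ('k^3) set"
 assumes "type_S' E \<sigma>"
 shows "\<exists>\<alpha> l. \<alpha> \<noteq> 0 \<and> \<alpha>^3 \<noteq> 1 \<and> \<alpha>*l = \<alpha>^3 - 1 \<and> presents E \<sigma> (\<lambda>v. v $ 1*((v $ 1)\<^sup>2 - l * v $ 2 * v $ 3)) (sel3 (m33 1 0 0 0 0 1 0 (- \<alpha>) 0) (m33 0 0 (- \<alpha>) 0 0 0 1 0 0) (m33 0 1 0 (- \<alpha>) 0 0 0 0 0))"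
proof -
 obtain \<alpha> l where a: "\<alpha>^3 \<noteq> 0" "\<alpha>^3 \<noteq> 1" "l = (\<alpha>^3 - 1) / \<alpha>" and ext: "\<sigma> \<in> extensional E"
  and E: "E = locus (\<lambda>x y z. x) \<union> locus (\<lambda>x y z. x^2 - l * y * z)"
  and s: "\<forall>b c. pnt 0 b c \<in> locus (\<lambda>x y z. x) \<longrightarrow> \<sigma> (pnt 0 b c) = pnt 0 b (\<alpha> * c)"
   "\<forall>a b c. pnt a b c \<in> locus (\<lambda>x y z. x^2 - l*y*z) \<longrightarrow> \<sigma> (pnt a b c) = pnt a (\<alpha>*b) (inverse \<alpha> * c)"
  using assms unfolding type_S'_def by blast
 have nz: "\<alpha> \<noteq> 0" using a(1) by auto
 have l: "\<alpha>*l = \<alpha>*(\<alpha>*\<alpha>) - 1" using nz a(3) by (simp add: field_simps power3_eq_cube)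
 \<comment> \<open>The factor \<open>u\<close> lets the relation between \<alpha> and
   \<open>l\<close> rewrite inside products that are already in normal form.\<close>
 have l': "\<alpha> * (l * u) = \<alpha> * (\<alpha> * (\<alpha> * u)) - u" for u
  using arg_cong[OF l, of "\<lambda>t. t * u"] by (simp add: algebra_simps)
 have mem1: "proj v \<in> locus (\<lambda>x y z. x) \<longleftrightarrow> v \<noteq> 0 \<and> v $ 1 = 0"
  and mem2: "proj v \<in> locus (\<lambda>x y z. x^2 - l*y*z) \<longleftrightarrow> v \<noteq> 0 \<and> (v $ 1)\<^sup>2 - l * v $ 2 * v $ 3 = 0" for v :: "'k^3"
  by (rule mem_locus[where n = 1], simp) (rule mem_locus[where n = 2], simp add: algebra_simps power2_eq_square)
 have mem: "proj v \<in> E \<longleftrightarrow> v \<noteq> 0 \<and> v $ 1*((v $ 1)\<^sup>2 - l * v $ 2 * v $ 3) = 0" for v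
  unfolding E Un_iff mem1 mem2 by auto
 have EP2: "E \<subseteq> P2" unfolding E using locus_subset_P2 by blast

 have "presents E \<sigma> (\<lambda>v. v $ 1*((v $ 1)\<^sup>2 - l * v $ 2 * v $ 3)) (sel3 (m33 1 0 0 0 0 1 0 (- \<alpha>) 0) (m33 0 0 (- \<alpha>) 0 0 0 1 0 0) (m33 0 1 0 (- \<alpha>) 0 0 0 0 0))"
 proof (rule presentsI)
  show "proj v \<in> E \<longleftrightarrow> v \<noteq> 0 \<and> v $ 1*((v $ 1)\<^sup>2 - l * v $ 2 * v $ 3) = 0" for v by (rule mem)
  show "E \<subseteq> P2" by (rule EP2)
  show "\<sigma> \<in> extensional E" by (rule ext)
 next
  fix v :: "'k^3"
  let ?B = "sel3 (m33 1 0 0 0 0 1 0 (- \<alpha>) 0) (m33 0 0 (- \<alpha>) 0 0 0 1 0 0) (m33 0 1 0 (- \<alpha>) 0 0 0 0 0)"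
  have "det (lmat ?B v) = \<alpha> * (v $ 1 * ((v $ 1)\<^sup>2 - l * v $ 2 * v $ 3))"
   by (simp add: det_3 lmat_def sum_3 algebra_simps power3_eq_cube power2_eq_square l')
  then show "det (lmat ?B v) = 0 \<longleftrightarrow> v $ 1*((v $ 1)\<^sup>2 - l * v $ 2 * v $ 3) = 0" using nz by (simp only: mult_eq_0_iff) simp
  have "det (rmat ?B v) = \<alpha> * (v $ 1 * ((v $ 1)\<^sup>2 - l * v $ 2 * v $ 3))"
   by (simp add: det_3 rmat_def sum_3 algebra_simps power3_eq_cube power2_eq_square l')
  then show "det (rmat ?B v) = 0 \<longleftrightarrow> v $ 1*((v $ 1)\<^sup>2 - l * v $ 2 * v $ 3) = 0" using nz by (simp only: mult_eq_0_iff) simp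
  assume v: "v \<noteq> 0"
  show False if "minors_zero (lmat ?B v)"
   using v minors_zeroD[OF that] nz by (auto simp: lmat_def sum_3 vec3_nz_iff)
  show False if "minors_zero (rmat ?B v)"
   using v minors_zeroD[OF that] nz by (auto simp: rmat_def sum_3 vec3_nz_iff)
  assume F: "v $ 1 * ((v $ 1)\<^sup>2 - l * v $ 2 * v $ 3) = 0"
  obtain x y z where xyz: "v = vector [x, y, z]" by (rule vec3_cases)
  have vE: "pnt x y z \<in> E" using mem[of v] v F xyz by simp
  show "\<exists>w. w \<noteq> 0 \<and> \<sigma> (proj v) = proj w \<and> (\<forall>k. bil (?B k) v w = 0)"
  proof (cases "x = 0")
   case True
   then have "pnt x y z \<in> locus (\<lambda>x y z. x)" using mem1[of v] v xyz by simp
   then show ?thesis using s(1) True v nz unfolding xyz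
    by (intro exI[of _ "vector [0, y, \<alpha> * z]"]) (auto simp: forall_3 bil_def sum_3)
  next
   case False
   then have c: "x\<^sup>2 = l * y * z" using F xyz by simp
   then have "pnt x y z \<in> locus (\<lambda>x y z. x^2 - l*y*z)" using mem2[of v] v xyz by simp
   moreover have "x * (x * \<alpha>) + y * z = z * (\<alpha> * (\<alpha> * (\<alpha> * y)))"
    using c l'[of "y * z"] by (simp add: power2_eq_square algebra_simps)
   then have "y * (inverse \<alpha> * z) - \<alpha> * z * (\<alpha> * y) + x * x = 0"
    using nz by (simp add: field_simps)
   ultimately show ?thesis using s(2) False v nz unfolding xyz
    by (intro exI[of _ "vector [x, \<alpha>*y, inverse \<alpha>*z]"]) (auto simp: forall_3 bil_def sum_3 algebra_simps)
  qed
 qed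
 then show ?thesis using nz a by (intro exI[of _ \<alpha>] exI[of _ l]) simp
qed

text \<open>The matrices are the relations \<open>xy - yx\<close>, \<open>xz - zx - y^2\<close>,
  \<open>x^2 + yz - zy\<close>. Both determinants are \<open>x^3 + y^3\<close>, the product of the
  three lines.\<close>

lemma presents_T:
 fixes \<sigma> :: "(('k::field_char_0)^3) set \<Rightarrow> ('k^3) set"
 assumes "type_T E \<sigma>"
 shows "\<exists>\<epsilon>::'k. \<epsilon>^3 = 1 \<and> \<epsilon> \<noteq> 1 \<and> presents E \<sigma> (\<lambda>v. (v $ 1)^3 + (v $ 2)^3) (sel3 (m33 0 1 0 (- 1) 0 0 0 0 0) (m33 0 0 1 0 (- 1) 0 (- 1) 0 0) (m33 1 0 0 0 0 1 0 (- 1) 0))"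
proof -
 obtain \<epsilon> where e: "\<epsilon>^3 = 1" "\<epsilon> \<noteq> 1" and ext: "\<sigma> \<in> extensional E"
  and E: "E = locus (\<lambda>x y z. x + y) \<union> locus (\<lambda>x y z. \<epsilon>*x + y) \<union> locus (\<lambda>x y z. \<epsilon>^2*x + y)"
  and s: "\<forall>a c. pnt a (- a) c \<in> E \<longrightarrow> \<sigma> (pnt a (- a) c) = pnt a (- a) (a + c)"
   "\<forall>a c. pnt a (- \<epsilon>*a) c \<in> E \<longrightarrow> \<sigma> (pnt a (- \<epsilon>*a) c) = pnt a (- \<epsilon>*a) (\<epsilon>^2*a + c)"
   "\<forall>a c. pnt a (- (\<epsilon>^2)*a) c \<in> E \<longrightarrow> \<sigma> (pnt a (- (\<epsilon>^2)*a) c) = pnt a (- (\<epsilon>^2)*a) (\<epsilon>*a + c)"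
  using assms unfolding type_T_def by blast
 have nz: "(1::'k) \<noteq> 0" by simp
 have e2: "1 + \<epsilon> + \<epsilon> * \<epsilon> = 0"
 proof -
  have "(\<epsilon> - 1)*(1 + \<epsilon> + \<epsilon>*\<epsilon>) = 0" using e(1) by (simp add: algebra_simps power3_eq_cube)
  then show ?thesis using e(2) by simp
 qed
 have ee: "\<epsilon>*\<epsilon> = - 1 - \<epsilon>" using e2 by (simp add: eq_neg_iff_add_eq_0 algebra_simps)
 have ee': "\<epsilon> * (\<epsilon> * u) = - u - \<epsilon> * u" for u
  using arg_cong[OF ee, of "\<lambda>t. t * u"] by (simp add: algebra_simps)
 have mem1: "proj v \<in> locus (\<lambda>x y z. c*x + y) \<longleftrightarrow> v \<noteq> 0 \<and> c * v $ 1 + v $ 2 = 0" for v :: "'k^3" and c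
  by (rule mem_locus[where n = 1]) (simp add: algebra_simps)
 have fac: "(1 * x + y) * (\<epsilon> * x + y) * (\<epsilon>^2 * x + y) = x^3 + y^3" for x y
  by (simp add: cubic_simps ee ee')
 have E': "E = locus (\<lambda>x y z. 1*x + y) \<union> locus (\<lambda>x y z. \<epsilon>*x + y) \<union> locus (\<lambda>x y z. \<epsilon>^2*x + y)"
  unfolding E by simp
 have mem: "proj v \<in> E \<longleftrightarrow> v \<noteq> 0 \<and> (v $ 1)^3 + (v $ 2)^3 = 0" for v
  unfolding E' Un_iff mem1 fac[symmetric] by auto
 have EP2: "E \<subseteq> P2" unfolding E using locus_subset_P2 by blast

 have "presents E \<sigma> (\<lambda>v. (v $ 1)^3 + (v $ 2)^3) (sel3 (m33 0 1 0 (- 1) 0 0 0 0 0) (m33 0 0 1 0 (- 1) 0 (- 1) 0 0) (m33 1 0 0 0 0 1 0 (- 1) 0))"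
 proof (rule presentsI)
  show "proj v \<in> E \<longleftrightarrow> v \<noteq> 0 \<and> (v $ 1)^3 + (v $ 2)^3 = 0" for v by (rule mem)
  show "E \<subseteq> P2" by (rule EP2)
  show "\<sigma> \<in> extensional E" by (rule ext)
 next
  fix v :: "'k^3"
  let ?B = "sel3 (m33 0 1 0 (- 1) 0 0 0 0 0) (m33 0 0 1 0 (- 1) 0 (- 1) 0 0) (m33 1 0 0 0 0 1 0 (- 1) 0)"
  have "det (lmat ?B v) = 1 * ((v $ 1)^3 + (v $ 2)^3)"
   by (simp add: det_3 lmat_def sum_3 algebra_simps power3_eq_cube power2_eq_square)
  then show "det (lmat ?B v) = 0 \<longleftrightarrow> (v $ 1)^3 + (v $ 2)^3 = 0" using nz by (simp only: mult_eq_0_iff) simp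
  have "det (rmat ?B v) = 1 * ((v $ 1)^3 + (v $ 2)^3)"
   by (simp add: det_3 rmat_def sum_3 algebra_simps power3_eq_cube power2_eq_square)
  then show "det (rmat ?B v) = 0 \<longleftrightarrow> (v $ 1)^3 + (v $ 2)^3 = 0" using nz by (simp only: mult_eq_0_iff) simp
  assume v: "v \<noteq> 0"
  show False if "minors_zero (lmat ?B v)"
   using v minors_zeroD[OF that] nz by (auto simp: lmat_def sum_3 vec3_nz_iff)
  show False if "minors_zero (rmat ?B v)"
   using v minors_zeroD[OF that] nz by (auto simp: rmat_def sum_3 vec3_nz_iff)
  assume F: "(v $ 1)^3 + (v $ 2)^3 = 0"
  obtain x y z where xyz: "v = vector [x, y, z]" by (rule vec3_cases)
  have vE: "pnt x y z \<in> E" using mem[of v] v F xyz by simp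
  have "(1*x + y)*(\<epsilon>*x + y)*(\<epsilon>^2*x + y) = 0" using F xyz by (simp only: fac) simp
  then consider "y = - x" | "y = - \<epsilon> * x" | "y = - (\<epsilon>^2) * x"
   by (auto simp: add_eq_0_iff2)
  then show "\<exists>w. w \<noteq> 0 \<and> \<sigma> (proj v) = proj w \<and> (\<forall>k. bil (?B k) v w = 0)"
  proof cases
   case 1
   then show ?thesis using s(1) vE v unfolding xyz
    by (intro exI[of _ "vector [x, - x, x + z]"]) (auto simp: forall_3 bil_def sum_3 algebra_simps)
  next
   case 2
   have "\<sigma> (pnt x y z) = pnt x y (\<epsilon>^2*x + z)" using s(2) vE unfolding 2 by blast
   then show ?thesis using v unfolding xyz
    by (intro exI[of _ "vector [x, y, \<epsilon>^2 * x + z]"])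
     (auto simp: 2 forall_3 bil_def sum_3 algebra_simps power2_eq_square ee ee')
  next
   case 3
   have "\<sigma> (pnt x y z) = pnt x y (\<epsilon>*x + z)" using s(3) vE unfolding 3 by blast
   then show ?thesis using v unfolding xyz
    by (intro exI[of _ "vector [x, y, \<epsilon> * x + z]"])
     (auto simp: 3 forall_3 bil_def sum_3 algebra_simps power2_eq_square ee ee')
  qed
 qed
 then show ?thesis using e by (intro exI[of _ \<epsilon>]) simp
qed

text \<open>The matrices are the relations \<open>x^2 + xy - yx\<close>,
  \<open>xy + yx + xz - zx\<close>, \<open>xz + zx + yz - zy - x^2 - y^2\<close>. Both determinants
  are -3 times the cubic, where characteristic zero enters.\<close>

lemma presents_T':
 fixes \<sigma> :: "(('k::field_char_0)^3) set \<Rightarrow> ('k^3) set"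
 assumes "type_T' E \<sigma>"
 shows "presents E \<sigma> (\<lambda>v. v $ 1*((v $ 2)\<^sup>2 - v $ 1 * v $ 3)) (sel3 (m33 1 1 0 (- 1) 0 0 0 0 0) (m33 0 1 1 1 0 0 (- 1) 0 0) (m33 (- 1) 0 1 0 (- 1) 1 1 (- 1) 0))"
proof -
 have ext: "\<sigma> \<in> extensional E"
  and E: "E = locus (\<lambda>x y z. x) \<union> locus (\<lambda>x y z. y^2 - x * z)"
  and s: "\<forall>b c. pnt 0 b c \<in> locus (\<lambda>x y z. x) \<longrightarrow> \<sigma> (pnt 0 b c) = pnt 0 b (b + c)"
   "\<forall>a b c. pnt a b c \<in> locus (\<lambda>x y z. y^2 - x*z) \<longrightarrow> \<sigma> (pnt a b c) = pnt a (- a + b) (a - 2*b + c)"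
  using assms unfolding type_T'_def by blast+
 have nz: "(-3::'k) \<noteq> 0" by simp
 have mem1: "proj v \<in> locus (\<lambda>x y z. x) \<longleftrightarrow> v \<noteq> 0 \<and> v $ 1 = 0"
  and mem2: "proj v \<in> locus (\<lambda>x y z. y^2 - x*z) \<longleftrightarrow> v \<noteq> 0 \<and> (v $ 2)\<^sup>2 - v $ 1 * v $ 3 = 0" for v :: "'k^3"
  by (rule mem_locus[where n = 1], simp) (rule mem_locus[where n = 2], simp add: algebra_simps power2_eq_square)
 have mem: "proj v \<in> E \<longleftrightarrow> v \<noteq> 0 \<and> v $ 1*((v $ 2)\<^sup>2 - v $ 1 * v $ 3) = 0" for v
  unfolding E Un_iff mem1 mem2 by auto
 have EP2: "E \<subseteq> P2" unfolding E using locus_subset_P2 by blast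

 have "presents E \<sigma> (\<lambda>v. v $ 1*((v $ 2)\<^sup>2 - v $ 1 * v $ 3)) (sel3 (m33 1 1 0 (- 1) 0 0 0 0 0) (m33 0 1 1 1 0 0 (- 1) 0 0) (m33 (- 1) 0 1 0 (- 1) 1 1 (- 1) 0))"
 proof (rule presentsI)
  show "proj v \<in> E \<longleftrightarrow> v \<noteq> 0 \<and> v $ 1*((v $ 2)\<^sup>2 - v $ 1 * v $ 3) = 0" for v by (rule mem)
  show "E \<subseteq> P2" by (rule EP2)
  show "\<sigma> \<in> extensional E" by (rule ext)
 next
  fix v :: "'k^3"
  let ?B = "sel3 (m33 1 1 0 (- 1) 0 0 0 0 0) (m33 0 1 1 1 0 0 (- 1) 0 0) (m33 (- 1) 0 1 0 (- 1) 1 1 (- 1) 0)"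
  have "det (lmat ?B v) = (- 3) * (v $ 1 * ((v $ 2)\<^sup>2 - v $ 1 * v $ 3))"
   by (simp add: det_3 lmat_def sum_3 algebra_simps power3_eq_cube power2_eq_square)
  then show "det (lmat ?B v) = 0 \<longleftrightarrow> v $ 1*((v $ 2)\<^sup>2 - v $ 1 * v $ 3) = 0" using nz by (simp only: mult_eq_0_iff) simp
  have "det (rmat ?B v) = (- 3) * (v $ 1 * ((v $ 2)\<^sup>2 - v $ 1 * v $ 3))"
   by (simp add: det_3 rmat_def sum_3 algebra_simps power3_eq_cube power2_eq_square)
  then show "det (rmat ?B v) = 0 \<longleftrightarrow> v $ 1*((v $ 2)\<^sup>2 - v $ 1 * v $ 3) = 0" using nz by (simp only: mult_eq_0_iff) simp
  assume v: "v \<noteq> 0"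
  show False if "minors_zero (lmat ?B v)"
   using v minors_zeroD[OF that] nz by (auto simp: lmat_def sum_3 vec3_nz_iff)
  show False if "minors_zero (rmat ?B v)"
   using v minors_zeroD[OF that] nz by (auto simp: rmat_def sum_3 vec3_nz_iff)
  assume F: "v $ 1 * ((v $ 2)\<^sup>2 - v $ 1 * v $ 3) = 0"
  obtain x y z where xyz: "v = vector [x, y, z]" by (rule vec3_cases)
  have vE: "pnt x y z \<in> E" using mem[of v] v F xyz by simp
  show "\<exists>w. w \<noteq> 0 \<and> \<sigma> (proj v) = proj w \<and> (\<forall>k. bil (?B k) v w = 0)"
  proof (cases "x = 0")
   case True
   then have "pnt x y z \<in> locus (\<lambda>x y z. x)" using mem1[of v] v xyz by simp
   then show ?thesis using s(1) True v unfolding xyz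
    by (intro exI[of _ "vector [0, y, y + z]"]) (auto simp: forall_3 bil_def sum_3 algebra_simps)
  next
   case False
   then have c: "y * y = x * z" using F xyz by (simp add: power2_eq_square)
   then have "pnt x y z \<in> locus (\<lambda>x y z. y^2 - x*z)" using mem2[of v] v xyz by (simp add: power2_eq_square)
   then show ?thesis using s(2) False v unfolding xyz
    by (intro exI[of _ "vector [x, - x + y, x - 2 * y + z]"])
     (auto simp: forall_3 bil_def sum_3 algebra_simps c)
  qed
 qed
 then show ?thesis .
qed

text \<open>The matrices are the relations \<open>x^2 + yz - \<alpha> zy\<close>,
  \<open>y^2 + zx - \<alpha> xz\<close>, \<open>xy - \<alpha> yx\<close>. Both determinants are
  \<alpha> times the cubic.\<close>

lemma presents_NC:
 fixes \<sigma> :: "(('k::field_char_0)^3) set \<Rightarrow> ('k^3) set"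
 assumes "type_NC E \<sigma>"
 shows "\<exists>\<alpha> l. \<alpha> \<noteq> 0 \<and> \<alpha>^3 \<noteq> 1 \<and> \<alpha>*l = \<alpha>^3 - 1 \<and> presents E \<sigma> (\<lambda>v. (v $ 1)^3 + (v $ 2)^3 - l * v $ 1 * v $ 2 * v $ 3) (sel3 (m33 1 0 0 0 0 1 0 (- \<alpha>) 0) (m33 0 0 (- \<alpha>) 0 1 0 1 0 0) (m33 0 1 0 (- \<alpha>) 0 0 0 0 0))"
proof -
 obtain \<alpha> l where a: "\<alpha>^3 \<noteq> 0" "\<alpha>^3 \<noteq> 1" "l = (\<alpha>^3 - 1) / \<alpha>" and ext: "\<sigma> \<in> extensional E"
  and E: "E = locus (\<lambda>x y z. x^3 + y^3 - l * x * y * z)"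
  and s: "\<forall>a b c. pnt a b c \<in> E \<and> b \<noteq> 0 \<longrightarrow> \<sigma> (pnt a b c) = pnt a (\<alpha>*b) (- (a^2 / b) + \<alpha>^2 * c)"
   "\<sigma> (pnt 0 0 1) = pnt 0 0 1"
  using assms unfolding type_NC_def by blast
 have nz: "\<alpha> \<noteq> 0" using a(1) by auto
 have l: "\<alpha>*l = \<alpha>*(\<alpha>*\<alpha>) - 1" using nz a(3) by (simp add: field_simps power3_eq_cube)
 have l': "\<alpha> * (l * u) = \<alpha> * (\<alpha> * (\<alpha> * u)) - u" for u
  using arg_cong[OF l, of "\<lambda>t. t * u"] by (simp add: algebra_simps)
 have mem: "proj v \<in> E \<longleftrightarrow> v \<noteq> 0 \<and> (v $ 1)^3 + (v $ 2)^3 - l * v $ 1 * v $ 2 * v $ 3 = 0" for v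
  unfolding E by (rule mem_locus[where n = 3]) (simp add: algebra_simps power3_eq_cube)
 have EP2: "E \<subseteq> P2" unfolding E by (rule locus_subset_P2)

 have "presents E \<sigma> (\<lambda>v. (v $ 1)^3 + (v $ 2)^3 - l * v $ 1 * v $ 2 * v $ 3) (sel3 (m33 1 0 0 0 0 1 0 (- \<alpha>) 0) (m33 0 0 (- \<alpha>) 0 1 0 1 0 0) (m33 0 1 0 (- \<alpha>) 0 0 0 0 0))"
 proof (rule presentsI)
  show "proj v \<in> E \<longleftrightarrow> v \<noteq> 0 \<and> (v $ 1)^3 + (v $ 2)^3 - l * v $ 1 * v $ 2 * v $ 3 = 0" for v by (rule mem)
  show "E \<subseteq> P2" by (rule EP2)
  show "\<sigma> \<in> extensional E" by (rule ext)
 next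
  fix v :: "'k^3"
  let ?B = "sel3 (m33 1 0 0 0 0 1 0 (- \<alpha>) 0) (m33 0 0 (- \<alpha>) 0 1 0 1 0 0) (m33 0 1 0 (- \<alpha>) 0 0 0 0 0)"
  have "det (lmat ?B v) = \<alpha> * ((v $ 1)^3 + (v $ 2)^3 - l * v $ 1 * v $ 2 * v $ 3)"
   by (simp add: det_3 lmat_def sum_3 algebra_simps power3_eq_cube power2_eq_square l')
  then show "det (lmat ?B v) = 0 \<longleftrightarrow> (v $ 1)^3 + (v $ 2)^3 - l * v $ 1 * v $ 2 * v $ 3 = 0" using nz by (simp only: mult_eq_0_iff) simp
  have "det (rmat ?B v) = \<alpha> * ((v $ 1)^3 + (v $ 2)^3 - l * v $ 1 * v $ 2 * v $ 3)"
   by (simp add: det_3 rmat_def sum_3 algebra_simps power3_eq_cube power2_eq_square l')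
  then show "det (rmat ?B v) = 0 \<longleftrightarrow> (v $ 1)^3 + (v $ 2)^3 - l * v $ 1 * v $ 2 * v $ 3 = 0" using nz by (simp only: mult_eq_0_iff) simp
  assume v: "v \<noteq> 0"
  show False if "minors_zero (lmat ?B v)"
   using v minors_zeroD[OF that] nz by (auto simp: lmat_def sum_3 vec3_nz_iff)
  show False if "minors_zero (rmat ?B v)"
   using v minors_zeroD[OF that] nz by (auto simp: rmat_def sum_3 vec3_nz_iff)
  assume F: "(v $ 1)^3 + (v $ 2)^3 - l * v $ 1 * v $ 2 * v $ 3 = 0"
  obtain x y z where xyz: "v = vector [x, y, z]" by (rule vec3_cases)
  have vE: "pnt x y z \<in> E" using mem[of v] v F xyz by simp
  have c: "x^3 + y^3 = l * x * y * z" using F xyz by simp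
  show "\<exists>w. w \<noteq> 0 \<and> \<sigma> (proj v) = proj w \<and> (\<forall>k. bil (?B k) v w = 0)"
  proof (cases "y = 0")
   case True
   then have x: "x = 0" using c by simp
   then have "pnt x y z = pnt 0 0 1" using v True xyz by (intro pnt_eqI) auto
   then show ?thesis using s(2) x True unfolding xyz
    by (intro exI[of _ "vector [0, 0, 1]"]) (simp add: forall_3 bil_def sum_3)
  next
   case False
   define w3 where "w3 = - (x^2 / y) + \<alpha>^2 * z"
   have w3: "y * w3 = \<alpha> * (\<alpha> * (y * z)) - x * x"
    using False by (simp add: w3_def field_simps power2_eq_square)
   have w3': "y * (w3 * u) = \<alpha> * (\<alpha> * (y * (z * u))) - x * (x * u)" for u
    using arg_cong[OF w3, of "\<lambda>t. t * u"] by (simp add: algebra_simps)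
   have s3: "\<sigma> (pnt x y z) = pnt x (\<alpha>*y) w3" using s(1) vE False unfolding w3_def by blast
   \<comment> \<open>The second form is verified after multiplication by \<open>y\<close>, which
     removes the denominator of \<open>w3\<close> and turns it into the equation of the
     curve.\<close>
   have "\<alpha>*(x*(x*x)) + \<alpha>*(y*(y*y)) + x*(y*z) = \<alpha>*(\<alpha>*(\<alpha>*(x*(y*z))))"
    using arg_cong[OF c, of "\<lambda>t. \<alpha>*t"] l'[of "x*(y*z)"] by (simp add: algebra_simps power3_eq_cube)
   then have "y * (x * z + y * (\<alpha> * y)) = y * (w3 * (\<alpha> * x))"
    unfolding w3' by (simp add: algebra_simps)
   then have b2: "x * z + y * (\<alpha> * y) = w3 * (\<alpha> * x)" using False by simp
   show ?thesis using False v nz unfolding xyz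
    by (intro exI[of _ "vector [x, \<alpha> * y, w3]"])
     (use b2 w3 in \<open>simp add: s3 forall_3 bil_def sum_3 algebra_simps\<close>)
  qed
 qed
 then show ?thesis using nz a by (intro exI[of _ \<alpha>] exI[of _ l]) simp
qed

text \<open>The matrices are the relations \<open>xy - yx - y^2\<close>,
  \<open>3x^2 + y^2 + yz - zy\<close>, \<open>xz - zx + yz + zy - xy - yx\<close>. Both determinants
  are -3 times the cubic.\<close>

lemma presents_CC:
 fixes \<sigma> :: "(('k::field_char_0)^3) set \<Rightarrow> ('k^3) set"
 assumes "type_CC E \<sigma>"
 shows "presents E \<sigma> (\<lambda>v. (v $ 1)^3 - (v $ 2)\<^sup>2 * v $ 3) (sel3 (m33 0 1 0 (- 1) (- 1) 0 0 0 0) (m33 3 0 0 0 1 1 0 (- 1) 0) (m33 0 (- 1) 1 (- 1) 0 1 (- 1) 1 0))"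
proof -
 note D = assms[unfolded type_CC_def]
 have ext: "\<sigma> \<in> extensional E" using D by (rule conjunct1)
 have E: "E = locus (\<lambda>x y z. x^3 - y^2*z)" using D[THEN conjunct2] by (rule conjunct1)
 note s = D[THEN conjunct2, THEN conjunct2, THEN conjunct1] D[THEN conjunct2, THEN conjunct2, THEN conjunct2]
 have nz: "(-3::'k) \<noteq> 0" by simp
 have mem: "proj v \<in> E \<longleftrightarrow> v \<noteq> 0 \<and> (v $ 1)^3 - (v $ 2)\<^sup>2 * v $ 3 = 0" for v
  unfolding E by (rule mem_locus[where n = 3]) (simp add: algebra_simps power3_eq_cube power2_eq_square)
 have EP2: "E \<subseteq> P2" unfolding E by (rule locus_subset_P2)

 have "presents E \<sigma> (\<lambda>v. (v $ 1)^3 - (v $ 2)\<^sup>2 * v $ 3) (sel3 (m33 0 1 0 (- 1) (- 1) 0 0 0 0) (m33 3 0 0 0 1 1 0 (- 1) 0) (m33 0 (- 1) 1 (- 1) 0 1 (- 1) 1 0))"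
 proof (rule presentsI)
  show "proj v \<in> E \<longleftrightarrow> v \<noteq> 0 \<and> (v $ 1)^3 - (v $ 2)\<^sup>2 * v $ 3 = 0" for v by (rule mem)
  show "E \<subseteq> P2" by (rule EP2)
  show "\<sigma> \<in> extensional E" by (rule ext)
 next
  fix v :: "'k^3"
  let ?B = "sel3 (m33 0 1 0 (- 1) (- 1) 0 0 0 0) (m33 3 0 0 0 1 1 0 (- 1) 0) (m33 0 (- 1) 1 (- 1) 0 1 (- 1) 1 0)"
  have "det (lmat ?B v) = (- 3) * ((v $ 1)^3 - (v $ 2)\<^sup>2 * v $ 3)"
   by (simp add: det_3 lmat_def sum_3 algebra_simps power3_eq_cube power2_eq_square)
  then show "det (lmat ?B v) = 0 \<longleftrightarrow> (v $ 1)^3 - (v $ 2)\<^sup>2 * v $ 3 = 0" using nz by (simp only: mult_eq_0_iff) simp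
  have "det (rmat ?B v) = (- 3) * ((v $ 1)^3 - (v $ 2)\<^sup>2 * v $ 3)"
   by (simp add: det_3 rmat_def sum_3 algebra_simps power3_eq_cube power2_eq_square)
  then show "det (rmat ?B v) = 0 \<longleftrightarrow> (v $ 1)^3 - (v $ 2)\<^sup>2 * v $ 3 = 0" using nz by (simp only: mult_eq_0_iff) simp
  assume v: "v \<noteq> 0"
  show False if "minors_zero (lmat ?B v)"
   using v minors_zeroD[OF that] nz by (auto simp: lmat_def sum_3 vec3_nz_iff)
  show False if "minors_zero (rmat ?B v)"
   using v minors_zeroD[OF that] nz by (auto simp: rmat_def sum_3 vec3_nz_iff)
  assume F: "(v $ 1)^3 - (v $ 2)\<^sup>2 * v $ 3 = 0"
  obtain x y z where xyz: "v = vector [x, y, z]" by (rule vec3_cases)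
  have vE: "pnt x y z \<in> E" using mem[of v] v F xyz by simp
  have c: "x*(x*x) = y*(y*z)" using F xyz by (simp add: power3_eq_cube power2_eq_square mult.assoc)
  show "\<exists>w. w \<noteq> 0 \<and> \<sigma> (proj v) = proj w \<and> (\<forall>k. bil (?B k) v w = 0)"
  proof (cases "y = 0")
   case True
   then have x: "x = 0" using c by simp
   then have "pnt x y z = pnt 0 0 1" using v True xyz by (intro pnt_eqI) auto
   then show ?thesis using s(2) x True unfolding xyz
    by (intro exI[of _ "vector [0, 0, 1]"]) (simp add: forall_3 bil_def sum_3)
  next
   case False
   define w3 where "w3 = - 3 * (x^2 / y) + 3 * x - y + z"
   have w3: "y * w3 = 3 * (x * y) - 3 * (x * x) - y * y + y * z"
    using False by (simp add: w3_def field_simps power2_eq_square)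
   have w3': "y*(u*w3) = 3*(x*(y*u)) - 3*(x*(x*u)) - y*(y*u) + y*(z*u)" for u
    using arg_cong[OF w3, of "\<lambda>t. t * u"] by (simp add: algebra_simps)
   have s3: "\<sigma> (pnt x y z) = pnt (x - y) y w3" using s(1) vE False unfolding w3_def by blast
   have "y * (x * w3 + y * w3) = y * (2 * (x * y) + z * x - 2 * (z * y) - y * y)"
    unfolding distrib_left w3' using c by (simp add: algebra_simps)
   then have b3: "x*w3 + y*w3 = 2*(x*y) + z*x - 2*(z*y) - y*y" using False by (simp only: mult_cancel_left) simp
   show ?thesis using False v unfolding xyz
    by (intro exI[of _ "vector [x - y, y, w3]"])
     (use b3 w3 in \<open>simp add: s3 forall_3 bil_def sum_3 algebra_simps\<close>)
  qed
 qed
 then show ?thesis .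
qed

text \<open>The three commutators. As a linear system in one argument they form a cross product,
  whose determinant vanishes identically and whose kernel is spanned by the other argument.\<close>

lemma presents_P:
 fixes \<sigma> :: "(('k::field_char_0)^3) set \<Rightarrow> ('k^3) set"
 assumes "type_P E \<sigma>"
 shows "presents E \<sigma> (\<lambda>v. 0 * v $ 1) (sel3 (m33 0 0 0 0 0 1 0 (- 1) 0) (m33 0 0 (- 1) 0 0 0 1 0 0) (m33 0 1 0 (- 1) 0 0 0 0 0))"
proof -
 have E: "E = P2" and s: "\<sigma> = (\<lambda>p\<in>E. p)" using assms unfolding type_P_def by blast+
 have ext: "\<sigma> \<in> extensional E" by (simp add: s)
 have nz: "(1::'k) \<noteq> 0" by simp
 have mem: "proj v \<in> E \<longleftrightarrow> v \<noteq> 0 \<and> 0 * v $ 1 = 0" for v by (simp add: E)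
 have EP2: "E \<subseteq> P2" by (simp add: E)

 have "presents E \<sigma> (\<lambda>v. 0 * v $ 1) (sel3 (m33 0 0 0 0 0 1 0 (- 1) 0) (m33 0 0 (- 1) 0 0 0 1 0 0) (m33 0 1 0 (- 1) 0 0 0 0 0))"
 proof (rule presentsI)
  show "proj v \<in> E \<longleftrightarrow> v \<noteq> 0 \<and> 0 * v $ 1 = 0" for v by (rule mem)
  show "E \<subseteq> P2" by (rule EP2)
  show "\<sigma> \<in> extensional E" by (rule ext)
 next
  fix v :: "'k^3"
  let ?B = "sel3 (m33 0 0 0 0 0 1 0 (- 1) 0) (m33 0 0 (- 1) 0 0 0 1 0 0) (m33 0 1 0 (- 1) 0 0 0 0 0)"
  have "det (lmat ?B v) = 1 * (0 * v $ 1)"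
   by (simp add: det_3 lmat_def sum_3 algebra_simps power3_eq_cube power2_eq_square)
  then show "det (lmat ?B v) = 0 \<longleftrightarrow> 0 * v $ 1 = 0" using nz by (simp only: mult_eq_0_iff) simp
  have "det (rmat ?B v) = 1 * (0 * v $ 1)"
   by (simp add: det_3 rmat_def sum_3 algebra_simps power3_eq_cube power2_eq_square)
  then show "det (rmat ?B v) = 0 \<longleftrightarrow> 0 * v $ 1 = 0" using nz by (simp only: mult_eq_0_iff) simp
  assume v: "v \<noteq> 0"
  show False if "minors_zero (lmat ?B v)"
   using v minors_zeroD[OF that] nz by (auto simp: lmat_def sum_3 vec3_nz_iff)
  show False if "minors_zero (rmat ?B v)"
   using v minors_zeroD[OF that] nz by (auto simp: rmat_def sum_3 vec3_nz_iff)
  assume F: "0 * v $ 1 = 0"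
  obtain x y z where xyz: "v = vector [x, y, z]" by (rule vec3_cases)
  have vE: "pnt x y z \<in> E" using mem[of v] v F xyz by simp
  show "\<exists>w. w \<noteq> 0 \<and> \<sigma> (proj v) = proj w \<and> (\<forall>k. bil (?B k) v w = 0)"
   using v by (intro exI[of _ v]) (simp add: s E forall_3 bil_def sum_3)
 qed
 then show ?thesis .
qed

text \<open>The matrices are the relations \<open>yz - \<alpha> zy\<close>,
  \<open>zx - \<alpha> xz\<close>, \<open>xy - \<alpha> yx\<close>. Both determinants are
  \<open>(1 - \<alpha>^3) xyz\<close>.\<close>

lemma presents_S:
 fixes \<sigma> :: "(('k::field_char_0)^3) set \<Rightarrow> ('k^3) set"
 assumes "type_S E \<sigma>"
 shows "\<exists>\<alpha>. \<alpha> \<noteq> 0 \<and> \<alpha>^3 \<noteq> 1 \<and> presents E \<sigma> (\<lambda>v. v $ 1 * v $ 2 * v $ 3) (sel3 (m33 0 0 0 0 0 1 0 (- \<alpha>) 0) (m33 0 0 (- \<alpha>) 0 0 0 1 0 0) (m33 0 1 0 (- \<alpha>) 0 0 0 0 0))"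
proof -
 obtain \<alpha> where a: "\<alpha>^3 \<noteq> 0" "\<alpha>^3 \<noteq> 1" and ext: "\<sigma> \<in> extensional E"
  and E: "E = locus (\<lambda>x y z. x) \<union> locus (\<lambda>x y z. y) \<union> locus (\<lambda>x y z. z)"
  and s: "\<forall>b c. pnt 0 b c \<in> E \<longrightarrow> \<sigma> (pnt 0 b c) = pnt 0 b (\<alpha> * c)"
   "\<forall>a c. pnt a 0 c \<in> E \<longrightarrow> \<sigma> (pnt a 0 c) = pnt (\<alpha>*a) 0 c"
   "\<forall>a b. pnt a b 0 \<in> E \<longrightarrow> \<sigma> (pnt a b 0) = pnt a (\<alpha>*b) 0"
  using assms unfolding type_S_def by blast
 have nz: "\<alpha> \<noteq> 0" "1 - \<alpha>^3 \<noteq> 0" using a by auto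
 have mem: "proj v \<in> E \<longleftrightarrow> v \<noteq> 0 \<and> v $ 1 * v $ 2 * v $ 3 = 0" for v
  unfolding E using mem_locus[where F = "\<lambda>x y z. x" and n = 1] mem_locus[where F = "\<lambda>x y z. y" and n = 1]
   mem_locus[where F = "\<lambda>x y z. z" and n = 1] by auto
 have EP2: "E \<subseteq> P2" unfolding E using locus_subset_P2 by blast

 have "presents E \<sigma> (\<lambda>v. v $ 1 * v $ 2 * v $ 3) (sel3 (m33 0 0 0 0 0 1 0 (- \<alpha>) 0) (m33 0 0 (- \<alpha>) 0 0 0 1 0 0) (m33 0 1 0 (- \<alpha>) 0 0 0 0 0))"
 proof (rule presentsI)
  show "proj v \<in> E \<longleftrightarrow> v \<noteq> 0 \<and> v $ 1 * v $ 2 * v $ 3 = 0" for v by (rule mem)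
  show "E \<subseteq> P2" by (rule EP2)
  show "\<sigma> \<in> extensional E" by (rule ext)
 next
  fix v :: "'k^3"
  let ?B = "sel3 (m33 0 0 0 0 0 1 0 (- \<alpha>) 0) (m33 0 0 (- \<alpha>) 0 0 0 1 0 0) (m33 0 1 0 (- \<alpha>) 0 0 0 0 0)"
  have "det (lmat ?B v) = (1 - \<alpha>^3) * (v $ 1 * v $ 2 * v $ 3)"
   by (simp add: det_3 lmat_def sum_3 algebra_simps power3_eq_cube power2_eq_square)
  then show "det (lmat ?B v) = 0 \<longleftrightarrow> v $ 1 * v $ 2 * v $ 3 = 0" using nz by (simp only: mult_eq_0_iff) simp
  have "det (rmat ?B v) = (1 - \<alpha>^3) * (v $ 1 * v $ 2 * v $ 3)"
   by (simp add: det_3 rmat_def sum_3 algebra_simps power3_eq_cube power2_eq_square)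
  then show "det (rmat ?B v) = 0 \<longleftrightarrow> v $ 1 * v $ 2 * v $ 3 = 0" using nz by (simp only: mult_eq_0_iff) simp
  assume v: "v \<noteq> 0"
  show False if "minors_zero (lmat ?B v)"
   using v minors_zeroD[OF that] nz by (auto simp: lmat_def sum_3 vec3_nz_iff)
  show False if "minors_zero (rmat ?B v)"
   using v minors_zeroD[OF that] nz by (auto simp: rmat_def sum_3 vec3_nz_iff)
  assume F: "v $ 1 * v $ 2 * v $ 3 = 0"
  obtain x y z where xyz: "v = vector [x, y, z]" by (rule vec3_cases)
  have vE: "pnt x y z \<in> E" using mem[of v] v F xyz by simp
  consider "x = 0" | "y = 0" | "z = 0" using F xyz by auto
  then show "\<exists>w. w \<noteq> 0 \<and> \<sigma> (proj v) = proj w \<and> (\<forall>k. bil (?B k) v w = 0)"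
  proof cases
   case 1
   then show ?thesis using s(1) vE v nz unfolding xyz
    by (intro exI[of _ "vector [0, y, \<alpha> * z]"]) (auto simp: forall_3 bil_def sum_3)
  next
   case 2
   then show ?thesis using s(2) vE v nz unfolding xyz
    by (intro exI[of _ "vector [\<alpha> * x, 0, z]"]) (auto simp: forall_3 bil_def sum_3)
  next
   case 3
   then show ?thesis using s(3) vE v nz unfolding xyz
    by (intro exI[of _ "vector [x, \<alpha> * y, 0]"]) (auto simp: forall_3 bil_def sum_3)
  qed
 qed
 then show ?thesis using nz a by (intro exI[of _ \<alpha>]) simp
qed

section \<open>Rigidity of the singular types\<close>

lemma m33_mult: "m33 a b c d e f g h i *v vector [x, y, z] =
 (vector [a*x + b*y + c*z, d*x + e*y + f*z, g*x + h*y + i*z] :: ('k::field)^3)"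
 by (simp add: vec3_eq_iff matrix_vector_mult_3)

lemma m33_cases:
 obtains a b c d e f g h i where "(T::('k::field)^3^3) = m33 a b c d e f g h i"
proof -
 have "T = m33 (T $ 1 $ 1) (T $ 1 $ 2) (T $ 1 $ 3) (T $ 2 $ 1) (T $ 2 $ 2) (T $ 2 $ 3) (T $ 3 $ 1) (T $ 3 $ 2) (T $ 3 $ 3)"
  by (simp add: vec3_eq_iff)
 then show ?thesis by (rule that)
qed

lemma m33_invertible:
 "invertible (m33 a b c d e f g h i :: ('k::field)^3^3) \<longleftrightarrow>
  a * (e * i - f * h) - b * (d * i - f * g) + c * (d * h - e * g) \<noteq> 0"
 unfolding invertible_det_nz det_3 by (simp add: algebra_simps)

lemma proj_m33_scaled:
 fixes k :: "'k::field"
 assumes "k \<noteq> 0" "a' = k*a" "b' = k*b" "c' = k * c" "d' = k*d" "e' = k*e" "f' = k*f"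
  "g' = k * g" "h' = k * h" "i' = k * i"
 shows "proj (m33 a' b' c' d' e' f' g' h' i' *v v) = proj (m33 a b c d e f g h i *v v)"
proof -
 have "m33 a' b' c' d' e' f' g' h' i' *v v = k *s (m33 a b c d e f g h i *v v)"
  using assms by (simp add: vec3_eq_iff matrix_vector_mult_3 algebra_simps)
 then show ?thesis using assms(1) by (simp add: proj_smult)
qed

text \<open>Moves the property from points to coordinate vectors. The conditions in
  \<open>main\<close> also cover zero vectors, for which they are trivial, so the cases can
  substitute parametrised points without checking that they are nonzero.\<close>

lemma rigidI:
 assumes pr: "presents E \<sigma> F B" and F0: "F 0 = 0"
  and main: "\<And>T T'. \<lbrakk>invertible T; invertible T'; \<And>v. F v = 0 \<Longrightarrow> F (T *v v) = 0; \<And>v. F v = 0 \<Longrightarrow> F (T' *v v) = 0;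
   \<And>v w. (\<And>k. bil (B k) v w = 0) \<Longrightarrow> (\<And>k. bil (B k) (T *v v) (T' *v w) = 0)\<rbrakk>
   \<Longrightarrow> \<forall>v. v \<noteq> 0 \<longrightarrow> F v = 0 \<longrightarrow> proj (T' *v v) = proj (T *v v)"
 shows "rigid E \<sigma>"
 unfolding rigid_def
proof (intro allI impI ballI)
 note E = presentsD(4)[OF pr] and graph = presentsD(5)[OF pr]
 fix T T' p
 assume T: "preserves T E" and T': "preserves T' E"
  and c: "\<forall>p\<in>E. \<sigma> (pmap T p) = pmap T' (\<sigma> p)" and p: "p \<in> E"
 have inv: "invertible T" "invertible T'" using T T' by (auto simp: preserves_def)
 have F: "F (S *v v) = 0" if S: "preserves S E" and v: "F v = 0" for S v
 proof (cases "v = 0")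
  case False
  then show ?thesis using preserves_mem[OF S, of "proj v"] E v by simp
 qed (simp add: F0)
 have b: "bil (B k) (T *v v) (T' *v w) = 0" if b: "\<And>k. bil (B k) v w = 0" for v w k
 proof (cases "v = 0 \<or> w = 0")
  case True
  then show ?thesis by (auto simp: bil_def)
 next
  case False
  then have g: "proj v \<in> E" "\<sigma> (proj v) = proj w" using presents_step[OF pr _ _ b] by auto
  then have "\<sigma> (proj (T *v v)) = proj (T' *v w)" using c by force
  moreover have "proj (T *v v) \<in> E" using preserves_mem[OF T g(1)] by simp
  ultimately show ?thesis using graph[of "T *v v" "T' *v w"] False inv by (simp add: invertible_mult_nz)
 qed
 have *: "\<forall>v. v \<noteq> 0 \<longrightarrow> F v = 0 \<longrightarrow> proj (T' *v v) = proj (T *v v)"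
  by (rule main) (use inv F[OF T] F[OF T'] b in auto)
 have "p \<in> P2" using p presentsD(2)[OF pr] by blast
 then obtain v where "v \<noteq> 0" "p = proj v" by (rule P2_cases)
 then show "pmap T' p = pmap T p" using * p E by simp
qed

text \<open>The row \<open>(x, y, z)\<close> annihilates every column of an invertible matrix. In
  the applications it is the gradient of the cubic at the image of a singular point, and its
  vanishing shows that this image is singular too.\<close>

lemma column_combination_0:
 fixes a b c :: "'k::field"
 assumes "invertible (m33 a b c d e f g h i)"
  and "x * a + y * d + z * g = 0" "x * b + y * e + z * h = 0" "x * c + y * f + z * i = 0"
 shows "x = 0" "y = 0" "z = 0"
proof -
 have "invertible (transpose (m33 a b c d e f g h i))"
  using assms(1) by (simp add: invertible_det_nz)
 moreover have "transpose (m33 a b c d e f g h i) *v vector [x, y, z] = 0"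
  using assms(2-) by (simp add: vec3_eq_iff matrix_vector_mult_3 transpose_def mult.commute)
 ultimately have "vector [x, y, z] = (0 :: 'k^3)" by (simp only: invertible_mult_nz)
 then show "x = 0" "y = 0" "z = 0" by simp_all
qed

lemma poly_eq_0_if_nonzero_roots:
 fixes r :: "('k::field_char_0) poly"
 assumes "\<And>t. t \<noteq> 0 \<Longrightarrow> poly r t = 0"
 shows "r = 0"
 by (rule poly_zero_if_infinite_roots[of "UNIV - {0}"]) (use assms in \<open>simp_all add: infinite_UNIV_char_0\<close>)

text \<open>The image \<open>(p, q, g)\<close> of the cusp has vanishing gradient, so it is the cusp
  again. The parametrisation \<open>(s, 1, s^3)\<close> then gives a polynomial identity whose
  coefficients leave only diagonal matrices.\<close>

lemma CC_normal_form:
 fixes T :: "('k::field_char_0)^3^3"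
 assumes inv: "invertible T"
  and F: "\<And>x y z. x^3 = y^2 * z \<Longrightarrow>
   ((T *v vector [x, y, z]) $ 1)^3 = ((T *v vector [x, y, z]) $ 2)^2*(T *v vector [x, y, z]) $ 3"
 shows "\<exists>a d g. a \<noteq> 0 \<and> d \<noteq> 0 \<and> g \<noteq> 0 \<and> a^3 = d^2*g \<and> T = m33 a 0 0 0 d 0 0 0 g"
proof -
 obtain a b p c d q e f g where T: "T = m33 a b p c d q e f g" by (rule m33_cases)
 note det = inv[unfolded T m33_invertible]
 have F0: "p^3 = q^2 * g" using F[of 0 0 1] by (simp add: T m33_mult)
 let ?R = "[:3*p:]*[:a, b:]\<^sup>2 - [:g:]*[:c, d:]\<^sup>2 - [:2*q:]*[:c, d:]*[:e, f:] + [:0, 0, 1:]*([:a, b:]^3 - [:c, d:]\<^sup>2*[:e, f:])"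
 \<comment> \<open>The gradient at \<open>(p, q, g)\<close> paired with the first two columns: along
   \<open>(u^2, u^3, 1)\<close> these are the coefficients of \<open>u^2\<close> and
   \<open>u^3\<close>. The third column is covered by Euler's relation, \<open>g3\<close>.\<close>
 let ?g1 = "3*p\<^sup>2*a - 2*q*g * c - q\<^sup>2*e" and ?g2 = "3*p\<^sup>2*b - 2*q*g*d - q\<^sup>2*f"
 have "pCons ?g1 (pCons ?g2 ?R) = 0"
 proof (rule poly_eq_0_if_nonzero_roots)
  fix u :: 'k assume u: "u \<noteq> 0"
  have "(p + u\<^sup>2*(a + u*b))^3 - (q + u\<^sup>2*(c + u*d))\<^sup>2*(g + u\<^sup>2*(e + u*f)) = 0"
   using F[of "u\<^sup>2" "u^3" 1] by (simp add: T m33_mult cubic_simps)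
  moreover have "(p + u\<^sup>2*(a + u*b))^3 - (q + u\<^sup>2*(c + u*d))\<^sup>2*(g + u\<^sup>2*(e + u*f)) =
   (p^3 - q\<^sup>2 * g) + u\<^sup>2 * poly (pCons ?g1 (pCons ?g2 ?R)) u"
   by (simp add: cubic_simps)
  ultimately show "poly (pCons ?g1 (pCons ?g2 ?R)) u = 0" using F0 u by simp
 qed
 then have g: "?g1 = 0" "?g2 = 0" by (simp_all only: pCons_eq_0_iff)
 have g3: "3 * p\<^sup>2 * p - 2 * q * g * q - q\<^sup>2 * g = 0"
  using F0 by (simp add: cubic_simps)
 have z: "3 * p\<^sup>2 = 0" "- (q\<^sup>2) = 0"
  by (rule column_combination_0[OF inv[unfolded T], of "3*p\<^sup>2" "- (2*q*g)" "- (q\<^sup>2)"];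
   use g g3 in \<open>simp add: algebra_simps\<close>)+
 then have pq: "p = 0 \<and> q = 0" by simp
 have g0: "g \<noteq> 0" "a * d - b * c \<noteq> 0" using det pq by (auto simp: algebra_simps)
 have "[:b^3 - d\<^sup>2*f, 3*a*b\<^sup>2 - d\<^sup>2*e - 2 * c*d*f, 3*a\<^sup>2*b - c\<^sup>2*f - 2 * c*d*e,
   a^3 - d\<^sup>2 * g - c\<^sup>2 * e, - 2 * c * d * g, - (c\<^sup>2 * g):] = 0"
 proof (rule poly_eq_0_if_nonzero_roots)
  fix s :: 'k
  show "poly [:b^3 - d\<^sup>2*f, 3*a*b\<^sup>2 - d\<^sup>2*e - 2 * c*d*f, 3*a\<^sup>2*b - c\<^sup>2*f - 2 * c*d*e,
   a^3 - d\<^sup>2 * g - c\<^sup>2 * e, - 2 * c * d * g, - (c\<^sup>2 * g):] s = 0"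
   using F[of s 1 "s^3"] pq by (simp add: T m33_mult cubic_simps)
 qed
 then have co: "b^3 = d\<^sup>2*f" "3*a*b\<^sup>2 = d\<^sup>2*e + 2 * c*d*f" "3*a\<^sup>2*b = c\<^sup>2*f + 2 * c*d*e"
   "a^3 = d\<^sup>2 * g + c\<^sup>2 * e" "c\<^sup>2 * g = 0" by (simp_all add: algebra_simps)
 have c: "c = 0" using co(5) g0 by simp
 then have ad: "a \<noteq> 0" "d \<noteq> 0" using g0 by auto
 have "b = 0" using co(3) c ad by simp
 then have "e = 0" "f = 0" using co c ad by simp_all
 then show ?thesis using T co c ad g0 pq \<open>b = 0\<close> by (intro exI[of _ a] exI[of _ d] exI[of _ g]) simp
qed

text \<open>The relation \<open>xy - yx - y^2\<close> along the curve already forces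
  \<open>a = d\<close> and \<open>a' = d'\<close>; with the cubic relations among the entries both
  matrices become scalar.\<close>

lemma rigid_CC:
 fixes \<sigma> :: "(('k::field_char_0)^3) set \<Rightarrow> ('k^3) set"
 assumes "type_CC E \<sigma>"
 shows "rigid E \<sigma>"
proof (rule rigidI[OF presents_CC[OF assms]])
 let ?B = "sel3 (m33 0 1 0 (- 1) (- 1) 0 0 0 0) (m33 3 0 0 0 1 1 0 (- 1) 0) (m33 0 (- 1) 1 (- 1) 0 1 (- 1) 1 0) :: 3 \<Rightarrow> 'k^3^3"
 fix T T' :: "'k^3^3"
 assume inv: "invertible T" "invertible T'"
  and F: "\<And>v. (v $ 1)^3 - (v $ 2)\<^sup>2 * v $ 3 = 0 \<Longrightarrow> ((T *v v) $ 1)^3 - ((T *v v) $ 2)\<^sup>2*(T *v v) $ 3 = 0"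
  and F': "\<And>v. (v $ 1)^3 - (v $ 2)\<^sup>2 * v $ 3 = 0 \<Longrightarrow> ((T' *v v) $ 1)^3 - ((T' *v v) $ 2)\<^sup>2*(T' *v v) $ 3 = 0"
  and b: "\<And>v w k. (\<And>k. bil (?B k) v w = 0) \<Longrightarrow> bil (?B k) (T *v v) (T' *v w) = 0"
 obtain a d g where T: "a \<noteq> 0" "d \<noteq> 0" "a^3 = d\<^sup>2*g" "T = m33 a 0 0 0 d 0 0 0 g"
  using CC_normal_form[OF inv(1)] F[of "vector [x, y, z]" for x y z] by auto
 obtain a' d' g' where T': "a' \<noteq> 0" "d' \<noteq> 0" "a'^3 = d'\<^sup>2*g'" "T' = m33 a' 0 0 0 d' 0 0 0 g'"
  using CC_normal_form[OF inv(2)] F'[of "vector [x, y, z]" for x y z] by auto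
 have b0: "bil (?B k) (vector [s, 1, s^3]) (vector [s - 1, 1, (s - 1)^3]) = 0" for s k
  using exhaust_3[of k] by (auto simp: bil_def sum_3 algebra_simps power3_eq_cube)
 have b1: "a * s * d' - d * a' * (s - 1) - d * d' = 0" for s
  using b[OF b0, of 1 s] by (simp add: T T' m33_mult bil_def sum_3 algebra_simps)
 have e: "d*a' = d*d'" "a*d' = d*d'" using b1[of 0] b1[of 1] by (simp_all add: algebra_simps)
 then have "a' = d'" "a = d" using T T' by simp_all
 moreover from this have "g = d" "g' = d'" using T T' by (simp_all add: power3_eq_cube power2_eq_square)
 ultimately have "proj (T' *v v) = proj (T *v v)" for v
  unfolding T T' using T T' by (intro proj_m33_scaled[where k = "d' / d"]) auto
 then show "\<forall>v. v \<noteq> 0 \<longrightarrow> (v $ 1)^3 - (v $ 2)\<^sup>2 * v $ 3 = 0 \<longrightarrow> proj (T' *v v) = proj (T *v v)" by blast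
qed simp

text \<open>As for the cusp, the image of the node has vanishing gradient. The node has two
  branches, parametrised by \<open>(lt, lt^2, 1 + t^3)\<close> and by the same curve with the first
  two coordinates exchanged; their directions supply the first two columns.\<close>

lemma NC_normal_form:
 fixes T :: "('k::field_char_0)^3^3"
 assumes inv: "invertible T" and l: "l \<noteq> 0"
  and F: "\<And>x y z. x^3 + y^3 = l*x*y*z \<Longrightarrow> ((T *v vector [x, y, z]) $ 1)^3 + ((T *v vector [x, y, z]) $ 2)^3 =
   l * (T *v vector [x, y, z]) $ 1 * (T *v vector [x, y, z]) $ 2 * (T *v vector [x, y, z]) $ 3"
 shows "\<exists>a d g. a \<noteq> 0 \<and> d \<noteq> 0 \<and> g \<noteq> 0 \<and> a\<^sup>2 = d*g \<and> d\<^sup>2 = a*g \<and>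
  (T = m33 a 0 0 0 d 0 0 0 g \<or> T = m33 0 a 0 d 0 0 0 0 g)"
proof -
 obtain a b p c d q e f g where T: "T = m33 a b p c d q e f g" by (rule m33_cases)
 note det = inv[unfolded T m33_invertible]
 have F0: "p^3 + q^3 = l * p * q * g" using F[of 0 0 1] by (simp add: T m33_mult)
 \<comment> \<open>\<open>(A, C, E)\<close> is the image of the direction of a branch; the linear
   coefficient in \<open>t\<close> of the cubic along the image curve is \<open>l\<close> times the
   gradient paired with it.\<close>
 have gr: "(3*p\<^sup>2 - l*q*g)*A + (3*q\<^sup>2 - l*p*g)*C + (- (l*p*q))*E = 0"
  if h: "\<And>t. (p + t*(l*A + t*(l*B + t*p)))^3 + (q + t*(l*C + t*(l*D + t*q)))^3 =
   l*(p + t*(l*A + t*(l*B + t*p)))*(q + t*(l*C + t*(l*D + t*q)))*(g + t*(l*E + t*(l*G + t*g)))"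
  for A B C D E G
 proof -
  let ?W1 = "[:l*A, l*B, p:]" and ?W2 = "[:l*C, l*D, q:]" and ?W3 = "[:l*E, l*G, g:]"
  let ?R = "[:3*p\<^sup>2 - l*q*g:]*?W1 + [:3*q\<^sup>2 - l*p*g:]*?W2 - [:l*p*q:]*?W3 +
   [:0, 1:]*([:3*p:]*?W1\<^sup>2 + [:3*q:]*?W2\<^sup>2 - [:l:]*([:g:]*?W1*?W2 + [:p:]*?W2*?W3 + [:q:]*?W1*?W3)) +
   [:0, 0, 1:] * (?W1^3 + ?W2^3 - [:l:] * ?W1 * ?W2 * ?W3)"
  have taylor: "(p + t*W1)^3 + (q + t*W2)^3 - l*(p + t*W1)*(q + t*W2)*(g + t*W3) =
   (p^3 + q^3 - l*p*q*g) + t*((3*p\<^sup>2 - l*q*g)*W1 + (3*q\<^sup>2 - l*p*g)*W2 - l*p*q*W3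
   + t*(3*p*W1\<^sup>2 + 3*q*W2\<^sup>2 - l*(g*W1*W2 + p*W2*W3 + q*W1*W3))
   + t * t * (W1^3 + W2^3 - l * W1 * W2 * W3))" for t W1 W2 W3
   by (simp add: cubic_simps)
  have "?R = 0"
  proof (rule poly_eq_0_if_nonzero_roots)
   fix t :: 'k assume t: "t \<noteq> 0"
   define W1 W2 W3 where W: "W1 = l*A + t*(l*B + t*p)" "W2 = l*C + t*(l*D + t*q)" "W3 = l*E + t*(l*G + t*g)"
   have pW: "poly ?W1 t = W1" "poly ?W2 t = W2" "poly ?W3 t = W3" by (simp_all add: W)
   have pR: "poly ?R t = (3*p\<^sup>2 - l*q*g)*W1 + (3*q\<^sup>2 - l*p*g)*W2 - l*p*q*W3
    + t*(3*p*W1\<^sup>2 + 3*q*W2\<^sup>2 - l*(g*W1*W2 + p*W2*W3 + q*W1*W3))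
    + t * t * (W1^3 + W2^3 - l * W1 * W2 * W3)"
    unfolding poly_add poly_diff poly_mult poly_power pW by simp
   have "(p + t * W1)^3 + (q + t * W2)^3 - l * (p + t * W1) * (q + t * W2) * (g + t * W3) = 0"
    using h[of t] by (simp add: W)
   then have "t * poly ?R t = 0" unfolding taylor pR using F0 by simp
   then show "poly ?R t = 0" using t by simp
  qed
  then have "poly ?R 0 = 0" by simp
  then have "l*((3*p\<^sup>2 - l*q*g)*A + (3*q\<^sup>2 - l*p*g)*C + (- (l*p*q))*E) = 0"
   by (simp add: algebra_simps)
  then show ?thesis using l by simp
 qed
 have row: "x*(l*t) + y*(l*t*t) + z*(1 + t^3) = z + t*(l*x + t*(l*y + t*z))"
  and row': "x*(l*t*t) + y*(l*t) + z*(1 + t^3) = z + t*(l*y + t*(l*x + t*z))" for x y z t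
  by (simp_all add: algebra_simps power3_eq_cube)
 have onF: "(l * t)^3 + (l * t * t)^3 = l * (l * t) * (l * t * t) * (1 + t^3)"
  and onF': "(l * t * t)^3 + (l * t)^3 = l * (l * t * t) * (l * t) * (1 + t^3)" for t
  by (simp_all add: algebra_simps power3_eq_cube)
 have g1: "(3*p\<^sup>2 - l*q*g)*a + (3*q\<^sup>2 - l*p*g) * c + (- (l*p*q))*e = 0"
 proof (rule gr)
  fix t show "(p + t*(l*a + t*(l*b + t*p)))^3 + (q + t*(l * c + t*(l*d + t*q)))^3 =
   l*(p + t*(l*a + t*(l*b + t*p)))*(q + t*(l * c + t*(l*d + t*q)))*(g + t*(l*e + t*(l*f + t*g)))"
   using F[OF onF, of t] by (simp only: T m33_mult vector_3 row)
 qed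
 have g2: "(3*p\<^sup>2 - l*q*g)*b + (3*q\<^sup>2 - l*p*g)*d + (- (l*p*q))*f = 0"
 proof (rule gr)
  fix t show "(p + t*(l*b + t*(l*a + t*p)))^3 + (q + t*(l*d + t*(l * c + t*q)))^3 =
   l*(p + t*(l*b + t*(l*a + t*p)))*(q + t*(l*d + t*(l * c + t*q)))*(g + t*(l*f + t*(l*e + t*g)))"
   using F[OF onF', of t] by (simp only: T m33_mult vector_3 row')
 qed
 have g3: "(3*p\<^sup>2 - l*q*g)*p + (3*q\<^sup>2 - l*p*g)*q + (- (l*p*q))*g = 0"
  using arg_cong[OF F0, of "\<lambda>u. 3 * u"] by (simp add: cubic_simps)
 note z = column_combination_0[OF inv[unfolded T] g1 g2 g3]
 have pq: "p = 0" "q = 0" using z l by auto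
 have g0: "g \<noteq> 0" "a * d - b * c \<noteq> 0" using det pq by (auto simp: algebra_simps)
 \<comment> \<open>Once the node is fixed, the cubic along the image of the parametrised curve is
   divisible by \<open>l^3 t^2\<close>; these are the coefficients of the quotient, up to
   sign.\<close>
 have "[:a * c * g, a * c * l * e + (a * d + b * c) * g - a^3 - c^3,
  a * c * l * f + (a * d + b * c) * l * e + b * d * g - 3 * a\<^sup>2 * b - 3 * c\<^sup>2 * d,
  a * c * g + (a * d + b * c) * l * f + b * d * l * e - 3 * a * b\<^sup>2 - 3 * c * d\<^sup>2,
  (a * d + b * c) * g + b * d * l * f - b^3 - d^3, b * d * g:] = 0" (is "?P = 0")
 proof (rule poly_eq_0_if_nonzero_roots)
  fix t :: 'k assume t: "t \<noteq> 0"
  define A C G where AC: "A = a + b*t" "C = c + d*t" "G = g + t*(l*e + t*(l*f + t*g))"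
  have r: "0 + t*(l*x + t*(l*y + t*0)) = l*t*(x + y*t)" for x y by (simp add: algebra_simps)
  have "(l * t * A)^3 + (l * t * C)^3 = l * (l * t * A) * (l * t * C) * G"
   using F[OF onF, of t] unfolding T m33_mult vector_3 row pq r AC .
  then have "l^3 * t\<^sup>2 * (A * C * G - t * (A^3 + C^3)) = 0"
   by (simp add: cubic_simps)
  then have "A * C * G - t * (A^3 + C^3) = 0" using t l by simp
  then show "poly ?P t = 0" by (simp add: AC cubic_simps)
 qed
 then have co: "a * c = 0" "a * c * l * e + (a * d + b * c) * g = a^3 + c^3"
  "a * c * l * f + (a * d + b * c) * l * e + b * d * g = 3 * a\<^sup>2 * b + 3 * c\<^sup>2 * d"
  "a * c * g + (a * d + b * c) * l * f + b * d * l * e = 3 * a * b\<^sup>2 + 3 * c * d\<^sup>2"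
  "(a * d + b * c) * g + b * d * l * f = b^3 + d^3" "b * d = 0"
  using g0 by (simp_all add: algebra_simps)
 show ?thesis
 proof (cases "a = 0")
  case True
  then have bc: "b \<noteq> 0" "c \<noteq> 0" "d = 0" using g0 co by auto
  then have "e = 0" "f = 0" "c^3 = b * c * g" "b^3 = b * c * g" using co True l by simp_all
  then have "c\<^sup>2 = b*g" "b\<^sup>2 = c*g" using bc by (simp_all add: power2_eq_square power3_eq_cube)
  then show ?thesis using True bc g0 pq T \<open>e = 0\<close> \<open>f = 0\<close>
   by (intro exI[of _ b] exI[of _ c] exI[of _ g]) simp
 next
  case False
  then have bc: "c = 0" "d \<noteq> 0" "b = 0" using g0 co by auto
  then have "e = 0" "f = 0" "a^3 = a * d * g" "d^3 = a * d * g" using co False l by simp_all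
  then have "a\<^sup>2 = d*g" "d\<^sup>2 = a*g" using bc False by (simp_all add: power2_eq_square power3_eq_cube)
  then show ?thesis using False bc g0 pq T \<open>e = 0\<close> \<open>f = 0\<close>
   by (intro exI[of _ a] exI[of _ d] exI[of _ g]) simp
 qed
qed

text \<open>The lines meet in \<open>(0, 0, 1)\<close>, the only point where the gradient of
  \<open>x^3 + y^3\<close> vanishes, so every \<open>T\<close> fixes it. The other points are
  \<open>(1, -\<eta>, z)\<close> with \<open>\<eta>^3 = 1\<close>, and identities of degree at most
  two in \<eta> are split by the three cube roots of unity.\<close>

lemma rigid_T:
 fixes \<sigma> :: "(('k::field_char_0)^3) set \<Rightarrow> ('k^3) set"
 assumes "type_T E \<sigma>"
 shows "rigid E \<sigma>"
proof -
 let ?B = "sel3 (m33 0 1 0 (- 1) 0 0 0 0 0) (m33 0 0 1 0 (- 1) 0 (- 1) 0 0) (m33 1 0 0 0 0 1 0 (- 1) 0) :: 3 \<Rightarrow> 'k^3^3"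
 obtain \<epsilon> :: 'k where e: "\<epsilon>^3 = 1" "\<epsilon> \<noteq> 1" and pr: "presents E \<sigma> (\<lambda>v. (v $ 1)^3 + (v $ 2)^3) ?B"
  using presents_T[OF assms] by blast
 have e2: "\<epsilon>\<^sup>2 \<noteq> 1" using e by (metis mult_1 power2_eq_square power3_eq_cube)
 have e21: "\<epsilon>\<^sup>2 \<noteq> \<epsilon>" using e by (auto simp: power2_eq_square power3_eq_cube)
 have root: "(\<epsilon>\<^sup>2)^3 = 1" using e(1) by (metis power_mult mult.commute power_one)
 have three: "X = 0 \<and> Y = 0 \<and> Z = 0" if h: "\<And>\<eta>. \<eta>^3 = 1 \<Longrightarrow> X + Y*\<eta> + Z*\<eta>\<^sup>2 = 0" for X Y Z :: 'k
 proof -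
  have 1: "X + Y + Z = 0" using h[of 1] by simp
  have 2: "X + Y * \<epsilon> + Z * \<epsilon>\<^sup>2 = 0" using h[OF e(1)] .
  have "(\<epsilon>\<^sup>2)\<^sup>2 = \<epsilon>^3*\<epsilon>" by (simp add: power2_eq_square power3_eq_cube)
  then have e4: "(\<epsilon>\<^sup>2)\<^sup>2 = \<epsilon>" by (simp only: e(1)) simp
  have 3: "X + Y * \<epsilon>\<^sup>2 + Z * \<epsilon> = 0" using h[OF root] by (simp only: e4)
  have "(Y - Z)*(\<epsilon>\<^sup>2 - \<epsilon>) = (X + Y*\<epsilon>\<^sup>2 + Z*\<epsilon>) - (X + Y*\<epsilon> + Z*\<epsilon>\<^sup>2)"
   by (simp add: algebra_simps)
  then have "(Y - Z) * (\<epsilon>\<^sup>2 - \<epsilon>) = 0" by (simp only: 2 3) simp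
  then have yz: "Y = Z" using e21 by simp
  have "Y*(\<epsilon> + \<epsilon>\<^sup>2 - 2) = (X + Y*\<epsilon> + Y*\<epsilon>\<^sup>2) - (X + Y + Y)" by (simp add: algebra_simps)
  then have "Y * (\<epsilon> + \<epsilon>\<^sup>2 - 2) = 0" using 1 2 by (simp only: yz) simp
  moreover have "\<epsilon> + \<epsilon>\<^sup>2 - 2 = - 3"
  proof -
   have "(\<epsilon> - 1)*(1 + \<epsilon> + \<epsilon>\<^sup>2) = \<epsilon>^3 - 1" by (simp add: cubic_simps)
   then have "(\<epsilon> - 1)*(1 + \<epsilon> + \<epsilon>\<^sup>2) = 0" by (simp only: e(1)) simp
   then have "1 + \<epsilon> + \<epsilon>\<^sup>2 = 0" using e(2) by simp
   then have "(1 + \<epsilon> + \<epsilon>\<^sup>2) - 3 = - 3" by simp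
   then show ?thesis by simp
  qed
  ultimately have "Y = 0" by simp
  then show ?thesis using yz 1 by simp
 qed
 have normal: "\<exists>a b c d e f g. g \<noteq> 0 \<and> (a \<noteq> 0 \<and> d \<noteq> 0 \<and> T = m33 a 0 0 0 d 0 e f g \<or> b \<noteq> 0 \<and> c \<noteq> 0 \<and> T = m33 0 b 0 c 0 0 e f g)"
  if inv: "invertible T" and F: "\<And>v. (v $ 1)^3 + (v $ 2)^3 = 0 \<Longrightarrow> ((T *v v) $ 1)^3 + ((T *v v) $ 2)^3 = 0" for T :: "'k^3^3"
 proof -
  obtain a b p c d q e f g where T: "T = m33 a b p c d q e f g" by (rule m33_cases)
  have F1: "(a - b*\<eta> + p*z)^3 + (c - d*\<eta> + q*z)^3 = 0" if "\<eta>^3 = 1" for \<eta> z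
   using F[of "vector [1, - \<eta>, z]"] that by (simp add: T m33_mult)
  have co: "p\<^sup>2*(a - b*\<eta>) + q\<^sup>2*(c - d*\<eta>) = 0 \<and> (a - b*\<eta>)^3 + (c - d*\<eta>)^3 = 0 \<and> p^3 + q^3 = 0"
   if eta: "\<eta>^3 = 1" for \<eta>
  proof -
   let ?A = "a - b * \<eta>" and ?C = "c - d * \<eta>"
   have "[:?A^3 + ?C^3, 3*(?A\<^sup>2*p + ?C\<^sup>2*q), 3*(p\<^sup>2*?A + q\<^sup>2*?C), p^3 + q^3:] = 0"
   proof (rule poly_eq_0_if_nonzero_roots)
    fix z :: 'k
    have "(A + p*z)^3 + (C + q*z)^3 = poly [:A^3 + C^3, 3*(A\<^sup>2*p + C\<^sup>2*q), 3*(p\<^sup>2*A + q\<^sup>2*C), p^3 + q^3:] z"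
     for A C by (simp add: cubic_simps)
    then show "poly [:?A^3 + ?C^3, 3*(?A\<^sup>2*p + ?C\<^sup>2*q), 3*(p\<^sup>2*?A + q\<^sup>2*?C), p^3 + q^3:] z = 0"
     using F1[OF eta, of z] by metis
   qed
   then have co: "?A^3 + ?C^3 = 0" "3 * (p\<^sup>2 * ?A + q\<^sup>2 * ?C) = 0" "p^3 + q^3 = 0"
    by (simp_all only: pCons_eq_0_iff)
   have "p\<^sup>2 * ?A + q\<^sup>2 * ?C = 0" using co(2) by (simp only: mult_eq_0_iff) simp
   then show ?thesis using co by simp
  qed
  have "(p\<^sup>2*a + q\<^sup>2 * c) + (- (p\<^sup>2*b + q\<^sup>2*d))*\<eta> + 0*\<eta>\<^sup>2 = 0" if "\<eta>^3 = 1" for \<eta>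
   using co[OF that] by (simp add: algebra_simps)
  from three[OF this] have g1: "p\<^sup>2*a + q\<^sup>2 * c + 0*e = 0" and g2: "p\<^sup>2*b + q\<^sup>2*d + 0*f = 0"
   by (simp_all add: neg_eq_iff_add_eq_0)
  have g3: "p\<^sup>2*p + q\<^sup>2*q + 0*g = 0" using co[of 1] by (simp add: power2_eq_square power3_eq_cube)
  note z = column_combination_0[OF inv[unfolded T] g1 g2 g3]
  have pq: "p = 0" "q = 0" using z by auto
  have g0: "g \<noteq> 0" "a*d - b * c \<noteq> 0" using inv[unfolded T m33_invertible] pq by (auto simp: algebra_simps)
  have "(a^3 + c^3 - b^3 - d^3) + (- 3*(a\<^sup>2*b + c\<^sup>2*d))*\<eta> + 3*(a*b\<^sup>2 + c*d\<^sup>2)*\<eta>\<^sup>2 = 0" if "\<eta>^3 = 1" for \<eta>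
  proof -
   have "(a^3 + c^3 - b^3 - d^3) + (- 3*(a\<^sup>2*b + c\<^sup>2*d))*\<eta> + 3*(a*b\<^sup>2 + c*d\<^sup>2)*\<eta>\<^sup>2 =
    ((a - b * \<eta>)^3 + (c - d * \<eta>)^3) + (\<eta>^3 - 1) * (b^3 + d^3)"
    by (simp add: cubic_simps)
   then show ?thesis using co[OF that] that by simp
  qed
  from three[OF this] have "a\<^sup>2*b + c\<^sup>2*d = 0" "a*b\<^sup>2 + c*d\<^sup>2 = 0"
   by (simp_all only: mult_eq_0_iff) simp_all
  then have h: "a\<^sup>2 * b = - (c\<^sup>2 * d)" "a * b\<^sup>2 = - (c * d\<^sup>2)"
   by (simp_all only: eq_neg_iff_add_eq_0)
  have "a = 0 \<or> b = 0"
  proof (rule ccontr)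
   assume "\<not> ?thesis"
   then have ab: "a \<noteq> 0" "b \<noteq> 0" by auto
   have cd: "c \<noteq> 0" "d \<noteq> 0" using h ab by auto
   have "(a\<^sup>2*b)*(c*d\<^sup>2) = (a*b\<^sup>2)*(c\<^sup>2*d)" by (simp add: h)
   then have "a * d = b * c" using ab cd by (simp add: power2_eq_square)
   then show False using g0 by simp
  qed
  then show ?thesis
  proof
   assume "b = 0"
   moreover from this have "d \<noteq> 0" "a \<noteq> 0" using g0 by auto
   moreover have "c = 0" using h calculation by auto
   ultimately show ?thesis using g0 pq T
    by - (rule exI[of _ a], rule exI[of _ 0], rule exI[of _ 0], rule exI[of _ d], rule exI[of _ e], rule exI[of _ f], rule exI[of _ g], simp)
  next
   assume "a = 0"
   moreover from this have "b \<noteq> 0" "c \<noteq> 0" using g0 by auto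
   moreover have "d = 0" using h calculation by auto
   ultimately show ?thesis using g0 pq T
    by - (rule exI[of _ 0], rule exI[of _ b], rule exI[of _ c], rule exI[of _ 0], rule exI[of _ e], rule exI[of _ f], rule exI[of _ g], simp)
  qed
 qed
 show ?thesis
 proof (rule rigidI[OF pr])
  fix T T' :: "'k^3^3"
  assume inv: "invertible T" "invertible T'"
   and F: "\<And>v. (v $ 1)^3 + (v $ 2)^3 = 0 \<Longrightarrow> ((T *v v) $ 1)^3 + ((T *v v) $ 2)^3 = 0"
   and F': "\<And>v. (v $ 1)^3 + (v $ 2)^3 = 0 \<Longrightarrow> ((T' *v v) $ 1)^3 + ((T' *v v) $ 2)^3 = 0"
   and b: "\<And>v w k. (\<And>k. bil (?B k) v w = 0) \<Longrightarrow> bil (?B k) (T *v v) (T' *v w) = 0"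
  have b0: "bil (?B k) (vector [1, - \<eta>, z]) (vector [1, - \<eta>, z + \<eta>\<^sup>2]) = 0" if "\<eta>^3 = 1" for \<eta> z k
   using exhaust_3[of k] that by (auto simp: bil_def sum_3 algebra_simps power3_eq_cube power2_eq_square)
  note bb = b[OF b0]
  obtain a b c d e f g where T: "g \<noteq> 0" "a \<noteq> 0 \<and> d \<noteq> 0 \<and> T = m33 a 0 0 0 d 0 e f g \<or> b \<noteq> 0 \<and> c \<noteq> 0 \<and> T = m33 0 b 0 c 0 0 e f g"
   using normal[OF inv(1) F] by blast
  obtain a' b' c' d' e' f' g' where T': "g' \<noteq> 0" "a' \<noteq> 0 \<and> d' \<noteq> 0 \<and> T' = m33 a' 0 0 0 d' 0 e' f' g' \<or> b' \<noteq> 0 \<and> c' \<noteq> 0 \<and> T' = m33 0 b' 0 c' 0 0 e' f' g'"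
   using normal[OF inv(2) F'] by blast
  have "proj (T' *v v) = proj (T *v v)" for v
  proof -
   consider (dd) "a \<noteq> 0" "d \<noteq> 0" "T = m33 a 0 0 0 d 0 e f g" "a' \<noteq> 0" "d' \<noteq> 0" "T' = m33 a' 0 0 0 d' 0 e' f' g'"
    | (da) "a \<noteq> 0" "d \<noteq> 0" "T = m33 a 0 0 0 d 0 e f g" "b' \<noteq> 0" "c' \<noteq> 0" "T' = m33 0 b' 0 c' 0 0 e' f' g'"
    | (ad) "b \<noteq> 0" "c \<noteq> 0" "T = m33 0 b 0 c 0 0 e f g" "a' \<noteq> 0" "d' \<noteq> 0" "T' = m33 a' 0 0 0 d' 0 e' f' g'"
    | (aa) "b \<noteq> 0" "c \<noteq> 0" "T = m33 0 b 0 c 0 0 e f g" "b' \<noteq> 0" "c' \<noteq> 0" "T' = m33 0 b' 0 c' 0 0 e' f' g'"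
    using T T' by blast
   then show ?thesis
   proof cases
    case dd
    have 1: "a * d' = d * a'" using bb[of 1 1 0] by (simp add: dd m33_mult bil_def sum_3)
    have 2: "(a*e' - a'*e) + (a'*f - a*f')*\<eta> + (a*g' - d*d')*\<eta>\<^sup>2 + z*(a*g' - g*a') = 0" if "\<eta>^3 = 1" for \<eta> z
     using bb[OF that, of 2 z] by (simp add: dd m33_mult bil_def sum_3 algebra_simps power2_eq_square)
    have 3: "a * g' = g * a'" using 2[of 1 0] 2[of 1 1] by simp
    have "(a*e' - a'*e) + (a'*f - a*f')*\<eta> + (a*g' - d*d')*\<eta>\<^sup>2 = 0" if "\<eta>^3 = 1" for \<eta>
     using 2[OF that, of 0] by simp
    from three[OF this] have "a * e' = a' * e" "a' * f = a * f'" by simp_all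
    then show ?thesis unfolding dd using dd 1 3
     by (intro proj_m33_scaled[where k = "a' / a"]) (simp_all add: field_simps)
   next
    case da
    have "a * c' = d * b' * \<eta>\<^sup>2" if "\<eta>^3 = 1" for \<eta>
     using bb[OF that, of 1 0] by (simp add: da m33_mult bil_def sum_3 algebra_simps power2_eq_square)
    \<comment> \<open>If only one of \<open>T\<close> and \<open>T'\<close> exchanges the
      coordinates, a factor \<open>\<eta>^2\<close> remains on one side, and the values
      \<open>\<eta> = 1\<close> and \<open>\<eta> = \<epsilon>\<close> contradict each
      other.\<close>
    from this[of 1] this[OF e(1)] show ?thesis using da e2 by simp
   next
    case ad
    have "b * d' * \<eta>\<^sup>2 = c * a'" if "\<eta>^3 = 1" for \<eta>
     using bb[OF that, of 1 0] by (simp add: ad m33_mult bil_def sum_3 algebra_simps power2_eq_square)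
    from this[of 1] this[OF e(1)] show ?thesis using ad e2 by simp
   next
    case aa
    have 1: "b * c' = c * b'" using bb[of 1 1 0] by (simp add: aa m33_mult bil_def sum_3)
    have 2: "(- b*g' - c * c') + (b'*e - b*e')*\<eta> + (b*f' - b'*f)*\<eta>\<^sup>2 + z*\<eta>*(g*b' - b*g') = 0" if eta: "\<eta>^3 = 1" for \<eta> z
    proof -
     have "- (b*\<eta>)*(e' - f'*\<eta> + g'*(z + \<eta>\<^sup>2)) + (e - f*\<eta> + g*z)*(b'*\<eta>) - c * c' = 0"
      using bb[OF that, of 2 z] by (simp add: aa m33_mult bil_def sum_3 algebra_simps)
     moreover have "- (b*\<eta>)*(e' - f'*\<eta> + g'*(z + \<eta>\<^sup>2)) + (e - f*\<eta> + g*z)*(b'*\<eta>) - c * c' =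
      (- b*g'*\<eta>^3 - c * c') + (b'*e - b*e')*\<eta> + (b*f' - b'*f)*\<eta>\<^sup>2 + z*\<eta>*(g*b' - b*g')"
      by (simp add: cubic_simps)
     ultimately show ?thesis using eta by simp
    qed
    have 3: "b * g' = g * b'" using 2[of 1 0] 2[of 1 1] by simp
    have "(- b*g' - c * c') + (b'*e - b*e')*\<eta> + (b*f' - b'*f)*\<eta>\<^sup>2 = 0" if "\<eta>^3 = 1" for \<eta>
     using 2[OF that, of 0] by simp
    from three[OF this] have "b' * e = b * e'" "b * f' = b' * f" by simp_all
    then show ?thesis unfolding aa using aa 1 3
     by (intro proj_m33_scaled[where k = "b' / b"]) (simp_all add: field_simps)
   qed
  qed
  then show "\<forall>v. v \<noteq> 0 \<longrightarrow> (v $ 1)^3 + (v $ 2)^3 = 0 \<longrightarrow> proj (T' *v v) = proj (T *v v)" by blast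
 qed simp
qed

text \<open>The hypotheses are the coefficients of
  \<open>(y2 + t y3)^2 = (x2 + t x3) (z2 + t z3)\<close>, a parametrised line inside the smooth
  conic \<open>y^2 = xz\<close>. There is none, so the two vectors are proportional; algebraically,
  the squares of the minors vanish.\<close>

lemma rank_one_columns:
 fixes x2 :: "'k::field_char_0"
 assumes "y2 * y2 = x2 * z2" "2 * (y2 * y3) = x2 * z3 + x3 * z2" "y3 * y3 = x3 * z3"
 shows "x2 * y3 = x3 * y2" "x2 * z3 = x3 * z2" "y2 * z3 = y3 * z2"
proof -
 have "(x2 * z3 - x3 * z2)\<^sup>2 = (x2 * z3 + x3 * z2)\<^sup>2 - 4 * (x2 * z2) * (x3 * z3)"
  by (simp add: algebra_simps power2_eq_square)
 also have "\<dots> = 0" unfolding assms(2)[symmetric] assms(1,3)[symmetric] by (simp add: power2_eq_square)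
 finally show xz: "x2 * z3 = x3 * z2" by simp
 have yy: "y2 * y3 = x2 * z3" using assms(2) xz by simp
 have "(x2*y3 - x3*y2)\<^sup>2 = x2*x2*(y3*y3) - 2*(x2*x3)*(y2*y3) + x3*x3*(y2*y2)"
  by (simp add: algebra_simps power2_eq_square)
 also have "\<dots> = x2*x3*(x3*z2 - x2*z3)" unfolding assms(1,3) yy by (simp add: algebra_simps)
 finally show "x2 * y3 = x3 * y2" using xz by simp
 have "(y2*z3 - y3*z2)\<^sup>2 = (y2*y2)*z3*z3 - 2*(z2*z3)*(y2*y3) + (y3*y3)*z2*z2"
  by (simp add: algebra_simps power2_eq_square)
 also have "\<dots> = z2*z3*(x3*z2 - x2*z3)" unfolding assms(1,3) yy by (simp add: algebra_simps)
 finally show "y2 * z3 = y3 * z2" using xz by simp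
qed

text \<open>If the line \<open>x = 0\<close> were sent into the conic, its two columns would be
  proportional, against invertibility; so it is preserved. The conic is then compared in the
  parametrisation \<open>(1, t, t^2)\<close>.\<close>

lemma T'_normal_form:
 fixes T :: "('k::field_char_0)^3^3"
 assumes inv: "invertible T"
  and F: "\<And>v. v $ 1*((v $ 2)\<^sup>2 - v $ 1 * v $ 3) = 0 \<Longrightarrow> (T *v v) $ 1*(((T *v v) $ 2)\<^sup>2 - (T *v v) $ 1*(T *v v) $ 3) = 0"
 shows "\<exists>a c d e f g. a \<noteq> 0 \<and> d \<noteq> 0 \<and> T = m33 a 0 0 c d 0 e f g \<and> d\<^sup>2 = a*g \<and> 2 * c*d = a*f \<and> c\<^sup>2 = a*e"
proof -
 obtain a m n c d q e f g where T: "T = m33 a m n c d q e f g" by (rule m33_cases)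
 note det = inv[unfolded T m33_invertible]
 have "[:m, n:] * ([:d, q:]\<^sup>2 - [:m, n:] * [:f, g:]) = 0"
 proof (rule poly_eq_0_if_nonzero_roots)
  fix t show "poly ([:m, n:] * ([:d, q:]\<^sup>2 - [:m, n:] * [:f, g:])) t = 0"
   using F[of "vector [0, 1, t]"] by (simp add: T m33_mult algebra_simps)
 qed
 then have "[:m, n:] = 0 \<or> [:d, q:]\<^sup>2 - [:m, n:]*[:f, g:] = 0" by (simp only: mult_eq_0_iff)
 then have mn: "m = 0 \<and> n = 0"
 proof
  assume "[:d, q:]\<^sup>2 - [:m, n:] * [:f, g:] = 0"
  then have "d * d = m * f" "2 * (d * q) = m * g + n * f" "q * q = n * g"
   by (simp_all add: power2_eq_square algebra_simps)
  note r = rank_one_columns[OF this]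
  have "a * (d * g - q * f) - m * (c * g - q * e) + n * (c * f - d * e) =
   a*(d*g - q*f) - c*(m*g - n*f) + e*(m*q - n*d)" by (simp add: algebra_simps)
  then show ?thesis using det r by simp
 qed simp
 have a0: "a \<noteq> 0" "d * g - q * f \<noteq> 0" using det mn by auto
 have "[:c\<^sup>2 - a*e, 2 * c*d - a*f, d\<^sup>2 + 2 * c*q - a*g, 2*d*q, q\<^sup>2:] = 0" (is "?P = 0")
 proof (rule poly_eq_0_if_nonzero_roots)
  fix t :: 'k
  have "a * ((c + d * t + q * t\<^sup>2)\<^sup>2 - a * (e + f * t + g * t\<^sup>2)) = 0"
   using F[of "vector [1, t, t\<^sup>2]"] mn by (simp add: T m33_mult)
  then have "(c + d*t + q*t\<^sup>2)\<^sup>2 - a*(e + f*t + g*t\<^sup>2) = 0" using a0 by simp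
  then show "poly ?P t = 0" by (simp add: algebra_simps power2_eq_square)
 qed
 then have co: "c\<^sup>2 = a*e" "2 * c*d = a*f" "d\<^sup>2 + 2 * c*q = a*g" "q\<^sup>2 = 0" by auto
 then have "q = 0" by simp
 then have "d \<noteq> 0" using a0 by auto
 then show ?thesis using T mn co a0 \<open>q = 0\<close>
  by - (rule exI[of _ a], rule exI[of _ c], rule exI[of _ d], rule exI[of _ e], rule exI[of _ f], rule exI[of _ g], simp)
qed

lemma rigid_T':
 fixes \<sigma> :: "(('k::field_char_0)^3) set \<Rightarrow> ('k^3) set"
 assumes "type_T' E \<sigma>"
 shows "rigid E \<sigma>"
proof (rule rigidI[OF presents_T'[OF assms]])
 let ?B = "sel3 (m33 1 1 0 (- 1) 0 0 0 0 0) (m33 0 1 1 1 0 0 (- 1) 0 0) (m33 (- 1) 0 1 0 (- 1) 1 1 (- 1) 0) :: 3 \<Rightarrow> 'k^3^3"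
 fix T T' :: "'k^3^3"
 assume inv: "invertible T" "invertible T'"
  and F: "\<And>v. v $ 1*((v $ 2)\<^sup>2 - v $ 1 * v $ 3) = 0 \<Longrightarrow> (T *v v) $ 1*(((T *v v) $ 2)\<^sup>2 - (T *v v) $ 1*(T *v v) $ 3) = 0"
  and F': "\<And>v. v $ 1*((v $ 2)\<^sup>2 - v $ 1 * v $ 3) = 0 \<Longrightarrow> (T' *v v) $ 1*(((T' *v v) $ 2)\<^sup>2 - (T' *v v) $ 1*(T' *v v) $ 3) = 0"
  and b: "\<And>v w k. (\<And>k. bil (?B k) v w = 0) \<Longrightarrow> bil (?B k) (T *v v) (T' *v w) = 0"
 obtain a c d e f g where T: "a \<noteq> 0" "d \<noteq> 0" "T = m33 a 0 0 c d 0 e f g" "d\<^sup>2 = a*g" "2 * c*d = a*f" "c\<^sup>2 = a*e"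
  using T'_normal_form[OF inv(1) F] by blast
 obtain a' c' d' e' f' g' where T': "a' \<noteq> 0" "d' \<noteq> 0" "T' = m33 a' 0 0 c' d' 0 e' f' g'" "d'\<^sup>2 = a'*g'" "2 * c'*d' = a'*f'" "c'\<^sup>2 = a'*e'"
  using T'_normal_form[OF inv(2) F'] by blast
 have l0: "bil (?B k) (vector [0, 1, w]) (vector [0, 1, 1 + w]) = 0" for w k
  using exhaust_3[of k] by (auto simp: bil_def sum_3 algebra_simps)
 have c0: "bil (?B k) (vector [1, t, t*t]) (vector [1, t - 1, (t - 1)*(t - 1)]) = 0" for t k
  using exhaust_3[of k] by (auto simp: bil_def sum_3 algebra_simps)
 have l: "d * (f' + g' * (1 + w)) - (f + g * w) * d' - d * d' = 0" for w
  using b[OF l0, of 3 w] by (simp add: T T' m33_mult bil_def sum_3 algebra_simps)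
 have cc: "a * (c' + d' * (t - 1)) - (c + d * t) * a' + a * a' = 0" for t
  using b[OF c0, of 1 t] by (simp add: T T' m33_mult bil_def sum_3 algebra_simps)
 define k where "k = a' / a"
 have k: "a' = k * a" "k \<noteq> 0" using T T' by (simp_all add: k_def)
 have "a * d' = a * (k * d)" using cc[of 0] cc[of 1] k by (simp add: algebra_simps)
 then have kd: "d' = k * d" using T by simp
 have "a * c' = a * (k * (c + d - a))" using cc[of 0] by (simp add: kd k algebra_simps)
 then have kc: "c' = k * (c + d - a)" using T by simp
 have "d*g' - d'*g = (d*(f' + g'*(1 + 1)) - (f + g*1)*d' - d*d') - (d*(f' + g'*(1 + 0)) - (f + g*0)*d' - d*d')"
  by (simp add: algebra_simps)
 also have "\<dots> = 0" unfolding l by simp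
 finally have "d * g' = d * (k * g)" by (simp add: kd algebra_simps)
 then have kg: "g' = k * g" using T by simp
 have "d*(a*(f' + k*g - k*f - k*d)) = a*(d*(f' + g'*(1 + 0)) - (f + g*0)*d' - d*d')"
  by (simp add: kd kg algebra_simps)
 then have "d * (a * (f' + k * g - k * f - k * d)) = 0" unfolding l by simp
 then have "f' + k * g - k * f - k * d = 0" using T by (simp only: mult_eq_0_iff) simp
 then have f': "f' = k * (f + d - g)" by (simp add: algebra_simps eq_diff_eq)
 \<comment> \<open>Substituting the primed entries into \<open>2 c' d' = a' f'\<close> and
   subtracting the relations for \<open>T\<close> leaves \<open>3 (d - a) = 0\<close> up to nonzero
   factors.\<close>
 have "k*((k*d)*(3*(d - a))) = (2*(k*(c + d - a))*(k*d) - k*a*(k*(f + d - g)))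
   - k * k * (2 * c * d - a * f) + k * k * (d\<^sup>2 - a * g)"
  by (simp add: algebra_simps power2_eq_square)
 also have "\<dots> = 0" using T'(5) T(4,5) unfolding k(1) kd kc f' by simp
 finally have "(k * d) * (3 * (d - a)) = 0" using k by simp
 then have da: "d = a" using k T by simp
 have kc': "c' = k * c" using kc da by simp
 have "a * g = a * d" using T(4) da by (auto simp: power2_eq_square)
 then have "g = d" using T(1) by auto
 then have kf': "f' = k * f" using f' by simp
 have "k * a * (e' - k * e) = (k * a * e' - (k * c)\<^sup>2) + k * k * (c\<^sup>2 - a * e)"
  by (simp add: algebra_simps power2_eq_square)
 also have "\<dots> = 0" using T'(6) T(6) unfolding k(1) kc' by simp
 finally have "k * a * (e' - k * e) = 0" .
 then have ke: "e' = k * e" using k T by simp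
 have "proj (T' *v v) = proj (T *v v)" for v
  unfolding T(3) T'(3) using k kd kc' kg kf' ke by (intro proj_m33_scaled[where k = k]) auto
 then show "\<forall>v. v \<noteq> 0 \<longrightarrow> v $ 1*((v $ 2)\<^sup>2 - v $ 1 * v $ 3) = 0 \<longrightarrow> proj (T' *v v) = proj (T *v v)" by blast
qed simp

text \<open>Replaces the hypothesis on \<sigma> by one on its parameter:
  \<open>\<alpha>^6 = 1\<close> gives \<open>\<sigma>^6 = id\<close>, hence
  \<open>\<sigma>^2 = id\<close>, hence \<open>\<alpha>^2 = 1\<close>.\<close>

lemma power_hypothesis:
 assumes pr: "presents E \<sigma> F B"
  and six: "\<And>p. p \<in> E \<Longrightarrow> \<alpha>^6 = 1 \<Longrightarrow> (\<sigma> ^^ 6) p = p"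
  and two: "(\<And>p. p \<in> E \<Longrightarrow> (\<sigma> ^^ 2) p = p) \<Longrightarrow> \<alpha>\<^sup>2 = 1"
  and hyp: "\<sigma> [^]\<^bsub>BijGroup E\<^esub> (6::nat) \<noteq> \<one>\<^bsub>BijGroup E\<^esub> \<or> \<sigma> [^]\<^bsub>BijGroup E\<^esub> (2::nat) = \<one>\<^bsub>BijGroup E\<^esub>"
 shows "\<alpha>^6 = (1::'k::field) \<Longrightarrow> \<alpha>\<^sup>2 = 1"
 using hyp six two unfolding pow_eq_one_iff[OF presentsD(3)[OF pr]] by blast

abbreviation hypothesis_6_2 where
 "hypothesis_6_2 E \<sigma> \<equiv> \<sigma> [^]\<^bsub>BijGroup E\<^esub> (6::nat) \<noteq> \<one>\<^bsub>BijGroup E\<^esub> \<or> \<sigma> [^]\<^bsub>BijGroup E\<^esub> (2::nat) = \<one>\<^bsub>BijGroup E\<^esub>"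

lemma E_cases:
 assumes "presents E \<sigma> F B" "p \<in> E"
 obtains x y z where "p = pnt x y z" "x \<noteq> 0 \<or> y \<noteq> 0 \<or> z \<noteq> 0" "F (vector [x, y, z]) = 0"
proof -
 have "p \<in> P2" using assms presentsD(2) by blast
 then obtain v where v: "v \<noteq> 0" "p = proj v" by (rule P2_cases)
 obtain x y z where "v = vector [x, y, z]" by (rule vec3_cases)
 then show ?thesis using that v assms(2) presentsD(4)[OF assms(1)] by auto
qed

text \<open>On the rational parametrisation \<gamma> of the nodal cubic, \<sigma> sends
  \<open>t\<close> to \<open>\<alpha> t\<close>. Matrices that keep the two branches of the node
  give proportional entries at once. Those that exchange the branches invert \<open>t\<close>, which
  leaves a factor \<open>\<alpha>^2\<close>; as the entries satisfy \<open>a^3 = d^3\<close>, this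
  implies \<open>\<alpha>^6 = 1\<close>.\<close>

lemma rigid_NC:
 fixes \<sigma> :: "(('k::field_char_0)^3) set \<Rightarrow> ('k^3) set"
 assumes "type_NC E \<sigma>" and hyp: "hypothesis_6_2 E \<sigma>"
 shows "rigid E \<sigma>"
proof -
 obtain \<alpha> l where al: "\<alpha> \<noteq> 0" "\<alpha>^3 \<noteq> 1" "\<alpha>*l = \<alpha>^3 - 1"
  and pr: "presents E \<sigma> (\<lambda>v. (v $ 1)^3 + (v $ 2)^3 - l * v $ 1 * v $ 2 * v $ 3)
   (sel3 (m33 1 0 0 0 0 1 0 (- \<alpha>) 0) (m33 0 0 (- \<alpha>) 0 1 0 1 0 0) (m33 0 1 0 (- \<alpha>) 0 0 0 0 0))"
  using presents_NC[OF assms(1)] by blast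
 let ?B = "sel3 (m33 1 0 0 0 0 1 0 (- \<alpha>) 0) (m33 0 0 (- \<alpha>) 0 1 0 1 0 0) (m33 0 1 0 (- \<alpha>) 0 0 0 0 0)"
 have l: "l \<noteq> 0" using al by auto
 have al': "\<alpha> * (l * u) = \<alpha> * (\<alpha> * (\<alpha> * u)) - u" for u
  using arg_cong[OF al(3), of "\<lambda>t. t * u"] by (simp add: algebra_simps power3_eq_cube)
 define \<gamma> where "\<gamma> = (\<lambda>t. vector [l*t, l*t*t, 1 + t*t*t] :: 'k^3)"
 have g0: "bil (?B k) (\<gamma> t) (\<gamma> (\<alpha> * t)) = 0" for t k
  using exhaust_3[of k] by (auto simp: \<gamma>_def bil_def sum_3 algebra_simps al')
 have gnz: "\<gamma> t \<noteq> 0" for t using l by (auto simp: \<gamma>_def)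
 have pow: "(\<sigma> ^^ n) (proj (\<gamma> t)) = proj (\<gamma> (\<alpha>^n * t))" for n t
  using presents_funpow[OF pr, of "\<lambda>n. \<gamma> (\<alpha>^n*t)" n] g0[of _ "\<alpha>^n*t" for n] gnz by (simp add: mult.assoc)
 \<comment> \<open>The parameter of a point is \<open>y / x\<close>; the node has parameter
   0.\<close>
 have param: "\<exists>t. p = proj (\<gamma> t)" if "p \<in> E" for p
 proof -
  obtain x y z where p: "p = pnt x y z" "x \<noteq> 0 \<or> y \<noteq> 0 \<or> z \<noteq> 0" "x^3 + y^3 = l*x*y*z"
   using E_cases[OF pr \<open>p \<in> E\<close>] by auto
  show ?thesis
  proof (cases "x = 0")
   case True
   then have "y = 0" using p by simp
   then have "p = proj (\<gamma> 0)" unfolding p(1) \<gamma>_def using p(2) True by (intro pnt_eqI) auto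
   then show ?thesis by blast
  next
   case False
   have "x * (x * (x * x)) + x * (y * (y * y)) = l * (x * (x * (y * z)))"
    using arg_cong[OF p(3), of "\<lambda>u. x * u"] by (simp add: power3_eq_cube algebra_simps)
   then have "p = proj (\<gamma> (y / x))" unfolding p(1) \<gamma>_def using p False l
    by (intro pnt_eqI) (auto simp: field_simps power3_eq_cube)
   then show ?thesis by blast
  qed
 qed
 have a2: "\<alpha>^6 = 1 \<Longrightarrow> \<alpha>\<^sup>2 = 1"
 proof (rule power_hypothesis[OF pr _ _ hyp])
  show "(\<sigma> ^^ 6) p = p" if "p \<in> E" "\<alpha>^6 = 1" for p using param[OF that(1)] that(2) pow[of 6] by auto
  assume *: "\<And>p. p \<in> E \<Longrightarrow> (\<sigma> ^^ 2) p = p"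
  have "proj (\<gamma> 1) \<in> E" using presents_step(1)[OF pr gnz gnz g0] .
  from *[OF this] have "proj (\<gamma> 1) = proj (\<gamma> (\<alpha>\<^sup>2))" by (simp add: pow)
  from pnt_eqD(1)[OF this[unfolded \<gamma>_def]] have "\<alpha>\<^sup>2*(\<alpha>\<^sup>2 - 1) = 0" using l by (simp add: algebra_simps)
  then show "\<alpha>\<^sup>2 = 1" using al by simp
 qed
 show ?thesis
 proof (rule rigidI[OF pr])
  fix T T' :: "'k^3^3"
  assume inv: "invertible T" "invertible T'"
   and F: "\<And>v. (v $ 1)^3 + (v $ 2)^3 - l * v $ 1 * v $ 2 * v $ 3 = 0 \<Longrightarrow> ((T *v v) $ 1)^3 + ((T *v v) $ 2)^3 - l*(T *v v) $ 1*(T *v v) $ 2*(T *v v) $ 3 = 0"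
   and F': "\<And>v. (v $ 1)^3 + (v $ 2)^3 - l * v $ 1 * v $ 2 * v $ 3 = 0 \<Longrightarrow> ((T' *v v) $ 1)^3 + ((T' *v v) $ 2)^3 - l*(T' *v v) $ 1*(T' *v v) $ 2*(T' *v v) $ 3 = 0"
   and b: "\<And>v w k. (\<And>k. bil (?B k) v w = 0) \<Longrightarrow> bil (?B k) (T *v v) (T' *v w) = 0"
  obtain a d g where T: "a \<noteq> 0" "d \<noteq> 0" "g \<noteq> 0" "a\<^sup>2 = d*g" "d\<^sup>2 = a*g" "T = m33 a 0 0 0 d 0 0 0 g \<or> T = m33 0 a 0 d 0 0 0 0 g"
   using NC_normal_form[OF inv(1) l] F[of "vector [x, y, z]" for x y z] by auto
  obtain a' d' g' where T': "a' \<noteq> 0" "d' \<noteq> 0" "g' \<noteq> 0" "a'\<^sup>2 = d'*g'" "d'\<^sup>2 = a'*g'" "T' = m33 a' 0 0 0 d' 0 0 0 g' \<or> T' = m33 0 a' 0 d' 0 0 0 0 g'"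
   using NC_normal_form[OF inv(2) l] F'[of "vector [x, y, z]" for x y z] by auto
  note bb = b[OF g0, of 3]
  have scaled: "\<exists>k. k \<noteq> 0 \<and> a' = k*a \<and> d' = k*d \<and> g' = k*g" if r: "a*d' = d*a'"
  proof -
   define k where "k = a' / a"
   have k: "a' = k*a" "d' = k*d" "k \<noteq> 0" using r T T' by (simp_all add: k_def field_simps)
   have "k * d * (g' - k * g) = (k * d * g' - (k * a)\<^sup>2) + k * k * (a\<^sup>2 - d * g)"
    by (simp add: algebra_simps power2_eq_square)
   also have "\<dots> = 0" using T'(4) T(4) unfolding k(1,2) by simp
   finally have "k * d * (g' - k * g) = 0" .
   then have "g' = k * g" using k T by simp
   then show ?thesis using k by blast
  qed
  have "proj (T' *v v) = proj (T *v v)" for v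
  proof -
   consider (dd) "T = m33 a 0 0 0 d 0 0 0 g" "T' = m33 a' 0 0 0 d' 0 0 0 g'"
    | (da) "T = m33 a 0 0 0 d 0 0 0 g" "T' = m33 0 a' 0 d' 0 0 0 0 g'"
    | (ad) "T = m33 0 a 0 d 0 0 0 0 g" "T' = m33 a' 0 0 0 d' 0 0 0 g'"
    | (aa) "T = m33 0 a 0 d 0 0 0 0 g" "T' = m33 0 a' 0 d' 0 0 0 0 g'"
    using T(6) T'(6) by blast
   then show ?thesis
   proof cases
    case dd
    have "a*d' = d*a'" using bb[of 1] al(1) l by (simp add: dd \<gamma>_def m33_mult bil_def sum_3 algebra_simps)
    then obtain k where k: "k \<noteq> 0" "a' = k*a" "d' = k*d" "g' = k*g" using scaled by blast
    show ?thesis unfolding dd by (rule proj_m33_scaled[where k = k]) (use k in auto)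
   next
    case da
    have b: "l*l*\<alpha>*t*t*(a*d') = l*l*\<alpha>*t*t*(\<alpha>*\<alpha>*t*t*(d*a'))" for t
     using bb[of t] by (simp add: da \<gamma>_def m33_mult bil_def sum_3 algebra_simps)
    have b': "a * d' = \<alpha> * \<alpha> * t * t * (d * a')" if "t \<noteq> 0" for t
     using b[of t] al l that by (simp only: mult_cancel_left) simp
    \<comment> \<open>The two sides depend differently on \<open>t\<close>; the values 1 and 2 make
      a nonzero quantity equal to four times itself.\<close>
    have "\<alpha>*\<alpha>*(d*a') = \<alpha>*\<alpha>*(d*a')*4" using b'[of 1] b'[of 2] by (simp add: algebra_simps)
    then show ?thesis using T T' al(1) by simp
   next
    case ad
    have b: "l*l*\<alpha>*\<alpha>*t*t*(t*t*(a*d')) = l*l*\<alpha>*\<alpha>*t*t*(d*a')" for t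
     using bb[of t] by (simp add: ad \<gamma>_def m33_mult bil_def sum_3 algebra_simps)
    have b': "t * t * (a * d') = d * a'" if "t \<noteq> 0" for t
     using b[of t] al l that by (simp only: mult_cancel_left) simp
    have "a * d' = a * d' * 4" using b'[of 1] b'[of 2] by (simp add: algebra_simps)
    then show ?thesis using T T' al(1) by simp
   next
    case aa
    have "l * l * \<alpha> * (a * d') = l * l * \<alpha> * (\<alpha>\<^sup>2 * (d * a'))"
     using bb[of 1] by (simp add: aa \<gamma>_def m33_mult bil_def sum_3 algebra_simps power2_eq_square)
    then have r: "a * d' = \<alpha>\<^sup>2 * (d * a')" using al(1) l by simp
    have cube: "x^3 = y^3" if "x\<^sup>2 = y * z" "y\<^sup>2 = x * z" for x y z :: 'k
    proof -
     have "x * x\<^sup>2 = y * y\<^sup>2" unfolding that by (simp add: ac_simps)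
     then show ?thesis by (simp add: power2_eq_square power3_eq_cube mult.assoc)
    qed
    have "(a*d')^3 = (\<alpha>\<^sup>2)^3*(d^3*a'^3)" unfolding r by (simp add: power_mult_distrib)
    also have "\<dots> = \<alpha>^6 * (a * d')^3"
     unfolding cube[OF T(4,5), symmetric] cube[OF T'(4,5)] by (simp add: power_mult_distrib flip: power_mult)
    finally have "\<alpha>^6 = 1" using T T' by simp
    then have "\<alpha>\<^sup>2 = 1" by (rule a2)
    then have "a * d' = d * a'" using r by simp
    then obtain k where k: "k \<noteq> 0" "a' = k*a" "d' = k*d" "g' = k*g" using scaled by blast
    show ?thesis unfolding aa by (rule proj_m33_scaled[where k = k]) (use k in auto)
   qed
  qed
  then show "\<forall>v. v \<noteq> 0 \<longrightarrow> (v $ 1)^3 + (v $ 2)^3 - l * v $ 1 * v $ 2 * v $ 3 = 0 \<longrightarrow> proj (T' *v v) = proj (T *v v)"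
   by blast
 qed simp
qed

text \<open>The line is preserved for the same reason as in type T'. The conic
  \<open>x^2 = l y z\<close> is parametrised by \<open>(t, 1, t^2 / l)\<close>, and
  \<open>h = q / l\<close>, \<open>k = g / l\<close> clear the denominators.\<close>

lemma S'_normal_form:
 fixes T :: "('k::field_char_0)^3^3"
 assumes inv: "invertible T" and l: "l \<noteq> 0"
  and F: "\<And>v. v $ 1 * ((v $ 1)\<^sup>2 - l * v $ 2 * v $ 3) = 0 \<Longrightarrow>
   (T *v v) $ 1 * (((T *v v) $ 1)\<^sup>2 - l * (T *v v) $ 2 * (T *v v) $ 3) = 0"
 shows "\<exists>a d g. a \<noteq> 0 \<and> d \<noteq> 0 \<and> g \<noteq> 0 \<and> a\<^sup>2 = d*g \<and> (T = m33 a 0 0 0 d 0 0 0 g \<or> T = m33 a 0 0 0 0 d 0 g 0)"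
proof -
 obtain a m n c d q e f g where T: "T = m33 a m n c d q e f g" by (rule m33_cases)
 note det = inv[unfolded T m33_invertible]
 have "[:m, n:] * ([:m, n:]\<^sup>2 - [:l * d, l * q:] * [:f, g:]) = 0"
 proof (rule poly_eq_0_if_nonzero_roots)
  fix t
  have "(m + n * t) * ((m + n * t)\<^sup>2 - l * (d + q * t) * (f + g * t)) = 0"
   using F[of "vector [0, 1, t]"] by (simp add: T m33_mult)
  then show "poly ([:m, n:] * ([:m, n:]\<^sup>2 - [:l * d, l * q:] * [:f, g:])) t = 0"
   by (simp add: algebra_simps)
 qed
 then have "[:m, n:] = 0 \<or> [:m, n:]\<^sup>2 - [:l*d, l*q:]*[:f, g:] = 0" by (simp only: mult_eq_0_iff)
 then have mn: "m = 0 \<and> n = 0"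
 proof
  assume "[:m, n:]\<^sup>2 - [:l * d, l * q:] * [:f, g:] = 0"
  then have "m * m = l * d * f" "2 * (m * n) = l * d * g + l * q * f" "n * n = l * q * g"
   by (simp_all add: power2_eq_square algebra_simps)
  note r = rank_one_columns[OF this]
  have r': "d * n = q * m" "d * g = q * f" using r(1,2) l by (simp_all add: mult.assoc)
  have "a * (d * g - q * f) - m * (c * g - q * e) + n * (c * f - d * e) =
   a*(d*g - q*f) - c*(m*g - n*f) - e*(d*n - q * m)" by (simp add: algebra_simps)
  then show ?thesis using det r(3) r' by simp
 qed simp
 have a0: "a \<noteq> 0" "d * g - q * f \<noteq> 0" using det mn by auto
 define h k where "h = q / l" and "k = g / l"
 have hk: "q = l * h" "g = l * k" using l by (simp_all add: h_def k_def)
 have "[:l*d*f, l*(d*e + c*f), l*(d * k + c*e + h*f) - a\<^sup>2, l*(c * k + h*e), l*h * k:] = 0" (is "?P = 0")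
 proof (rule poly_eq_0_if_nonzero_roots)
  fix t :: 'k assume t: "t \<noteq> 0"
  have "a*t*((a*t)\<^sup>2 - l*(c*t + d + h*(t*t))*(e*t + f + k*(t*t))) = 0"
   using F[of "vector [t, 1, t * t / l]"] mn l by (simp add: T m33_mult hk power2_eq_square)
  then have "l*(c*t + d + h*(t*t))*(e*t + f + k*(t*t)) - (a*t)\<^sup>2 = 0" using a0 t by simp
  then show "poly ?P t = 0" by (simp add: algebra_simps power2_eq_square)
 qed
 then have co': "l*d*f = 0" "l*(d*e + c*f) = 0" "l*(d * k + c*e + h*f) - a\<^sup>2 = 0" "l*(c * k + h*e) = 0" "l*h * k = 0"
  by (simp_all only: pCons_eq_0_iff)
 have co: "d * f = 0" "d * e + c * f = 0" "c * k + h * e = 0" "h * k = 0"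
  using co'(1,2,4,5) l by (simp_all only: mult_eq_0_iff) simp_all
 have a2: "a\<^sup>2 = l * (d * k + c * e + h * f)" using co'(3) by simp
 show ?thesis
 proof (cases "d = 0")
  case True
  then have n: "f \<noteq> 0" "q \<noteq> 0" using a0 by auto
  then have "c = 0" "k = 0" using co True hk by auto
  moreover have "e = 0" using co(3) calculation n hk by auto
  ultimately show ?thesis using T True n a0 mn a2 hk
   by - (rule exI[of _ a], rule exI[of _ q], rule exI[of _ f], simp)
 next
  case False
  then have n: "f = 0" "e = 0" using co by auto
  then have g: "g \<noteq> 0" using a0 by auto
  then have "h = 0" "c = 0" using co hk n by auto
  then show ?thesis using T False n g a0 mn a2 hk
   by - (rule exI[of _ a], rule exI[of _ d], rule exI[of _ g], simp)
 qed
qed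

text \<open>\<sigma> fixes the two points common to the line and the conic. Matrices that exchange
  them reverse the scaling by \<alpha> on both components; one comparison on each component and the
  relation \<open>a^2 = d g\<close> then force \<open>\<alpha>^6 = 1\<close>.\<close>

lemma rigid_S':
 fixes \<sigma> :: "(('k::field_char_0)^3) set \<Rightarrow> ('k^3) set"
 assumes "type_S' E \<sigma>" and hyp: "hypothesis_6_2 E \<sigma>"
 shows "rigid E \<sigma>"
proof -
 obtain \<alpha> l where al: "\<alpha> \<noteq> 0" "\<alpha>^3 \<noteq> 1" "\<alpha>*l = \<alpha>^3 - 1"
  and pr: "presents E \<sigma> (\<lambda>v. v $ 1 * ((v $ 1)\<^sup>2 - l * v $ 2 * v $ 3))
   (sel3 (m33 1 0 0 0 0 1 0 (- \<alpha>) 0) (m33 0 0 (- \<alpha>) 0 0 0 1 0 0) (m33 0 1 0 (- \<alpha>) 0 0 0 0 0))"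
  using presents_S'[OF assms(1)] by blast
 let ?B = "sel3 (m33 1 0 0 0 0 1 0 (- \<alpha>) 0) (m33 0 0 (- \<alpha>) 0 0 0 1 0 0) (m33 0 1 0 (- \<alpha>) 0 0 0 0 0)"
 have l: "l \<noteq> 0" using al by auto
 have lw: "bil (?B k) (vector [0, b, c]) (vector [0, b, \<alpha> * c]) = 0" for b c k
  using exhaust_3[of k] by (auto simp: bil_def sum_3)
 have cw: "bil (?B k) (vector [x, y, z]) (vector [x, \<alpha>*y, z / \<alpha>]) = 0" if "x*x = l*y*z" for x y z k
 proof -
  have "\<alpha> * (x * x) = \<alpha>^3 * (y * z) - y * z"
   using arg_cong[OF al(3), of "\<lambda>u. u * (y * z)"] that by (simp add: algebra_simps)
  then have "x * x + y * (z / \<alpha>) - \<alpha> * z * (\<alpha> * y) = 0"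
   using al(1) by (simp add: field_simps power3_eq_cube)
  then show ?thesis using exhaust_3[of k] al(1) by (auto simp: bil_def sum_3 algebra_simps)
 qed
 have powl: "(\<sigma> ^^ n) (pnt 0 b c) = pnt 0 b (\<alpha>^n * c)" if "b \<noteq> 0 \<or> c \<noteq> 0" for b c n
  using presents_funpow[OF pr, of "\<lambda>n. vector [0, b, \<alpha>^n * c]" n] lw[of _ b "\<alpha>^n * c" for n] that al(1) by (simp add: mult.assoc)
 have powc: "(\<sigma> ^^ n) (pnt x y z) = pnt x (\<alpha>^n*y) (z / \<alpha>^n)" if "x*x = l*y*z" "x \<noteq> 0" for x y z n
 proof -
  have step: "bil (?B k) (vector [x, \<alpha>^n*y, z / \<alpha>^n]) (vector [x, \<alpha>^Suc n*y, z / \<alpha>^Suc n]) = 0" for n k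
  proof -
   have e: "\<alpha>*(\<alpha>^n*y) = \<alpha>^Suc n*y" "z / \<alpha>^n / \<alpha> = z / \<alpha>^Suc n" by simp_all
   have "x * x = l * (\<alpha>^n * y) * (z / \<alpha>^n)" using that(1) al(1) by simp
   from cw[OF this, of k] show ?thesis unfolding e .
  qed
  have nz: "(vector [x, \<alpha>^n*y, z / \<alpha>^n] :: 'k^3) \<noteq> 0" for n using that(2) by simp
  from presents_funpow[where \<gamma> = "\<lambda>n. vector [x, \<alpha>^n*y, z / \<alpha>^n]", OF pr nz step, of n] show ?thesis by simp
 qed
 have a2: "\<alpha>^6 = 1 \<Longrightarrow> \<alpha>\<^sup>2 = 1"
 proof (rule power_hypothesis[OF pr _ _ hyp])
  show "(\<sigma> ^^ 6) p = p" if p: "p \<in> E" and a6: "\<alpha>^6 = 1" for p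
  proof -
   obtain x y z where xyz: "p = pnt x y z" "x \<noteq> 0 \<or> y \<noteq> 0 \<or> z \<noteq> 0" "x*(x\<^sup>2 - l*y*z) = 0"
    using E_cases[OF pr p] by auto
   show ?thesis
   proof (cases "x = 0")
    case True
    then show ?thesis using powl[of y z 6] xyz a6 by simp
   next
    case False
    then show ?thesis using powc[of x y z 6] xyz a6 by (simp add: power2_eq_square)
   qed
  qed
  assume *: "\<And>p. p \<in> E \<Longrightarrow> (\<sigma> ^^ 2) p = p"
  have "pnt 0 1 1 \<in> E" using presentsD(4)[OF pr] by simp
  from *[OF this] have "pnt 0 1 1 = pnt 0 1 (\<alpha>\<^sup>2)" using powl[of 1 1 2] by simp
  from pnt_eqD(3)[OF this] show "\<alpha>\<^sup>2 = 1" by simp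
 qed
 show ?thesis
 proof (rule rigidI[OF pr])
  fix T T' :: "'k^3^3"
  assume inv: "invertible T" "invertible T'"
   and F: "\<And>v. v $ 1*((v $ 1)\<^sup>2 - l * v $ 2 * v $ 3) = 0 \<Longrightarrow> (T *v v) $ 1*(((T *v v) $ 1)\<^sup>2 - l*(T *v v) $ 2*(T *v v) $ 3) = 0"
   and F': "\<And>v. v $ 1*((v $ 1)\<^sup>2 - l * v $ 2 * v $ 3) = 0 \<Longrightarrow> (T' *v v) $ 1*(((T' *v v) $ 1)\<^sup>2 - l*(T' *v v) $ 2*(T' *v v) $ 3) = 0"
   and b: "\<And>v w k. (\<And>k. bil (?B k) v w = 0) \<Longrightarrow> bil (?B k) (T *v v) (T' *v w) = 0"
  obtain a d g where T: "a \<noteq> 0" "d \<noteq> 0" "g \<noteq> 0" "a\<^sup>2 = d*g" "T = m33 a 0 0 0 d 0 0 0 g \<or> T = m33 a 0 0 0 0 d 0 g 0"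
   using S'_normal_form[OF inv(1) l F] by blast
  obtain a' d' g' where T': "a' \<noteq> 0" "d' \<noteq> 0" "g' \<noteq> 0" "a'\<^sup>2 = d'*g'" "T' = m33 a' 0 0 0 d' 0 0 0 g' \<or> T' = m33 a' 0 0 0 0 d' 0 g' 0"
   using S'_normal_form[OF inv(2) l F'] by blast
  note bl = b[OF lw, of 1 1] and bc = b[OF cw, of 1 1 "1 / l" 3]
  have "proj (T' *v v) = proj (T *v v)" for v
  proof -
   consider (dd) "T = m33 a 0 0 0 d 0 0 0 g" "T' = m33 a' 0 0 0 d' 0 0 0 g'"
    | (da) "T = m33 a 0 0 0 d 0 0 0 g" "T' = m33 a' 0 0 0 0 d' 0 g' 0"
    | (ad) "T = m33 a 0 0 0 0 d 0 g 0" "T' = m33 a' 0 0 0 d' 0 0 0 g'"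
    | (aa) "T = m33 a 0 0 0 0 d 0 g 0" "T' = m33 a' 0 0 0 0 d' 0 g' 0"
    using T(5) T'(5) by blast
   then show ?thesis
   proof cases
    case dd
    have 1: "d*g' = g*d'" using bl[of 1] al(1) by (simp add: dd m33_mult bil_def sum_3 algebra_simps)
    have 2: "a*d' = d*a'" using bc al(1) l by (simp add: dd m33_mult bil_def sum_3 algebra_simps)
    have "d * (a * g') = a * (d * g')" by (simp only: ac_simps)
    also have "\<dots> = g * (a * d')" by (simp only: 1 ac_simps)
    also have "\<dots> = d * (g * a')" by (simp only: 2 ac_simps)
    finally have 3: "a * g' = g * a'" using T(2) by simp
    show ?thesis unfolding dd using T T' 2 3
     by (intro proj_m33_scaled[where k = "a' / a"]) (simp_all add: field_simps)
   next
    case da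
    have "d * g' = 0" using bl[of 0] by (simp add: da m33_mult bil_def sum_3)
    then show ?thesis using T T' by simp
   next
    case ad
    have "g * d' = 0" using b[OF lw, of 1 1 0] al(1) by (simp add: ad m33_mult bil_def sum_3)
    then show ?thesis using T T' by simp
   next
    case aa
    have 1: "d*g' = \<alpha>\<^sup>2*(g*d')" using bl[of 1] by (simp add: aa m33_mult bil_def sum_3 power2_eq_square algebra_simps)
    have "(1 / (l*\<alpha>))*(a*d') = (1 / (l*\<alpha>))*(\<alpha>\<^sup>2*(d*a'))"
     using bc al(1) l by (simp add: aa m33_mult bil_def sum_3 field_simps power2_eq_square)
    then have 2: "a * d' = \<alpha>\<^sup>2 * (d * a')" using al(1) l by simp
    define k where "k = a' / a"
    have k: "a' = k * a" "k \<noteq> 0" using T T' by (simp_all add: k_def)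
    have d': "d' = \<alpha>\<^sup>2 * k * d" using 2 T by (simp add: k(1))
    have g': "g' = \<alpha>\<^sup>2 * \<alpha>\<^sup>2 * k * g" using 1 T by (simp add: d')
    have "(k * a)\<^sup>2 = \<alpha>^6 * (k * k * (d * g))" using T'(4) unfolding k(1) d' g'
     by (simp add: algebra_simps flip: power_add)
    then have "\<alpha>^6 = 1" using T k by (simp add: power2_eq_square)
    then have "\<alpha>\<^sup>2 = 1" by (rule a2)
    then show ?thesis unfolding aa using k d' g'
     by (intro proj_m33_scaled[where k = k]) simp_all
   qed
  qed
  then show "\<forall>v. v \<noteq> 0 \<longrightarrow> v $ 1*((v $ 1)\<^sup>2 - l * v $ 2 * v $ 3) = 0 \<longrightarrow> proj (T' *v v) = proj (T *v v)"
   by blast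
 qed simp
qed

text \<open>A line inside the coordinate triangle lies in one of its sides, because the polynomial
  ring has no zero divisors.\<close>

lemma S_line:
 fixes a :: "'k::field_char_0"
 assumes "\<And>t. (a + b * t) * (c + d * t) * (e + f * t) = 0"
 shows "a = 0 \<and> b = 0 \<or> c = 0 \<and> d = 0 \<or> e = 0 \<and> f = 0"
proof -
 have "[:a, b:] * [:c, d:] * [:e, f:] = 0"
 proof (rule poly_eq_0_if_nonzero_roots)
  fix t show "poly ([:a, b:] * [:c, d:] * [:e, f:]) t = 0"
   using assms[of t] by (simp only: poly_mult poly_pCons) (simp add: mult.commute)
 qed
 then show ?thesis by (simp only: mult_eq_0_iff pCons_eq_0_iff) auto
qed

text \<open>In the product of the three equations the two sides have the same factors except for
  \<open>(\<alpha>^2)^3\<close>; the indices run once around the triangle.\<close>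

lemma odd_six:
 fixes \<alpha> :: "'k::field"
 assumes "p*q' = \<alpha>\<^sup>2*(q*p')" "q*r' = \<alpha>\<^sup>2*(r*q')" "r*p' = \<alpha>\<^sup>2*(p*r')"
  and "p \<noteq> 0" "q \<noteq> 0" "r \<noteq> 0" "p' \<noteq> 0" "q' \<noteq> 0" "r' \<noteq> 0"
 shows "\<alpha>^6 = 1"
proof -
 let ?m = "(p * q') * (q * r') * (r * p')"
 have "?m = \<alpha>\<^sup>2 * \<alpha>\<^sup>2 * \<alpha>\<^sup>2 * ?m"
  by (subst (1) assms(1), subst (1) assms(2), subst (1) assms(3)) (simp only: ac_simps)
 also have "\<alpha>\<^sup>2*\<alpha>\<^sup>2*\<alpha>\<^sup>2 = \<alpha>^6" by (simp flip: power_add)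
 finally show ?thesis using assms(4-) by simp
qed

text \<open>Matrices preserving the triangle are monomial. The vertices, fixed by \<sigma>, show
  that \<open>T'\<close> has the same shape as \<open>T\<close>, and one further point on each side
  compares the entries. Permutations that keep the cyclic order of the sides give proportional
  entries at once; transpositions leave a factor \<open>\<alpha>^2\<close>.\<close>

lemma rigid_S:
 fixes \<sigma> :: "(('k::field_char_0)^3) set \<Rightarrow> ('k^3) set"
 assumes "type_S E \<sigma>" and hyp: "hypothesis_6_2 E \<sigma>"
 shows "rigid E \<sigma>"
proof -
 obtain \<alpha> where al: "\<alpha> \<noteq> 0" "\<alpha>^3 \<noteq> 1"
  and pr: "presents E \<sigma> (\<lambda>v. v $ 1 * v $ 2 * v $ 3)
   (sel3 (m33 0 0 0 0 0 1 0 (- \<alpha>) 0) (m33 0 0 (- \<alpha>) 0 0 0 1 0 0) (m33 0 1 0 (- \<alpha>) 0 0 0 0 0))"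
  using presents_S[OF assms(1)] by blast
 let ?B = "sel3 (m33 0 0 0 0 0 1 0 (- \<alpha>) 0) (m33 0 0 (- \<alpha>) 0 0 0 1 0 0) (m33 0 1 0 (- \<alpha>) 0 0 0 0 0)"
 have w1: "bil (?B k) (vector [0, b, c]) (vector [0, b, \<alpha> * c]) = 0"
  and w2: "bil (?B k) (vector [b, 0, c]) (vector [\<alpha> * b, 0, c]) = 0"
  and w3: "bil (?B k) (vector [b, c, 0]) (vector [b, \<alpha> * c, 0]) = 0" for b c k
  using exhaust_3[of k] by (auto simp: bil_def sum_3)
 have p1: "(\<sigma> ^^ n) (pnt 0 b c) = pnt 0 b (\<alpha>^n * c)" if "b \<noteq> 0 \<or> c \<noteq> 0" for b c n
  using presents_funpow[OF pr, of "\<lambda>n. vector [0, b, \<alpha>^n * c]" n] w1[of _ b "\<alpha>^n * c" for n] that al(1) by (simp add: mult.assoc)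
 have p2: "(\<sigma> ^^ n) (pnt b 0 c) = pnt (\<alpha>^n*b) 0 c" if "b \<noteq> 0 \<or> c \<noteq> 0" for b c n
  using presents_funpow[OF pr, of "\<lambda>n. vector [\<alpha>^n*b, 0, c]" n] w2[of _ "\<alpha>^n*b" c for n] that al(1) by (simp add: mult.assoc)
 have p3: "(\<sigma> ^^ n) (pnt b c 0) = pnt b (\<alpha>^n * c) 0" if "b \<noteq> 0 \<or> c \<noteq> 0" for b c n
  using presents_funpow[OF pr, of "\<lambda>n. vector [b, \<alpha>^n * c, 0]" n] w3[of _ b "\<alpha>^n * c" for n] that al(1) by (simp add: mult.assoc)
 have a2: "\<alpha>^6 = 1 \<Longrightarrow> \<alpha>\<^sup>2 = 1"
 proof (rule power_hypothesis[OF pr _ _ hyp])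
  show "(\<sigma> ^^ 6) p = p" if p: "p \<in> E" and a6: "\<alpha>^6 = 1" for p
  proof -
   obtain x y z where xyz: "p = pnt x y z" "x \<noteq> 0 \<or> y \<noteq> 0 \<or> z \<noteq> 0" "x*y*z = 0"
    using E_cases[OF pr p] by auto
   consider "x = 0" | "y = 0" | "z = 0" using xyz by auto
   then show ?thesis
    by cases (use p1[of y z 6] p2[of x z 6] p3[of x y 6] xyz a6 in auto)
  qed
  assume *: "\<And>p. p \<in> E \<Longrightarrow> (\<sigma> ^^ 2) p = p"
  have "pnt 0 1 1 \<in> E" using presentsD(4)[OF pr] by simp
  from *[OF this] have "pnt 0 1 1 = pnt 0 1 (\<alpha>\<^sup>2)" using p1[of 1 1 2] by simp
  from pnt_eqD(3)[OF this] show "\<alpha>\<^sup>2 = 1" by simp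
 qed
 show ?thesis
 proof (rule rigidI[OF pr])
  fix T T' :: "'k^3^3"
  assume inv: "invertible T" "invertible T'"
   and F: "\<And>v. v $ 1 * v $ 2 * v $ 3 = 0 \<Longrightarrow> (T *v v) $ 1*(T *v v) $ 2*(T *v v) $ 3 = 0"
   and b: "\<And>v w k. (\<And>k. bil (?B k) v w = 0) \<Longrightarrow> bil (?B k) (T *v v) (T' *v w) = 0"
  obtain a11 a12 a13 a21 a22 a23 a31 a32 a33 where T: "T = m33 a11 a12 a13 a21 a22 a23 a31 a32 a33" by (rule m33_cases)
  obtain b11 b12 b13 b21 b22 b23 b31 b32 b33 where T': "T' = m33 b11 b12 b13 b21 b22 b23 b31 b32 b33" by (rule m33_cases)
  note det = inv(1)[unfolded T m33_invertible] and det' = inv(2)[unfolded T' m33_invertible]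
  have l1: "a12 = 0 \<and> a13 = 0 \<or> a22 = 0 \<and> a23 = 0 \<or> a32 = 0 \<and> a33 = 0"
   by (rule S_line) (use F[of "vector [0, 1, t]" for t] in \<open>simp add: T m33_mult\<close>)
  have l2: "a11 = 0 \<and> a13 = 0 \<or> a21 = 0 \<and> a23 = 0 \<or> a31 = 0 \<and> a33 = 0"
   by (rule S_line) (use F[of "vector [1, 0, t]" for t] in \<open>simp add: T m33_mult\<close>)
  have l3: "a11 = 0 \<and> a12 = 0 \<or> a21 = 0 \<and> a22 = 0 \<or> a31 = 0 \<and> a32 = 0"
   by (rule S_line) (use F[of "vector [1, t, 0]" for t] in \<open>simp add: T m33_mult\<close>)
  have basis: "bil (?B k) (vector [1, 0, 0]) (vector [1, 0, 0]) = 0" "bil (?B k) (vector [0, 1, 0]) (vector [0, 1, 0]) = 0"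
   "bil (?B k) (vector [0, 0, 1]) (vector [0, 0, 1]) = 0" for k
   using w3[of k 1 0] w1[of k 1 0] w2[of k 0 1] by simp_all
  note e = b[OF basis(1)] b[OF basis(2)] b[OF basis(3)]
  note e' = e(1)[of 1] e(1)[of 2] e(1)[of 3] e(2)[of 1] e(2)[of 2] e(2)[of 3] e(3)[of 1] e(3)[of 2] e(3)[of 3]
  note r = b[OF w1, of _ 1 1] b[OF w2, of _ 1 1] b[OF w3, of _ 1 1]
  note r' = r(1)[of 1] r(1)[of 2] r(1)[of 3] r(2)[of 1] r(2)[of 2] r(2)[of 3] r(3)[of 1] r(3)[of 2] r(3)[of 3]
  note E = e'[unfolded T T' m33_mult] and R = r'[unfolded T T' m33_mult]
  have "proj (T' *v v) = proj (T *v v)" for v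
  proof -
   \<comment> \<open>Each side goes into a side, and invertibility leaves the six permutation
     patterns.\<close>
   have "(a12 = 0 \<and> a13 = 0 \<and> a21 = 0 \<and> a23 = 0 \<and> a31 = 0 \<and> a32 = 0 \<and> a11 \<noteq> 0 \<and> a22 \<noteq> 0 \<and> a33 \<noteq> 0) \<or>
    (a11 = 0 \<and> a13 = 0 \<and> a21 = 0 \<and> a22 = 0 \<and> a32 = 0 \<and> a33 = 0 \<and> a12 \<noteq> 0 \<and> a23 \<noteq> 0 \<and> a31 \<noteq> 0) \<or>
    (a11 = 0 \<and> a12 = 0 \<and> a22 = 0 \<and> a23 = 0 \<and> a31 = 0 \<and> a33 = 0 \<and> a13 \<noteq> 0 \<and> a21 \<noteq> 0 \<and> a32 \<noteq> 0) \<or>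
    (a12 = 0 \<and> a13 = 0 \<and> a21 = 0 \<and> a22 = 0 \<and> a31 = 0 \<and> a33 = 0 \<and> a11 \<noteq> 0 \<and> a23 \<noteq> 0 \<and> a32 \<noteq> 0) \<or>
    (a11 = 0 \<and> a12 = 0 \<and> a21 = 0 \<and> a23 = 0 \<and> a32 = 0 \<and> a33 = 0 \<and> a13 \<noteq> 0 \<and> a22 \<noteq> 0 \<and> a31 \<noteq> 0) \<or>
    (a11 = 0 \<and> a13 = 0 \<and> a22 = 0 \<and> a23 = 0 \<and> a31 = 0 \<and> a32 = 0 \<and> a12 \<noteq> 0 \<and> a21 \<noteq> 0 \<and> a33 \<noteq> 0)"
    using l1 l2 l3 det by (elim disjE conjE; simp)
   then consider (id) "a12 = 0" "a13 = 0" "a21 = 0" "a23 = 0" "a31 = 0" "a32 = 0" "a11 \<noteq> 0" "a22 \<noteq> 0" "a33 \<noteq> 0"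
    | (c1) "a11 = 0" "a13 = 0" "a21 = 0" "a22 = 0" "a32 = 0" "a33 = 0" "a12 \<noteq> 0" "a23 \<noteq> 0" "a31 \<noteq> 0"
    | (c2) "a11 = 0" "a12 = 0" "a22 = 0" "a23 = 0" "a31 = 0" "a33 = 0" "a13 \<noteq> 0" "a21 \<noteq> 0" "a32 \<noteq> 0"
    | (t1) "a12 = 0" "a13 = 0" "a21 = 0" "a22 = 0" "a31 = 0" "a33 = 0" "a11 \<noteq> 0" "a23 \<noteq> 0" "a32 \<noteq> 0"
    | (t2) "a11 = 0" "a12 = 0" "a21 = 0" "a23 = 0" "a32 = 0" "a33 = 0" "a13 \<noteq> 0" "a22 \<noteq> 0" "a31 \<noteq> 0"
    | (t3) "a11 = 0" "a13 = 0" "a22 = 0" "a23 = 0" "a31 = 0" "a32 = 0" "a12 \<noteq> 0" "a21 \<noteq> 0" "a33 \<noteq> 0"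
    by (elim disjE conjE) assumption+
   then show ?thesis
   proof cases
    case id
    have z: "b12 = 0" "b13 = 0" "b21 = 0" "b23 = 0" "b31 = 0" "b32 = 0"
     using E id al(1) by (simp_all add: bil_def sum_3)
    have nz: "b11 \<noteq> 0" "b22 \<noteq> 0" "b33 \<noteq> 0" using det' z by auto
    have "a11 * b22 = a22 * b11" "a11 * b33 = a33 * b11"
     using R id z al(1) by (simp_all add: bil_def sum_3 algebra_simps)
    then show ?thesis unfolding T T' using id z nz
     by (intro proj_m33_scaled[where k = "b11 / a11"]) (simp_all add: field_simps)
   next
    case c1
    have z: "b11 = 0" "b13 = 0" "b21 = 0" "b22 = 0" "b32 = 0" "b33 = 0"
     using E c1 al(1) by (simp_all add: bil_def sum_3)
    have nz: "b12 \<noteq> 0" "b23 \<noteq> 0" "b31 \<noteq> 0" using det' z by auto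
    have "a12 * b23 = a23 * b12" "a12 * b31 = a31 * b12"
     using R c1 z al(1) by (simp_all add: bil_def sum_3 algebra_simps)
    then show ?thesis unfolding T T' using c1 z nz
     by (intro proj_m33_scaled[where k = "b12 / a12"]) (simp_all add: field_simps)
   next
    case c2
    have z: "b11 = 0" "b12 = 0" "b22 = 0" "b23 = 0" "b31 = 0" "b33 = 0"
     using E c2 al(1) by (simp_all add: bil_def sum_3)
    have nz: "b13 \<noteq> 0" "b21 \<noteq> 0" "b32 \<noteq> 0" using det' z by auto
    have "a13 * b21 = a21 * b13" "a13 * b32 = a32 * b13"
     using R c2 z al(1) by (simp_all add: bil_def sum_3 algebra_simps)
    then show ?thesis unfolding T T' using c2 z nz
     by (intro proj_m33_scaled[where k = "b13 / a13"]) (simp_all add: field_simps)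
   next
    case t1
    have z: "b12 = 0" "b13 = 0" "b21 = 0" "b22 = 0" "b31 = 0" "b33 = 0"
     using E t1 al(1) by (simp_all add: bil_def sum_3)
    have nz: "b11 \<noteq> 0" "b23 \<noteq> 0" "b32 \<noteq> 0" using det' z by auto
    have t: "a11*b23 = \<alpha>\<^sup>2*(a23*b11)" "a23*b32 = \<alpha>\<^sup>2*(a32*b23)" "a32*b11 = \<alpha>\<^sup>2*(a11*b32)"
     using R t1 z al(1) by (simp_all add: bil_def sum_3 algebra_simps power2_eq_square)
    have "\<alpha>\<^sup>2 = 1" by (rule a2, rule odd_six[OF t]) (use t1 nz in auto)
    then show ?thesis unfolding T T' using t1 z nz t
     by (intro proj_m33_scaled[where k = "b11 / a11"]) (simp_all add: field_simps)
   next
    case t2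
    have z: "b11 = 0" "b12 = 0" "b21 = 0" "b23 = 0" "b32 = 0" "b33 = 0"
     using E t2 al(1) by (simp_all add: bil_def sum_3)
    have nz: "b13 \<noteq> 0" "b22 \<noteq> 0" "b31 \<noteq> 0" using det' z by auto
    have t: "a13*b22 = \<alpha>\<^sup>2*(a22*b13)" "a22*b31 = \<alpha>\<^sup>2*(a31*b22)" "a31*b13 = \<alpha>\<^sup>2*(a13*b31)"
     using R t2 z al(1) by (simp_all add: bil_def sum_3 algebra_simps power2_eq_square)
    have "\<alpha>\<^sup>2 = 1" by (rule a2, rule odd_six[OF t]) (use t2 nz in auto)
    then show ?thesis unfolding T T' using t2 z nz t
     by (intro proj_m33_scaled[where k = "b13 / a13"]) (simp_all add: field_simps)
   next
    case t3
    have z: "b11 = 0" "b13 = 0" "b22 = 0" "b23 = 0" "b31 = 0" "b32 = 0"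
     using E t3 al(1) by (simp_all add: bil_def sum_3)
    have nz: "b12 \<noteq> 0" "b21 \<noteq> 0" "b33 \<noteq> 0" using det' z by auto
    have t: "a12*b21 = \<alpha>\<^sup>2*(a21*b12)" "a21*b33 = \<alpha>\<^sup>2*(a33*b21)" "a33*b12 = \<alpha>\<^sup>2*(a12*b33)"
     using R t3 z al(1) by (simp_all add: bil_def sum_3 algebra_simps power2_eq_square)
    have "\<alpha>\<^sup>2 = 1" by (rule a2, rule odd_six[OF t]) (use t3 nz in auto)
    then show ?thesis unfolding T T' using t3 z nz t
     by (intro proj_m33_scaled[where k = "b12 / a12"]) (simp_all add: field_simps)
   qed
  qed
  then show "\<forall>v. v \<noteq> 0 \<longrightarrow> v $ 1 * v $ 2 * v $ 3 = 0 \<longrightarrow> proj (T' *v v) = proj (T *v v)" by blast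
 qed simp
qed

section \<open>Twists of graded algebras\<close>

locale gr_alg =
 fixes A :: "('k::field, 'a) gralg" (structure)
 assumes ga: "graded_algebra A"
begin

sublocale ring A
 using ga unfolding graded_algebra_def by (rule conjunct1)

lemma sm_closed [simp]: "x \<in> carrier A \<Longrightarrow> c \<odot> x \<in> carrier A"
 and sm_one [simp]: "x \<in> carrier A \<Longrightarrow> 1 \<odot> x = x"
 and sm_assoc: "x \<in> carrier A \<Longrightarrow> c \<odot> (d \<odot> x) = (c*d) \<odot> x"
 and sm_dist: "x \<in> carrier A \<Longrightarrow> y \<in> carrier A \<Longrightarrow> c \<odot> (x \<oplus> y) = c \<odot> x \<oplus> c \<odot> y"
 and sm_left: "x \<in> carrier A \<Longrightarrow> y \<in> carrier A \<Longrightarrow> (c \<odot> x) \<otimes> y = c \<odot> (x \<otimes> y)"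
 and gr_sm: "x \<in> grade A n \<Longrightarrow> c \<odot> x \<in> grade A n"
 and gr_one: "\<one> \<in> grade A 0"
 and gr_mult: "x \<in> grade A m \<Longrightarrow> y \<in> grade A n \<Longrightarrow> x \<otimes> y \<in> grade A (m + n)"
 and dsd: "direct_sum_decomposition A (grade A)"
 and sm_distr: "x \<in> carrier A \<Longrightarrow> (c + d) \<odot> x = c \<odot> x \<oplus> d \<odot> x"
 using ga unfolding graded_algebra_def by simp_all

lemma sm_right: "x \<in> carrier A \<Longrightarrow> y \<in> carrier A \<Longrightarrow> x \<otimes> (c \<odot> y) = c \<odot> (x \<otimes> y)"
proof -
 have "\<forall>c. \<forall>x\<in>carrier A. \<forall>y\<in>carrier A. c \<odot> (x \<otimes> y) = x \<otimes> (c \<odot> y)"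
  using ga unfolding graded_algebra_def by (elim conjE) assumption
 then show "x \<in> carrier A \<Longrightarrow> y \<in> carrier A \<Longrightarrow> x \<otimes> (c \<odot> y) = c \<odot> (x \<otimes> y)" by simp
qed

lemma gr_sub: "additive_subgroup (grade A n) A"
 using dsd unfolding direct_sum_decomposition_def by simp

lemma gr_carrier: "x \<in> grade A n \<Longrightarrow> x \<in> carrier A"
 using additive_subgroup.a_subset[OF gr_sub] by blast

lemma gr_add: "x \<in> grade A n \<Longrightarrow> y \<in> grade A n \<Longrightarrow> x \<oplus> y \<in> grade A n"
 using additive_subgroup.a_closed[OF gr_sub] .

lemma gr_zero: "\<zero> \<in> grade A n"
 using additive_subgroup.zero_closed[OF gr_sub] .

lemma sm_zero [simp]: "c \<odot> \<zero> = \<zero>"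
proof -
 have "c \<odot> \<zero> \<oplus> c \<odot> \<zero> = c \<odot> \<zero> \<oplus> \<zero>" using sm_dist[of \<zero> \<zero> c] by simp
 then show ?thesis using add.l_cancel[of "c \<odot> \<zero>" "c \<odot> \<zero>" \<zero>] by simp
qed

definition supp :: "'a \<Rightarrow> nat set" where "supp x = {i. components A x i \<noteq> \<zero>}"

lemma comp_props:
 assumes "x \<in> carrier A"
 shows "components A x i \<in> grade A i" "finite (supp x)" "x = finsum A (components A x) (supp x)"
proof -
 have "\<exists>!f. (\<forall>i. f i \<in> grade A i) \<and> finite {i. f i \<noteq> \<zero>} \<and> x = finsum A f {i. f i \<noteq> \<zero>}"
  using dsd assms unfolding direct_sum_decomposition_def by simp
 from theI'[OF this] show "components A x i \<in> grade A i" "finite (supp x)" "x = finsum A (components A x) (supp x)"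
  unfolding components_def[symmetric] supp_def by simp_all
qed

lemma comp_carrier: "x \<in> carrier A \<Longrightarrow> components A x i \<in> carrier A"
 using comp_props gr_carrier by blast

lemma comp_unique:
 assumes "x \<in> carrier A" "\<And>i. f i \<in> grade A i" "finite {i. f i \<noteq> \<zero>}" "x = finsum A f {i. f i \<noteq> \<zero>}"
 shows "components A x = f"
proof -
 have "\<exists>!f. (\<forall>i. f i \<in> grade A i) \<and> finite {i. f i \<noteq> \<zero>} \<and> x = finsum A f {i. f i \<noteq> \<zero>}"
  using dsd assms(1) unfolding direct_sum_decomposition_def by simp
 from the1_equality[OF this] show ?thesis using assms(2-) unfolding components_def by simp
qed

lemma finsum_extend:
 assumes "finite S" "U \<subseteq> S" "\<And>i. i \<in> S \<Longrightarrow> f i \<in> carrier A" "\<And>i. i \<in> S - U \<Longrightarrow> f i = \<zero>"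
 shows "finsum A f U = finsum A f S"
proof -
 have "finsum A f S = finsum A f (U \<union> (S - U))" using assms(2) by (simp add: Un_absorb1)
 also have "\<dots> = finsum A f U \<oplus> finsum A f (S - U)"
  using assms finite_subset[OF assms(2,1)] by (intro finsum_Un_disjoint) auto
 also have "finsum A f (S - U) = \<zero>" using assms(4) by (simp cong: finsum_cong)
 finally show ?thesis using assms by (simp add: Pi_def subset_eq)
qed

lemma comp_unique':
 assumes "x \<in> carrier A" "\<And>i. f i \<in> grade A i" "finite S" "\<And>i. i \<notin> S \<Longrightarrow> f i = \<zero>" "x = finsum A f S"
 shows "components A x = f"
proof (rule comp_unique[OF assms(1,2)])
 have sub: "{i. f i \<noteq> \<zero>} \<subseteq> S" using assms(4) by blast
 then show "finite {i. f i \<noteq> \<zero>}" using assms(3) finite_subset by blast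
 show "x = finsum A f {i. f i \<noteq> \<zero>}"
  unfolding assms(5) by (rule finsum_extend[symmetric, OF assms(3) sub]) (use assms(2) gr_carrier in auto)
qed

lemma comp_homogeneous:
 assumes "x \<in> grade A m"
 shows "components A x = (\<lambda>i. if i = m then x else \<zero>)"
proof (rule comp_unique'[where S = "{m}"])
 show "x = finsum A (\<lambda>i. if i = m then x else \<zero>) {m}"
  using gr_carrier[OF assms] by (simp add: finsum_insert)
qed (use assms gr_carrier gr_zero in auto)

lemma comp_sum:
 assumes "x \<in> carrier A" "finite S" "supp x \<subseteq> S"
 shows "x = finsum A (components A x) S"
proof -
 have "finsum A (components A x) (supp x) = finsum A (components A x) S"
  by (rule finsum_extend[OF assms(2,3)]) (auto simp: supp_def comp_carrier assms)
 then show ?thesis using comp_props(3)[OF assms(1)] by simp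
qed

lemma comp_add:
 assumes "x \<in> carrier A" "y \<in> carrier A"
 shows "components A (x \<oplus> y) = (\<lambda>i. components A x i \<oplus> components A y i)"
proof (rule comp_unique'[where S = "supp x \<union> supp y"])
 have f: "finite (supp x \<union> supp y)" using comp_props assms by simp
 show "x \<oplus> y = finsum A (\<lambda>i. components A x i \<oplus> components A y i) (supp x \<union> supp y)"
  using comp_sum[OF assms(1) f] comp_sum[OF assms(2) f] assms comp_carrier by (simp add: finsum_addf)
qed (use assms comp_props gr_add in \<open>auto simp: supp_def\<close>)

lemma hom_induct [consumes 1, case_names homogeneous add]:
 assumes "x \<in> carrier A"
  and h: "\<And>m x. x \<in> grade A m \<Longrightarrow> P x"
  and add: "\<And>x y. x \<in> carrier A \<Longrightarrow> y \<in> carrier A \<Longrightarrow> P x \<Longrightarrow> P y \<Longrightarrow> P (x \<oplus> y)"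
 shows "P x"
proof -
 have "P (finsum A (components A x) S)" if "finite S" for S
  using that
 proof (induction S)
  case empty
  then show ?case using h[OF gr_zero] by simp
 next
  case (insert i S)
  have c: "components A x \<in> S \<rightarrow> carrier A" using comp_carrier[OF assms(1)] by simp
  have "P (components A x i \<oplus> finsum A (components A x) S)"
   by (rule add[OF comp_carrier[OF assms(1)] finsum_closed[OF c] h[OF comp_props(1)[OF assms(1)]] insert.IH])
  then show ?case using insert c comp_carrier[OF assms(1)] by (simp add: finsum_insert)
 qed
 then show ?thesis using comp_props(2,3)[OF assms(1)] by metis
qed

definition gadd :: "('a \<Rightarrow> 'a) \<Rightarrow> bool" where
 "gadd f \<longleftrightarrow> (\<forall>x\<in>carrier A. f x \<in> carrier A) \<and> (\<forall>x\<in>carrier A. \<forall>y\<in>carrier A. f (x \<oplus> y) = f x \<oplus> f y) \<and>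
   (\<forall>n. \<forall>x\<in>grade A n. f x \<in> grade A n)"

lemma gaddD:
 assumes "gadd f"
 shows "x \<in> carrier A \<Longrightarrow> f x \<in> carrier A" "x \<in> carrier A \<Longrightarrow> y \<in> carrier A \<Longrightarrow> f (x \<oplus> y) = f x \<oplus> f y"
  "x \<in> grade A n \<Longrightarrow> f x \<in> grade A n" "f \<zero> = \<zero>"
proof -
 show c: "x \<in> carrier A \<Longrightarrow> f x \<in> carrier A" and a: "x \<in> carrier A \<Longrightarrow> y \<in> carrier A \<Longrightarrow> f (x \<oplus> y) = f x \<oplus> f y"
  and "x \<in> grade A n \<Longrightarrow> f x \<in> grade A n" for x y n
  using assms by (auto simp: gadd_def)
 have "f \<zero> \<oplus> f \<zero> = f \<zero> \<oplus> \<zero>" using a[of \<zero> \<zero>] c[of \<zero>] by simp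
 then show "f \<zero> = \<zero>" using add.l_cancel[of "f \<zero>" "f \<zero>" \<zero>] c[of \<zero>] by simp
qed

lemma gadd_finsum:
 assumes f: "gadd f" and "finite S" "\<And>i. i \<in> S \<Longrightarrow> g i \<in> carrier A"
 shows "f (finsum A g S) = finsum A (\<lambda>i. f (g i)) S"
 using assms(2,3)
proof (induction S)
 case (insert i S)
 then show ?case using gaddD[OF f] by (simp add: finsum_insert Pi_def)
qed (simp add: gaddD[OF f])

lemma gadd_comp:
 assumes f: "gadd f" and x: "x \<in> carrier A"
 shows "components A (f x) = (\<lambda>i. f (components A x i))"
proof (rule comp_unique'[where S = "supp x"])
 show "f x = finsum A (\<lambda>i. f (components A x i)) (supp x)"
  using gadd_finsum[OF f comp_props(2)[OF x], of "components A x"] comp_props(3)[OF x] comp_carrier[OF x] by simp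
qed (use gaddD[OF f] comp_props[OF x] x in \<open>auto simp: supp_def\<close>)

lemma gadd_compose: "gadd f \<Longrightarrow> gadd g \<Longrightarrow> gadd (\<lambda>x. f (g x))"
 unfolding gadd_def by simp

lemma glaD:
 assumes "graded_linear_auto A f"
 shows "gadd f" "inj_on f (carrier A)" "f ` carrier A = carrier A" "f ` grade A n = grade A n"
  "x \<in> carrier A \<Longrightarrow> f (c \<odot> x) = c \<odot> f x"
proof -
 have f: "bij_betw f (carrier A) (carrier A)" "\<And>n. f ` grade A n = grade A n"
  "\<And>x y. x \<in> carrier A \<Longrightarrow> y \<in> carrier A \<Longrightarrow> f (x \<oplus> y) = f x \<oplus> f y"
  using assms by (simp_all add: graded_linear_auto_def)
 then show "inj_on f (carrier A)" "f ` carrier A = carrier A" "f ` grade A n = grade A n"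
  by (simp_all add: bij_betw_def)
 then show "gadd f" using f unfolding gadd_def by blast
 show "x \<in> carrier A \<Longrightarrow> f (c \<odot> x) = c \<odot> f x" using assms by (simp add: graded_linear_auto_def)
qed

lemma glaI:
 assumes "gadd f" "gadd g" "\<And>x c. x \<in> carrier A \<Longrightarrow> f (c \<odot> x) = c \<odot> f x"
  and fg: "\<And>x. x \<in> carrier A \<Longrightarrow> f (g x) = x" and gf: "\<And>x. x \<in> carrier A \<Longrightarrow> g (f x) = x"
 shows "graded_linear_auto A f"
 unfolding graded_linear_auto_def
proof (intro conjI ballI allI)
 show "bij_betw f (carrier A) (carrier A)"
  by (rule bij_betwI[of _ _ _ g]) (use assms gaddD in auto)
 fix n show "f ` grade A n = grade A n"
 proof (rule equalityI; rule subsetI)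
  fix x assume x: "x \<in> grade A n"
  then have "x = f (g x)" "g x \<in> grade A n" using fg gr_carrier gaddD(3)[OF assms(2)] by simp_all
  then show "x \<in> f ` grade A n" by (rule image_eqI)
 qed (use gaddD(3)[OF assms(1)] in auto)
qed (use assms gaddD in auto)

text \<open>The isomorphisms between twists are sought among these degreewise scalings.\<close>

definition Sc :: "(nat \<Rightarrow> 'k) \<Rightarrow> 'a \<Rightarrow> 'a" where
 "Sc \<psi> x = finsum A (\<lambda>i. \<psi> i \<odot> components A x i) (supp x)"

lemma Sc_extend:
 assumes "x \<in> carrier A" "finite S" "supp x \<subseteq> S"
 shows "Sc \<psi> x = finsum A (\<lambda>i. \<psi> i \<odot> components A x i) S"
 unfolding Sc_def by (rule finsum_extend[OF assms(2,3)]) (use assms comp_carrier in \<open>auto simp: supp_def\<close>)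

lemma Sc_homogeneous: "x \<in> grade A m \<Longrightarrow> Sc \<psi> x = \<psi> m \<odot> x"
proof -
 assume x: "x \<in> grade A m"
 have "supp x \<subseteq> {m}" by (auto simp: supp_def comp_homogeneous[OF x])
 from Sc_extend[OF gr_carrier[OF x] _ this] show ?thesis
  using gr_carrier[OF x] by (simp add: comp_homogeneous[OF x] finsum_insert)
qed

lemma Sc_gadd: "gadd (Sc \<psi>)"
 unfolding gadd_def
proof (intro conjI ballI allI)
 show "Sc \<psi> x \<in> carrier A" if "x \<in> carrier A" for x
  unfolding Sc_def using comp_carrier[OF that] by (intro finsum_closed) auto
 show "Sc \<psi> x \<in> grade A n" if "x \<in> grade A n" for x n
  using that by (simp add: Sc_homogeneous gr_sm)
 fix x y assume x: "x \<in> carrier A" and y: "y \<in> carrier A"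
 let ?S = "supp x \<union> supp y"
 have S: "finite ?S" using comp_props x y by simp
 have sub: "supp (x \<oplus> y) \<subseteq> ?S" using x y by (auto simp: supp_def comp_add)
 have "Sc \<psi> (x \<oplus> y) = finsum A (\<lambda>i. \<psi> i \<odot> components A x i \<oplus> \<psi> i \<odot> components A y i) ?S"
  using Sc_extend[OF _ S sub, of \<psi>] x y comp_carrier by (simp add: comp_add sm_dist)
 also have "\<dots> = Sc \<psi> x \<oplus> Sc \<psi> y"
  using Sc_extend[OF x S, of \<psi>] Sc_extend[OF y S, of \<psi>] x y comp_carrier by (simp add: finsum_addf)
 finally show "Sc \<psi> (x \<oplus> y) = Sc \<psi> x \<oplus> Sc \<psi> y" .
qed

lemma Sc_smult: "x \<in> carrier A \<Longrightarrow> Sc \<psi> (c \<odot> x) = c \<odot> Sc \<psi> x"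
proof (induction rule: hom_induct)
 case (homogeneous m x)
 then show ?case
  using Sc_homogeneous[OF homogeneous] Sc_homogeneous[OF gr_sm[OF homogeneous]]
  by (simp add: sm_assoc gr_carrier mult.commute)
next
 case (add x y)
 then show ?case by (simp add: sm_dist gaddD[OF Sc_gadd])
qed

lemma Sc_Sc: "x \<in> carrier A \<Longrightarrow> (\<And>n. \<psi> n*\<omega> n = 1) \<Longrightarrow> Sc \<psi> (Sc \<omega> x) = x"
proof (induction rule: hom_induct)
 case (homogeneous m x)
 then show ?case
  using Sc_homogeneous[OF homogeneous(1)] Sc_homogeneous[OF gr_sm[OF homogeneous(1)]]
  by (simp add: sm_assoc gr_carrier)
next
 case (add x y)
 then show ?case by (simp add: gaddD[OF Sc_gadd])
qed

lemma Sc_gla: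
 assumes "\<And>n. \<psi> n \<noteq> 0"
 shows "graded_linear_auto A (Sc \<psi>)"
 by (rule glaI[OF Sc_gadd Sc_gadd[of "\<lambda>n. inverse (\<psi> n)"]]) (use assms in \<open>simp_all add: Sc_smult Sc_Sc\<close>)

lemma twist_simps:
 "carrier (twist A \<theta>) = carrier A" "x \<oplus>\<^bsub>twist A \<theta>\<^esub> y = x \<oplus> y"
 "c \<odot>\<^bsub>twist A \<theta>\<^esub> x = c \<odot> x" "grade (twist A \<theta>) = grade A" "\<one>\<^bsub>twist A \<theta>\<^esub> = inv_into (carrier A) (\<theta> 0) \<one>"
 "x \<otimes>\<^bsub>twist A \<theta>\<^esub> y = finsum A (\<lambda>m. components A x m \<otimes> \<theta> (int m) y) (supp x)"
 by (simp_all add: twist_def supp_def)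

text \<open>Products in a twist are sums over the components of the left factor, so multiplicativity
  reduces to homogeneous factors. The unit needs its own hypothesis because
  \<open>\<theta> 0\<close> may differ from the identity.\<close>

lemma twist_iso:
 assumes P: "graded_linear_auto A \<Psi>" and t: "\<And>n. graded_linear_auto A (\<theta> n)" "\<And>n. graded_linear_auto A (\<theta>' n)"
  and h: "\<And>m l a b. a \<in> grade A m \<Longrightarrow> b \<in> grade A l \<Longrightarrow> \<Psi> (a \<otimes> \<theta> (int m) b) = \<Psi> a \<otimes> \<theta>' (int m) (\<Psi> b)"
  and one: "\<Psi> (inv_into (carrier A) (\<theta> 0) \<one>) = inv_into (carrier A) (\<theta>' 0) \<one>"
 shows "gralg_iso (twist A \<theta>) (twist A \<theta>') \<Psi>"
proof -
 note P' = gaddD[OF glaD(1)[OF P]] and t' = gaddD[OF glaD(1)[OF t(1)]] gaddD[OF glaD(1)[OF t(2)]]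
 have h': "\<Psi> (a \<otimes> \<theta> (int m) b) = \<Psi> a \<otimes> \<theta>' (int m) (\<Psi> b)" if a: "a \<in> grade A m" and b: "b \<in> carrier A" for a b m
  using b
 proof (induction rule: hom_induct)
  case (homogeneous l b)
  then show ?case using h[OF a] by blast
 next
  case (add x y)
  then show ?case using gr_carrier[OF a] by (simp add: P' t' r_distr)
 qed
 have "\<Psi> (x \<otimes>\<^bsub>twist A \<theta>\<^esub> y) = \<Psi> x \<otimes>\<^bsub>twist A \<theta>'\<^esub> \<Psi> y" if x: "x \<in> carrier A" and y: "y \<in> carrier A" for x y
 proof -
  have c: "components A x m \<otimes> \<theta> (int m) y \<in> carrier A" for m using comp_carrier[OF x] t'(1) y by simp
  have s: "supp (\<Psi> x) = supp x"
  proof -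
   have "\<Psi> (components A x i) = \<zero> \<longleftrightarrow> components A x i = \<zero>" for i
    using inj_onD[OF glaD(2)[OF P], of "components A x i" \<zero>] comp_carrier[OF x] P'(4) by auto
   then show ?thesis by (simp add: supp_def gadd_comp[OF glaD(1)[OF P] x])
  qed
  have "\<Psi> (x \<otimes>\<^bsub>twist A \<theta>\<^esub> y) = finsum A (\<lambda>m. \<Psi> (components A x m \<otimes> \<theta> (int m) y)) (supp x)"
   unfolding twist_simps by (rule gadd_finsum[OF glaD(1)[OF P] comp_props(2)[OF x] c])
  also have "\<dots> = finsum A (\<lambda>m. components A (\<Psi> x) m \<otimes> \<theta>' (int m) (\<Psi> y)) (supp (\<Psi> x))"
   using h'[OF comp_props(1)[OF x] y] by (simp add: s gadd_comp[OF glaD(1)[OF P] x])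
  finally show ?thesis unfolding twist_simps .
 qed
 moreover have "x \<otimes>\<^bsub>twist A \<theta>\<^esub> y \<in> carrier A" if "x \<in> carrier A" "y \<in> carrier A" for x y
  unfolding twist_simps using that comp_carrier t'(1) by (intro finsum_closed) auto
 ultimately show ?thesis
  unfolding gralg_iso_def ring_iso_def ring_hom_def
  using P one by (auto simp: twist_simps P' glaD[OF P] graded_linear_auto_def)
qed

end

lemma gralg_iso_trans:
 assumes "gralg_iso A B f" "gralg_iso B C g"
 shows "gralg_iso A C (g \<circ> f)"
 unfolding gralg_iso_def
proof (intro conjI allI ballI)
 have f: "f \<in> ring_iso A B" and g: "g \<in> ring_iso B C" using assms by (simp_all add: gralg_iso_def)
 show "g \<circ> f \<in> ring_iso A C" by (rule ring_iso_set_trans[OF f g])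
 fix c x assume x: "x \<in> carrier A"
 have "f x \<in> carrier B" using f x by (auto simp: ring_iso_def ring_hom_def)
 then show "(g \<circ> f) (c \<odot>\<^bsub>A\<^esub> x) = c \<odot>\<^bsub>C\<^esub> (g \<circ> f) x" using assms x by (simp add: gralg_iso_def)
next
 fix n show "(g \<circ> f) ` grade A n = grade C n" using assms by (simp add: gralg_iso_def flip: image_image image_comp)
qed

lemma iso_class_eqI:
 assumes "gralg_iso A B f" "gralg_iso B A g"
 shows "iso_class A = iso_class B"
 unfolding iso_class_def using gralg_iso_trans[OF assms(1)] gralg_iso_trans[OF assms(2)] by blast

context gr_alg
begin

definition ghom :: "('a \<Rightarrow> 'a) \<Rightarrow> bool" where
 "ghom f \<longleftrightarrow> graded_linear_auto A f \<and> (\<forall>m n. \<forall>a\<in>grade A m. \<forall>b\<in>grade A n. f (a \<otimes> b) = f a \<otimes> f b)"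

text \<open>An algebraic twisting system is indexed by all integers. Inside this subgroup of
  \<open>BijGroup\<close> the negative powers of an automorphism, and the rule for adding exponents,
  are available at once.\<close>

lemma ghom_subgroup: "subgroup {f \<in> Bij (carrier A). ghom f} (BijGroup (carrier A))"
proof -
 let ?B = "BijGroup (carrier A)"
 interpret B: group ?B by (rule group_BijGroup)
 have gl_cong: "graded_linear_auto A g" if "graded_linear_auto A f" "\<And>x. x \<in> carrier A \<Longrightarrow> g x = f x" for f g
 proof -
  have "g ` grade A n = f ` grade A n" for n using that(2) gr_carrier by (intro image_cong) auto
  moreover have "bij_betw g (carrier A) (carrier A) = bij_betw f (carrier A) (carrier A)"
   by (rule bij_betw_cong) (rule that)
  ultimately show ?thesis using that by (simp add: graded_linear_auto_def)
 qed
 show ?thesis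
 proof (rule B.subgroupI)
  show "{f \<in> Bij (carrier A). ghom f} \<subseteq> carrier ?B" by (auto simp: BijGroup_simps)
  have "graded_linear_auto A (\<lambda>x\<in>carrier A. x)"
   by (rule gl_cong[of "\<lambda>x. x"]) (auto simp: graded_linear_auto_def bij_betw_def)
  then have "ghom (\<lambda>x\<in>carrier A. x)" by (auto simp: ghom_def gr_carrier)
  then show "{f \<in> Bij (carrier A). ghom f} \<noteq> {}" using id_Bij by blast
  fix f assume f: "f \<in> {f \<in> Bij (carrier A). ghom f}"
  then have fB: "f \<in> Bij (carrier A)" and gl: "graded_linear_auto A f"
   and mult: "\<And>m n a b. a \<in> grade A m \<Longrightarrow> b \<in> grade A n \<Longrightarrow> f (a \<otimes> b) = f a \<otimes> f b" by (auto simp: ghom_def)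
  note F = glaD[OF gl] gaddD[OF glaD(1)[OF gl]]
  define h where "h = inv\<^bsub>?B\<^esub> f"
  have hB: "h \<in> Bij (carrier A)" using fB B.inv_closed by (simp add: h_def BijGroup_simps)
  have heq: "h x = inv_into (carrier A) f x" if "x \<in> carrier A" for x
   using fB that by (simp add: h_def inv_BijGroup)
  have hc: "h x \<in> carrier A" if "x \<in> carrier A" for x using Bij_mem[OF hB that] .
  have fh: "f (h x) = x" if "x \<in> carrier A" for x using that F(3) by (simp add: heq f_inv_into_f)
  have hf: "h (f x) = x" if "x \<in> carrier A" for x using that F(2,6) by (simp add: heq inv_into_f_f)
  have inj: "x = y" if "f x = f y" "x \<in> carrier A" "y \<in> carrier A" for x y using F(2) that by (rule inj_onD)
  have hg: "h x \<in> grade A n" if x: "x \<in> grade A n" for x n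
  proof -
   obtain y where "y \<in> grade A n" "x = f y" using F(4)[of n] x by blast
   then show ?thesis using hf gr_carrier by simp
  qed
  have hadd: "h (x \<oplus> y) = h x \<oplus> h y" if "x \<in> carrier A" "y \<in> carrier A" for x y
   by (rule inj) (use that in \<open>simp_all add: hc fh F(7)\<close>)
  have hsm: "h (c \<odot> x) = c \<odot> h x" if "x \<in> carrier A" for c x
   by (rule inj) (use that in \<open>simp_all add: hc fh F(5)\<close>)
  have "gadd h" unfolding gadd_def using hc hadd hg by blast
  then have "graded_linear_auto A h" using hsm hf fh by (rule glaI[OF _ F(1)])
  moreover have "h (a \<otimes> b) = h a \<otimes> h b" if ab: "a \<in> grade A m" "b \<in> grade A n" for a b m n
   by (rule inj) (use mult[OF hg[OF ab(1)] hg[OF ab(2)]] ab[THEN gr_carrier] in \<open>simp_all add: hc fh\<close>)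
  ultimately show "inv\<^bsub>?B\<^esub> f \<in> {f \<in> Bij (carrier A). ghom f}" using hB by (auto simp: ghom_def h_def)
  fix g assume g: "g \<in> {f \<in> Bij (carrier A). ghom f}"
  then have gB: "g \<in> Bij (carrier A)" and gl': "graded_linear_auto A g"
   and mult': "\<And>m n a b. a \<in> grade A m \<Longrightarrow> b \<in> grade A n \<Longrightarrow> g (a \<otimes> b) = g a \<otimes> g b" by (auto simp: ghom_def)
  note G = glaD[OF gl'] gaddD[OF glaD(1)[OF gl']]
  have fg: "(f \<otimes>\<^bsub>?B\<^esub> g) x = f (g x)" if "x \<in> carrier A" for x
   using fB gB that by (simp add: BijGroup_simps compose_eq)
  have "graded_linear_auto A (\<lambda>x. f (g x))"
   using F(1-5) G(1-6) unfolding graded_linear_auto_def bij_betw_def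
   by (simp add: image_image[symmetric] inj_on_def F(7) G(7))
  then have "graded_linear_auto A (f \<otimes>\<^bsub>?B\<^esub> g)" by (rule gl_cong) (rule fg)
  moreover have "(f \<otimes>\<^bsub>?B\<^esub> g) (a \<otimes> b) = (f \<otimes>\<^bsub>?B\<^esub> g) a \<otimes> (f \<otimes>\<^bsub>?B\<^esub> g) b"
   if ab: "a \<in> grade A m" "b \<in> grade A n" for a b m n
   using ab[THEN gr_carrier] mult'[OF ab] mult[OF G(8)[OF ab(1)] G(8)[OF ab(2)]] by (simp add: fg)
  moreover have "f \<otimes>\<^bsub>?B\<^esub> g \<in> Bij (carrier A)" using B.m_closed fB gB by (simp add: BijGroup_simps)
  ultimately show "f \<otimes>\<^bsub>?B\<^esub> g \<in> {f \<in> Bij (carrier A). ghom f}" by (auto simp: ghom_def)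
 qed
qed

end

context gr_alg
begin

lemma gla_compose:
 assumes f: "graded_linear_auto A f" and g: "graded_linear_auto A g"
 shows "graded_linear_auto A (\<lambda>x. f (g x))"
proof -
 have "bij_betw (\<lambda>x. f (g x)) (carrier A) (carrier A)"
  using bij_betw_trans[of g "carrier A" "carrier A" f "carrier A"] f g
  by (simp add: graded_linear_auto_def comp_def)
 moreover have "(\<lambda>x. f (g x)) ` grade A n = grade A n" for n
  using glaD(4)[OF f, of n] glaD(4)[OF g, of n] image_image[of f g "grade A n"] by simp
 moreover have "f (g (c \<odot> x)) = c \<odot> f (g x)" if "x \<in> carrier A" for c x
  using glaD(5)[OF g that] glaD(5)[OF f gaddD(1)[OF glaD(1)[OF g] that]] by simp
 moreover have "f (g (x \<oplus> y)) = f (g x) \<oplus> f (g y)" if "x \<in> carrier A" "y \<in> carrier A" for x y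
  using gaddD(2)[OF gadd_compose[OF glaD(1)[OF f] glaD(1)[OF g]] that] .
 ultimately show ?thesis unfolding graded_linear_auto_def by (intro conjI ballI allI)
qed

text \<open>In degree one \<open>\<theta> n\<close> is a multiple of a power of
  \<open>\<theta> 1\<close>, and the algebra is generated there. Dividing \<open>\<theta> 1\<close>
  in degree \<open>m\<close> by \<open>e m\<close> gives an algebra automorphism \<phi> with
  \<open>\<theta> n = d n m \<phi>^n\<close> in degree \<open>m\<close>. Up to the constant
  \<open>u\<close> the function \<open>d\<close> is a coboundary, so a degreewise scaling identifies
  the twist with the one by the powers of \<phi>. The three summands in \<open>gen\<close> reflect
  the three generators.\<close>

lemma twist_algebraic:
 fixes c :: "nat \<Rightarrow> 'k"
 assumes tw: "twisting_system A \<theta>"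
  and deg0: "\<And>x. x \<in> grade A 0 \<Longrightarrow> \<exists>k. x = k \<odot> \<one>"
  and gen: "\<And>n x. x \<in> grade A (Suc n) \<Longrightarrow> \<exists>a1\<in>grade A 1. \<exists>a2\<in>grade A 1. \<exists>a3\<in>grade A 1.
   \<exists>b1\<in>grade A n. \<exists>b2\<in>grade A n. \<exists>b3\<in>grade A n. x = a1 \<otimes> b1 \<oplus> (a2 \<otimes> b2 \<oplus> a3 \<otimes> b3)"
  and c: "\<And>n. c n \<noteq> 0" "c 1 = 1" "\<And>n x. n \<ge> 1 \<Longrightarrow> x \<in> grade A 1 \<Longrightarrow> \<theta> (int n) x = c n \<odot> ((\<theta> 1) ^^ n) x"
 shows "\<exists>\<theta>'. twisting_system A \<theta>' \<and> algebraic A \<theta>' \<and> (\<forall>x\<in>carrier A. \<theta>' 0 x = x) \<and>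
  iso_class (twist A \<theta>) = iso_class (twist A \<theta>')"
proof -
 have t: "graded_linear_auto A (\<theta> n)" for n using tw by (simp add: twisting_system_def)
 note G = glaD[OF t] gaddD[OF glaD(1)[OF t]]
 have tm: "\<theta> n (a \<otimes> \<theta> (int m) b) = \<theta> n a \<otimes> \<theta> (n + int m) b" if "a \<in> grade A m" "b \<in> grade A l" for n m l a b
  using tw that unfolding twisting_system_def by blast
 have u_ex: "\<exists>u. \<theta> n \<one> = u \<odot> \<one>" for n using deg0[of "\<theta> n \<one>"] G(8)[OF gr_one] by blast
 obtain u0 where u0: "\<theta> 0 \<one> = u0 \<odot> \<one>" using u_ex by blast
 have theta0: "\<theta> 0 b = u \<odot> b" if u: "\<theta> n \<one> = u \<odot> \<one>" and b: "b \<in> grade A l" for n u b l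
 proof -
  have "\<theta> n (\<theta> 0 b) = (u \<odot> \<one>) \<otimes> \<theta> n b"
   using tm[OF gr_one b, of n] b G(6,8) gr_carrier by (simp add: u)
  also have "\<dots> = \<theta> n (u \<odot> b)" using G(5,6) b gr_carrier by (simp add: sm_left)
  finally show ?thesis using inj_onD[OF G(2)[of n]] b G(6) gr_carrier by simp
 qed
 \<comment> \<open>The defining identity with left factor 1 makes \<open>\<theta> 0\<close> a
   scalar. That scalar can vanish only in the zero algebra, where 1 serves as well.\<close>
 have "\<exists>u. u \<noteq> 0 \<and> (\<forall>l. \<forall>b\<in>grade A l. \<theta> 0 b = u \<odot> b)"
 proof (cases "u0 = 0")
  case False
  then show ?thesis using theta0[OF u0] by blast
 next
  case True
  have z: "x = \<zero>" if "x \<in> carrier A" for x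
  proof -
   have zz: "0 \<odot> y = \<zero>" if "y \<in> carrier A" for y
    using sm_distr[OF that, of 0 0] add.l_cancel[of "0 \<odot> y" "0 \<odot> y" \<zero>] that by simp
   have "\<one> = \<zero>" using inj_onD[OF G(2)[of 0], of \<one> \<zero>] u0 True G(9) zz by simp
   then show ?thesis using that by (metis l_one l_null)
  qed
  have "\<theta> 0 b = 1 \<odot> b" if "b \<in> grade A l" for b l using z[of "\<theta> 0 b"] z[of b] gr_carrier[OF that] G(6) by simp
  then show ?thesis by (intro exI[of _ 1]) simp
 qed
 then obtain u where u: "u \<noteq> 0" and u_th: "\<And>l b. b \<in> grade A l \<Longrightarrow> \<theta> 0 b = u \<odot> b" by blast
 have th1: "\<theta> n \<one> = u \<odot> \<one>" for n
 proof -
  obtain v where v: "\<theta> n \<one> = v \<odot> \<one>" using u_ex by blast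
  show ?thesis using theta0[OF v gr_one] u_th[OF gr_one] v by simp
 qed
 \<comment> \<open>The value \<open>u\<close> at 0 extends the formula
   \<open>\<theta> n = e n \<phi>^n\<close> in degree one to \<open>n = 0\<close>; it also makes
   \<open>C 1 = u\<close>, whence \<open>d 1 m = e m\<close>.\<close>
 define e where "e = (\<lambda>n. if n = 0 then u else c n)"
 have e0: "e n \<noteq> 0" for n using c(1) u by (simp add: e_def)
 have e1: "e 1 = 1" using c(2) by (simp add: e_def)
 define C where "C = (\<lambda>n. \<Prod>i<n. e i)"
 have C0: "C n \<noteq> 0" for n using e0 by (simp add: C_def)
 have CS: "C (Suc n) = C n*e n" and C00: "C 0 = 1" for n by (simp_all add: C_def mult.commute)
 define d where "d = (\<lambda>n m. u * C (n + m) / (C n * C m))"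
 have d0: "d n m \<noteq> 0" for n m using u C0 by (simp add: d_def)
 define \<phi> where "\<phi> = (\<lambda>x. \<theta> 1 (Sc (\<lambda>m. inverse (e m)) x))"
 have phi_gla: "graded_linear_auto A \<phi>"
 proof -
  have s: "graded_linear_auto A (Sc (\<lambda>m. inverse (e m)))" by (rule Sc_gla) (use e0 in simp)
  show ?thesis unfolding \<phi>_def by (rule gla_compose[OF t s])
 qed
 note P = glaD[OF phi_gla] gaddD[OF glaD(1)[OF phi_gla]]
 have phi_h: "\<phi> x = inverse (e m) \<odot> \<theta> 1 x" if "x \<in> grade A m" for x m
  using that G(5) gr_carrier by (simp add: \<phi>_def Sc_homogeneous[OF that])
 have th_phi: "\<theta> 1 x = e m \<odot> \<phi> x" if "x \<in> grade A m" for x m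
  using e0 G(6) gr_carrier[OF that] by (simp add: phi_h[OF that] sm_assoc)
 have pn: "gadd (\<phi> ^^ n)" "\<And>x k. x \<in> carrier A \<Longrightarrow> (\<phi> ^^ n) (k \<odot> x) = k \<odot> (\<phi> ^^ n) x" for n
 proof (induction n)
  case 0
  { case 1 show ?case by (simp add: gadd_def) }
  { case 2 then show ?case by simp }
 next
  case (Suc n)
  { case 1 show ?case using gadd_compose[OF P(1) Suc(1)] by (simp add: comp_def) }
  { case (2 x k) then show ?case using Suc(2) gaddD(1)[OF Suc(1)] P(5) by simp }
 qed
 note PN = gaddD[OF pn(1)]
 have c1: "\<theta> (int n) x = e n \<odot> (\<phi> ^^ n) x" if x: "x \<in> grade A 1" for n x
 proof (cases "n = 0")
  case True
  then show ?thesis using u_th[OF x] by (simp add: e_def)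
 next
  case False
  have "(\<phi> ^^ k) x = ((\<theta> 1) ^^ k) x \<and> ((\<theta> 1) ^^ k) x \<in> grade A 1" for k
  proof (induction k)
   case (Suc k)
   then have g: "((\<theta> 1) ^^ k) x \<in> grade A 1" by simp
   then have "\<theta> 1 (((\<theta> 1) ^^ k) x) = \<phi> (((\<theta> 1) ^^ k) x)"
    using th_phi[OF g] sm_one[OF P(6)[OF gr_carrier[OF g]]] by (simp add: e1 del: One_nat_def)
   then show ?case using Suc G(8)[OF g, of 1] by simp
  qed (use x in simp)
  then show ?thesis using c(3)[OF _ x, of n] False by (simp add: e_def)
 qed
 have phi1: "\<phi> \<one> = \<one>" using phi_h[OF gr_one] th1[of 1] u by (simp add: e_def sm_assoc)
 have phin1: "(\<phi> ^^ n) \<one> = \<one>" for n by (induction n) (simp_all add: phi1)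
 \<comment> \<open>Writing \<open>b = \<theta> 1 b'\<close> brings the product into the shape of the
   defining identity; the induction hypothesis at \<open>n + 1\<close> evaluates the right
   factor.\<close>
 have step: "\<theta> (int n) (a \<otimes> b) = (e n*d (Suc n) m / e m) \<odot> ((\<phi> ^^ n) a \<otimes> (\<phi> ^^ n) b)"
  if a: "a \<in> grade A 1" and b: "b \<in> grade A m" and IH: "\<And>n x. x \<in> grade A m \<Longrightarrow> \<theta> (int n) x = d n m \<odot> (\<phi> ^^ n) x"
  for a b m n
 proof -
  obtain b' where b': "b' \<in> grade A m" "b = \<theta> 1 b'" using b G(4)[of 1 m] by blast
  have pb: "(\<phi> ^^ n) b = e m \<odot> (\<phi> ^^ Suc n) b'"
   using b' th_phi[OF b'(1)] pn(2)[of "\<phi> b'" n "e m"] P(6) gr_carrier by (simp add: funpow_swap1)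
  then have "(\<phi> ^^ Suc n) b' = inverse (e m) \<odot> (\<phi> ^^ n) b"
   using e0[of m] PN(1)[of b' "Suc n"] b' gr_carrier by (simp add: sm_assoc del: funpow.simps)
  then have tb: "\<theta> (int (Suc n)) b' = (d (Suc n) m / e m) \<odot> (\<phi> ^^ n) b"
   using IH[OF b'(1), of "Suc n"] PN(1)[OF gr_carrier[OF b], of n] by (simp add: sm_assoc divide_inverse del: funpow.simps of_nat_Suc)
  have "\<theta> (int n) (a \<otimes> b) = \<theta> (int n) a \<otimes> \<theta> (int (Suc n)) b'"
   using tm[of a 1 b' m "int n"] a b' by (simp add: add.commute)
  also have "\<dots> = (e n \<odot> (\<phi> ^^ n) a) \<otimes> ((d (Suc n) m / e m) \<odot> (\<phi> ^^ n) b)"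
   by (simp only: tb c1[OF a])
  also have "\<dots> = (e n*(d (Suc n) m / e m)) \<odot> ((\<phi> ^^ n) a \<otimes> (\<phi> ^^ n) b)"
   using PN(1)[OF gr_carrier[OF a], of n] PN(1)[OF gr_carrier[OF b], of n] by (simp add: sm_left sm_right sm_assoc mult.commute)
  finally show ?thesis by simp
 qed
 have arith: "e n * d (Suc n) m / e m = d n (Suc m)" for n m
  using u C0 e0 by (simp add: d_def CS field_simps)
 have dS: "d 1 m = e m" for m
  using u C0 e0 by (simp add: d_def CS C00 e_def)
 have claim: "\<theta> (int n) x = d n m \<odot> (\<phi> ^^ n) x" if "x \<in> grade A m" for n m x
  using that
 proof (induction m arbitrary: n x)
  case 0
  obtain k where k: "x = k \<odot> \<one>" using deg0[OF 0] by blast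
  then show ?case using G(5)[of \<one> "int n" k] pn(2)[of \<one> n k] th1[of "int n"] phin1 C0 C00
   by (simp add: d_def sm_assoc mult.commute)
 next
  case (Suc m)
  have prod: "\<theta> (int n) (a \<otimes> b) = d n (Suc m) \<odot> (\<phi> ^^ n) (a \<otimes> b)" if a: "a \<in> grade A 1" and b: "b \<in> grade A m" for a b n
  proof -
   have ab: "\<phi> (x \<otimes> y) = \<phi> x \<otimes> \<phi> y" if x: "x \<in> grade A 1" and y: "y \<in> grade A m" for x y
   proof -
    have xy: "x \<otimes> y \<in> grade A (Suc m)" using gr_mult[OF x y] by simp
    have "\<phi> (x \<otimes> y) = inverse (e (Suc m)) \<odot> (d 1 (Suc m) \<odot> (\<phi> x \<otimes> \<phi> y))"
     using step[OF x y Suc.IH, of 1] by (simp add: phi_h[OF xy] arith del: of_nat_1)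
    then show ?thesis using e0 P(6)[OF gr_carrier[OF x]] P(6)[OF gr_carrier[OF y]] by (simp add: dS[unfolded One_nat_def] sm_assoc)
   qed
   have "(\<phi> ^^ k) (a \<otimes> b) = (\<phi> ^^ k) a \<otimes> (\<phi> ^^ k) b" for k
    by (induction k) (use ab[OF PN(3)[OF a] PN(3)[OF b]] in simp_all)
   then show ?thesis using step[OF a b Suc.IH, of n] by (simp only: arith)
  qed
  obtain a1 a2 a3 b1 b2 b3 where ab: "a1 \<in> grade A 1" "a2 \<in> grade A 1" "a3 \<in> grade A 1" "b1 \<in> grade A m" "b2 \<in> grade A m" "b3 \<in> grade A m"
   and x: "x = a1 \<otimes> b1 \<oplus> (a2 \<otimes> b2 \<oplus> a3 \<otimes> b3)" using gen[OF Suc.prems] by blast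
  note car = ab[THEN gr_carrier]
  show ?case unfolding x using car prod[OF ab(1,4)] prod[OF ab(2,5)] prod[OF ab(3,6)]
   by (simp add: G(7) PN(2) PN(1) sm_dist)
 qed
 have phi_mult1: "\<phi> (a \<otimes> b) = \<phi> a \<otimes> \<phi> b" if a: "a \<in> grade A 1" and b: "b \<in> grade A m" for a b m
 proof -
  have xy: "a \<otimes> b \<in> grade A (Suc m)" using gr_mult[OF a b] by simp
  have "\<phi> (a \<otimes> b) = inverse (e (Suc m)) \<odot> (d 1 (Suc m) \<odot> (\<phi> a \<otimes> \<phi> b))"
   using step[OF a b claim, of 1] by (simp add: phi_h[OF xy] arith del: of_nat_1)
  then show ?thesis using e0 P(6)[OF gr_carrier[OF a]] P(6)[OF gr_carrier[OF b]] by (simp add: dS[unfolded One_nat_def] sm_assoc)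
 qed
 have phi_mult: "\<phi> (a \<otimes> b) = \<phi> a \<otimes> \<phi> b" if "a \<in> grade A m" "b \<in> grade A l" for a b m l
  using that
 proof (induction m arbitrary: a b l)
  case 0
  obtain k where k: "a = k \<odot> \<one>" using deg0[OF 0(1)] by blast
  then show ?case using 0(2) gr_carrier P(5,6) phi1 by (simp add: sm_left)
 next
  case (Suc m)
  obtain a1 a2 a3 b1 b2 b3 where ab: "a1 \<in> grade A 1" "a2 \<in> grade A 1" "a3 \<in> grade A 1" "b1 \<in> grade A m" "b2 \<in> grade A m" "b3 \<in> grade A m"
   and x: "a = a1 \<otimes> b1 \<oplus> (a2 \<otimes> b2 \<oplus> a3 \<otimes> b3)" using gen[OF Suc.prems(1)] by blast
  note car = ab[THEN gr_carrier] gr_carrier[OF Suc.prems(2)]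
  have one: "\<phi> ((x \<otimes> y) \<otimes> b) = \<phi> (x \<otimes> y) \<otimes> \<phi> b" if "x \<in> grade A 1" "y \<in> grade A m" for x y
   using phi_mult1[OF that(1) gr_mult[OF that(2) Suc.prems(2)]] Suc.IH[OF that(2) Suc.prems(2)] phi_mult1[OF that]
    that[THEN gr_carrier] car(7) P(6) by (simp add: m_assoc)
  show ?case unfolding x using car one[OF ab(1,4)] one[OF ab(2,5)] one[OF ab(3,6)]
   by (simp add: l_distr P(7) P(6))
 qed
 let ?B = "BijGroup (carrier A)"
 interpret B: group ?B by (rule group_BijGroup)
 define \<rho> where "\<rho> = restrict \<phi> (carrier A)"
 have rB: "\<rho> \<in> Bij (carrier A)" using P(2,3) by (auto simp: \<rho>_def Bij_def bij_betw_def inj_on_def)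
 have "\<rho> ` grade A n = grade A n" for n
  using P(4)[of n] gr_carrier by (auto simp: \<rho>_def cong: image_cong)
 then have "graded_linear_auto A \<rho>"
  using rB P(5-7) by (simp add: graded_linear_auto_def Bij_def \<rho>_def)
 then have "ghom \<rho>"
  unfolding ghom_def using phi_mult gr_carrier by (simp add: \<rho>_def)
 then have rH: "\<rho> \<in> {f \<in> Bij (carrier A). ghom f}" using rB by simp
 define \<theta>' where "\<theta>' = (\<lambda>n::int. \<rho> [^]\<^bsub>?B\<^esub> n)"
 have t'H: "\<theta>' n \<in> Bij (carrier A)" "ghom (\<theta>' n)" for n
  using B.int_pow_in_subgroup[OF ghom_subgroup rH, of n] by (simp_all add: \<theta>'_def)
 then have t': "graded_linear_auto A (\<theta>' n)" for n by (simp add: ghom_def)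
 have t'm: "\<theta>' n (a \<otimes> b) = \<theta>' n a \<otimes> \<theta>' n b" if "a \<in> grade A m" "b \<in> grade A l" for a b m l n
  using t'H(2)[of n] that unfolding ghom_def by blast
 have t'add: "\<theta>' (m + n) x = \<theta>' m (\<theta>' n x)" if "x \<in> carrier A" for m n x
  using B.int_pow_mult[of \<rho> m n] rB t'H(1) that by (simp add: \<theta>'_def BijGroup_simps compose_eq)
 have t'0: "\<theta>' 0 x = x" if "x \<in> carrier A" for x using that by (simp add: \<theta>'_def BijGroup_simps)
 have t'n: "\<theta>' (int n) x = (\<phi> ^^ n) x" if "x \<in> carrier A" for n x
 proof -
  have "(\<rho> ^^ n) x = (\<phi> ^^ n) x \<and> (\<phi> ^^ n) x \<in> carrier A" by (induction n) (use that P(6) in \<open>auto simp: \<rho>_def\<close>)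
  then show ?thesis using Bij_nat_pow(2)[OF rB that, of n] by (simp add: \<theta>'_def int_pow_int)
 qed
 have tw': "twisting_system A \<theta>'"
  unfolding twisting_system_def
 proof (intro conjI allI ballI t')
  fix n m l a b assume ab: "a \<in> grade A m" "b \<in> grade A l"
  have "\<theta>' (int m) b \<in> grade A l" using gaddD(3)[OF glaD(1)[OF t'] ab(2)] .
  then show "\<theta>' n (a \<otimes> \<theta>' (int m) b) = \<theta>' n a \<otimes> \<theta>' (n + int m) b"
   using t'm[OF ab(1)] t'add[OF gr_carrier[OF ab(2)]] by simp
 qed
 \<comment> \<open>Solves \<open>\<psi> (m + l) * d m l = \<psi> m * \<psi> l\<close>; its value
   \<open>u\<close> at 0 carries the unit \<open>inverse u\<close> of the first twist to 1.\<close>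
 define \<psi> where "\<psi> = (\<lambda>m. u / C m)"
 have psi0: "\<psi> m \<noteq> 0" for m using u C0 by (simp add: \<psi>_def)
 have psi: "\<psi> (m + l)*d m l = \<psi> m*\<psi> l" for m l using C0 by (simp add: \<psi>_def d_def field_simps)
 have ab_carrier: "a \<otimes> (\<phi> ^^ m) b \<in> carrier A" "a \<otimes> (\<phi> ^^ m) b \<in> grade A (m + l)" if "a \<in> grade A m" "b \<in> grade A l" for a b m l
  using gr_mult[OF that(1) PN(3)[OF that(2)]] gr_carrier by auto
 have "gralg_iso (twist A \<theta>) (twist A \<theta>') (Sc \<psi>)"
 proof (rule twist_iso[OF Sc_gla t t'])
  fix a b m l assume ab: "a \<in> grade A m" "b \<in> grade A l"
  note car = ab[THEN gr_carrier] PN(1)[OF gr_carrier[OF ab(2)], of m]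
  have "Sc \<psi> (a \<otimes> \<theta> (int m) b) = d m l \<odot> (\<psi> (m + l) \<odot> (a \<otimes> (\<phi> ^^ m) b))"
   using car ab_carrier[OF ab] Sc_homogeneous[OF ab_carrier(2)[OF ab]] by (simp add: claim[OF ab(2)] sm_right Sc_smult)
  also have "\<dots> = (\<psi> m*\<psi> l) \<odot> (a \<otimes> (\<phi> ^^ m) b)" using ab_carrier[OF ab] by (simp add: sm_assoc psi[symmetric] mult.commute[of "d m l"])
  also have "\<dots> = Sc \<psi> a \<otimes> \<theta>' (int m) (Sc \<psi> b)"
   using car Sc_homogeneous[OF ab(1)] Sc_homogeneous[OF ab(2)] t'n pn(2)[OF car(2)]
   by (simp add: sm_left sm_right sm_assoc mult.commute)
  finally show "Sc \<psi> (a \<otimes> \<theta> (int m) b) = Sc \<psi> a \<otimes> \<theta>' (int m) (Sc \<psi> b)" .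
 next
  have i: "inv_into (carrier A) (\<theta> 0) \<one> = inverse u \<odot> \<one>"
   using u_th[OF gr_sm[OF gr_one], of "inverse u"] u G(2)[of 0] by (intro inv_into_f_eq) (simp_all add: sm_assoc)
  have "inv_into (carrier A) (\<theta>' 0) \<one> = \<one>"
   by (rule inv_into_f_eq[OF glaD(2)[OF t']]) (simp_all add: t'0)
  then show "Sc \<psi> (inv_into (carrier A) (\<theta> 0) \<one>) = inv_into (carrier A) (\<theta>' 0) \<one>"
   using Sc_homogeneous[OF gr_sm[OF gr_one]] u by (simp add: i sm_assoc \<psi>_def C00)
 qed (rule psi0)
 moreover have "gralg_iso (twist A \<theta>') (twist A \<theta>) (Sc (\<lambda>m. inverse (\<psi> m)))"
 proof (rule twist_iso[OF Sc_gla t' t])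
  fix a b m l assume ab: "a \<in> grade A m" "b \<in> grade A l"
  note car = ab[THEN gr_carrier] PN(1)[OF gr_carrier[OF ab(2)], of m]
  let ?S = "Sc (\<lambda>m. inverse (\<psi> m))"
  have "?S (a \<otimes> \<theta>' (int m) b) = inverse (\<psi> (m + l)) \<odot> (a \<otimes> (\<phi> ^^ m) b)"
   using car Sc_homogeneous[OF ab_carrier(2)[OF ab]] by (simp add: t'n)
  also have "inverse (\<psi> (m + l)) = inverse (\<psi> m) * inverse (\<psi> l) * d m l"
   using psi[of m l] psi0 by (simp add: field_simps)
  also have "\<dots> \<odot> (a \<otimes> (\<phi> ^^ m) b) = ?S a \<otimes> \<theta> (int m) (?S b)"
   using car Sc_homogeneous[OF ab(1)] Sc_homogeneous[OF ab(2)] G(5)[OF car(2)]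
   by (simp add: claim[OF ab(2)] sm_left sm_right sm_assoc ac_simps)
  finally show "?S (a \<otimes> \<theta>' (int m) b) = ?S a \<otimes> \<theta> (int m) (?S b)" .
 next
  have i: "inv_into (carrier A) (\<theta> 0) \<one> = inverse u \<odot> \<one>"
   using u_th[OF gr_sm[OF gr_one], of "inverse u"] u G(2)[of 0] by (intro inv_into_f_eq) (simp_all add: sm_assoc)
  have "inv_into (carrier A) (\<theta>' 0) \<one> = \<one>"
   by (rule inv_into_f_eq[OF glaD(2)[OF t']]) (simp_all add: t'0)
  then show "Sc (\<lambda>m. inverse (\<psi> m)) (inv_into (carrier A) (\<theta>' 0) \<one>) = inv_into (carrier A) (\<theta> 0) \<one>"
   using Sc_homogeneous[OF gr_one] by (simp add: i \<psi>_def C00 inverse_eq_divide)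
 qed (use psi0 in simp)
 ultimately have "iso_class (twist A \<theta>) = iso_class (twist A \<theta>')" by (rule iso_class_eqI)
 moreover have "algebraic A \<theta>'" unfolding algebraic_def using t'add by blast
 ultimately show ?thesis using tw' t'0 by blast
qed

end

section \<open>The algebra of a pair\<close>

lemma free_ring_simps [simp]:
 "carrier free_ring = (UNIV :: 'k::field free3 set)"
 "x \<otimes>\<^bsub>free_ring\<^esub> y = x*(y :: 'k free3)" "x \<oplus>\<^bsub>free_ring\<^esub> y = x + (y :: 'k free3)"
 "\<one>\<^bsub>free_ring\<^esub> = (1 :: 'k free3)" "\<zero>\<^bsub>free_ring\<^esub> = (0 :: 'k free3)"
 by (simp_all add: free_ring_def)

lemma ring_free_ring: "ring (free_ring :: 'k::field free3 ring)"
proof (rule ringI)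
 show "abelian_group (free_ring :: 'k free3 ring)"
 proof (rule abelian_groupI)
  fix x :: "'k free3"
  show "\<exists>y\<in>carrier free_ring. y \<oplus>\<^bsub>free_ring\<^esub> x = \<zero>\<^bsub>free_ring\<^esub>"
   by (rule bexI[of _ "- x"]) simp_all
 qed (simp_all add: add.assoc add.commute)
 show "Group.monoid (free_ring :: 'k free3 ring)"
  by (rule monoidI) (simp_all add: mult.assoc)
qed (simp_all add: distrib_left distrib_right)

text \<open>The homogeneous part of degree \<open>n\<close>, word length being the degree.\<close>

definition hp :: "nat \<Rightarrow> ('k::field) free3 \<Rightarrow> 'k free3" where
 "hp n f = (\<Sum>w | w \<in> Poly_Mapping.keys f \<and> length w = n. Poly_Mapping.single w (Poly_Mapping.lookup f w))"

lemma lookup_hp: "Poly_Mapping.lookup (hp n f) w = (if length w = n then Poly_Mapping.lookup f w else 0)"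
proof -
 have "Poly_Mapping.lookup (hp n f) w =
  (\<Sum>v | v \<in> Poly_Mapping.keys f \<and> length v = n. if v = w then Poly_Mapping.lookup f w else 0)"
  unfolding hp_def lookup_sum by (intro sum.cong refl) (auto simp: lookup_single when_def)
 then show ?thesis by (simp add: in_keys_iff)
qed

lemma hp_zero [simp]: "hp n 0 = 0"
 and hp_add: "hp n (f + g) = hp n f + hp n g"
 and hp_diff: "hp n (f - g) = hp n f - hp n g"
 by (auto intro!: poly_mapping_eqI simp: lookup_hp lookup_add lookup_minus)

lemma hp_sum: "hp n (\<Sum>x\<in>S. f x) = (\<Sum>x\<in>S. hp n (f x))"
 by (induction S rule: infinite_finite_induct) (simp_all add: hp_add)

lemma free_grade_iff: "f \<in> free_grade n \<longleftrightarrow> (\<forall>w. length w \<noteq> n \<longrightarrow> Poly_Mapping.lookup f w = 0)"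
 by (auto simp: free_grade_def in_keys_iff)

lemma hp_free_grade: "hp n f \<in> free_grade n"
 by (simp add: free_grade_iff lookup_hp)

lemma hp_homogeneous: "f \<in> free_grade m \<Longrightarrow> hp n f = (if n = m then f else 0)"
 by (rule poly_mapping_eqI) (auto simp: lookup_hp free_grade_iff)

lemma hp_single: "hp n (Poly_Mapping.single w c) = (if length w = n then Poly_Mapping.single w c else 0)"
 by (rule poly_mapping_eqI) (auto simp: lookup_hp lookup_single when_def)

lemma free_sum_single: "(f :: 'k::field free3) = (\<Sum>w\<in>Poly_Mapping.keys f. Poly_Mapping.single w (Poly_Mapping.lookup f w))"
proof (rule poly_mapping_eqI)
 fix v
 have "(\<Sum>w\<in>Poly_Mapping.keys f. Poly_Mapping.lookup (Poly_Mapping.single w (Poly_Mapping.lookup f w)) v) =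
  (\<Sum>w\<in>Poly_Mapping.keys f. if w = v then Poly_Mapping.lookup f v else 0)"
  by (intro sum.cong refl) (auto simp: lookup_single when_def)
 then show "Poly_Mapping.lookup f v = Poly_Mapping.lookup (\<Sum>w\<in>Poly_Mapping.keys f. Poly_Mapping.single w (Poly_Mapping.lookup f w)) v"
  unfolding lookup_sum by (simp add: in_keys_iff)
qed

lemma free_induct [case_names single add]:
 fixes f :: "('k::field) free3"
 assumes single: "\<And>w c. P (Poly_Mapping.single w c)" and add: "\<And>f g. P f \<Longrightarrow> P g \<Longrightarrow> P (f + g)"
 shows "P f"
proof -
 have P0: "P 0" using single[of "[]" 0] by simp
 have "P (\<Sum>w\<in>S. Poly_Mapping.single w (Poly_Mapping.lookup f w))" if "finite S" for S
  using that by (induction S) (auto intro: P0 single add)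
 from this[of "Poly_Mapping.keys f"] show ?thesis using free_sum_single[of f] by simp
qed

lemma mult_single_free: "Poly_Mapping.single v a*Poly_Mapping.single w b = (Poly_Mapping.single (v @ w) (a*b) :: 'k::field free3)"
 by (simp add: mult_single plus_list_def)

lemma hp_mult: "hp n (f * g) = (\<Sum>i\<le>n. hp i f * hp (n - i) g)"
proof (induction f rule: free_induct)
 case (single v a)
 show ?case
 proof (induction g rule: free_induct)
  case (single w b)
  have "(\<Sum>i\<le>n. hp i (Poly_Mapping.single v a)*hp (n - i) (Poly_Mapping.single w b)) =
   (\<Sum>i\<le>n. if i = length v then Poly_Mapping.single v a*hp (n - length v) (Poly_Mapping.single w b) else 0)"
   by (intro sum.cong refl) (auto simp: hp_single)
  also have "\<dots> = hp n (Poly_Mapping.single v a * Poly_Mapping.single w b)"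
   by (auto simp: mult_single_free hp_single)
  finally show ?case by simp
 qed (simp add: hp_add distrib_left sum.distrib)
qed (simp add: hp_add distrib_right sum.distrib)

lemma hp_decomposition:
 obtains N where "\<And>n. n \<ge> N \<Longrightarrow> hp n f = 0" "f = (\<Sum>n<N. hp n f)"
proof -
 obtain N where N: "\<forall>k\<in>length ` Poly_Mapping.keys f. k < N"
  using finite_nat_set_iff_bounded[of "length ` Poly_Mapping.keys f"] by auto
 have z: "Poly_Mapping.lookup f w = 0" if "length w \<ge> N" for w
  using N that by (force simp: in_keys_iff)
 show thesis
 proof (rule that[of N])
  show "hp n f = 0" if "n \<ge> N" for n by (rule poly_mapping_eqI) (use z that in \<open>simp add: lookup_hp\<close>)
  show "f = (\<Sum>n<N. hp n f)"
  proof (rule poly_mapping_eqI)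
   fix w
   have "(\<Sum>n<N. Poly_Mapping.lookup (hp n f) w) = (\<Sum>n<N. if n = length w then Poly_Mapping.lookup f w else 0)"
    by (intro sum.cong refl) (auto simp: lookup_hp)
   then show "Poly_Mapping.lookup f w = Poly_Mapping.lookup (\<Sum>n<N. hp n f) w"
    unfolding lookup_sum using z[of w] by auto
  qed
 qed
qed

lemma lookup_scalar: "Poly_Mapping.lookup (Poly_Mapping.single [] c*f) w = c*Poly_Mapping.lookup (f :: 'k::field free3) w"
 by (induction f rule: free_induct)
  (simp_all add: mult_single_free lookup_single when_def lookup_add distrib_left)

lemma scalar_central: "f*Poly_Mapping.single [] c = Poly_Mapping.single [] c*(f :: 'k::field free3)"
 by (induction f rule: free_induct) (simp_all add: mult_single_free mult.commute distrib_left distrib_right)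

lemma scalar_free_grade: "f \<in> free_grade n \<Longrightarrow> Poly_Mapping.single [] c*f \<in> free_grade n"
 by (simp add: free_grade_iff lookup_scalar)

lemma add_free_grade: "f \<in> free_grade n \<Longrightarrow> g \<in> free_grade n \<Longrightarrow> f + g \<in> free_grade n"
 by (simp add: free_grade_iff lookup_add)

lemma minus_free_grade: "f \<in> free_grade n \<Longrightarrow> - f \<in> free_grade n"
 by (simp add: free_grade_iff)

lemma single_free_grade: "length w = n \<Longrightarrow> Poly_Mapping.single w c \<in> free_grade n"
 by (auto simp: free_grade_iff lookup_single when_def)

lemma zero_free_grade: "0 \<in> free_grade n"
 by (simp add: free_grade_iff)

lemma sum_free_grade: "(\<And>x. x \<in> S \<Longrightarrow> f x \<in> free_grade n) \<Longrightarrow> (\<Sum>x\<in>S. f x) \<in> free_grade n"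
 by (induction S rule: infinite_finite_induct) (simp_all add: zero_free_grade add_free_grade)

lemma mult_free_grade:
 assumes "f \<in> free_grade m" "g \<in> free_grade n" shows "f * g \<in> free_grade (m + n)"
proof -
 have "f * g = (\<Sum>v\<in>Poly_Mapping.keys f. \<Sum>w\<in>Poly_Mapping.keys g.
   Poly_Mapping.single (v @ w) (Poly_Mapping.lookup f v * Poly_Mapping.lookup g w))"
  by (subst free_sum_single[of f], subst free_sum_single[of g]) (simp add: sum_product mult_single_free)
 also have "\<dots> \<in> free_grade (m + n)"
  using assms by (intro sum_free_grade single_free_grade) (auto simp: free_grade_def)
 finally show ?thesis .
qed

lemma scalar_one: "Poly_Mapping.single [] 1 = (1 :: 'k::field free3)"
 using single_one[where 'a = "3 list" and 'b = 'k] by (simp add: zero_list_def)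

lemma free_grade_0: "f \<in> free_grade 0 \<Longrightarrow> f = Poly_Mapping.single [] (Poly_Mapping.lookup f [])"
 by (rule poly_mapping_eqI) (auto simp: free_grade_iff lookup_single when_def)

text \<open>Words are sorted by their first letter; this is what makes degree one generate the
  algebra.\<close>

lemma free_grade_Suc:
 assumes f: "(f :: 'k::field free3) \<in> free_grade (Suc n)"
 obtains h where "\<And>i. h i \<in> free_grade n" "f = (\<Sum>i\<in>UNIV. Poly_Mapping.single [i] 1*h i)"
proof -
 define h where "h = (\<lambda>i. \<Sum>w | w \<in> Poly_Mapping.keys f \<and> hd w = i. Poly_Mapping.single (tl w) (Poly_Mapping.lookup f w))"
 have ne: "w \<in> Poly_Mapping.keys f \<Longrightarrow> hd w # tl w = w" for w using f by (cases w) (auto simp: free_grade_def)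
 have "(\<Sum>i\<in>UNIV. Poly_Mapping.single [i] 1 * h i) =
  (\<Sum>i\<in>UNIV. \<Sum>w | w \<in> Poly_Mapping.keys f \<and> hd w = i. Poly_Mapping.single w (Poly_Mapping.lookup f w))"
  unfolding h_def sum_distrib_left by (intro sum.cong refl) (auto simp: mult_single_free ne)
 also have "\<dots> = (\<Sum>w\<in>Poly_Mapping.keys f. Poly_Mapping.single w (Poly_Mapping.lookup f w))"
  by (rule sum.group) simp_all
 finally have "f = (\<Sum>i\<in>UNIV. Poly_Mapping.single [i] 1*h i)" using free_sum_single[of f] by simp
 moreover have "h i \<in> free_grade n" for i
  unfolding h_def using f by (intro sum_free_grade single_free_grade) (auto simp: free_grade_def)
 ultimately show thesis using that by blast
qed

locale homogeneous_ideal =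
 fixes I :: "('k::field) free3 set"
 assumes ideal: "ideal I free_ring" and hp_mem: "f \<in> I \<Longrightarrow> hp n f \<in> I"
begin

lemma I_zero: "0 \<in> I" and I_add: "f \<in> I \<Longrightarrow> g \<in> I \<Longrightarrow> f + g \<in> I"
 using additive_subgroup.zero_closed[OF ideal.axioms(1)[OF ideal]]
  additive_subgroup.a_closed[OF ideal.axioms(1)[OF ideal]] by simp_all

lemma I_left: "f \<in> I \<Longrightarrow> g*f \<in> I" and I_right: "f \<in> I \<Longrightarrow> f*g \<in> I"
 using ideal.I_l_closed[OF ideal] ideal.I_r_closed[OF ideal] by simp_all

lemma I_uminus: "f \<in> I \<Longrightarrow> - f \<in> I"
 using I_left[of f "-1"] by simp

lemma I_diff: "f \<in> I \<Longrightarrow> g \<in> I \<Longrightarrow> f - g \<in> I"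
 using I_add[of f "- g"] I_uminus by simp

lemma I_sum: "(\<And>x. x \<in> S \<Longrightarrow> f x \<in> I) \<Longrightarrow> (\<Sum>x\<in>S. f x) \<in> I"
 by (induction S rule: infinite_finite_induct) (simp_all add: I_zero I_add)

definition pr :: "'k free3 \<Rightarrow> 'k free3 set" where "pr f = I +>\<^bsub>free_ring\<^esub> f"

lemma pr_mem: "g \<in> pr f \<longleftrightarrow> g - f \<in> I"
proof
 assume "g \<in> pr f"
 then show "g - f \<in> I" by (auto simp: pr_def a_r_coset_def')
next
 assume "g - f \<in> I"
 then show "g \<in> pr f" unfolding pr_def a_r_coset_def' by (intro UN_I[of "g - f"]) simp_all
qed

lemma pr_eq: "pr f = pr g \<longleftrightarrow> f - g \<in> I"
proof
 assume "pr f = pr g"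
 then show "f - g \<in> I" using pr_mem[of f f] pr_mem[of f g] I_zero by simp
next
 assume fg: "f - g \<in> I"
 show "pr f = pr g"
 proof (rule equalityI; rule subsetI)
  fix x assume "x \<in> pr f"
  then show "x \<in> pr g" using I_add[OF _ fg, of "x - f"] by (simp add: pr_mem)
 next
  fix x assume "x \<in> pr g"
  then show "x \<in> pr f" using I_diff[OF _ fg, of "x - g"] by (simp add: pr_mem)
 qed
qed

abbreviation Q where "Q \<equiv> quotient_gralg I"

lemma Q_carrier: "carrier Q = range pr"
 by (auto simp: quotient_gralg_def FactRing_def A_RCOSETS_def' pr_def)

lemma Q_mult: "pr f \<otimes>\<^bsub>Q\<^esub> pr g = pr (f * g)"
 using ideal.rcoset_mult_add[OF ideal, of f g] by (simp add: quotient_gralg_def FactRing_def pr_def)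

lemma Q_add: "pr f \<oplus>\<^bsub>Q\<^esub> pr g = pr (f + g)"
 using ideal.a_rcos_sum[OF ideal, of f g] by (simp add: quotient_gralg_def FactRing_def pr_def)

lemma Q_zero: "\<zero>\<^bsub>Q\<^esub> = pr 0"
 by (simp add: quotient_gralg_def FactRing_def pr_def a_r_coset_def')

lemma Q_one: "\<one>\<^bsub>Q\<^esub> = pr 1"
 by (simp add: quotient_gralg_def FactRing_def pr_def)

lemma Q_smult: "c \<odot>\<^bsub>Q\<^esub> pr f = pr (Poly_Mapping.single [] c * f)"
proof -
 have "pr (Poly_Mapping.single [] c*g) = pr (Poly_Mapping.single [] c*f)" if "g \<in> pr f" for g
  using that I_left[of "g - f" "Poly_Mapping.single [] c"] by (simp add: pr_eq pr_mem right_diff_distrib)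
 moreover have "f \<in> pr f" by (simp add: pr_mem I_zero)
 ultimately have "(\<Union>g\<in>pr f. pr (Poly_Mapping.single [] c*g)) = pr (Poly_Mapping.single [] c*f)" by blast
 then show ?thesis by (simp add: quotient_gralg_def pr_def)
qed

lemma Q_grade: "grade Q n = pr ` free_grade n"
 by (auto simp: quotient_gralg_def pr_def)

lemmas Q_simps = Q_carrier Q_mult Q_add Q_zero Q_one Q_smult

lemma Q_abelian_group: "abelian_group Q"
proof (rule abelian_groupI)
 fix x assume "x \<in> carrier Q"
 then obtain f where "x = pr f" by (auto simp: Q_carrier)
 then show "\<exists>y\<in>carrier Q. y \<oplus>\<^bsub>Q\<^esub> x = \<zero>\<^bsub>Q\<^esub>"
  by (intro bexI[of _ "pr (- f)"]) (simp_all add: Q_simps)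
qed (auto simp: Q_simps ac_simps)

lemma Q_ring: "ring Q"
proof (rule ringI[OF Q_abelian_group])
 show "Group.monoid Q" by (rule monoidI) (auto simp: Q_simps mult.assoc)
qed (auto simp: Q_simps distrib_left distrib_right)

lemma Q_finsum: "finite S \<Longrightarrow> finsum Q (\<lambda>i. pr (h i)) S = pr (\<Sum>i\<in>S. h i)"
proof (induction S rule: finite_induct)
 case empty
 interpret abelian_group Q by (rule Q_abelian_group)
 show ?case by (simp add: Q_zero)
next
 case (insert i S)
 interpret abelian_group Q by (rule Q_abelian_group)
 show ?case using insert by (simp add: finsum_insert Pi_def Q_simps)
qed

lemma Q_grade_subgroup: "additive_subgroup (grade Q n) Q"
proof (rule additive_subgroupI)
 interpret abelian_group Q by (rule Q_abelian_group)
 show "subgroup (grade Q n) (add_monoid Q)"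
 proof (rule add.subgroupI)
  show "grade Q n \<subseteq> carrier Q" by (auto simp: Q_grade Q_carrier)
  show "grade Q n \<noteq> {}" using zero_free_grade by (auto simp: Q_grade)
  fix a assume "a \<in> grade Q n"
  then obtain f where f: "a = pr f" "f \<in> free_grade n" by (auto simp: Q_grade)
  have "\<ominus>\<^bsub>Q\<^esub> a = pr (- f)" by (rule minus_equality) (simp_all add: f Q_simps)
  then show "\<ominus>\<^bsub>Q\<^esub> a \<in> grade Q n" using f minus_free_grade by (auto simp: Q_grade)
  fix b assume "b \<in> grade Q n"
  then obtain g where "b = pr g" "g \<in> free_grade n" by (auto simp: Q_grade)
  then show "a \<oplus>\<^bsub>Q\<^esub> b \<in> grade Q n" using f add_free_grade by (auto simp: Q_grade Q_add)
 qed
qed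

text \<open>For existence, homogeneous parts that lie in \<open>I\<close> are dropped from the index
  set. For uniqueness, the difference of two lifts lies in \<open>I\<close>, and so do its
  homogeneous parts.\<close>

lemma Q_direct_sum: "direct_sum_decomposition Q (grade Q)"
 unfolding direct_sum_decomposition_def
proof (intro conjI allI ballI Q_grade_subgroup)
 fix x assume "x \<in> carrier Q"
 then obtain g where x: "x = pr g" by (auto simp: Q_carrier)
 obtain N where N: "\<And>n. n \<ge> N \<Longrightarrow> hp n g = 0" "g = (\<Sum>n<N. hp n g)" using hp_decomposition[of g] by blast
 let ?F = "\<lambda>i. pr (hp i g)"
 let ?S = "{i. ?F i \<noteq> \<zero>\<^bsub>Q\<^esub>}"
 have S: "?S \<subseteq> {..<N}" using N(1) by (force simp: Q_zero)
 then have fin: "finite ?S" using finite_subset by blast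
 have "g = (\<Sum>i\<in>{..<N} - ?S. hp i g) + (\<Sum>i\<in>?S. hp i g)"
  by (rule trans[OF N(2) sum.subset_diff[OF S]]) simp
 then have "g - (\<Sum>i\<in>?S. hp i g) = (\<Sum>i\<in>{..<N} - ?S. hp i g)" by (simp only: diff_eq_eq)
 moreover have "(\<Sum>i\<in>{..<N} - ?S. hp i g) \<in> I" by (rule I_sum) (auto simp: Q_zero pr_eq)
 ultimately have "x = pr (\<Sum>i\<in>?S. hp i g)" unfolding x pr_eq by (simp only:)
 then have ex: "x = finsum Q ?F ?S" using Q_finsum[OF fin, of "\<lambda>i. hp i g"] by simp
 show "\<exists>!f. (\<forall>i. f i \<in> grade Q i) \<and> finite {i. f i \<noteq> \<zero>\<^bsub>Q\<^esub>} \<and> x = finsum Q f {i. f i \<noteq> \<zero>\<^bsub>Q\<^esub>}"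
 proof (rule ex1I[of _ ?F])
  show "(\<forall>i. ?F i \<in> grade Q i) \<and> finite ?S \<and> x = finsum Q ?F ?S"
   using fin ex hp_free_grade by (auto simp: Q_grade)
 next
  fix F assume F: "(\<forall>i. F i \<in> grade Q i) \<and> finite {i. F i \<noteq> \<zero>\<^bsub>Q\<^esub>} \<and> x = finsum Q F {i. F i \<noteq> \<zero>\<^bsub>Q\<^esub>}"
  let ?T = "{i. F i \<noteq> \<zero>\<^bsub>Q\<^esub>}"
  have "\<forall>i. \<exists>h. h \<in> free_grade i \<and> F i = pr h" using F by (auto simp: Q_grade)
  then obtain h where h: "\<And>i. h i \<in> free_grade i" "\<And>i. F i = pr (h i)" by metis
  have "F = (\<lambda>i. pr (h i))" using h(2) by blast
  then have "x = pr (\<Sum>i\<in>?T. h i)" using F Q_finsum[of ?T h] by simp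
  then have d: "(\<Sum>i\<in>?T. h i) - g \<in> I" using x pr_eq[of "\<Sum>i\<in>?T. h i" g] by simp
  show "F = ?F"
  proof
   fix j
   have "hp j (\<Sum>i\<in>?T. h i) = (\<Sum>i\<in>?T. if i = j then h j else 0)"
    unfolding hp_sum by (intro sum.cong refl) (auto simp: hp_homogeneous[OF h(1)])
   then have e: "(if j \<in> ?T then h j else 0) - hp j g \<in> I"
    using hp_mem[OF d, of j] F by (simp add: hp_diff)
   show "F j = ?F j"
   proof (cases "j \<in> ?T")
    case True
    then show ?thesis using e by (simp add: h(2) pr_eq)
   next
    case False
    then have "F j = pr 0" by (simp add: Q_zero)
    then show ?thesis using e False by (simp only: pr_eq if_False)
   qed
  qed
 qed
qed

lemma Q_graded_algebra: "graded_algebra Q"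
 unfolding graded_algebra_def
proof (intro conjI allI ballI Q_ring Q_direct_sum)
 show "\<one>\<^bsub>Q\<^esub> \<in> grade Q 0"
  using single_free_grade[of "[]" 0 1] by (auto simp: Q_grade Q_one scalar_one)
next
 fix c d x y assume "x \<in> carrier Q" "y \<in> carrier Q"
 then obtain f g where "x = pr f" "y = pr g" by (auto simp: Q_carrier)
 then show "c \<odot>\<^bsub>Q\<^esub> (x \<oplus>\<^bsub>Q\<^esub> y) = c \<odot>\<^bsub>Q\<^esub> x \<oplus>\<^bsub>Q\<^esub> c \<odot>\<^bsub>Q\<^esub> y"
  "c \<odot>\<^bsub>Q\<^esub> (x \<otimes>\<^bsub>Q\<^esub> y) = (c \<odot>\<^bsub>Q\<^esub> x) \<otimes>\<^bsub>Q\<^esub> y"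
  "c \<odot>\<^bsub>Q\<^esub> (x \<otimes>\<^bsub>Q\<^esub> y) = x \<otimes>\<^bsub>Q\<^esub> (c \<odot>\<^bsub>Q\<^esub> y)"
  by (simp_all add: Q_simps distrib_left mult.assoc) (simp add: scalar_central mult.assoc[symmetric])
next
 fix c d x assume "x \<in> carrier Q"
 then obtain f where f: "x = pr f" by (auto simp: Q_carrier)
 show "c \<odot>\<^bsub>Q\<^esub> x \<in> carrier Q" "1 \<odot>\<^bsub>Q\<^esub> x = x" by (simp_all add: f Q_simps scalar_one)
 have "Poly_Mapping.single [] (c*d) = Poly_Mapping.single [] c*(Poly_Mapping.single [] d :: 'k free3)"
  by (simp add: mult_single_free)
 then show "(c*d) \<odot>\<^bsub>Q\<^esub> x = c \<odot>\<^bsub>Q\<^esub> (d \<odot>\<^bsub>Q\<^esub> x)" by (simp add: f Q_simps mult.assoc)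
 show "(c + d) \<odot>\<^bsub>Q\<^esub> x = c \<odot>\<^bsub>Q\<^esub> x \<oplus>\<^bsub>Q\<^esub> d \<odot>\<^bsub>Q\<^esub> x" by (simp add: f Q_simps single_add distrib_right)
next
 fix n c x assume "x \<in> grade Q n"
 then obtain f where "x = pr f" "f \<in> free_grade n" by (auto simp: Q_grade)
 then show "c \<odot>\<^bsub>Q\<^esub> x \<in> grade Q n" using scalar_free_grade by (auto simp: Q_grade Q_smult)
next
 fix m n x y assume "x \<in> grade Q m" "y \<in> grade Q n"
 then obtain f g where "x = pr f" "f \<in> free_grade m" "y = pr g" "g \<in> free_grade n" by (auto simp: Q_grade)
 then show "x \<otimes>\<^bsub>Q\<^esub> y \<in> grade Q (m + n)"
  using imageI[OF mult_free_grade[of f m g n], of pr] by (simp add: Q_grade Q_mult)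
qed

sublocale gr_alg Q
 by (rule gr_alg.intro[OF Q_graded_algebra])

lemma Q_degree_0:
 assumes "x \<in> grade Q 0" shows "\<exists>k. x = k \<odot>\<^bsub>Q\<^esub> \<one>\<^bsub>Q\<^esub>"
proof -
 obtain f where f: "x = pr f" "f \<in> free_grade 0" using assms by (auto simp: Q_grade)
 have "f = Poly_Mapping.single [] (Poly_Mapping.lookup f [])*1" using free_grade_0[OF f(2)] by simp
 then have "x = Poly_Mapping.lookup f [] \<odot>\<^bsub>Q\<^esub> \<one>\<^bsub>Q\<^esub>" by (simp only: f(1) Q_one Q_smult) 
 then show ?thesis by blast
qed

lemma Q_generated:
 assumes "x \<in> grade Q (Suc n)"
 shows "\<exists>a1\<in>grade Q 1. \<exists>a2\<in>grade Q 1. \<exists>a3\<in>grade Q 1. \<exists>b1\<in>grade Q n. \<exists>b2\<in>grade Q n. \<exists>b3\<in>grade Q n.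
  x = a1 \<otimes>\<^bsub>Q\<^esub> b1 \<oplus>\<^bsub>Q\<^esub> (a2 \<otimes>\<^bsub>Q\<^esub> b2 \<oplus>\<^bsub>Q\<^esub> a3 \<otimes>\<^bsub>Q\<^esub> b3)"
proof -
 obtain f where f: "x = pr f" "f \<in> free_grade (Suc n)" using assms by (auto simp: Q_grade)
 obtain h where h: "\<And>i. h i \<in> free_grade n" "f = (\<Sum>i\<in>UNIV. Poly_Mapping.single [i] 1*h i)"
  using free_grade_Suc[OF f(2)] by blast
 let ?x = "\<lambda>i. pr (Poly_Mapping.single [i] 1)" and ?h = "\<lambda>i. pr (h i)"
 have mem: "?x i \<in> grade Q 1" "?h i \<in> grade Q n" for i
  using h(1)[of i] single_free_grade[of "[i]" 1 1] by (auto simp: Q_grade)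
 have "x = ?x 1 \<otimes>\<^bsub>Q\<^esub> ?h 1 \<oplus>\<^bsub>Q\<^esub> (?x 2 \<otimes>\<^bsub>Q\<^esub> ?h 2 \<oplus>\<^bsub>Q\<^esub> ?x 3 \<otimes>\<^bsub>Q\<^esub> ?h 3)"
  by (simp add: f(1) h(2) Q_simps sum_3 add.assoc)
 then show ?thesis
  by - (rule bexI[OF _ mem(1)[of 1]], rule bexI[OF _ mem(1)[of 2]], rule bexI[OF _ mem(1)[of 3]],
   rule bexI[OF _ mem(2)[of 1]], rule bexI[OF _ mem(2)[of 2]], rule bexI[OF _ mem(2)[of 3]])
qed

end

lemma relations_zero: "0 \<in> relations E \<sigma>"
 and relations_add: "f \<in> relations E \<sigma> \<Longrightarrow> g \<in> relations E \<sigma> \<Longrightarrow> f + g \<in> relations E \<sigma>"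
 and relations_scalar: "f \<in> relations E \<sigma> \<Longrightarrow> Poly_Mapping.single [] c*f \<in> relations E \<sigma>"
proof -
 show "0 \<in> relations E \<sigma>" by (simp add: relations_def zero_free_grade)
 show "f + g \<in> relations E \<sigma>" if "f \<in> relations E \<sigma>" "g \<in> relations E \<sigma>"
  using that unfolding relations_def by (simp add: add_free_grade lookup_add distrib_right sum.distrib)
 show "Poly_Mapping.single [] c*f \<in> relations E \<sigma>" if "f \<in> relations E \<sigma>"
  using that unfolding relations_def
  by (simp add: scalar_free_grade lookup_scalar mult.assoc sum_distrib_left[symmetric])
qed

lemma relations_grade: "f \<in> relations E \<sigma> \<Longrightarrow> f \<in> free_grade 2"
 by (simp add: relations_def)

lemma genideal_relations:
 "ideal (Idl\<^bsub>free_ring\<^esub> (relations E \<sigma>)) free_ring" "relations E \<sigma> \<subseteq> Idl\<^bsub>free_ring\<^esub> (relations E \<sigma>)"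
 using ring.genideal_ideal[OF ring_free_ring, of "relations E \<sigma>"] ring.genideal_self[OF ring_free_ring, of "relations E \<sigma>"]
 by simp_all

text \<open>The set \<open>J\<close> of elements with all the asserted properties is an ideal
  containing the relations, so it contains the generated ideal. In degree two nothing new arises,
  because only the scalar part of a cofactor contributes and the relations form a subspace.\<close>

lemma genideal_relations_hp:
 assumes "f \<in> Idl\<^bsub>free_ring\<^esub> (relations E \<sigma>)"
 shows "hp 0 f = 0" "hp 1 f = 0" "hp 2 f \<in> relations E \<sigma>" "hp n f \<in> Idl\<^bsub>free_ring\<^esub> (relations E \<sigma>)"
proof -
 let ?I = "Idl\<^bsub>free_ring\<^esub> (relations E \<sigma>)"
 note id = genideal_relations(1)[of E \<sigma>]
 interpret R: ring free_ring by (rule ring_free_ring)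
 have I0: "0 \<in> ?I" and I_add: "\<And>f g. f \<in> ?I \<Longrightarrow> g \<in> ?I \<Longrightarrow> f + g \<in> ?I"
  using additive_subgroup.zero_closed[OF ideal.axioms(1)[OF id]]
   additive_subgroup.a_closed[OF ideal.axioms(1)[OF id]] by simp_all
 have I_left: "\<And>f g. f \<in> ?I \<Longrightarrow> g*f \<in> ?I" and I_right: "\<And>f g. f \<in> ?I \<Longrightarrow> f*g \<in> ?I"
  using ideal.I_l_closed[OF id] ideal.I_r_closed[OF id] by simp_all
 have I_sum: "(\<Sum>x\<in>S. h x) \<in> ?I" if "\<And>x. x \<in> S \<Longrightarrow> h x \<in> ?I" for S :: "nat set" and h
  using that by (induction S rule: infinite_finite_induct) (simp_all add: I0 I_add)
 define J where "J = {f. hp 0 f = 0 \<and> hp 1 f = 0 \<and> hp 2 f \<in> relations E \<sigma> \<and> (\<forall>n. hp n f \<in> ?I)}"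
 have J_left: "g * f \<in> J" if f: "f \<in> J" for f g
 proof -
  have z: "hp 0 f = 0" "hp (Suc 0) f = 0" "hp 2 f \<in> relations E \<sigma>" "\<And>n. hp n f \<in> ?I" using f by (simp_all add: J_def)
  have "hp 2 (g * f) = hp 0 g * hp 2 f" using z by (simp add: hp_mult numeral_2_eq_2)
  also have "hp 0 g = Poly_Mapping.single [] (Poly_Mapping.lookup (hp 0 g) [])" by (rule free_grade_0[OF hp_free_grade])
  finally have "hp 2 (g*f) \<in> relations E \<sigma>" using relations_scalar[OF z(3)] by simp
  moreover have "hp n (g*f) \<in> ?I" for n unfolding hp_mult using z by (intro I_sum I_left) simp
  ultimately show ?thesis using z by (simp add: J_def hp_mult)
 qed
 have J_right: "f * g \<in> J" if f: "f \<in> J" for f g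
 proof -
  have z: "hp 0 f = 0" "hp (Suc 0) f = 0" "hp 2 f \<in> relations E \<sigma>" "\<And>n. hp n f \<in> ?I" using f by (simp_all add: J_def)
  have "hp 2 (f * g) = hp 2 f * hp 0 g" using z by (simp add: hp_mult numeral_2_eq_2)
  also have "hp 0 g = Poly_Mapping.single [] (Poly_Mapping.lookup (hp 0 g) [])" by (rule free_grade_0[OF hp_free_grade])
  finally have "hp 2 (f*g) = Poly_Mapping.single [] (Poly_Mapping.lookup (hp 0 g) [])*hp 2 f" by (simp add: scalar_central)
  then have "hp 2 (f * g) \<in> relations E \<sigma>" using relations_scalar[OF z(3)] by simp
  moreover have "hp n (f*g) \<in> ?I" for n unfolding hp_mult using z by (intro I_sum I_right) simp
  ultimately show ?thesis using z by (simp add: J_def hp_mult)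
 qed
 have J_add: "f + g \<in> J" if "f \<in> J" "g \<in> J" for f g
  using that by (simp add: J_def hp_add relations_add I_add)
 have "ideal J free_ring"
 proof (rule idealI[OF ring_free_ring])
  show "subgroup J (add_monoid free_ring)"
  proof (rule R.add.subgroupI)
   show "J \<noteq> {}" using I0 relations_zero[of E \<sigma>] by (auto simp: J_def intro!: exI[of _ 0])
   fix f assume f: "f \<in> J"
   have "\<ominus>\<^bsub>free_ring\<^esub> f = - f" by (rule R.minus_equality) simp_all
   also have "\<dots> = (- 1) * f" by simp
   finally show "\<ominus>\<^bsub>free_ring\<^esub> f \<in> J" using J_left[OF f] by (simp only:)
  qed (simp_all add: J_add)
 qed (simp_all add: J_left J_right)
 moreover have "relations E \<sigma> \<subseteq> J"
 proof
  fix f assume f: "f \<in> relations E \<sigma>"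
  then show "f \<in> J" using genideal_relations(2)[of E \<sigma>] I0
   by (auto simp: J_def hp_homogeneous[OF relations_grade[OF f]])
 qed
 ultimately have "?I \<subseteq> J" by (rule R.genideal_minimal)
 then have "f \<in> J" using assms by blast
 then show "hp 0 f = 0" "hp 1 f = 0" "hp 2 f \<in> relations E \<sigma>" "hp n f \<in> ?I" by (simp_all add: J_def)
qed

definition lin :: "('k::field)^3 \<Rightarrow> 'k free3" where
 "lin a = (\<Sum>i\<in>UNIV. Poly_Mapping.single [i] (a $ i))"

lemma lin_grade: "lin a \<in> free_grade 1"
 unfolding lin_def by (intro sum_free_grade single_free_grade) simp

lemma lookup_lin: "Poly_Mapping.lookup (lin a) [i] = a $ i"
proof -
 have "Poly_Mapping.lookup (lin a) [i] = (\<Sum>j\<in>UNIV. if j = i then a $ j else 0)"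
  unfolding lin_def lookup_sum by (intro sum.cong refl) (auto simp: lookup_single when_def)
 then show ?thesis by simp
qed

lemma free_grade_1: "f \<in> free_grade 1 \<Longrightarrow> f = lin (\<chi> i. Poly_Mapping.lookup f [i])"
proof (rule poly_mapping_eqI)
 fix w assume f: "f \<in> free_grade 1"
 show "Poly_Mapping.lookup f w = Poly_Mapping.lookup (lin (\<chi> i. Poly_Mapping.lookup f [i])) w"
 proof (cases "length w = 1")
  case True
  then obtain i where "w = [i]" by (metis length_Suc_conv length_0_conv One_nat_def)
  then show ?thesis by (simp add: lookup_lin)
 next
  case False
  then show ?thesis using f lin_grade[of "\<chi> i. Poly_Mapping.lookup f [i]"] by (simp add: free_grade_iff)
 qed
qed

lemma free_grade_2: "f \<in> free_grade 2 \<Longrightarrow> f = form_of_matrix (\<chi> i j. Poly_Mapping.lookup f [i, j])"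
proof (rule poly_mapping_eqI)
 fix w assume f: "f \<in> free_grade 2"
 show "Poly_Mapping.lookup f w = Poly_Mapping.lookup (form_of_matrix (\<chi> i j. Poly_Mapping.lookup f [i, j])) w"
 proof (cases "length w = 2")
  case True
  then obtain i j where "w = [i, j]" by (metis length_Suc_conv length_0_conv numeral_2_eq_2)
  then show ?thesis by (simp add: lookup_form_of_matrix)
 next
  case False
  then show ?thesis using f form_of_matrix_grade[of "\<chi> i j. Poly_Mapping.lookup f [i, j]"] by (simp add: free_grade_iff)
 qed
qed

lemma lin_add: "lin (a + b) = lin a + lin b"
 by (simp add: lin_def single_add sum.distrib)

lemma lin_smult: "lin (c *s a) = Poly_Mapping.single [] c * lin a"
 by (simp add: lin_def sum_distrib_left mult_single_free)

lemma lin_sum_axis: "lin a = (\<Sum>i\<in>UNIV. Poly_Mapping.single [] (a $ i)*lin (axis i 1))"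
proof -
 have "lin (axis i 1) = Poly_Mapping.single [i] (1::'a)" for i :: 3
  unfolding lin_def by (rule trans[OF sum.mono_neutral_right[of UNIV "{i}"]]) (auto simp: axis_def)
 then show ?thesis by (simp add: lin_def mult_single_free)
qed

lemma form_of_matrix_add: "form_of_matrix (A + B) = form_of_matrix A + form_of_matrix B"
 by (simp add: form_of_matrix_def single_add sum.distrib)

lemma lin_mult: "lin a * lin b = form_of_matrix (\<chi> i j. a $ i * b $ j)"
 by (simp add: lin_def form_of_matrix_def sum_product mult_single_free)

lemma form_of_matrix_rows: "form_of_matrix G = (\<Sum>i\<in>UNIV. lin (axis i 1)*lin (G $ i))"
proof -
 have "lin (axis i 1) = Poly_Mapping.single [i] (1::'a)" for i :: 3
  unfolding lin_def by (rule trans[OF sum.mono_neutral_right[of UNIV "{i}"]]) (auto simp: axis_def)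
 then show ?thesis by (simp add: form_of_matrix_def lin_def sum_distrib_left mult_single_free)
qed

declare transpose_matrix_vector [simp del]

text \<open>\<open>N ** G ** transpose S\<close> is the tensor \<open>G\<close> after
  \<open>N\<close> acts on its first and \<open>S\<close> on its second factor; the right-hand side
  is this action computed row by row.\<close>

lemma transform_component:
 fixes N S G :: "('k::field)^3^3"
 shows "(N ** G ** transpose S) $ k $ l = (\<Sum>i\<in>UNIV. N $ k $ i * (S *v G $ i) $ l)"
 by (simp add: matrix_matrix_mult_def matrix_vector_mult_def transpose_def sum_3 algebra_simps)

text \<open>A substitution in the relations acts on points by the transposed matrices.\<close>

lemma bil_transform:
 fixes N S G :: "('k::field)^3^3"
 shows "bil (N ** G ** transpose S) v w = bil G (transpose N *v v) (transpose S *v w)"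
proof -
 have e: "(transpose N *v v) $ i = N $ 1 $ i * v $ 1 + N $ 2 $ i * v $ 2 + N $ 3 $ i * v $ 3" for i
  by (simp add: matrix_vector_mult_3) (simp add: transpose_def)
 have d: "(\<Sum>l\<in>UNIV. (S *v x) $ l*w $ l) = (\<Sum>j\<in>UNIV. x $ j*(transpose S *v w) $ j)" for x
  by (simp add: matrix_vector_mult_def transpose_def sum_3 algebra_simps)
 have "bil (N ** G ** transpose S) v w = (\<Sum>i\<in>UNIV. (transpose N *v v) $ i*(\<Sum>l\<in>UNIV. (S *v G $ i) $ l*w $ l))"
  unfolding bil_def transform_component
  by (simp add: e sum_3 algebra_simps)
 also have "\<dots> = bil G (transpose N *v v) (transpose S *v w)"
  unfolding d bil_def by (simp add: sum_3 algebra_simps)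
 finally show ?thesis .
qed

lemma invertible_transpose:
 fixes N :: "('k::field)^3^3"
 shows "invertible (transpose N) \<longleftrightarrow> invertible N"
 by (simp add: invertible_det_nz det_transpose)

lemma mult_axis: "(N *v axis j 1) $ i = N $ i $ j"
 for N :: "('k::field)^3^3"
 by (simp add: matrix_vector_mult_def axis_def if_distrib cong: if_cong)

lemma form_in_relations: "form_of_matrix G \<in> relations E \<sigma> \<longleftrightarrow> (\<forall>p\<in>E. \<forall>v\<in>p. \<forall>w\<in>\<sigma> p. bil G v w = 0)"
 by (simp add: relations_def form_of_matrix_grade lookup_form_of_matrix bil_def)

text \<open>The common zeros of the relations are the graph of \<sigma>, so a substitution that
  preserves the relations moves the graph into itself.\<close>

lemma geometric_transport:
 fixes E :: "(('k::field)^3) set set"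
 assumes g: "geometric E \<sigma>" and inv: "invertible N" "invertible S"
  and rel: "\<And>G. form_of_matrix G \<in> relations E \<sigma> \<Longrightarrow> form_of_matrix (N ** G ** transpose S) \<in> relations E \<sigma>"
  and p: "p \<in> E"
 shows "pmap (transpose N) p \<in> E" "\<sigma> (pmap (transpose N) p) = pmap (transpose S) (\<sigma> p)"
proof -
 have E: "E \<subseteq> P2" "\<sigma> \<in> Bij E" using g by (auto simp: geometric_def)
 have "p \<in> P2" using E(1) p by blast
 then obtain v where v: "v \<noteq> 0" "p = proj v" by (rule P2_cases)
 have "\<sigma> p \<in> P2" using E(1) Bij_mem[OF E(2) p] by blast
 then obtain w where w: "w \<noteq> 0" "\<sigma> p = proj w" by (rule P2_cases)
 have "relzero E \<sigma> (transpose N *v v) (transpose S *v w)"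
  unfolding relzero_def
 proof
  fix f assume f: "f \<in> relations E \<sigma>"
  define G where "G = (\<chi> i j. Poly_Mapping.lookup f [i, j])"
  have fG: "f = form_of_matrix G" unfolding G_def by (rule free_grade_2[OF relations_grade[OF f]])
  have "form_of_matrix (N ** G ** transpose S) \<in> relations E \<sigma>" using rel f fG by simp
  then have "bil (N ** G ** transpose S) v w = 0" using p v w by (simp add: form_in_relations)
  then have "bil G (transpose N *v v) (transpose S *v w) = 0" by (simp only: bil_transform)
  then show "(\<Sum>i\<in>UNIV. \<Sum>j\<in>UNIV. Poly_Mapping.lookup f [i, j]*(transpose N *v v) $ i*(transpose S *v w) $ j) = 0"
   by (simp add: fG lookup_form_of_matrix bil_def)
 qed
 moreover have "invertible (transpose N)" "invertible (transpose S)"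
  using inv by (simp_all add: invertible_transpose)
 then have "transpose N *v v \<noteq> 0" "transpose S *v w \<noteq> 0" using v w by (simp_all add: invertible_mult_nz)
 ultimately show "pmap (transpose N) p \<in> E" "\<sigma> (pmap (transpose N) p) = pmap (transpose S) (\<sigma> p)"
  using g v w by (auto simp: geometric_def)
qed

locale pair_relations =
 fixes E :: "(('k::field)^3) set set" and \<sigma> :: "('k^3) set \<Rightarrow> ('k^3) set"
begin

sublocale homogeneous_ideal "Idl\<^bsub>free_ring\<^esub> (relations E \<sigma>)"
 by (rule homogeneous_ideal.intro[OF genideal_relations(1) genideal_relations_hp(4)])

lemma lin_eq: "pr (lin a) = pr (lin b) \<longleftrightarrow> a = b"
proof
 assume "pr (lin a) = pr (lin b)"
 then have "hp 1 (lin a - lin b) = 0" unfolding pr_eq by (rule genideal_relations_hp(2))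
 then have "lin a = lin b" by (simp add: hp_diff hp_homogeneous[OF lin_grade])
 then show "a = b" by (metis lookup_lin vec_eq_iff)
qed simp

lemma form_eq_0: "pr (form_of_matrix G) = pr 0 \<longleftrightarrow> form_of_matrix G \<in> relations E \<sigma>"
proof
 assume "pr (form_of_matrix G) = pr 0"
 then have "hp 2 (form_of_matrix G - 0) \<in> relations E \<sigma>" unfolding pr_eq by (rule genideal_relations_hp(3))
 then show "form_of_matrix G \<in> relations E \<sigma>" by (simp add: hp_homogeneous[OF form_of_matrix_grade])
qed (use genideal_relations(2) in \<open>auto simp: pr_eq\<close>)

lemma degree_1_cases:
 assumes "x \<in> grade Q 1" obtains a where "x = pr (lin a)"
proof -
 obtain f where f: "x = pr f" "f \<in> free_grade 1" using assms by (auto simp: Q_grade)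
 then show thesis using that[of "\<chi> i. Poly_Mapping.lookup f [i]"] free_grade_1[OF f(2)] by simp
qed

lemma lin_grade_1: "pr (lin a) \<in> grade Q 1"
 using lin_grade by (auto simp: Q_grade)

text \<open>The ideal is zero in degree one, so that component has the letters as a basis and a
  graded linear automorphism acts on it by a matrix.\<close>

lemma linear_action:
 assumes f: "graded_linear_auto Q f"
 obtains N where "invertible N" "\<And>a. f (pr (lin a)) = pr (lin (N *v a))"
proof -
 note F = gaddD[OF glaD(1)[OF f]] glaD(5)[OF f]
 have "\<forall>i. \<exists>b. f (pr (lin (axis i 1))) = pr (lin b)"
  using degree_1_cases[OF F(3)[OF lin_grade_1]] by blast
 then obtain b where b: "\<And>i. f (pr (lin (axis i 1))) = pr (lin (b i))" by metis
 define N where "N = (\<chi> k i. b i $ k)"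
 have act: "f (pr (lin a)) = pr (lin (N *v a))" for a
 proof -
  let ?e = "\<lambda>i. pr (lin (axis i 1))"
  have c: "?e i \<in> carrier Q" for i by (simp add: Q_carrier)
  have "pr (lin a) = (a $ 1) \<odot>\<^bsub>Q\<^esub> ?e 1 \<oplus>\<^bsub>Q\<^esub> ((a $ 2) \<odot>\<^bsub>Q\<^esub> ?e 2 \<oplus>\<^bsub>Q\<^esub> (a $ 3) \<odot>\<^bsub>Q\<^esub> ?e 3)"
   by (subst lin_sum_axis) (simp add: Q_smult Q_add sum_3 add.assoc)
  then have "f (pr (lin a)) = (a $ 1) \<odot>\<^bsub>Q\<^esub> f (?e 1) \<oplus>\<^bsub>Q\<^esub> ((a $ 2) \<odot>\<^bsub>Q\<^esub> f (?e 2) \<oplus>\<^bsub>Q\<^esub> (a $ 3) \<odot>\<^bsub>Q\<^esub> f (?e 3))"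
   using F(1,2,4,5) c by simp
  also have "\<dots> = pr (lin ((a $ 1) *s b 1 + ((a $ 2) *s b 2 + (a $ 3) *s b 3)))"
   by (simp only: b Q_smult Q_add lin_add lin_smult)
  also have "(a $ 1) *s b 1 + ((a $ 2) *s b 2 + (a $ 3) *s b 3) = N *v a"
   by (simp add: vec_eq_iff matrix_vector_mult_3 N_def ac_simps)
  finally show ?thesis .
 qed
 have "v = 0" if "N *v v = 0" for v
 proof -
  have "f (pr (lin v)) = f (pr (lin 0))" using act[of v] act[of 0] that by simp
  then have "pr (lin v) = pr (lin 0)" by (rule inj_onD[OF glaD(2)[OF f]]) (simp_all add: Q_carrier)
  then show ?thesis by (simp add: lin_eq)
 qed
 then have "invertible N" by (rule invertibleI_nz)
 then show thesis using that act by blast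
qed

text \<open>Evaluating the twisting identity at the preimage of \<open>c\<close> under
  \<open>\<theta> 1\<close> shows that \<open>\<theta> n\<close> acts on products of two elements of
  degree one by \<open>N\<close> on the left and \<open>N' N1^-1\<close> on the right. As
  \<open>\<theta> n\<close> is well defined and injective on the quotient, this substitution
  preserves the relations in both directions.\<close>

lemma twist_relations:
 assumes tw: "twisting_system Q \<theta>"
  and N: "invertible N" "\<And>a. \<theta> n (pr (lin a)) = pr (lin (N *v a))"
  and N1: "invertible N1" "\<And>a. \<theta> 1 (pr (lin a)) = pr (lin (N1 *v a))"
  and N': "invertible N'" "\<And>a. \<theta> (n + 1) (pr (lin a)) = pr (lin (N' *v a))"
 shows "form_of_matrix (N ** G ** transpose (N' ** matrix_inv N1)) \<in> relations E \<sigma> \<longleftrightarrow> form_of_matrix G \<in> relations E \<sigma>"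
proof -
 define S where "S = N' ** matrix_inv N1"
 have t: "graded_linear_auto Q (\<theta> n)" using tw by (simp add: twisting_system_def)
 note F = gaddD[OF glaD(1)[OF t]]
 have prod: "\<theta> n (pr (lin a * lin c)) = pr (lin (N *v a) * lin (S *v c))" for a c
 proof -
  have "\<theta> n (pr (lin a) \<otimes>\<^bsub>Q\<^esub> \<theta> (int 1) (pr (lin (matrix_inv N1 *v c)))) =
   \<theta> n (pr (lin a)) \<otimes>\<^bsub>Q\<^esub> \<theta> (n + int 1) (pr (lin (matrix_inv N1 *v c)))"
   using tw lin_grade_1 unfolding twisting_system_def by blast
  then show ?thesis
   by (simp add: N N1 N' Q_mult matrix_inv_props[OF N1(1)] S_def matrix_vector_mul_assoc[symmetric])
 qed
 let ?r = "\<lambda>i. lin (axis i 1)*lin (G $ i)" and ?s = "\<lambda>i. lin (N *v axis i 1)*lin (S *v G $ i)"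
 have "\<theta> n (pr (form_of_matrix G)) = \<theta> n (pr (?r 1) \<oplus>\<^bsub>Q\<^esub> (pr (?r 2) \<oplus>\<^bsub>Q\<^esub> pr (?r 3)))"
  by (simp add: form_of_matrix_rows Q_add sum_3 add.assoc)
 also have "\<dots> = \<theta> n (pr (?r 1)) \<oplus>\<^bsub>Q\<^esub> (\<theta> n (pr (?r 2)) \<oplus>\<^bsub>Q\<^esub> \<theta> n (pr (?r 3)))"
 proof -
  have "pr f \<in> carrier Q" for f by (simp add: Q_carrier)
  then show ?thesis using F(1,2) by simp
 qed
 also have "\<dots> = pr (?s 1 + (?s 2 + ?s 3))" by (simp only: prod Q_add)
 also have "?s 1 + (?s 2 + ?s 3) = form_of_matrix (N ** G ** transpose S)"
  unfolding lin_mult form_of_matrix_add[symmetric]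
  by (rule arg_cong[of _ _ form_of_matrix])
   (simp add: vec_eq_iff transform_component sum_3 mult_axis add.assoc)
 finally have act: "\<theta> n (pr (form_of_matrix G)) = pr (form_of_matrix (N ** G ** transpose S))" .
 have z: "\<theta> n (pr 0) = pr 0" using F(4) by (simp add: Q_zero)
 have "pr (form_of_matrix (N ** G ** transpose S)) = pr 0 \<longleftrightarrow> pr (form_of_matrix G) = pr 0"
  using inj_onD[OF glaD(2)[OF t], of "pr (form_of_matrix G)" "pr 0"] act z by (auto simp: Q_carrier)
 then show ?thesis by (simp add: form_eq_0 S_def)
qed

text \<open>Makes matrices that agree on the points of \<open>E\<close> proportional. Linear span
  alone would be too weak: a diagonal matrix fixes the three coordinate points.\<close>

definition (in -) spanning :: "(('k::field)^3) set set \<Rightarrow> bool" where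
 "spanning E \<longleftrightarrow> (\<forall>T. (\<forall>p\<in>E. pmap T p = p) \<longrightarrow> (\<exists>c. \<forall>v. T *v v = c *s v))"

lemma transform_inverse:
 fixes N S G :: "'k^3^3"
 assumes "invertible N" "invertible S"
 shows "N ** (matrix_inv N ** G ** transpose (matrix_inv S)) ** transpose S = G"
proof -
 have "N ** (matrix_inv N ** G ** transpose (matrix_inv S)) ** transpose S =
  (N ** matrix_inv N) ** G ** (transpose (matrix_inv S) ** transpose S)"
  by (simp add: matrix_mul_assoc)
 also have "transpose (matrix_inv S) ** transpose S = transpose (S ** matrix_inv S)" by (simp add: matrix_transpose_mul)
 finally show ?thesis using assms by (simp only: matrix_inv_props transpose_mat matrix_mul_lid matrix_mul_rid)
qed

text \<open>Rigidity, applied to the transposes of \<open>N\<close> and \<open>S = N' N1^-1\<close>,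
  says that they agree on \<open>E\<close>; the spanning condition then makes \<open>N'\<close> a
  multiple of \<open>N N1\<close>.\<close>

lemma twist_matrices:
 assumes g: "geometric E \<sigma>" and r: "rigid E \<sigma>" and sp: "spanning E"
  and tw: "twisting_system Q \<theta>"
  and N: "invertible N" "\<And>a. \<theta> n (pr (lin a)) = pr (lin (N *v a))"
  and N1: "invertible N1" "\<And>a. \<theta> 1 (pr (lin a)) = pr (lin (N1 *v a))"
  and N': "invertible N'" "\<And>a. \<theta> (n + 1) (pr (lin a)) = pr (lin (N' *v a))"
 obtains d where "\<And>a. N' *v a = d *s (N *v (N1 *v a))"
proof -
 define S where "S = N' ** matrix_inv N1"
 have S: "invertible S" unfolding S_def using N' N1 matrix_inv_props by (blast intro: invertible_mult)
 note rel = twist_relations[OF tw N N1 N', folded S_def]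
 have rel': "form_of_matrix (matrix_inv N ** G ** transpose (matrix_inv S)) \<in> relations E \<sigma>"
  if "form_of_matrix G \<in> relations E \<sigma>" for G
  using rel[of "matrix_inv N ** G ** transpose (matrix_inv S)"] that by (simp add: transform_inverse N S)
 note A = geometric_transport[OF g N(1) S, OF rel[THEN iffD2]]
 note B = geometric_transport[OF g matrix_inv_props(1)[OF N(1)] matrix_inv_props(1)[OF S], OF rel']
 have tr: "pmap (transpose M) (pmap (transpose (matrix_inv M)) p) = p" if "invertible M" for M :: "'k^3^3" and p
  using that by (simp flip: pmap_mult matrix_transpose_mul add: matrix_inv_props transpose_mat)
 have pN: "preserves (transpose N) E"
  unfolding preserves_def
 proof (intro conjI equalityI subsetI)
  show "invertible (transpose N)" using N by (simp add: invertible_transpose)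
  fix p assume "p \<in> E"
  then show "p \<in> pmap (transpose N) ` E" using tr[OF N(1), of p] B(1)[of p] by (metis image_eqI)
 qed (use A(1) in auto)
 have E: "E \<subseteq> P2" "\<sigma> \<in> Bij E" using g by (auto simp: geometric_def)
 have \<sigma>E: "\<sigma> ` E = E" using E(2) by (simp add: Bij_def bij_betw_def)
 have AS: "pmap (transpose S) q \<in> E" if "q \<in> E" for q
 proof -
  have "q \<in> \<sigma> ` E" using \<sigma>E that by simp
  then obtain p where "p \<in> E" "q = \<sigma> p" by (rule imageE)
  then show ?thesis using A(1,2)[of p] Bij_mem[OF E(2), of "pmap (transpose N) p"] by simp
 qed
 have BS: "pmap (transpose (matrix_inv S)) q \<in> E" if "q \<in> E" for q
 proof -
  have "q \<in> \<sigma> ` E" using \<sigma>E that by simp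
  then obtain p where "p \<in> E" "q = \<sigma> p" by (rule imageE)
  then show ?thesis using B(1,2)[of p] Bij_mem[OF E(2), of "pmap (transpose (matrix_inv N)) p"] by simp
 qed
 have pS: "preserves (transpose S) E"
  unfolding preserves_def
 proof (intro conjI equalityI subsetI)
  show "invertible (transpose S)" using S by (simp add: invertible_transpose)
  fix p assume "p \<in> E"
  then show "p \<in> pmap (transpose S) ` E" using tr[OF S, of p] BS[of p] by (metis image_eqI)
 qed (use AS in auto)
 have eq: "pmap (transpose S) p = pmap (transpose N) p" if "p \<in> E" for p
  using r pN pS A(2) that unfolding rigid_def by blast
 have SN: "transpose N' = transpose N1 ** transpose S"
  by (simp add: S_def matrix_transpose_mul[symmetric] matrix_mul_assoc[symmetric] matrix_inv_props[OF N1(1)])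
 define M where "M = transpose N1 ** transpose N"
 have M: "invertible M" unfolding M_def using N N1 by (intro invertible_mult) (simp_all add: invertible_transpose)
 have "pmap (matrix_inv M ** transpose N') p = p" if "p \<in> E" for p
  using eq[OF that] pmap_inv(1)[OF M, of p] by (simp add: pmap_mult SN) (simp add: M_def pmap_mult)
 then obtain d where d: "\<And>v. (matrix_inv M ** transpose N') *v v = d *s v"
  using sp unfolding spanning_def by blast
 have "transpose N' *v v = d *s (M *v v)" for v
 proof -
  have "transpose N' *v v = M *v ((matrix_inv M ** transpose N') *v v)"
   by (simp add: matrix_vector_mul_assoc[symmetric] matrix_inv_props[OF M])
  then show ?thesis by (simp add: d vector_scalar_commute)
 qed
 then have e: "N' $ i $ j = d * (N ** N1) $ i $ j" for i j
  using mult_axis[of "transpose N'" i j] mult_axis[of M i j]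
  unfolding M_def matrix_transpose_mul[symmetric] by (simp add: transpose_def)
 have "N' *v a = d *s (N *v (N1 *v a))" for a
  by (simp add: matrix_vector_mul_assoc) (simp add: vec_eq_iff matrix_vector_mult_3 e algebra_simps)
 then show thesis using that by blast
qed

text \<open>The scalars comparing \<open>\<theta> (n + 1)\<close> with \<open>\<theta> n\<close>
  after \<open>\<theta> 1\<close> accumulate by induction to
  \<open>\<theta> n = c n (\<theta> 1)^n\<close> in degree one for \<open>n \<ge> 1\<close>, the
  input of \<open>twist_algebraic\<close>.\<close>

theorem Twist_eq:
 assumes g: "geometric E \<sigma>" and r: "rigid E \<sigma>" and sp: "spanning E"
 shows "Twist_alg (pair_algebra E \<sigma>) = Twist (pair_algebra E \<sigma>)"
proof -
 have "\<exists>\<theta>'. twisting_system Q \<theta>' \<and> algebraic Q \<theta>' \<and> (\<forall>x\<in>carrier Q. \<theta>' 0 x = x) \<and>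
  iso_class (twist Q \<theta>) = iso_class (twist Q \<theta>')" if tw: "twisting_system Q \<theta>" for \<theta>
 proof -
  have t: "graded_linear_auto Q (\<theta> n)" for n using tw by (simp add: twisting_system_def)
  have "\<exists>N. invertible N \<and> (\<forall>a. \<theta> n (pr (lin a)) = pr (lin (N *v a)))" for n
   using linear_action[OF t[of n]] by metis
  then obtain N where N: "\<And>n. invertible (N n)" "\<And>n a. \<theta> n (pr (lin a)) = pr (lin (N n *v a))" by metis
  have step: "\<exists>d. d \<noteq> 0 \<and> (\<forall>x\<in>grade Q 1. \<theta> (n + 1) x = d \<odot>\<^bsub>Q\<^esub> \<theta> n (\<theta> 1 x))" for n
  proof -
   obtain d where d: "\<And>a. N (n + 1) *v a = d *s (N n *v (N 1 *v a))"
    by (rule twist_matrices[OF g r sp tw N(1)[of n] N(2)[of n] N(1)[of 1] N(2)[of 1] N(1)[of "n + 1"] N(2)[of "n + 1"]]) blast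
   have "N (n + 1) *v axis 1 1 \<noteq> 0" using invertible_mult_nz[OF N(1)] by (simp add: axis_eq_0_iff)
   then have "d \<noteq> 0" using d[of "axis 1 1"] by auto
   moreover have "\<theta> (n + 1) x = d \<odot>\<^bsub>Q\<^esub> \<theta> n (\<theta> 1 x)" if "x \<in> grade Q 1" for x
    using that by (rule degree_1_cases) (simp add: N(2) d lin_smult Q_smult)
   ultimately show ?thesis by blast
  qed
  have "\<exists>c. c \<noteq> 0 \<and> (n = 1 \<longrightarrow> c = 1) \<and> (n \<ge> 1 \<longrightarrow> (\<forall>x\<in>grade Q 1. \<theta> (int n) x = c \<odot>\<^bsub>Q\<^esub> ((\<theta> 1) ^^ n) x))" for n :: nat
  proof (induction n)
   case 0
   show ?case by (rule exI[of _ 1]) simp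
  next
   case (Suc n)
   have g1: "\<theta> m x \<in> grade Q 1" if "x \<in> grade Q 1" for m x using gaddD(3)[OF glaD(1)[OF t] that] .
   show ?case
   proof (cases "n = 0")
    case True
    have "\<theta> 1 x = 1 \<odot>\<^bsub>Q\<^esub> \<theta> 1 x" if "x \<in> grade Q 1" for x using sm_one[OF gr_carrier[OF g1[OF that]]] by simp
    then show ?thesis using True by (intro exI[of _ 1]) simp
   next
    case False
    then obtain c where c: "c \<noteq> 0" "\<And>x. x \<in> grade Q 1 \<Longrightarrow> \<theta> (int n) x = c \<odot>\<^bsub>Q\<^esub> ((\<theta> 1) ^^ n) x" using Suc by auto
    obtain d where d: "d \<noteq> 0" "\<And>x. x \<in> grade Q 1 \<Longrightarrow> \<theta> (int n + 1) x = d \<odot>\<^bsub>Q\<^esub> \<theta> (int n) (\<theta> 1 x)" using step by blast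
    have "\<theta> (int (Suc n)) x = (d * c) \<odot>\<^bsub>Q\<^esub> ((\<theta> 1) ^^ Suc n) x" if x: "x \<in> grade Q 1" for x
    proof -
     have "((\<theta> 1) ^^ k) y \<in> grade Q 1" if "y \<in> grade Q 1" for k y using that by (induction k) (simp_all add: g1 del: One_nat_def)
     then have "((\<theta> 1) ^^ n) (\<theta> 1 x) \<in> carrier Q" using gr_carrier g1[OF x] by blast
     moreover have "\<theta> (int (Suc n)) x = d \<odot>\<^bsub>Q\<^esub> (c \<odot>\<^bsub>Q\<^esub> ((\<theta> 1) ^^ n) (\<theta> 1 x))"
      using d(2)[OF x] c(2)[OF g1[OF x]] by (simp add: add.commute)
     ultimately show ?thesis by (simp add: sm_assoc funpow_swap1)
    qed
    then show ?thesis using c(1) d(1) False by (intro exI[of _ "d * c"]) simp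
   qed
  qed
  then obtain c :: "nat \<Rightarrow> 'k" where c: "\<And>n. c n \<noteq> 0" "\<And>n. n = 1 \<Longrightarrow> c n = 1"
   "\<And>n x. n \<ge> 1 \<Longrightarrow> x \<in> grade Q 1 \<Longrightarrow> \<theta> (int n) x = c n \<odot>\<^bsub>Q\<^esub> ((\<theta> 1) ^^ n) x" by metis
  show ?thesis
   by (rule twist_algebraic[OF tw Q_degree_0 Q_generated c(1) c(2)[OF refl] c(3)])
 qed
 then have "Twist Q \<subseteq> Twist_alg Q" unfolding Twist_def Twist_alg_def by blast
 moreover have "Twist_alg Q \<subseteq> Twist Q" unfolding Twist_def Twist_alg_def by blast
 ultimately show ?thesis by (simp add: pair_algebra_def)
qed

end

section \<open>Matrices fixing every point of the curve\<close>

lemma spanningI: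
 fixes F :: "('k::field)^3 \<Rightarrow> 'k"
 assumes pr: "presents E \<sigma> F B"
  and main: "\<And>a b c d e f g h i. (\<And>x y z. F (vector [x, y, z]) = 0 \<Longrightarrow>
    (a * x + b * y + c * z) * y = (d * x + e * y + f * z) * x \<and>
    (a * x + b * y + c * z) * z = (g * x + h * y + i * z) * x \<and>
    (d * x + e * y + f * z) * z = (g * x + h * y + i * z) * y) \<Longrightarrow>
   b = 0 \<and> c = 0 \<and> d = 0 \<and> f = 0 \<and> g = 0 \<and> h = 0 \<and> e = a \<and> i = a"
 shows "spanning E"
 unfolding spanning_def
proof (intro allI impI)
 fix T :: "'k^3^3" assume fx: "\<forall>p\<in>E. pmap T p = p"
 obtain a b c d e f g h i where T: "T = m33 a b c d e f g h i" by (rule m33_cases)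
 have "b = 0 \<and> c = 0 \<and> d = 0 \<and> f = 0 \<and> g = 0 \<and> h = 0 \<and> e = a \<and> i = a"
 proof (rule main)
  fix x y z assume F: "F (vector [x, y, z]) = 0"
  show "(a * x + b * y + c * z) * y = (d * x + e * y + f * z) * x \<and>
    (a * x + b * y + c * z) * z = (g * x + h * y + i * z) * x \<and>
    (d * x + e * y + f * z) * z = (g * x + h * y + i * z) * y"
  proof (cases "x = 0 \<and> y = 0 \<and> z = 0")
   case False
   then have "pnt x y z \<in> E" using presentsD(4)[OF pr] F by simp
   then have "pnt (a*x + b*y + c*z) (d*x + e*y + f*z) (g*x + h*y + i*z) = pnt x y z"
    using fx unfolding T by (auto simp: m33_mult)
   from pnt_eqD[OF this] show ?thesis by simp
  qed simp
 qed
 then have "T *v v = a *s v" for v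
  by (simp add: T vec3_eq_iff matrix_vector_mult_3)
 then show "\<exists>c. \<forall>v. T *v v = c *s v" by blast
qed

lemma exists_primitive_cube_root:
 obtains \<omega> :: "'k::{alg_closed_field, field_char_0}" where "\<omega>\<^sup>2 + \<omega> + 1 = 0"
proof -
 obtain w :: 'k where "poly [:1, 1, 1:] w = 0"
  using alg_closed_imp_poly_has_root[of "[:1, 1, 1 :: 'k:]"] by auto
 then show thesis using that[of w] by (simp add: power2_eq_square algebra_simps)
qed

lemma primitive_cube_rootD:
 fixes \<omega> :: "'k::field_char_0"
 assumes "\<omega>\<^sup>2 + \<omega> + 1 = 0"
 shows "\<omega>^3 = 1" "\<omega> \<noteq> 1" "\<omega> \<noteq> 0" "\<omega> + 2 \<noteq> 0"
proof -
 have "\<omega>^3 - 1 = (\<omega> - 1)*(\<omega>\<^sup>2 + \<omega> + 1)" by (simp add: cubic_simps)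
 then show "\<omega>^3 = 1" using assms by simp
 show "\<omega> \<noteq> 1" using assms by auto
 show "\<omega> \<noteq> 0" using assms by auto
 show "\<omega> + 2 \<noteq> 0"
 proof
  assume "\<omega> + 2 = 0"
  then have "\<omega> = - 2" by (simp add: add_eq_0_iff2)
  then show False using assms by simp
 qed
qed

text \<open>A projectivity of the line with three fixed points is the identity; here the points are
  \<open>(1, -t)\<close> with \<open>t^3 = 1\<close>, and the entries are isolated by Fourier
  inversion over the cube roots of unity.\<close>

lemma three_points_fixed:
 fixes \<omega> a b d e :: "'k::field_char_0"
 assumes w: "\<omega>\<^sup>2 + \<omega> + 1 = 0"
  and fixed: "\<And>t. t^3 = 1 \<Longrightarrow> (a - b * t) * (- t) = d - e * t"
 shows "b = 0 \<and> d = 0 \<and> e = a"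
proof -
 note W = primitive_cube_rootD[OF w]
 have e1: "b - a - (d - e) = 0" using fixed[of 1] by simp
 have e2: "b*\<omega>\<^sup>2 - a*\<omega> - (d - e*\<omega>) = 0" using fixed[of \<omega>] W(1) by (simp add: algebra_simps power2_eq_square)
 have e3: "b * \<omega> - a * \<omega>\<^sup>2 - (d - e * \<omega>\<^sup>2) = 0"
 proof -
  have "(\<omega>\<^sup>2)^3 = (\<omega>^3)\<^sup>2" by (simp add: power_mult[symmetric] mult.commute)
  then have c: "(\<omega>\<^sup>2)^3 = 1" using W(1) by simp
  have "\<omega>\<^sup>2*\<omega>\<^sup>2 = \<omega>^3*\<omega>" by (simp add: power2_eq_square power3_eq_cube)
  then have "\<omega>\<^sup>2 * \<omega>\<^sup>2 = \<omega>" using W(1) by simp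
  moreover have "(a - b*\<omega>\<^sup>2)*(- (\<omega>\<^sup>2)) = b*(\<omega>\<^sup>2*\<omega>\<^sup>2) - a*\<omega>\<^sup>2" by (simp add: algebra_simps)
  ultimately show ?thesis using fixed[OF c] by simp
 qed
 have "3 * d = 0 \<and> 3 * b = 0 \<and> 3 * (a - e) = 0"
 proof (intro conjI)
  have "3*d = - ((b - a - (d - e)) + (b*\<omega>\<^sup>2 - a*\<omega> - (d - e*\<omega>)) + (b*\<omega> - a*\<omega>\<^sup>2 - (d - e*\<omega>\<^sup>2)))
   + (b - a + e) * (\<omega>\<^sup>2 + \<omega> + 1)" by (simp add: algebra_simps)
  then show "3 * d = 0" by (simp only: e1 e2 e3 w) simp
  have "3*b = (b - a - (d - e)) + \<omega>*(b*\<omega>\<^sup>2 - a*\<omega> - (d - e*\<omega>)) + \<omega>\<^sup>2*(b*\<omega> - a*\<omega>\<^sup>2 - (d - e*\<omega>\<^sup>2))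
   + 2*b*(1 - \<omega>^3) + (a - e + d)*(\<omega>\<^sup>2 + \<omega> + 1) + (e - a)*\<omega>*(1 - \<omega>^3)"
   by (simp add: cubic_simps)
  then show "3 * b = 0" by (simp only: e1 e2 e3 w W(1)) simp
  have "3*(a - e) = - ((b - a - (d - e)) + \<omega>\<^sup>2*(b*\<omega>\<^sup>2 - a*\<omega> - (d - e*\<omega>)) + \<omega>*(b*\<omega> - a*\<omega>\<^sup>2 - (d - e*\<omega>\<^sup>2)))
   + 2*(a - e)*(1 - \<omega>^3) + (b - d)*(\<omega>\<^sup>2 + \<omega> + 1) - b*\<omega>*(1 - \<omega>^3)"
   by (simp add: cubic_simps)
  then show "3 * (a - e) = 0" by (simp only: e1 e2 e3 w W(1)) simp
 qed
 then show ?thesis by simp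
qed

lemma spanning_P2: "spanning (P2 :: (('k::field)^3) set set)"
 unfolding spanning_def
proof (intro allI impI)
 fix T :: "'k^3^3" assume fx: "\<forall>p\<in>P2. pmap T p = p"
 obtain a b c d e f g h i where T: "T = m33 a b c d e f g h i" by (rule m33_cases)
 have eqs: "(a * x + b * y + c * z) * y = (d * x + e * y + f * z) * x \<and>
    (a * x + b * y + c * z) * z = (g * x + h * y + i * z) * x \<and>
    (d*x + e*y + f*z)*z = (g*x + h*y + i*z)*y" if "x \<noteq> 0 \<or> y \<noteq> 0 \<or> z \<noteq> 0" for x y z
 proof -
  have "pnt x y z \<in> P2" using that by simp
  then have "pnt (a*x + b*y + c*z) (d*x + e*y + f*z) (g*x + h*y + i*z) = pnt x y z"
   using fx unfolding T by (metis pmap_proj m33_mult)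
  from pnt_eqD[OF this] show ?thesis by simp
 qed
 have "T *v v = a *s v" for v
  using eqs[of 1 0 0] eqs[of 0 1 0] eqs[of 0 0 1] eqs[of 1 1 0] eqs[of 0 1 1]
  by (simp add: T vec3_eq_iff matrix_vector_mult_3)
 then show "\<exists>c. \<forall>v. T *v v = c *s v" by blast
qed

lemma spanning_S:
 fixes \<sigma> :: "(('k::field_char_0)^3) set \<Rightarrow> ('k^3) set"
 assumes "type_S E \<sigma>" shows "spanning E"
proof -
 obtain \<alpha> where "presents E \<sigma> (\<lambda>v. v $ 1 * v $ 2 * v $ 3) (sel3 (m33 0 0 0 0 0 1 0 (- \<alpha>) 0) (m33 0 0 (- \<alpha>) 0 0 0 1 0 0) (m33 0 1 0 (- \<alpha>) 0 0 0 0 0))"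
  using presents_S[OF assms] by (elim exE conjE)
 then show ?thesis
 proof (rule spanningI, goal_cases)
  case (1 a b c d e f g h i)
  from 1[of 1 0 0] 1[of 0 1 0] 1[of 0 0 1] 1[of 1 1 0] 1[of 0 1 1] show ?case by simp
 qed
qed

lemma spanning_S':
 fixes \<sigma> :: "(('k::field_char_0)^3) set \<Rightarrow> ('k^3) set"
 assumes "type_S' E \<sigma>" shows "spanning E"
proof -
 obtain \<alpha> l where al: "\<alpha> \<noteq> 0" "\<alpha>^3 \<noteq> 1" "\<alpha>*l = \<alpha>^3 - 1" and "presents E \<sigma> (\<lambda>v. v $ 1*((v $ 1)\<^sup>2 - l * v $ 2 * v $ 3)) (sel3 (m33 1 0 0 0 0 1 0 (- \<alpha>) 0) (m33 0 0 (- \<alpha>) 0 0 0 1 0 0) (m33 0 1 0 (- \<alpha>) 0 0 0 0 0))"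
  using presents_S'[OF assms] by (elim exE conjE)
 have l: "l \<noteq> 0" using al by auto
 show ?thesis
  using \<open>presents E \<sigma> _ _\<close>
 proof (rule spanningI, goal_cases)
  case (1 a b c d e f g h i)
  have 0: "b = 0" "h = 0" "c = 0" "f = 0" "i = e"
   using 1[of 0 1 0] 1[of 0 0 1] 1[of 0 1 1] by simp_all
  \<comment> \<open>The conic points \<open>(l, l, 1)\<close> and, further down,
    \<open>(-l, l, 1)\<close> complement the points of the line.\<close>
  have E: "(a*l + b*l + c*1)*l = (d*l + e*l + f*1)*l \<and> (a*l + b*l + c*1)*1 = (g*l + h*l + i*1)*l \<and> (d*l + e*l + f*1)*1 = (g*l + h*l + i*1)*l"
   by (rule 1) (simp add: power2_eq_square)
  have "l*(l*(a - e - d)) = (a*l + b*l + c*1)*l - (d*l + e*l + f*1)*l" "l*(a - (g*l + e)) = (a*l + b*l + c*1)*1 - (g*l + h*l + i*1)*l"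
   by (simp_all add: 0 algebra_simps)
  then have "l * (l * (a - e - d)) = 0" "l * (a - (g * l + e)) = 0" using E by simp_all
  then have 2: "a - e - d = 0" "a - (g*l + e) = 0" using l by (simp_all only: mult_eq_0_iff) simp_all
  have E: "(a*(- l) + b*l + c*1)*l = (d*(- l) + e*l + f*1)*(- l) \<and> (a*(- l) + b*l + c*1)*1 = (g*(- l) + h*l + i*1)*(- l) \<and> (d*(- l) + e*l + f*1)*1 = (g*(- l) + h*l + i*1)*l"
   by (rule 1) (simp add: power2_eq_square)
  have "- (l*(l*(a - e + d))) = (a*(- l) + b*l + c*1)*l - (d*(- l) + e*l + f*1)*(- l)" "- (l*(a - (e - g*l))) = (a*(- l) + b*l + c*1)*1 - (g*(- l) + h*l + i*1)*(- l)"
   by (simp_all add: 0 algebra_simps)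
  then have "l * (l * (a - e + d)) = 0" "l * (a - (e - g * l)) = 0" using E by simp_all
  then have 3: "a - e + d = 0" "a - (e - g*l) = 0" using l by (simp_all only: mult_eq_0_iff) simp_all
  have "2 * d = (a - e + d) - (a - e - d)" by simp
  then have d: "d = 0" by (simp only: 2 3) simp
  then have a: "e = a" using 2(1) by simp
  then have "g * l = 0" using 2(2) by simp
  then show ?case using 0 d a l by simp
 qed
qed

lemma spanning_T:
 fixes \<sigma> :: "(('k::field_char_0)^3) set \<Rightarrow> ('k^3) set"
 assumes "type_T E \<sigma>" shows "spanning E"
proof -
 obtain \<epsilon> :: 'k where ep: "\<epsilon>^3 = 1" "\<epsilon> \<noteq> 1" and pr: "presents E \<sigma> (\<lambda>v. (v $ 1)^3 + (v $ 2)^3) (sel3 (m33 0 1 0 (- 1) 0 0 0 0 0) (m33 0 0 1 0 (- 1) 0 (- 1) 0 0) (m33 1 0 0 0 0 1 0 (- 1) 0))"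
  using presents_T[OF assms] by (elim exE conjE)
 have "(\<epsilon> - 1)*(\<epsilon>\<^sup>2 + \<epsilon> + 1) = \<epsilon>^3 - 1" by (simp add: cubic_simps)
 then have w: "\<epsilon>\<^sup>2 + \<epsilon> + 1 = 0" using ep by simp
 show ?thesis
  using pr
 proof (rule spanningI, goal_cases)
  case (1 a b c d e f g h i)
  have 0: "c = 0" "f = 0" using 1[of 0 0 1] by simp_all
  have line: "(a - b * t) * (- t) = d - e * t \<and> g = h * t" if "t^3 = 1" for t
  proof -
   have "t \<noteq> 0" using that by auto
   then show ?thesis using 1[of 1 "- t" 0] that by (simp add: 0)
  qed
  then have 2: "b = 0 \<and> d = 0 \<and> e = a" using three_points_fixed[OF w] by blast
  have "h * \<epsilon> = h" using line[of 1] line[OF ep(1)] by simp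
  then have h: "h = 0" "g = 0" using ep(2) line[of 1] by simp_all
  show ?case using 1[of 1 "- 1" 1] 0 2 h by simp
 qed
qed

lemma spanning_T':
 fixes \<sigma> :: "(('k::field_char_0)^3) set \<Rightarrow> ('k^3) set"
 assumes "type_T' E \<sigma>" shows "spanning E"
 using presents_T'[OF assms]
proof (rule spanningI, goal_cases)
 case (1 a b c d e f g h i)
 have 0: "b = 0" "h = 0" "c = 0" "f = 0" "i = e"
  using 1[of 0 1 0] 1[of 0 0 1] 1[of 0 1 1] by simp_all
 have 2: "a = d + e" "a = g + e" using 1[of 1 1 1] by (simp_all add: 0)
 have "d + e = e - d" using 1[of 1 "- 1" 1] 2 by (simp add: 0)
 then have "2 * d = 0" by (simp add: algebra_simps)
 then show ?case using 0 2 by simp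
qed

lemma spanning_NC:
 fixes \<sigma> :: "(('k::{alg_closed_field, field_char_0})^3) set \<Rightarrow> ('k^3) set"
 assumes "type_NC E \<sigma>" shows "spanning E"
proof -
 obtain \<alpha> l where al: "\<alpha> \<noteq> 0" "\<alpha>^3 \<noteq> 1" "\<alpha>*l = \<alpha>^3 - 1"
  and pr: "presents E \<sigma> (\<lambda>v. (v $ 1)^3 + (v $ 2)^3 - l * v $ 1 * v $ 2 * v $ 3) (sel3 (m33 1 0 0 0 0 1 0 (- \<alpha>) 0) (m33 0 0 (- \<alpha>) 0 1 0 1 0 0) (m33 0 1 0 (- \<alpha>) 0 0 0 0 0))"
  using presents_NC[OF assms] by (elim exE conjE)
 have l: "l \<noteq> 0" using al by auto
 obtain \<omega> :: 'k where w: "\<omega>\<^sup>2 + \<omega> + 1 = 0" by (rule exists_primitive_cube_root)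
 note W = primitive_cube_rootD[OF w]
 show ?thesis
  using pr
 proof (rule spanningI, goal_cases)
  case (1 a b c d e f g h i)
  have 0: "c = 0" "f = 0" using 1[of 0 0 1] by simp_all
  have line: "(a - b * t) * (- t) = d - e * t \<and> g = h * t" if "t^3 = 1" for t
  proof -
   have "t \<noteq> 0" using that by auto
   then show ?thesis using 1[of 1 "- t" 0] that by (simp add: 0)
  qed
  then have 2: "b = 0 \<and> d = 0 \<and> e = a" using three_points_fixed[OF w] by blast
  have "h * \<omega> = h" using line[of 1] line[OF W(1)] by simp
  then have h: "h = 0" "g = 0" using W(2) line[of 1] by simp_all
  \<comment> \<open>A point of the cubic off the line \<open>z = 0\<close> and different from the
    node; it links the last diagonal entry to the others.\<close>
  show ?case using 1[of l l 2] 0 2 h l by (simp add: power3_eq_cube)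
 qed
qed

lemma spanning_CC:
 fixes \<sigma> :: "(('k::field_char_0)^3) set \<Rightarrow> ('k^3) set"
 assumes "type_CC E \<sigma>" shows "spanning E"
 using presents_CC[OF assms]
proof (rule spanningI, goal_cases)
 case (1 a b c d e f g h i)
 have 0: "b = 0" "h = 0" "c = 0" "f = 0"
  using 1[of 0 1 0] 1[of 0 0 1] by simp_all
 have 2: "a = d + e" "g + i = d + e" using 1[of 1 1 1] by (simp_all add: 0)
 have "d + e = e - d" using 1[of "- 1" 1 "- 1"] 2 by (simp add: 0)
 then have "2 * d = 0" by (simp add: algebra_simps)
 then have d: "d = 0" by simp
 have "2 * g + 8 * i = 8 * e" using 1[of 2 1 8] by (simp add: 0 d mult.commute)
 moreover have "g + i = e" using 2 d by simp
 moreover have "6*(i - e) = (2*g + 8*i) - 2*(g + i) - 6*e" by (simp add: algebra_simps)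
 ultimately have "6 * (i - e) = 8 * e - 2 * e - 6 * e" by (simp only:)
 then have "i = e" by simp
 then show ?case using 0 2 d by simp
qed

section \<open>Elliptic curves in Hesse form\<close>

abbreviation cub :: "'k::field \<Rightarrow> 'k^3 \<Rightarrow> 'k" where
 "cub l v \<equiv> hesse l (v $ 1) (v $ 2) (v $ 3)"

text \<open>One third of the derivative of the Hesse cubic at \<open>u\<close> in the direction
  \<open>w\<close>, so that \<open>3 * pol l u w\<close> is the coefficient of \<open>s^2 t\<close>
  along a line.\<close>

definition pol :: "'k::field \<Rightarrow> 'k^3 \<Rightarrow> 'k^3 \<Rightarrow> 'k" where
 "pol l u w = (u $ 1)\<^sup>2 * w $ 1 + (u $ 2)\<^sup>2 * w $ 2 + (u $ 3)\<^sup>2 * w $ 3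
   - l * (u $ 2 * u $ 3 * w $ 1 + u $ 1 * u $ 3 * w $ 2 + u $ 1 * u $ 2 * w $ 3)"

text \<open>Negation in the group law with zero element \<open>(1, -1, 0)\<close>, as
  \<open>cuts_line_origin\<close> shows.\<close>

definition swap :: "('k::field)^3 \<Rightarrow> 'k^3" where
 "swap v = vector [v $ 2, v $ 1, v $ 3]"

lemma swap_simps [simp]: "swap v $ 1 = v $ 2" "swap v $ 2 = v $ 1" "swap v $ 3 = v $ 3"
 by (simp_all add: swap_def)

lemma swap_eq_0 [simp]: "swap v = 0 \<longleftrightarrow> v = 0"
 by (auto simp: vec3_eq_iff)

lemma cub_line:
 "cub l (s *s u + t *s w) = s^3 * cub l u + 3 * s\<^sup>2*t*pol l u w + 3 * s*t\<^sup>2*pol l w u + t^3 * cub l w"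
 by (simp add: hesse_def pol_def cubic_simps)

lemma mem_hesse: "proj v \<in> locus (hesse l) \<longleftrightarrow> v \<noteq> 0 \<and> cub l v = 0"
 by (rule mem_locus[where n = 3]) (simp add: hesse_def power3_eq_cube algebra_simps)

lemma independent_if_proj_neq:
 fixes u w :: "('k::field)^3"
 assumes "u \<noteq> 0" "w \<noteq> 0" "proj u \<noteq> proj w" "s *s u + t *s w = 0"
 shows "s = 0 \<and> t = 0"
proof -
 have e: "s * u $ i = - (t * w $ i)" for i
  using assms(4) by (simp add: vec_eq_iff add_eq_0_iff2)
 have s: "s = 0"
 proof (rule ccontr)
  assume "s \<noteq> 0"
  have "s * (u $ i * w $ j) = s * (u $ j * w $ i)" for i j
   using e[of i] e[of j] by (simp add: mult.assoc[symmetric])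
  then have "u $ i*w $ j = u $ j*w $ i" for i j using \<open>s \<noteq> 0\<close> by (simp only: mult_cancel_left) simp
  then show False using proj_eqI assms(1-3) by blast
 qed
 then have "t *s w = 0" using assms(4) by simp
 then have "t = 0" using assms(2) by (simp only: vector_mul_eq_0) simp
 then show ?thesis using s by simp
qed

lemma cuts_lineI:
 assumes nz: "u1 \<noteq> 0" "u2 \<noteq> 0" "u3 \<noteq> 0"
  and ind: "\<And>s t. s *s u + t *s v = 0 \<Longrightarrow> s = 0 \<and> t = 0" and c: "c \<noteq> 0"
  and eq: "u1 = s1 *s u + t1 *s v" "u2 = s2 *s u + t2 *s v" "u3 = s3 *s u + t3 *s v"
  and F: "\<And>s t. F ((s *s u + t *s v) $ 1) ((s *s u + t *s v) $ 2) ((s *s u + t *s v) $ 3) =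
   c * (s * t1 - t * s1) * (s * t2 - t * s2) * (s * t3 - t * s3)"
 shows "cuts_line F (proj u1) (proj u2) (proj u3)"
 unfolding cuts_line_def Let_def
proof (rule conjI)
 show "{proj u1, proj u2, proj u3} \<subseteq> P2" using nz by simp
 show "\<exists>u v s1 t1 s2 t2 s3 t3 c. (\<forall>s t. s *s u + t *s v = 0 \<longrightarrow> s = 0 \<and> t = 0) \<and> c \<noteq> 0 \<and>
    proj u1 = proj (s1 *s u + t1 *s v) \<and> proj u2 = proj (s2 *s u + t2 *s v) \<and>
    proj u3 = proj (s3 *s u + t3 *s v) \<and>
    (\<forall>s t. F ((s *s u + t *s v) $ 1) ((s *s u + t *s v) $ 2) ((s *s u + t *s v) $ 3) =
      c * (s * t1 - t * s1) * (s * t2 - t * s2) * (s * t3 - t * s3))"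
  by (rule exI[of _ u], rule exI[of _ v], rule exI[of _ s1], rule exI[of _ t1], rule exI[of _ s2], rule exI[of _ t2],
   rule exI[of _ s3], rule exI[of _ t3], rule exI[of _ c])
   (use ind c F in \<open>simp add: eq\<close>)
qed

lemma cuts_lineE:
 assumes "cuts_line F p q r"
 obtains u v s1 t1 s2 t2 s3 t3 c where "\<And>s t. s *s u + t *s v = 0 \<Longrightarrow> s = 0 \<and> t = 0" "c \<noteq> 0"
  "p = proj (s1 *s u + t1 *s v)" "q = proj (s2 *s u + t2 *s v)" "r = proj (s3 *s u + t3 *s v)"
  "s1 *s u + t1 *s v \<noteq> 0" "s2 *s u + t2 *s v \<noteq> 0" "s3 *s u + t3 *s v \<noteq> 0"
  "\<And>s t. F ((s *s u + t *s v) $ 1) ((s *s u + t *s v) $ 2) ((s *s u + t *s v) $ 3) =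
   c * (s * t1 - t * s1) * (s * t2 - t * s2) * (s * t3 - t * s3)"
proof -
 have P: "p \<in> P2" "q \<in> P2" "r \<in> P2" using assms unfolding cuts_line_def by simp_all
 from assms obtain u v s1 t1 s2 t2 s3 t3 c where *: "\<forall>s t. s *s u + t *s v = 0 \<longrightarrow> s = 0 \<and> t = 0" "c \<noteq> 0"
  "p = proj (s1 *s u + t1 *s v)" "q = proj (s2 *s u + t2 *s v)" "r = proj (s3 *s u + t3 *s v)"
  "\<forall>s t. F ((s *s u + t *s v) $ 1) ((s *s u + t *s v) $ 2) ((s *s u + t *s v) $ 3) =
   c * (s * t1 - t * s1) * (s * t2 - t * s2) * (s * t3 - t * s3)"
  unfolding cuts_line_def Let_def by (elim conjE exE)
 have nz: "s1 *s u + t1 *s v \<noteq> 0" "s2 *s u + t2 *s v \<noteq> 0" "s3 *s u + t3 *s v \<noteq> 0"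
  using P *(3-5) by (simp_all only: proj_in_P2 not_False_eq_True)
 show thesis by (rule that[of u v c s1 t1 s2 t2 s3 t3]) (use * nz in simp_all)
qed

lemma mult_swap: "x * y * z = x * z * (y :: 'a::comm_semiring_1)"
 by (simp add: ac_simps)

lemma cuts_line_perm:
 assumes "cuts_line F p q r" shows "cuts_line F p r q"
proof -
 obtain u v s1 t1 s2 t2 s3 t3 c where *: "\<And>s t. s *s u + t *s v = 0 \<Longrightarrow> s = 0 \<and> t = 0" "c \<noteq> 0"
  "p = proj (s1 *s u + t1 *s v)" "q = proj (s2 *s u + t2 *s v)" "r = proj (s3 *s u + t3 *s v)"
  "s1 *s u + t1 *s v \<noteq> 0" "s2 *s u + t2 *s v \<noteq> 0" "s3 *s u + t3 *s v \<noteq> 0"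
  "\<And>s t. F ((s *s u + t *s v) $ 1) ((s *s u + t *s v) $ 2) ((s *s u + t *s v) $ 3) =
   c * (s * t1 - t * s1) * (s * t2 - t * s2) * (s * t3 - t * s3)"
  by (rule cuts_lineE[OF assms]) blast
 show ?thesis unfolding *(3-5)
 proof (rule cuts_lineI[OF *(6,8,7) _ *(2) refl refl refl])
  show "s = 0 \<and> t = 0" if "s *s u + t *s v = 0" for s t using that by (rule *(1))
  show "F ((s *s u + t *s v) $ 1) ((s *s u + t *s v) $ 2) ((s *s u + t *s v) $ 3) =
   c * (s * t1 - t * s1) * (s * t3 - t * s3) * (s * t2 - t * s2)" for s t
   by (rule trans[OF *(9)[of s t] mult_swap])
 qed
qed

lemma third_point_cuts:
 fixes u w :: "('k::field_char_0)^3"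
 assumes u: "u \<noteq> 0" "cub l u = 0" and w: "w \<noteq> 0" "cub l w = 0" and ne: "proj u \<noteq> proj w"
  and W: "W = pol l w u *s u - pol l u w *s w" "W \<noteq> 0"
 shows "cuts_line (hesse l) (proj u) (proj w) (proj W)"
proof (rule cuts_lineI[of u w W u w 3 1 0 0 1 "pol l w u" "- pol l u w"])
 show "s = 0 \<and> t = 0" if "s *s u + t *s w = 0" for s t
  by (rule independent_if_proj_neq[OF u(1) w(1) ne that])
 show "W = pol l w u *s u + (- pol l u w) *s w" by (simp add: W(1) vec3_eq_iff)
 show "cub l (s *s u + t *s w) = 3*(s*0 - t*1)*(s*1 - t*0)*(s*- pol l u w - t*pol l w u)" for s t
  unfolding cub_line by (simp add: u w power2_eq_square algebra_simps)
qed (use u w W in simp_all)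

text \<open>Recovers the two polar values from the values of the cubic at \<open>P + Q\<close> and
  \<open>P - Q\<close>.\<close>

lemma sum_difference:
 fixes x y :: "'k::field_char_0"
 assumes s: "3 * x + 3 * y = - c * d * (u + v)" and m: "- (3 * x) + 3 * y = c * d * (u - v)"
 shows "3 * y = - c * d * v" "3 * x = - c * d * u"
proof -
 have "2 * (3 * y) = (3 * x + 3 * y) + (- (3 * x) + 3 * y)" by simp
 also have "\<dots> = 2 * (- c * d * v)" unfolding s m by (simp add: algebra_simps)
 finally show "3 * y = - c * d * v" by (simp only: mult_cancel_left) simp
 have "2 * (3 * x) = (3 * x + 3 * y) - (- (3 * x) + 3 * y)" by simp
 also have "\<dots> = 2 * (- c * d * u)" unfolding s m by (simp add: algebra_simps)
 finally show "3 * x = - c * d * u" by (simp only: mult_cancel_left) simp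
qed

text \<open>Converse of \<open>third_point_cuts\<close>: in whatever parametrisation the line is
  given, the third point is the combination by polar values up to \<kappa>.\<close>

lemma cuts_line_reps:
 fixes p q r :: "(('k::field_char_0)^3) set"
 assumes cl: "cuts_line (hesse l) p q r" and ne: "p \<noteq> q"
 obtains P Q W \<kappa> where "P \<noteq> 0" "Q \<noteq> 0" "W \<noteq> 0" "p = proj P" "q = proj Q" "r = proj W" "\<kappa> \<noteq> 0"
  "\<kappa> *s W = pol l Q P *s P - pol l P Q *s Q" "cub l P = 0" "cub l Q = 0" "cub l W = 0"
proof -
 obtain u v s1 t1 s2 t2 s3 t3 c where *: "\<And>s t. s *s u + t *s v = 0 \<Longrightarrow> s = 0 \<and> t = 0" "c \<noteq> 0"
  "p = proj (s1 *s u + t1 *s v)" "q = proj (s2 *s u + t2 *s v)" "r = proj (s3 *s u + t3 *s v)"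
  "s1 *s u + t1 *s v \<noteq> 0" "s2 *s u + t2 *s v \<noteq> 0" "s3 *s u + t3 *s v \<noteq> 0"
  and F: "\<And>s t. cub l (s *s u + t *s v) = c*(s*t1 - t * s1)*(s*t2 - t * s2)*(s*t3 - t * s3)"
  by (rule cuts_lineE[OF cl]) blast
 define P Q W where PQW: "P = s1 *s u + t1 *s v" "Q = s2 *s u + t2 *s v" "W = s3 *s u + t3 *s v"
 define \<Delta> y z where d: "\<Delta> = s1*t2 - t1 * s2" "y = s1*t3 - t1 * s3" "z = s2*t3 - t2 * s3"
 have "\<Delta> \<noteq> 0"
 proof
  assume "\<Delta> = 0"
  have "P $ i * Q $ j - P $ j * Q $ i = \<Delta> * (u $ i * v $ j - u $ j * v $ i)" for i j
   by (simp add: PQW d algebra_simps)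
  then have "P $ i * Q $ j = P $ j * Q $ i" for i j using \<open>\<Delta> = 0\<close> by simp
  then have "proj P = proj Q" using proj_eqI[of P Q] *(6,7) by (simp add: PQW)
  then show False using ne *(3,4) by (simp add: PQW)
 qed
 have z: "cub l P = 0" "cub l Q = 0" "cub l W = 0" by (simp_all only: PQW F) simp_all
 have "1 *s P + 1 *s Q = (s1 + s2) *s u + (t1 + t2) *s v" "1 *s P + (- 1) *s Q = (s1 - s2) *s u + (t1 - t2) *s v"
  by (simp_all add: PQW vec3_eq_iff algebra_simps)
 then have s: "cub l (1 *s P + 1 *s Q) = - c*\<Delta>\<^sup>2*(y + z)" and m: "cub l (1 *s P + (- 1) *s Q) = c*\<Delta>\<^sup>2*(y - z)"
  by (simp_all only: F) (simp_all add: d power2_eq_square algebra_simps)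
 have s': "3*pol l P Q + 3*pol l Q P = - c*\<Delta>\<^sup>2*(y + z)" using s unfolding cub_line by (simp add: z)
 have m': "- (3*pol l P Q) + 3*pol l Q P = c*\<Delta>\<^sup>2*(y - z)" using m unfolding cub_line by (simp add: z)
 note \<beta> = sum_difference(1)[OF s' m'] and \<alpha> = sum_difference(2)[OF s' m']
 have "(c * \<Delta>^3 / 3) * W $ i = pol l Q P * P $ i - pol l P Q * Q $ i" for i
 proof -
  have "\<Delta> * W $ i = - z * P $ i + y * Q $ i" by (simp add: PQW d algebra_simps)
  then have "c*\<Delta>\<^sup>2*(\<Delta>*W $ i) = c*\<Delta>\<^sup>2*(- z*P $ i + y*Q $ i)" by simp
  also have "\<dots> = 3*pol l Q P*P $ i - 3*pol l P Q*Q $ i" unfolding \<alpha> \<beta> by (simp add: algebra_simps)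
  finally show ?thesis by (simp add: field_simps power2_eq_square power3_eq_cube)
 qed
 then have "(c*\<Delta>^3 / 3) *s W = pol l Q P *s P - pol l P Q *s Q" by (simp add: vec_eq_iff)
 then show thesis
  by (intro that[of P Q W "c*\<Delta>^3 / 3"]) (use z*\<open>\<Delta> \<noteq> 0\<close> in \<open>simp_all add: PQW\<close>)
qed

text \<open>Trilinear equations satisfied by the three points in which a line meets a Hesse cubic;
  \<open>l\<close> does not occur in them. Negating the last point turns them into the relations of
  the algebra.\<close>

definition tri_zero :: "('k::field)^3 \<Rightarrow> 'k^3 \<Rightarrow> 'k^3 \<Rightarrow> bool" where
 "tri_zero P Q W \<longleftrightarrow> P $ 1*Q $ 2*W $ 3 + P $ 2*Q $ 3*W $ 1 + P $ 3*Q $ 1*W $ 2 = 0 \<and>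
  P $ 1 * Q $ 3 * W $ 2 + P $ 2 * Q $ 1 * W $ 3 + P $ 3 * Q $ 2 * W $ 1 = 0 \<and>
  P $ 1 * Q $ 1 * W $ 1 + P $ 2 * Q $ 2 * W $ 2 + P $ 3 * Q $ 3 * W $ 3 = 0"

lemma tri_zero_perm: "tri_zero P Q W \<Longrightarrow> tri_zero P W Q"
 by (simp add: tri_zero_def ac_simps)

lemma tri_zero_smult:
 assumes "tri_zero P Q W"
 shows "tri_zero (a *s P) (b *s Q) (c *s W)"
proof -
 have "a*x1*(b*y1)*(c*z1) + a*x2*(b*y2)*(c*z2) + a*x3*(b*y3)*(c*z3) =
  a * b * c * (x1 * y1 * z1 + x2 * y2 * z2 + x3 * y3 * z3)" for x1 x2 x3 y1 y2 y3 z1 z2 z3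
  by (simp add: algebra_simps)
 then show ?thesis using assms by (simp add: tri_zero_def)
qed

text \<open>\<open>W\<close> enters linearly, so each equation expands in the quantities
  \<open>A1\<close>, \<open>B1\<close>, \<open>A2\<close>, \<open>B2\<close> formed from
  \<open>P\<close> and \<open>Q\<close>. All three reduce to \<open>A1 * B2 = A2 * B1\<close>, which
  holds because both points lie on the same curve.\<close>

lemma third_point_tri_zero:
 assumes P: "cub l P = 0" and Q: "cub l Q = 0" and k: "\<kappa> \<noteq> 0" and W: "\<kappa> *s W = pol l Q P *s P - pol l P Q *s Q"
 shows "tri_zero P Q W"
proof -
 define A1 where "A1 = (P $ 1)\<^sup>2*Q $ 1 + (P $ 2)\<^sup>2*Q $ 2 + (P $ 3)\<^sup>2*Q $ 3"
 define B1 where "B1 = (Q $ 1)\<^sup>2*P $ 1 + (Q $ 2)\<^sup>2*P $ 2 + (Q $ 3)\<^sup>2*P $ 3"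
 define A2 where "A2 = P $ 2 * P $ 3 * Q $ 1 + P $ 1 * P $ 3 * Q $ 2 + P $ 1 * P $ 2 * Q $ 3"
 define B2 where "B2 = Q $ 2 * Q $ 3 * P $ 1 + Q $ 1 * Q $ 3 * P $ 2 + Q $ 1 * Q $ 2 * P $ 3"
 have "A1*B2 - A2*B1 = cub l P*(Q $ 1*Q $ 2*Q $ 3) - cub l Q*(P $ 1*P $ 2*P $ 3)"
  by (simp add: A1_def A2_def B1_def B2_def hesse_def cubic_simps)
 then have AB: "A1 * B2 = A2 * B1" using P Q by simp
 have pq: "pol l P Q = A1 - l * A2" "pol l Q P = B1 - l * B2"
  by (simp_all add: pol_def A1_def A2_def B1_def B2_def)
 have w: "\<kappa> * W $ i = (B1 - l * B2) * P $ i - (A1 - l * A2) * Q $ i" for i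
  using arg_cong[OF W, of "\<lambda>x. x $ i"] by (simp add: pq algebra_simps)
 have lin: "\<kappa> * (x * W $ 1 + y * W $ 2 + z * W $ 3) =
  (B1 - l*B2)*(x*P $ 1 + y*P $ 2 + z*P $ 3) - (A1 - l*A2)*(x*Q $ 1 + y*Q $ 2 + z*Q $ 3)" for x y z
 proof -
  have "\<kappa>*(x*W $ 1 + y*W $ 2 + z*W $ 3) = x*(\<kappa>*W $ 1) + y*(\<kappa>*W $ 2) + z*(\<kappa>*W $ 3)"
   by (simp add: algebra_simps)
  then show ?thesis unfolding w by (simp add: algebra_simps)
 qed
 have "\<kappa>*(P $ 2*Q $ 3*W $ 1 + P $ 3*Q $ 1*W $ 2 + P $ 1*Q $ 2*W $ 3) = (B1 - l*B2)*A2 - (A1 - l*A2)*B2"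
  unfolding lin by (simp add: A2_def B2_def ac_simps)
 also have "\<dots> = A2 * B1 - A1 * B2" by (simp add: algebra_simps)
 finally have 1: "P $ 2 * Q $ 3 * W $ 1 + P $ 3 * Q $ 1 * W $ 2 + P $ 1 * Q $ 2 * W $ 3 = 0"
  using AB k by simp
 have "\<kappa>*(P $ 3*Q $ 2*W $ 1 + P $ 1*Q $ 3*W $ 2 + P $ 2*Q $ 1*W $ 3) = (B1 - l*B2)*A2 - (A1 - l*A2)*B2"
  unfolding lin by (simp add: A2_def B2_def ac_simps)
 also have "\<dots> = A2 * B1 - A1 * B2" by (simp add: algebra_simps)
 finally have 2: "P $ 3 * Q $ 2 * W $ 1 + P $ 1 * Q $ 3 * W $ 2 + P $ 2 * Q $ 1 * W $ 3 = 0"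
  using AB k by simp
 have "\<kappa>*(P $ 1*Q $ 1*W $ 1 + P $ 2*Q $ 2*W $ 2 + P $ 3*Q $ 3*W $ 3) = (B1 - l*B2)*A1 - (A1 - l*A2)*B1"
  unfolding lin by (simp add: A1_def B1_def power2_eq_square ac_simps)
 also have "\<dots> = l * (A2 * B1 - A1 * B2)" by (simp add: algebra_simps)
 finally have 3: "P $ 1 * Q $ 1 * W $ 1 + P $ 2 * Q $ 2 * W $ 2 + P $ 3 * Q $ 3 * W $ 3 = 0"
  using AB k by simp
 show ?thesis using 1 2 3 by (simp add: tri_zero_def ac_simps)
qed

text \<open>The bordered Hessian at a point of the curve, expressed through the tangent vector with vanishing first coordinate.\<close>

lemma bordered_hessian:
 fixes a b c :: "'k::field"
 assumes "hesse l a b c = 0" "a * b * c \<noteq> 0" "l^3 \<noteq> 1"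
 shows "b*(c\<^sup>2 - l*a*b)\<^sup>2 + c*(b\<^sup>2 - l*a * c)\<^sup>2 + l*a*(b\<^sup>2 - l*a * c)*(c\<^sup>2 - l*a*b) \<noteq> 0"
proof -
 have "b*(c\<^sup>2 - l*a*b)\<^sup>2 + c*(b\<^sup>2 - l*a * c)\<^sup>2 + l*a*(b\<^sup>2 - l*a * c)*(c\<^sup>2 - l*a*b)
  = b * c * hesse l a b c + (l^3 - 1) * a\<^sup>2 * (a * b * c)"
  by (simp add: hesse_def cubic_simps)
 then show ?thesis using assms by simp
qed

text \<open>By \<open>t\<close> the vector \<open>(0, y, z)\<close> is a tangent direction, and by
  \<open>h\<close> the contact along it has order at least three; the bordered Hessian excludes this
  off the coordinate lines.\<close>

lemma tangent_not_flex:
 fixes a b c :: "'k::field"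
 assumes "hesse l a b c = 0" "a * b * c \<noteq> 0" "l^3 \<noteq> 1"
  and t: "(b\<^sup>2 - l*a * c)*y + (c\<^sup>2 - l*a*b)*z = 0" and h: "b*y\<^sup>2 + c*z\<^sup>2 - l*a*y*z = 0"
 shows "y = 0 \<and> z = 0"
proof -
 define n2 n3 where n: "n2 = b\<^sup>2 - l * a * c" "n3 = c\<^sup>2 - l * a * b"
 define K where "K = b * n3\<^sup>2 + c * n2\<^sup>2 + l * a * n2 * n3"
 have K: "K \<noteq> 0" unfolding K_def n by (rule bordered_hessian[OF assms(1-3)])
 have t: "n2 * y + n3 * z = 0" using t by (simp only: n)
 have "y\<^sup>2*K = n3\<^sup>2*(b*y\<^sup>2 + c*z\<^sup>2 - l*a*y*z) + (n2*y + n3*z)*(c*(n2*y - n3*z) + l*a*y*n3)"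
  by (simp add: K_def power2_eq_square algebra_simps)
 then have y: "y = 0" using K by (simp only: t h) simp
 have "z\<^sup>2*K = n2\<^sup>2*(b*y\<^sup>2 + c*z\<^sup>2 - l*a*y*z) + (n2*y + n3*z)*(b*(n3*z - n2*y) + l*a*z*n2)"
  by (simp add: K_def power2_eq_square algebra_simps)
 then have "z = 0" using K by (simp only: t h) simp
 then show ?thesis using y by simp
qed

text \<open>The translating point of type EC: a point off the coordinate lines, that is, none of the
  flexes.\<close>

locale hesse_point =
 fixes l :: "'k::field_char_0" and P :: "'k^3"
 assumes l: "l^3 \<noteq> 1" and P: "cub l P = 0" and nz: "P $ 1 * P $ 2 * P $ 3 \<noteq> 0"
begin

lemma P_nz: "P \<noteq> 0" "P $ 1 \<noteq> 0" "P $ 2 \<noteq> 0" "P $ 3 \<noteq> 0"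
 using nz by auto

lemma not_flex:
 assumes "V $ 1 = 0" "pol l P V = 0" "pol l V P = 0"
 shows "V = 0"
proof -
 have "V $ 2 = 0 \<and> V $ 3 = 0"
 proof (rule tangent_not_flex[OF P nz l])
  show "((P $ 2)\<^sup>2 - l*P $ 1*P $ 3)*V $ 2 + ((P $ 3)\<^sup>2 - l*P $ 1*P $ 2)*V $ 3 = 0"
   using assms by (simp add: pol_def algebra_simps)
  show "P $ 2 * (V $ 2)\<^sup>2 + P $ 3 * (V $ 3)\<^sup>2 - l * P $ 1 * V $ 2 * V $ 3 = 0"
   using assms by (simp add: pol_def algebra_simps)
 qed
 then show ?thesis using assms(1) by (simp add: vec3_eq_iff)
qed

text \<open>If both polar values vanish, the cubic vanishes on the whole line through
  \<open>P\<close> and \<open>Q\<close>. The vector \<open>V\<close> of this line has first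
  coordinate 0, and unless it is zero \<open>P\<close> would be a flex.\<close>

lemma line_not_contained:
 assumes Q: "cub l Q = 0" "Q \<noteq> 0" and z: "pol l P Q = 0" "pol l Q P = 0"
 shows "proj P = proj Q"
proof -
 define V where "V = Q $ 1 *s P - P $ 1 *s Q"
 have "pol l P V = Q $ 1 * cub l P - P $ 1 * pol l P Q"
  by (simp add: V_def pol_def hesse_def cubic_simps)
 then have 1: "pol l P V = 0" using P z by simp
 have "pol l V P = (Q $ 1)\<^sup>2 * cub l P - 2*Q $ 1*P $ 1*pol l P Q + (P $ 1)\<^sup>2*pol l Q P"
  by (simp add: V_def pol_def hesse_def cubic_simps)
 then have 2: "pol l V P = 0" using P z by simp
 have "V = 0" by (rule not_flex[OF _ 1 2]) (simp add: V_def)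
 then have e: "Q $ 1 * P $ i = P $ 1 * Q $ i" for i by (simp add: V_def vec_eq_iff)
 have "Q = (Q $ 1 / P $ 1) *s P" using e P_nz by (simp add: vec_eq_iff field_simps)
 moreover from this have "Q $ 1 / P $ 1 \<noteq> 0" using Q(2) by (metis vector_smult_lzero)
 ultimately show ?thesis unfolding proj_eq_iff by blast
qed

lemma cuts_line_exists:
 assumes Q: "Q \<noteq> 0" "cub l Q = 0"
 shows "\<exists>W. W \<noteq> 0 \<and> cub l W = 0 \<and> cuts_line (hesse l) (proj P) (proj Q) (proj W)"
proof (cases "proj P = proj Q")
 case False
 define W where "W = pol l Q P *s P - pol l P Q *s Q"
 have "W \<noteq> 0"
 proof
  assume "W = 0"
  then have "pol l Q P *s P + (- pol l P Q) *s Q = 0" by (simp add: W_def vec3_eq_iff)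
  then have "pol l Q P = 0 \<and> - pol l P Q = 0" by (rule independent_if_proj_neq[OF P_nz(1) Q(1) False])
  then show False using line_not_contained[OF Q(2,1)] False by simp
 qed
 moreover have "cub l W = 0"
 proof -
  have e: "W = pol l Q P *s P + (- pol l P Q) *s Q" by (simp add: W_def vec3_eq_iff)
  show ?thesis unfolding e cub_line by (simp add: P Q power2_eq_square algebra_simps)
 qed
 ultimately show ?thesis using third_point_cuts[OF P_nz(1) P Q False W_def] by blast
next
 case True
 \<comment> \<open>The tangent direction at \<open>P\<close> with first coordinate 0. Along it the
   cubic is \<open>3 K s t^2 + t^3 * cub l V\<close>, which leaves the residual point
   \<open>W\<close> below.\<close>
 define V :: "'k^3" where "V = vector [0, (P $ 3)\<^sup>2 - l*P $ 1*P $ 2, - ((P $ 2)\<^sup>2 - l*P $ 1*P $ 3)]"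
 define K where "K = pol l V P"
 have PV: "pol l P V = 0" by (simp add: V_def pol_def algebra_simps)
 have "K = P $ 2*((P $ 3)\<^sup>2 - l*P $ 1*P $ 2)\<^sup>2 + P $ 3*((P $ 2)\<^sup>2 - l*P $ 1*P $ 3)\<^sup>2
   + l * P $ 1 * ((P $ 2)\<^sup>2 - l * P $ 1 * P $ 3) * ((P $ 3)\<^sup>2 - l * P $ 1 * P $ 2)"
  by (simp add: K_def V_def pol_def power2_eq_square algebra_simps)
 then have K: "K \<noteq> 0" using bordered_hessian[OF P nz l] by simp
 have V: "V \<noteq> 0" using K by (auto simp: K_def pol_def)
 have ne: "proj P \<noteq> proj V"
 proof
  assume "proj P = proj V"
  from proj_eq_cross[OF this, of 1] have "P $ 1 * V $ j = 0" for j by (simp add: V_def)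
  then show False using P_nz V by (simp add: vec_eq_iff)
 qed
 define W where "W = cub l V *s P + (- 3 * K) *s V"
 have W: "W \<noteq> 0"
  using independent_if_proj_neq[OF P_nz(1) V ne, of "cub l V" "- 3*K"] K by (auto simp: W_def)
 have cuts: "cuts_line (hesse l) (proj P) (proj P) (proj W)"
 proof (rule cuts_lineI[of P P W P V "- 1" 1 0 1 0 "cub l V" "- 3 * K"])
  show "s = 0 \<and> t = 0" if "s *s P + t *s V = 0" for s t
   by (rule independent_if_proj_neq[OF P_nz(1) V ne that])
  show "cub l (s *s P + t *s V) = - 1*(s*0 - t*1)*(s*0 - t*1)*(s*(- 3*K) - t * cub l V)" for s t
   unfolding cub_line by (simp add: P PV K_def[symmetric] cubic_simps)
 qed (use P_nz W in \<open>simp_all add: W_def\<close>)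
 have "cub l W = 0"
  unfolding W_def cub_line by (simp add: P PV K_def[symmetric] cubic_simps)
 then show ?thesis using W cuts True by auto
qed

text \<open>If one of \<open>q\<close>, \<open>r\<close> differs from \<open>P\<close>, the polar
  formula applies, after exchanging the two if necessary. What remains is a line meeting the curve
  three times at \<open>P\<close>, which is impossible because \<open>P\<close> is not a
  flex.\<close>

lemma cuts_line_tri_zero:
 assumes cl: "cuts_line (hesse l) (proj P) q r"
 obtains Q W where "Q \<noteq> 0" "W \<noteq> 0" "q = proj Q" "r = proj W" "tri_zero P Q W"
proof (cases "proj P = q")
 case False
 obtain P' Q W \<kappa> where *: "P' \<noteq> 0" "Q \<noteq> 0" "W \<noteq> 0" "proj P = proj P'" "q = proj Q" "r = proj W" "\<kappa> \<noteq> 0"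
  "\<kappa> *s W = pol l Q P' *s P' - pol l P' Q *s Q" "cub l P' = 0" "cub l Q = 0" "cub l W = 0"
  by (rule cuts_line_reps[OF cl False])
 have t: "tri_zero P' Q W" by (rule third_point_tri_zero[OF *(9,10,7,8)])
 obtain k where "P = k *s P'" using *(4) by (metis proj_eq_iff)
 then have "tri_zero P Q W" using tri_zero_smult[OF t, of k 1 1] by simp
 then show thesis using that * by blast
next
 case q: True
 show thesis
 proof (cases "proj P = r")
  case False
  obtain P' R W \<kappa> where *: "P' \<noteq> 0" "R \<noteq> 0" "W \<noteq> 0" "proj P = proj P'" "r = proj R" "q = proj W" "\<kappa> \<noteq> 0"
   "\<kappa> *s W = pol l R P' *s P' - pol l P' R *s R" "cub l P' = 0" "cub l R = 0" "cub l W = 0"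
   by (rule cuts_line_reps[OF cuts_line_perm[OF cl] False])
  have t: "tri_zero P' R W" by (rule third_point_tri_zero[OF *(9,10,7,8)])
  obtain k where "P = k *s P'" using *(4) by (metis proj_eq_iff)
  then have "tri_zero P R W" using tri_zero_smult[OF t, of k 1 1] by simp
  then show thesis using that[OF *(3,2,6,5)] tri_zero_perm by blast
 next
  case r: True
  obtain u v s1 t1 s2 t2 s3 t3 c where *: "\<And>s t. s *s u + t *s v = 0 \<Longrightarrow> s = 0 \<and> t = 0" "c \<noteq> 0"
   "proj P = proj (s1 *s u + t1 *s v)" "q = proj (s2 *s u + t2 *s v)" "r = proj (s3 *s u + t3 *s v)"
   "s1 *s u + t1 *s v \<noteq> 0" "s2 *s u + t2 *s v \<noteq> 0" "s3 *s u + t3 *s v \<noteq> 0"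
   and F: "\<And>s t. cub l (s *s u + t *s v) = c*(s*t1 - t * s1)*(s*t2 - t * s2)*(s*t3 - t * s3)"
   by (rule cuts_lineE[OF cl]) blast
  have par: "\<exists>k. s' = k * s1 \<and> t' = k*t1" if "proj P = proj (s' *s u + t' *s v)" for s' t'
  proof -
   have "proj (s1 *s u + t1 *s v) = proj (s' *s u + t' *s v)" using that *(3) by simp
   then obtain k where "s' *s u + t' *s v = k *s (s1 *s u + t1 *s v)" by (auto simp: proj_eq_iff)
   then have "(s' - k * s1) *s u + (t' - k*t1) *s v = 0" by (simp add: vec_eq_iff algebra_simps)
   from *(1)[OF this] show ?thesis by (intro exI[of _ k]) simp
  qed
  obtain k2 where k2: "s2 = k2 * s1" "t2 = k2 * t1" using par[of s2 t2] q *(4) by auto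
  obtain k3 where k3: "s3 = k3 * s1" "t3 = k3 * t1" using par[of s3 t3] r *(5) by auto
  obtain k where k: "s1 *s u + t1 *s v = k *s P" "k \<noteq> 0" using *(3) by (auto simp: proj_eq_iff)
  \<comment> \<open>The vector of the line with first coordinate 0; the cubic along
    \<open>s P + t V\<close> is a multiple of \<open>t^3\<close>, so both polar values of
    \<open>P\<close> and \<open>V\<close> vanish.\<close>
  define V where "V = v $ 1 *s u + (- (u $ 1)) *s v"
  define C where "C = c * k2 * k3"
  have cub: "cub l (s *s P + t *s V) = C * (t * P $ 1 * k)^3" for s t
  proof -
   have "P = inverse k *s (s1 *s u + t1 *s v)" using k by (simp add: vector_smult_assoc)
   then have "s *s P + t *s V = (s*inverse k * s1 + t * v $ 1) *s u + (s*inverse k*t1 - t*u $ 1) *s v"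
    by (simp add: V_def vec_eq_iff algebra_simps)
   then have "cub l (s *s P + t *s V) = C*((s*inverse k * s1 + t * v $ 1)*t1 - (s*inverse k*t1 - t*u $ 1) * s1)^3"
    by (simp only: F) (simp add: k2 k3 C_def power3_eq_cube algebra_simps)
   also have "(s*inverse k * s1 + t * v $ 1)*t1 - (s*inverse k*t1 - t*u $ 1) * s1 = t*((s1 *s u + t1 *s v) $ 1)"
    by (simp add: algebra_simps)
   finally show ?thesis by (simp add: k(1) ac_simps)
  qed
  define D where "D = C * (P $ 1 * k)^3"
  have 1: "3*pol l P V + 3*pol l V P + cub l V = D" using cub[of 1 1] unfolding cub_line by (simp add: P D_def)
  have 2: "- (3 * pol l P V) + 3 * pol l V P - cub l V = - D"
   using cub[of 1 "- 1"] unfolding cub_line by (simp add: P D_def power3_eq_cube)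
  have 3: "cub l V = D" using cub[of 0 1] unfolding cub_line by (simp add: D_def)
  have "6*pol l V P = (3*pol l P V + 3*pol l V P + cub l V) + (- (3*pol l P V) + 3*pol l V P - cub l V)" by simp
  then have a: "pol l V P = 0" by (simp only: 1 2) simp
  then have b: "pol l P V = 0" using 1 3 by simp
  have "V = 0" by (rule not_flex[OF _ b a]) (simp add: V_def)
  then have "v $ 1 = 0 \<and> - (u $ 1) = 0" unfolding V_def by (rule *(1))
  then have "(k *s P) $ 1 = 0" unfolding k(1)[symmetric] by simp
  then show thesis using k(2) P_nz by simp
 qed
qed

end

definition origin :: "('k::field)^3" where "origin = vector [1, - 1, 0]"

text \<open>The tangent at \<open>origin\<close>, spanned by \<open>origin\<close> and
  \<open>U\<close>, is a flex tangent and has no further point on the curve. For other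
  \<open>W\<close> its linear form \<open>X\<close> is therefore nonzero and cancels from the polar
  formula.\<close>

lemma cuts_line_origin:
 fixes W :: "('k::field_char_0)^3"
 assumes l: "l^3 \<noteq> 1" and W: "W \<noteq> 0" "cub l W = 0"
 shows "cuts_line (hesse l) (proj origin) (proj W) (proj (swap W))"
proof (cases "proj origin = proj W")
 case True
 define U :: "'k^3" where "U = vector [- l, 0, 1]"
 obtain k where k: "W = k *s origin" "k \<noteq> 0" using True by (auto simp: proj_eq_iff)
 have "swap W = (- k) *s origin" by (simp add: k origin_def vec3_eq_iff)
 moreover have "proj ((- k) *s origin) = proj origin" by (rule proj_smult) (use k(2) in simp)
 ultimately have s: "proj (swap W) = proj origin" by (simp only:)
 have "cuts_line (hesse l) (proj origin) (proj origin) (proj origin)"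
 proof (rule cuts_lineI[of origin origin origin origin U "- (1 - l^3)" 1 0 1 0 1 0])
  show "s = 0 \<and> t = 0" if "s *s origin + t *s U = 0" for s t
   using that by (simp add: origin_def U_def vec3_eq_iff)
  show "cub l (s *s origin + t *s U) = - (1 - l^3)*(s*0 - t*1)*(s*0 - t*1)*(s*0 - t*1)" for s t
   by (simp add: origin_def U_def hesse_def power3_eq_cube algebra_simps)
 qed (use l in \<open>simp_all add: origin_def vec3_eq_iff\<close>)
 then show ?thesis using True s by simp
next
 case False
 define X where "X = W $ 1 + W $ 2 + l * W $ 3"
 have pw: "pol l origin W = X" by (simp add: pol_def origin_def X_def algebra_simps)
 have wp: "pol l W origin = (W $ 1 - W $ 2) * X"
  by (simp add: pol_def origin_def X_def power2_eq_square algebra_simps)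
 have W': "pol l W origin *s origin - pol l origin W *s W = (- X) *s swap W"
  unfolding pw wp by (simp add: origin_def vec3_eq_iff algebra_simps)
 have X: "X \<noteq> 0"
 proof
  assume X: "X = 0"
  have "cub l W = (1 - l^3)*(W $ 3)^3 + X*(X\<^sup>2 - 3*X*l*W $ 3 + 3*l\<^sup>2*(W $ 3)\<^sup>2 - 3*W $ 1*W $ 2)"
   by (simp add: hesse_def X_def cubic_simps)
  then have z: "W $ 3 = 0" using W X l by simp
  then have "W = W $ 1 *s origin" using X by (simp add: X_def origin_def vec3_eq_iff add_eq_0_iff)
  then have "W $ 1 \<noteq> 0 \<and> W = W $ 1 *s origin" using W(1) by (metis vector_smult_lzero)
  then show False using False proj_eq_iff by metis
 qed
 have "cuts_line (hesse l) (proj origin) (proj W) (proj ((- X) *s swap W))"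
 proof (rule third_point_cuts[OF _ _ W False W'[symmetric]])
  show "(- X) *s swap W \<noteq> 0" using X W by (simp add: vector_mul_eq_0)
 qed (simp_all add: origin_def hesse_def)
 moreover have "proj ((- X) *s swap W) = proj (swap W)" by (rule proj_smult) (use X in simp)
 ultimately show ?thesis by (simp only:)
qed

text \<open>For \<open>w\<close> different from \<open>origin\<close> the polar formula determines
  \<open>r\<close> up to scalars. If \<open>w\<close> is \<open>origin\<close>, the symmetry in the
  last two points moves the argument to \<open>r\<close>.\<close>

lemma cuts_line_origin_unique:
 fixes W :: "('k::field_char_0)^3"
 assumes cl: "cuts_line (hesse l) (proj origin) w r" and w: "w = proj W" "W \<noteq> 0"
 shows "r = proj (swap W)"
proof -
 have ne: "r' = proj (swap Q')" if cl: "cuts_line (hesse l) (proj origin) q' r'" and ne: "proj origin \<noteq> q'" and q': "q' = proj Q'" "Q' \<noteq> 0" for q' r' Q'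
 proof -
  obtain P Q R \<kappa> where *: "P \<noteq> 0" "Q \<noteq> 0" "R \<noteq> 0" "proj origin = proj P" "q' = proj Q" "r' = proj R" "\<kappa> \<noteq> 0"
   "\<kappa> *s R = pol l Q P *s P - pol l P Q *s Q" "cub l P = 0" "cub l Q = 0" "cub l R = 0"
   by (rule cuts_line_reps[OF cl ne])
  obtain k where k: "P = k *s origin" "k \<noteq> 0" using *(4) by (auto simp: proj_eq_iff)
  have "proj Q = proj Q'" using *(5) q' by simp
  then obtain j where j: "Q' = j *s Q" "j \<noteq> 0" unfolding proj_eq_iff by blast
  define X where "X = Q $ 1 + Q $ 2 + l * Q $ 3"
  have pw: "pol l P Q = k\<^sup>2*X" by (simp add: k pol_def origin_def X_def power2_eq_square algebra_simps)
  have wp: "pol l Q P = k * (Q $ 1 - Q $ 2) * X"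
   by (simp add: k pol_def origin_def X_def power2_eq_square algebra_simps)
  have e: "\<kappa> *s R = (- (k\<^sup>2) * X) *s swap Q"
   unfolding *(8) pw wp by (simp add: k origin_def vec3_eq_iff power2_eq_square algebra_simps)
  have "\<kappa> *s R \<noteq> 0" using *(3,7) by (simp add: vector_mul_eq_0)
  then have X: "- (k\<^sup>2) * X \<noteq> 0" unfolding e by (auto simp: vector_mul_eq_0)
  have "proj R = proj (\<kappa> *s R)" using *(7) by (simp add: proj_smult)
  also have "\<dots> = proj (swap Q)" unfolding e using X by (rule proj_smult)
  also have "\<dots> = proj (j *s swap Q)" using j(2) by (simp add: proj_smult)
  also have "j *s swap Q = swap Q'" by (simp add: j vec3_eq_iff)
  finally show ?thesis using *(6) by simp
 qed
 have so: "swap (k *s origin) = (- k) *s origin" for k :: 'k by (simp add: origin_def vec3_eq_iff)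
 show ?thesis
 proof (cases "proj origin = w")
  case False
  then show ?thesis using ne[OF cl] w by simp
 next
  case o: True
  then obtain k where k: "W = k *s origin" "k \<noteq> 0" using w by (auto simp: proj_eq_iff)
  have sw: "proj (swap W) = proj origin" unfolding k so by (rule proj_smult) (use k in simp)
  show ?thesis
  proof (cases "proj origin = r")
   case False
   have "r \<in> P2" using cl unfolding cuts_line_def by simp
   then obtain R where R: "R \<noteq> 0" "r = proj R" by (rule P2_cases)
   have "w = proj (swap R)" by (rule ne[OF cuts_line_perm[OF cl] False R(2,1)])
   then obtain j where j: "swap R = j *s origin" "j \<noteq> 0" using o by (auto simp: proj_eq_iff)
   have "R = swap (swap R)" by (simp add: vec3_eq_iff)
   then have "R = (- j) *s origin" by (simp only: j so)
   moreover have "proj ((- j) *s origin) = proj origin" by (rule proj_smult) (use j(2) in simp)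
   ultimately have "r = proj origin" using R(2) by (simp only:)
   then show ?thesis using False by simp
  qed (simp add: sw)
 qed
qed

section \<open>Translations as zeros of the Sklyanin relations\<close>

abbreviation EC_forms :: "('k::field)^3 \<Rightarrow> 3 \<Rightarrow> 'k^3^3" where
 "EC_forms P \<equiv> sel3 (m33 (P $ 3) 0 0 0 0 (P $ 1) 0 (P $ 2) 0) (m33 0 0 (P $ 2) 0 (P $ 3) 0 (P $ 1) 0 0) (m33 0 (P $ 1) 0 (P $ 2) 0 0 0 0 (P $ 3))"

lemma EC_forms_zero:
 "(\<forall>k. bil (EC_forms P k) v w = 0) \<longleftrightarrow>
  P $ 3 * v $ 1 * w $ 1 + P $ 1 * v $ 2 * w $ 3 + P $ 2 * v $ 3 * w $ 2 = 0 \<and>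
  P $ 3 * v $ 2 * w $ 2 + P $ 1 * v $ 3 * w $ 1 + P $ 2 * v $ 1 * w $ 3 = 0 \<and>
  P $ 3 * v $ 3 * w $ 3 + P $ 1 * v $ 1 * w $ 2 + P $ 2 * v $ 2 * w $ 1 = 0"
 by (simp add: forall_3 bil_def sum_3 ac_simps)

text \<open>For \<open>P = (a, b, c)\<close> the forms are the Sklyanin relation
  \<open>c x^2 + a yz + b zy\<close> and its cyclic images; exchanging the first two coordinates of
  the last argument matches them with the collinearity equations.\<close>

lemma tri_zero_EC_forms: "tri_zero P v w \<longleftrightarrow> (\<forall>k. bil (EC_forms P k) v (swap w) = 0)"
 unfolding EC_forms_zero by (auto simp: tri_zero_def ac_simps)

text \<open>Rank one at a nonzero vector forces \<open>a^3 = b^3 = c^3\<close>; the equation of the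
  curve at \<open>(a, b, c)\<close> then gives \<open>l^3 = 1\<close>.\<close>

lemma hesse_minors:
 fixes a b c :: "'k::field_char_0"
 assumes P: "hesse l a b c = 0" and nz: "a * b * c \<noteq> 0" and l: "l^3 \<noteq> 1"
  and m: "b * c * v1\<^sup>2 = a\<^sup>2 * v2 * v3" "a * c * v1\<^sup>2 = b\<^sup>2 * v2 * v3" "a*b * v1\<^sup>2 = c\<^sup>2 * v2 * v3"
   "b * c * v2\<^sup>2 = a\<^sup>2 * v1 * v3" "b * c * v3\<^sup>2 = a\<^sup>2 * v1 * v2"
 shows "v1 = 0 \<and> v2 = 0 \<and> v3 = 0"
proof (cases "v1 = 0")
 case True
 then show ?thesis using m nz by simp
next
 case False
 have v: "v2 * v3 \<noteq> 0" using m(1) nz False by auto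
 have "(b * c * v1\<^sup>2)*(b\<^sup>2 * v2 * v3) = (a\<^sup>2 * v2 * v3)*(a * c * v1\<^sup>2)" using m(1,2) by simp
 then have "(c * v1\<^sup>2 * (v2 * v3)) * b^3 = (c * v1\<^sup>2 * (v2 * v3)) * a^3"
  by (simp add: power2_eq_square power3_eq_cube ac_simps)
 then have ba: "b^3 = a^3" using nz False v by (simp only: mult_cancel_left) auto
 have "(b * c * v1\<^sup>2)*(c\<^sup>2 * v2 * v3) = (a\<^sup>2 * v2 * v3)*(a*b * v1\<^sup>2)" using m(1,3) by simp
 then have "(b * v1\<^sup>2 * (v2 * v3)) * c^3 = (b * v1\<^sup>2 * (v2 * v3)) * a^3"
  by (simp add: power2_eq_square power3_eq_cube ac_simps)
 then have ca: "c^3 = a^3" using nz False v by (simp only: mult_cancel_left) auto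
 have "3 * a^3 = 3 * (l * a * b * c)" using P by (simp add: hesse_def ba ca algebra_simps)
 then have "a^3 = l * a * b * c" by simp
 then have "(a^3)^3 = (l * a * b * c)^3" by simp
 also have "\<dots> = l^3 * (a^3)^3" by (simp add: power_mult_distrib ba ca)
 finally have "l^3 = 1" using nz by simp
 then show ?thesis using l by simp
qed

context hesse_point
begin

text \<open>The determinants are \<open>-abc\<close> times the cubic because
  \<open>a^3 + b^3 + c^3 = 3 l a b c\<close> at \<open>P\<close>. The description in
  \<open>cubic_add\<close> is evaluated by showing that every candidate solves the bilinear
  equations, whose solution is unique.\<close>

lemma presents_EC: "presents (locus (hesse l)) (translation l (proj P)) (cub l) (EC_forms P)"
proof (rule presentsI)
 have S: "(P $ 1)^3 + (P $ 2)^3 + (P $ 3)^3 = 3*l*(P $ 1*P $ 2*P $ 3)" using P by (simp add: hesse_def algebra_simps)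
 have det: "det (lmat (EC_forms P) v) = - (P $ 1*P $ 2*P $ 3) * cub l v" "det (rmat (EC_forms P) v) = - (P $ 1*P $ 2*P $ 3) * cub l v" for v
 proof -
  have "det (lmat (EC_forms P) v) = ((P $ 1)^3 + (P $ 2)^3 + (P $ 3)^3)*(v $ 1 * v $ 2 * v $ 3)
    - (P $ 1 * P $ 2 * P $ 3) * ((v $ 1)^3 + (v $ 2)^3 + (v $ 3)^3)"
   by (simp add: det_3 lmat_def sum_3 power3_eq_cube algebra_simps)
  then show "det (lmat (EC_forms P) v) = - (P $ 1 * P $ 2 * P $ 3) * cub l v"
   unfolding S by (simp add: hesse_def algebra_simps)
  have "det (rmat (EC_forms P) v) = ((P $ 1)^3 + (P $ 2)^3 + (P $ 3)^3)*(v $ 1 * v $ 2 * v $ 3)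
    - (P $ 1 * P $ 2 * P $ 3) * ((v $ 1)^3 + (v $ 2)^3 + (v $ 3)^3)"
   by (simp add: det_3 rmat_def sum_3 power3_eq_cube algebra_simps)
  then show "det (rmat (EC_forms P) v) = - (P $ 1 * P $ 2 * P $ 3) * cub l v"
   unfolding S by (simp add: hesse_def algebra_simps)
 qed
 show "det (lmat (EC_forms P) v) = 0 \<longleftrightarrow> cub l v = 0" "det (rmat (EC_forms P) v) = 0 \<longleftrightarrow> cub l v = 0" for v
  unfolding det using nz by simp_all
 show minL: False if "v \<noteq> 0" "minors_zero (lmat (EC_forms P) v)" for v
 proof -
  note M = minors_zeroD[OF that(2)]
  have "v $ 1 = 0 \<and> v $ 2 = 0 \<and> v $ 3 = 0"
   by (rule hesse_minors[OF P nz l]) (use M in \<open>simp_all add: lmat_def sum_3 power2_eq_square ac_simps\<close>)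
  then show False using that(1) by (simp add: vec3_eq_iff)
 qed
 show False if "v \<noteq> 0" "minors_zero (rmat (EC_forms P) v)" for v
 proof -
  note M = minors_zeroD[OF that(2)]
  have P': "hesse l (P $ 2) (P $ 1) (P $ 3) = 0" "P $ 2 * P $ 1 * P $ 3 \<noteq> 0"
   using P nz by (simp_all add: hesse_def ac_simps)
  have "v $ 1 = 0 \<and> v $ 2 = 0 \<and> v $ 3 = 0"
   by (rule hesse_minors[OF P' l]) (use M in \<open>simp_all add: rmat_def sum_3 power2_eq_square ac_simps\<close>)
  then show False using that(1) by (simp add: vec3_eq_iff)
 qed
 show "proj v \<in> locus (hesse l) \<longleftrightarrow> v \<noteq> 0 \<and> cub l v = 0" for v by (rule mem_hesse)
 show "locus (hesse l) \<subseteq> P2" by (rule locus_subset_P2)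
 show "translation l (proj P) \<in> extensional (locus (hesse l))" by (simp add: translation_def)
 show "\<exists>w. w \<noteq> 0 \<and> translation l (proj P) (proj v) = proj w \<and> (\<forall>k. bil (EC_forms P k) v w = 0)" if v: "v \<noteq> 0" "cub l v = 0" for v
 proof -
  have uniq: "r \<in> P2 \<and> (\<exists>R. R \<noteq> 0 \<and> r = proj R \<and> (\<forall>k. bil (EC_forms P k) v R = 0))"
   if r: "\<exists>w. cuts_line (hesse l) (proj P) (proj v) w \<and> cuts_line (hesse l) (proj origin) w r" for r
  proof -
   obtain w where w: "cuts_line (hesse l) (proj P) (proj v) w" "cuts_line (hesse l) (proj origin) w r" using r by blast
   obtain Q W where QW: "Q \<noteq> 0" "W \<noteq> 0" "proj v = proj Q" "w = proj W" "tri_zero P Q W"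
    by (rule cuts_line_tri_zero[OF w(1)])
   obtain k where k: "v = k *s Q" using QW(3) by (metis proj_eq_iff)
   have "r = proj (swap W)" by (rule cuts_line_origin_unique[OF w(2) QW(4,2)])
   moreover have "tri_zero P v W" using tri_zero_smult[OF QW(5), of 1 k 1] by (simp add: k)
   ultimately show ?thesis using QW(2) by (intro conjI exI[of _ "swap W"]) (simp_all add: tri_zero_EC_forms)
  qed
  obtain W where W: "W \<noteq> 0" "cub l W = 0" "cuts_line (hesse l) (proj P) (proj v) (proj W)"
   using cuts_line_exists[OF v] by blast
  let ?Pr = "\<lambda>r. \<exists>w. cuts_line (hesse l) (proj P) (proj v) w \<and> cuts_line (hesse l) (proj origin) w r"
  have ex: "?Pr (proj (swap W))" using W(3) cuts_line_origin[OF l W(1,2)] by blast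
  have L: "lmat (EC_forms P) v *v w = 0 \<longleftrightarrow> (\<forall>k. bil (EC_forms P k) v w = 0)" for w
   by (simp add: vec_eq_iff lmat_mult)
  have "r = proj (swap W)" if prem: "?Pr r" for r
  proof -
   obtain R where R: "R \<noteq> 0" "r = proj R" "\<forall>k. bil (EC_forms P k) v R = 0" using uniq[OF prem] by blast
   obtain R' where R': "R' \<noteq> 0" "proj (swap W) = proj R'" "\<forall>k. bil (EC_forms P k) v R' = 0" using uniq[OF ex] by blast
   have "proj R = proj R'"
    by (rule kernel_unique[of "lmat (EC_forms P) v"]) (use L R R' minL[OF v(1)] in blast)+
   then show ?thesis using R R' by simp
  qed
  then have "(THE r. ?Pr r) = proj (swap W)" using ex by (intro the_equality) blast+
  then have "translation l (proj P) (proj v) = proj (swap W)"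
   using v by (simp add: translation_def cubic_add_def mem_hesse origin_def)
  then show ?thesis using uniq[OF ex] by auto
 qed
qed

end

section \<open>Linear automorphisms of a Hesse cubic\<close>

lemma three_values:
 fixes \<omega> A B C :: "'k::field_char_0"
 assumes w: "\<omega>\<^sup>2 + \<omega> + 1 = 0" and z: "\<And>t. t^3 = 1 \<Longrightarrow> A + t*B + t\<^sup>2*C = 0"
 shows "A = 0 \<and> B = 0 \<and> C = 0"
proof -
 have w3: "\<omega>^3 = 1"
 proof -
  have "\<omega>^3 - 1 = (\<omega> - 1)*(\<omega>\<^sup>2 + \<omega> + 1)" by (simp add: cubic_simps)
  then show ?thesis using w by simp
 qed
 have w4: "(\<omega>\<^sup>2)\<^sup>2 = \<omega>"
 proof -
  have "(\<omega>\<^sup>2)\<^sup>2 = \<omega>^3*\<omega>" by (simp add: power2_eq_square power3_eq_cube)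
  then show ?thesis using w3 by simp
 qed
 have "(\<omega>\<^sup>2)^3 = (\<omega>^3)\<^sup>2" by (simp add: power_mult[symmetric] mult.commute)
 then have w6: "(\<omega>\<^sup>2)^3 = 1" using w3 by simp
 have 1: "A + B + C = 0" using z[of 1] by simp
 have 2: "A + \<omega> * B + \<omega>\<^sup>2 * C = 0" using z[OF w3] .
 have 3: "A + \<omega>\<^sup>2 * B + \<omega> * C = 0" using z[OF w6] by (simp only: w4)
 have "3*A = (A + B + C) + (A + \<omega>*B + \<omega>\<^sup>2*C) + (A + \<omega>\<^sup>2*B + \<omega>*C) - (B + C)*(\<omega>\<^sup>2 + \<omega> + 1)"
  by (simp add: algebra_simps)
 then have A: "A = 0" by (simp only: 1 2 3 w) simp
 have "3*B = (A + B + C) + \<omega>\<^sup>2*(A + \<omega>*B + \<omega>\<^sup>2*C) + \<omega>*(A + \<omega>\<^sup>2*B + \<omega>*C)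
   - (A + C)*(\<omega>\<^sup>2 + \<omega> + 1) + (2*B)*(1 - \<omega>^3) + C*(\<omega> - (\<omega>\<^sup>2)\<^sup>2)"
  by (simp add: cubic_simps)
 then have B: "B = 0" by (simp only: 1 2 3 w w3 w4) simp
 show ?thesis using 1 A B by simp
qed

lemma cub_columns:
 "cub l (x *s C1 + y *s C2 + z *s C3) = x^3 * cub l C1 + y^3 * cub l C2 + z^3 * cub l C3
  + 3*(x\<^sup>2*y*pol l C1 C2 + x\<^sup>2*z*pol l C1 C3 + y\<^sup>2*x*pol l C2 C1 + y\<^sup>2*z*pol l C2 C3
   + z\<^sup>2 * x * pol l C3 C1 + z\<^sup>2 * y * pol l C3 C2)
  + x*y*z*(6*(C1 $ 1*C2 $ 1*C3 $ 1 + C1 $ 2*C2 $ 2*C3 $ 2 + C1 $ 3*C2 $ 3*C3 $ 3)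
   - 3 * l * (C1 $ 1 * C2 $ 2 * C3 $ 3 + C1 $ 1 * C2 $ 3 * C3 $ 2 + C1 $ 2 * C2 $ 1 * C3 $ 3
    + C1 $ 2 * C2 $ 3 * C3 $ 1 + C1 $ 3 * C2 $ 1 * C3 $ 2 + C1 $ 3 * C2 $ 2 * C3 $ 1))"
 by (simp add: hesse_def pol_def cubic_simps)

text \<open>The flexes on the coordinate axes and \<open>P\<close> determine the cubic up to a scalar.\<close>

lemma (in hesse_point) cubic_preserved:
 fixes C1 C2 C3 :: "'k^3" and \<omega> :: 'k
 assumes w: "\<omega>\<^sup>2 + \<omega> + 1 = 0"
  and E: "\<And>x y z. hesse l x y z = 0 \<Longrightarrow> cub l (x *s C1 + y *s C2 + z *s C3) = 0"
 shows "cub l C2 = cub l C1" "cub l C3 = cub l C1"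
  "pol l C1 C2 = 0" "pol l C1 C3 = 0" "pol l C2 C1 = 0" "pol l C2 C3 = 0" "pol l C3 C1 = 0" "pol l C3 C2 = 0"
  "6 * (C1 $ 1 * C2 $ 1 * C3 $ 1 + C1 $ 2 * C2 $ 2 * C3 $ 2 + C1 $ 3 * C2 $ 3 * C3 $ 3)
   - 3 * l * (C1 $ 1 * C2 $ 2 * C3 $ 3 + C1 $ 1 * C2 $ 3 * C3 $ 2 + C1 $ 2 * C2 $ 1 * C3 $ 3
    + C1 $ 2*C2 $ 3*C3 $ 1 + C1 $ 3*C2 $ 1*C3 $ 2 + C1 $ 3*C2 $ 2*C3 $ 1) = - 3*l * cub l C1"
proof -
 have "cub l U - cub l V = 0 \<and> - 3 * pol l U V = 0 \<and> 3 * pol l V U = 0"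
  if "\<And>t. t^3 = 1 \<Longrightarrow> cub l (1 *s U + (- t) *s V) = 0" for U V :: "'k^3"
 proof (rule three_values[OF w])
  fix t :: 'k assume t: "t^3 = 1"
  then have "(- t)^3 = - 1" by (simp add: power3_eq_cube)
  then show "cub l U - cub l V + t * (- 3 * pol l U V) + t\<^sup>2 * (3 * pol l V U) = 0"
   using that[OF t] unfolding cub_line by (simp add: algebra_simps)
 qed
 note line = this
 have 12: "cub l (1 *s C1 + (- t) *s C2) = 0" and 13: "cub l (1 *s C1 + (- t) *s C3) = 0" and 23: "cub l (1 *s C2 + (- t) *s C3) = 0" if "t^3 = 1" for t
  using E[of 1 "- t" 0] E[of 1 0 "- t"] E[of 0 1 "- t"] that by (simp_all add: hesse_def power3_eq_cube)
 from line[of C1 C2, OF 12] line[of C1 C3, OF 13] line[of C2 C3, OF 23]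
 show eqs: "cub l C2 = cub l C1" "cub l C3 = cub l C1"
  "pol l C1 C2 = 0" "pol l C1 C3 = 0" "pol l C2 C1 = 0" "pol l C2 C3 = 0" "pol l C3 C1 = 0" "pol l C3 C2 = 0"
  by simp_all
 define M where "M = 6*(C1 $ 1*C2 $ 1*C3 $ 1 + C1 $ 2*C2 $ 2*C3 $ 2 + C1 $ 3*C2 $ 3*C3 $ 3)
   - 3 * l * (C1 $ 1 * C2 $ 2 * C3 $ 3 + C1 $ 1 * C2 $ 3 * C3 $ 2 + C1 $ 2 * C2 $ 1 * C3 $ 3
    + C1 $ 2 * C2 $ 3 * C3 $ 1 + C1 $ 3 * C2 $ 1 * C3 $ 2 + C1 $ 3 * C2 $ 2 * C3 $ 1)"
 have "cub l (P $ 1 *s C1 + P $ 2 *s C2 + P $ 3 *s C3) = 0" by (rule E[OF P])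
 then have "((P $ 1)^3 + (P $ 2)^3 + (P $ 3)^3) * cub l C1 + P $ 1 * P $ 2 * P $ 3 * M = 0"
  unfolding cub_columns M_def[symmetric] by (simp add: eqs algebra_simps)
 moreover have "(P $ 1)^3 + (P $ 2)^3 + (P $ 3)^3 = 3 * l * (P $ 1 * P $ 2 * P $ 3)"
  using P by (simp add: hesse_def algebra_simps)
 ultimately have "(P $ 1*P $ 2*P $ 3)*(M + 3*l * cub l C1) = 0" by (simp only:) (simp add: algebra_simps)
 then have "M + 3 * l * cub l C1 = 0" using nz by (simp only: mult_eq_0_iff) simp
 then show "6*(C1 $ 1*C2 $ 1*C3 $ 1 + C1 $ 2*C2 $ 2*C3 $ 2 + C1 $ 3*C2 $ 3*C3 $ 3)
   - 3 * l * (C1 $ 1 * C2 $ 2 * C3 $ 3 + C1 $ 1 * C2 $ 3 * C3 $ 2 + C1 $ 2 * C2 $ 1 * C3 $ 3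
    + C1 $ 2*C2 $ 3*C3 $ 1 + C1 $ 3*C2 $ 1*C3 $ 2 + C1 $ 3*C2 $ 2*C3 $ 1) = - 3*l * cub l C1"
  unfolding M_def[symmetric] by (simp add: add_eq_0_iff2)
qed

text \<open>One third of the matrix of second derivatives. The form
  \<open>bil (hessian l u) v w\<close> is symmetric in all three arguments and equals
  \<open>2 * cub l u\<close> on the diagonal.\<close>

definition hessian :: "'k::field \<Rightarrow> 'k^3 \<Rightarrow> 'k^3^3" where
 "hessian l v = m33 (2 * v $ 1) (- (l * v $ 3)) (- (l * v $ 2)) (- (l * v $ 3)) (2 * v $ 2) (- (l * v $ 1))
   (- (l * v $ 2)) (- (l * v $ 1)) (2 * v $ 3)"

lemma det_hessian: "det (hessian l v) = 8*(1 - l^3)*(v $ 1 * v $ 2 * v $ 3) - 2*l\<^sup>2 * cub l v"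
 by (simp add: hessian_def det_3 hesse_def cubic_simps)

lemma bil_hessian_1: "bil (hessian l u) (x *s A + y *s B + z *s C) w = x*bil (hessian l u) A w + y*bil (hessian l u) B w + z*bil (hessian l u) C w"
 by (simp add: bil_def sum_3 algebra_simps)

lemma bil_hessian_comm: "bil (hessian l u) v w = bil (hessian l v) u w" "bil (hessian l u) v w = bil (hessian l u) w v"
 by (simp_all add: bil_def hessian_def sum_3 algebra_simps)

lemma bil_hessian_pol: "bil (hessian l u) u w = 2 * pol l u w"
 by (simp add: bil_def hessian_def pol_def sum_3 power2_eq_square algebra_simps)

lemma bil_axis: "bil G (axis i 1) (axis j 1) = G $ i $ j"
 using exhaust_3[of i] exhaust_3[of j] by (auto simp: bil_def sum_3 axis_def)

text \<open>If \<open>T\<close> multiplies the cubic by a constant, it multiplies the Hessian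
  determinant by one too. That determinant is a combination of \<open>xyz\<close> and the cubic,
  with nonzero coefficient at \<open>xyz\<close> because \<open>l^3 \<noteq> 1\<close>; so
  \<open>xyz\<close> is carried into the pencil spanned by the two.\<close>

lemma (in hesse_point) triangle_transform:
 fixes C1 C2 C3 :: "'k^3" and \<omega> :: 'k
 assumes w: "\<omega>\<^sup>2 + \<omega> + 1 = 0"
  and E: "\<And>x y z. hesse l x y z = 0 \<Longrightarrow> cub l (x *s C1 + y *s C2 + z *s C3) = 0"
  and T: "invertible T" "\<And>v. T *v v = v $ 1 *s C1 + v $ 2 *s C2 + v $ 3 *s C3"
 shows "\<exists>\<kappa> \<mu>. \<forall>v. (T *v v) $ 1*(T *v v) $ 2*(T *v v) $ 3 = \<kappa>*(v $ 1 * v $ 2 * v $ 3) + \<mu> * cub l v"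
proof -
 note pr = cubic_preserved[OF w E]
 let ?c = "cub l C1"
 let ?b = "\<lambda>u v w. bil (hessian l u) v w"
 have p: "pol l C C = cub l C" for C
  by (simp add: pol_def hesse_def cubic_simps)
 have "3*?b C1 C2 C3 = 6*(C1 $ 1*C2 $ 1*C3 $ 1 + C1 $ 2*C2 $ 2*C3 $ 2 + C1 $ 3*C2 $ 3*C3 $ 3)
   - 3 * l * (C1 $ 1 * C2 $ 2 * C3 $ 3 + C1 $ 1 * C2 $ 3 * C3 $ 2 + C1 $ 2 * C2 $ 1 * C3 $ 3
    + C1 $ 2 * C2 $ 3 * C3 $ 1 + C1 $ 3 * C2 $ 1 * C3 $ 2 + C1 $ 3 * C2 $ 2 * C3 $ 1)"
  by (simp add: bil_def hessian_def sum_3 algebra_simps)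
 also have "\<dots> = - 3 * l * ?c" by (rule pr(9))
 finally have "3*?b C1 C2 C3 = 3*(- (l*?c))" by (simp only: mult_minus_left mult_minus_right mult.assoc)
 then have b123: "?b C1 C2 C3 = - (l * ?c)" by (simp only: mult_cancel_left) simp
 have bb: "?b C1 C1 C1 = 2 * ?c" "?b C2 C2 C2 = 2 * ?c" "?b C3 C3 C3 = 2 * ?c"
  "?b C1 C1 C2 = 0" "?b C1 C1 C3 = 0" "?b C2 C2 C1 = 0" "?b C2 C2 C3 = 0" "?b C3 C3 C1 = 0" "?b C3 C3 C2 = 0"
  by (simp_all only: bil_hessian_pol p pr) simp_all
 have bc: "?b C1 C2 C1 = 0" "?b C2 C1 C1 = 0" "?b C1 C3 C1 = 0" "?b C3 C1 C1 = 0" "?b C2 C1 C2 = 0" "?b C1 C2 C2 = 0"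
  "?b C2 C3 C2 = 0" "?b C3 C2 C2 = 0" "?b C3 C1 C3 = 0" "?b C1 C3 C3 = 0" "?b C3 C2 C3 = 0" "?b C2 C3 C3 = 0"
  using bb bil_hessian_comm by metis+
 have bd: "?b C1 C3 C2 = - (l*?c)" "?b C2 C1 C3 = - (l*?c)" "?b C2 C3 C1 = - (l*?c)" "?b C3 C1 C2 = - (l*?c)" "?b C3 C2 C1 = - (l*?c)"
  using b123 bil_hessian_comm by metis+
 \<comment> \<open>By trilinearity this is a statement about the columns of \<open>T\<close>, on
   which the form takes \<open>?c\<close> times its values on the standard basis.\<close>
 have tri: "?b (T *v u) (T *v v) (T *v w) = ?c * ?b u v w" for u v w
 proof -
  have 1: "?b (x *s A + y *s B + z *s C) v w = x*?b A v w + y*?b B v w + z*?b C v w" for x y z A B C v w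
   unfolding bil_hessian_comm(1)[of l _ v w] by (rule bil_hessian_1)
  have 2: "?b u v (x *s A + y *s B + z *s C) = x*?b u v A + y*?b u v B + z*?b u v C" for x y z A B C u v
   unfolding bil_hessian_comm(2)[of l u v] by (rule bil_hessian_1)
  have "?b (T *v u) (T *v v) (T *v w) = ?c*(2*(u $ 1 * v $ 1*w $ 1 + u $ 2 * v $ 2*w $ 2 + u $ 3 * v $ 3*w $ 3)
   - l * (u $ 1 * v $ 2 * w $ 3 + u $ 1 * v $ 3 * w $ 2 + u $ 2 * v $ 1 * w $ 3
    + u $ 2 * v $ 3 * w $ 1 + u $ 3 * v $ 1 * w $ 2 + u $ 3 * v $ 2 * w $ 1))"
   unfolding T(2) 1 2 bil_hessian_1 by (simp add: bb bc bd b123 algebra_simps)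
  also have "2 * (u $ 1 * v $ 1 * w $ 1 + u $ 2 * v $ 2 * w $ 2 + u $ 3 * v $ 3 * w $ 3)
   - l * (u $ 1 * v $ 2 * w $ 3 + u $ 1 * v $ 3 * w $ 2 + u $ 2 * v $ 1 * w $ 3
    + u $ 2 * v $ 3 * w $ 1 + u $ 3 * v $ 1 * w $ 2 + u $ 3 * v $ 2 * w $ 1) = ?b u v w"
   by (simp add: bil_def hessian_def sum_3 algebra_simps)
  finally show ?thesis .
 qed
 have mat: "transpose T ** hessian l (T *v u) ** T = (\<chi> i j. ?c*hessian l u $ i $ j)" for u
 proof -
  have "(transpose T ** hessian l (T *v u) ** transpose (transpose T)) $ i $ j = ?c*hessian l u $ i $ j" for i j
   unfolding bil_axis[symmetric, of _ i j] bil_transform by (simp add: tri)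
  then show ?thesis by (simp add: vec_eq_iff)
 qed
 have h: "(det T)\<^sup>2 * det (hessian l (T *v u)) = ?c^3 * det (hessian l u)" for u
 proof -
  have "det (transpose T ** hessian l (T *v u) ** T) = (det T)\<^sup>2*det (hessian l (T *v u))"
   by (simp add: det_mul det_transpose power2_eq_square)
  moreover have "det (\<chi> i j. ?c * hessian l u $ i $ j) = ?c^3 * det (hessian l u)"
   by (simp add: det_3 power3_eq_cube algebra_simps)
  ultimately show ?thesis unfolding mat by simp
 qed
 have cT: "cub l (T *v v) = ?c * cub l v" for v
 proof -
  have "x^3 * c + y^3 * c2 + z^3 * c3 + 3*(x\<^sup>2*y*p12 + x\<^sup>2*z*p13 + y\<^sup>2*x*p21 + y\<^sup>2*z*p23 + z\<^sup>2*x*p31 + z\<^sup>2*y*p32)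
   + x * y * z * M = c * hesse l x y z"
   if "c2 = c" "c3 = c" "p12 = 0" "p13 = 0" "p21 = 0" "p23 = 0" "p31 = 0" "p32 = 0" "M = - 3*l * c" for x y z c c2 c3 p12 p13 p21 p23 p31 p32 M
   unfolding that by (simp add: hesse_def algebra_simps)
  note expand = this
  show ?thesis unfolding T(2) cub_columns by (rule expand[OF pr(1-9)])
 qed
 define D where "D = (det T)\<^sup>2 * (8 * (1 - l^3))"
 have D: "D \<noteq> 0" using T(1) l by (simp add: D_def invertible_det_nz)
 have quot: "X = A / D * g + B / D * F" if "D * X = A * g + B * F" for X A g B F
  using D that by (simp add: field_simps)
 show ?thesis
 proof (intro exI allI)
  fix v
  have "D * ((T *v v) $ 1 * (T *v v) $ 2 * (T *v v) $ 3) =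
   (?c^3*(8*(1 - l^3)))*(v $ 1 * v $ 2 * v $ 3) + (2*l\<^sup>2*?c*(det T)\<^sup>2 - 2*l\<^sup>2*?c^3) * cub l v"
   using h[of v] unfolding det_hessian cT D_def by (simp add: algebra_simps)
  then show "(T *v v) $ 1 * (T *v v) $ 2 * (T *v v) $ 3 =
   (?c^3*(8*(1 - l^3)) / D)*(v $ 1 * v $ 2 * v $ 3) + ((2*l\<^sup>2*?c*(det T)\<^sup>2 - 2*l\<^sup>2*?c^3) / D) * cub l v"
   by (rule quot)
 qed
qed

text \<open>One matrix for each permutation of the coordinates; \<open>dj\<close> always stands in
  column \<open>j\<close>.\<close>

definition monomial6 :: "'k::field \<Rightarrow> 'k \<Rightarrow> 'k \<Rightarrow> ('k^3^3) set" where
 "monomial6 d1 d2 d3 = {m33 d1 0 0 0 d2 0 0 0 d3, m33 0 d2 0 0 0 d3 d1 0 0, m33 0 0 d3 d1 0 0 0 d2 0,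
   m33 0 d2 0 d1 0 0 0 0 d3, m33 d1 0 0 0 0 d3 0 d2 0, m33 0 0 d3 0 d2 0 d1 0 0}"

lemma product_on_line:
 fixes c0 c1 c2 c3 m :: "'k::field_char_0"
 assumes "\<And>t. c0 + t * c1 + t\<^sup>2 * c2 + t^3 * c3 = m * (1 + t^3)" "c3 = m"
 shows "c1 = 0 \<and> c2 = 0"
proof -
 have 0: "c0 = m" using assms(1)[of 0] by simp
 have 1: "c1 + c2 = 0" using assms(1)[of 1] by (simp add: 0 assms(2) algebra_simps)
 have 2: "- c1 + c2 = 0" using assms(1)[of "- 1"] by (simp add: 0 assms(2) algebra_simps)
 have "2 * c2 = (c1 + c2) + (- c1 + c2)" by simp
 then have "c2 = 0" by (simp only: 1 2) simp
 then show ?thesis using 1 by simp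
qed

text \<open>A matrix preserving the cubic maps the coordinate triangle to a triangle of the Hesse pencil: it is monomial or a
 discrete Fourier transform up to diagonal factors.\<close>

lemma (in hesse_point) preserving_matrices:
 fixes T :: "'k^3^3" and \<omega> :: 'k
 assumes w: "\<omega>\<^sup>2 + \<omega> + 1 = 0" and inv: "invertible T" and E0: "\<forall>v. cub l v = 0 \<longrightarrow> cub l (T *v v) = 0"
 shows "(\<exists>d1 d2 d3. d1 \<noteq> 0 \<and> d2^3 = d1^3 \<and> d3^3 = d1^3 \<and> (l = 0 \<or> d1*d2*d3 = d1^3) \<and> T \<in> monomial6 d1 d2 d3) \<or>
  (\<exists>p q r b g e. e\<^sup>2 + e + 1 = 0 \<and> p \<noteq> 0 \<and> q^3 = p^3 \<and> r^3 = p^3 \<and> b^3 = 1 \<and> g^3 = 1 \<and>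
   6*p^3*b*g + 3*l*(b*g)*(p*q*r) = - l*(3*p^3 - 3*l*(p*q*r)) \<and>
   T = m33 p (p*b) (p*g) q (q*b*e) (q*g*e\<^sup>2) r (r*b*e\<^sup>2) (r*g*e))"
proof -
 obtain a1 b1 g1 a2 b2 g2 a3 b3 g3 where Tm: "T = m33 a1 b1 g1 a2 b2 g2 a3 b3 g3" by (rule m33_cases)
 define C1 C2 C3 :: "'k^3" where C: "C1 = vector [a1, a2, a3]" "C2 = vector [b1, b2, b3]" "C3 = vector [g1, g2, g3]"
 have T: "T *v v = v $ 1 *s C1 + v $ 2 *s C2 + v $ 3 *s C3" for v
  by (simp add: Tm C vec3_eq_iff matrix_vector_mult_3 mult.commute)
 have E': "cub l (x *s C1 + y *s C2 + z *s C3) = 0" if "hesse l x y z = 0" for x y z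
  using E0[rule_format, of "vector [x, y, z]"] that by (simp add: T)
 note pr = cubic_preserved[OF w E']
 obtain \<kappa> \<mu> where tr: "\<And>v. (T *v v) $ 1*(T *v v) $ 2*(T *v v) $ 3 = \<kappa>*(v $ 1 * v $ 2 * v $ 3) + \<mu> * cub l v"
  using triangle_transform[OF w E' inv T] by blast
 have col: "a1 * a2 * a3 = \<mu>" "b1 * b2 * b3 = \<mu>" "g1 * g2 * g3 = \<mu>"
  using tr[of "vector [1, 0, 0]"] tr[of "vector [0, 1, 0]"] tr[of "vector [0, 0, 1]"]
  by (simp_all add: T C hesse_def)
 \<comment> \<open>On the side \<open>z = 0\<close> of the triangle the cubic is
   \<open>1 + t^3\<close>, so the product of the three rows has vanishing middle
   coefficients.\<close>
 have ab: "a1*a2*b3 + a1*b2*a3 + b1*a2*a3 = 0 \<and> b1*b2*a3 + b1*a2*b3 + a1*b2*b3 = 0"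
 proof (rule product_on_line[OF _ col(2)])
  show "a1*a2*a3 + t*(a1*a2*b3 + a1*b2*a3 + b1*a2*a3) + t\<^sup>2*(b1*b2*a3 + b1*a2*b3 + a1*b2*b3)
   + t^3 * (b1 * b2 * b3) = \<mu> * (1 + t^3)" for t
   using tr[of "vector [1, t, 0]"] by (simp add: T C hesse_def cubic_simps)
 qed
 have ag: "a1*a2*g3 + a1*g2*a3 + g1*a2*a3 = 0 \<and> g1*g2*a3 + g1*a2*g3 + a1*g2*g3 = 0"
 proof (rule product_on_line[OF _ col(3)])
  show "a1*a2*a3 + t*(a1*a2*g3 + a1*g2*a3 + g1*a2*a3) + t\<^sup>2*(g1*g2*a3 + g1*a2*g3 + a1*g2*g3)
   + t^3 * (g1 * g2 * g3) = \<mu> * (1 + t^3)" for t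
   using tr[of "vector [1, 0, t]"] by (simp add: T C hesse_def cubic_simps)
 qed
 have bg: "b1*b2*g3 + b1*g2*b3 + g1*b2*b3 = 0 \<and> g1*g2*b3 + g1*b2*g3 + b1*g2*g3 = 0"
 proof (rule product_on_line[OF _ col(3)])
  show "b1*b2*b3 + t*(b1*b2*g3 + b1*g2*b3 + g1*b2*b3) + t\<^sup>2*(g1*g2*b3 + g1*b2*g3 + b1*g2*g3)
   + t^3 * (g1 * g2 * g3) = \<mu> * (1 + t^3)" for t
   using tr[of "vector [0, 1, t]"] by (simp add: T C hesse_def cubic_simps)
 qed
 have cubes: "b1^3 + b2^3 + b3^3 = a1^3 + a2^3 + a3^3" "g1^3 + g2^3 + g3^3 = a1^3 + a2^3 + a3^3"
  using pr(1,2) col by (simp_all add: C hesse_def mult.assoc add.assoc)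
 have c1: "cub l C1 = a1^3 + a2^3 + a3^3 - 3*l*\<mu>" using col by (simp add: C hesse_def mult.assoc)
 have sq: "a1\<^sup>2*b1 + a2\<^sup>2*b2 + a3\<^sup>2*b3 = 0" "a1\<^sup>2*g1 + a2\<^sup>2*g2 + a3\<^sup>2*g3 = 0"
 proof -
  have "pol l C1 C2 = a1\<^sup>2*b1 + a2\<^sup>2*b2 + a3\<^sup>2*b3 - l*(a1*a2*b3 + a1*b2*a3 + b1*a2*a3)"
   by (simp add: C pol_def algebra_simps)
  then show "a1\<^sup>2 * b1 + a2\<^sup>2 * b2 + a3\<^sup>2 * b3 = 0" using ab pr(3) by simp
  have "pol l C1 C3 = a1\<^sup>2*g1 + a2\<^sup>2*g2 + a3\<^sup>2*g3 - l*(a1*a2*g3 + a1*g2*a3 + g1*a2*a3)"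
   by (simp add: C pol_def algebra_simps)
  then show "a1\<^sup>2 * g1 + a2\<^sup>2 * g2 + a3\<^sup>2 * g3 = 0" using ag pr(4) by simp
 qed
 define A where "A = a1 * b1 * g1 + a2 * b2 * g2 + a3 * b3 * g3"
 define B where "B = a1*b2*g3 + a1*b3*g2 + a2*b1*g3 + a2*b3*g1 + a3*b1*g2 + a3*b2*g1"
 have mix: "6 * A - 3 * l * B = - 3 * l * (a1^3 + a2^3 + a3^3 - 3 * l * \<mu>)"
  using pr(9) unfolding c1 by (simp add: C A_def B_def)
 have nzdet: "a1*(b2*g3 - g2*b3) - b1*(a2*g3 - g2*a3) + g1*(a2*b3 - b2*a3) \<noteq> 0"
  using inv by (simp add: Tm m33_invertible)
 show ?thesis
 proof (cases "\<mu> = 0")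
  \<comment> \<open>The triangle is mapped to itself, and each column keeps a single nonzero
    entry.\<close>
  case mu: True
  have one: "(x2 = 0 \<and> x3 = 0) \<or> (x1 = 0 \<and> x3 = 0) \<or> (x1 = 0 \<and> x2 = 0)"
   if h: "x1*x2*x3 = 0" "x1*x2*y3 + x1*y2*x3 + y1*x2*x3 = 0" "x1*x2*z3 + x1*z2*x3 + z1*x2*x3 = 0"
    "x1 = 0 \<Longrightarrow> y1 \<noteq> 0 \<or> z1 \<noteq> 0" "x2 = 0 \<Longrightarrow> y2 \<noteq> 0 \<or> z2 \<noteq> 0" "x3 = 0 \<Longrightarrow> y3 \<noteq> 0 \<or> z3 \<noteq> 0"
   for x1 x2 x3 y1 y2 y3 z1 z2 z3 :: 'k
  proof -
   consider "x1 = 0" | "x2 = 0" | "x3 = 0" using h(1) by auto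
   then show ?thesis by cases (use h in auto)
  qed
  have r: "a1 \<noteq> 0 \<or> b1 \<noteq> 0 \<or> g1 \<noteq> 0" "a2 \<noteq> 0 \<or> b2 \<noteq> 0 \<or> g2 \<noteq> 0" "a3 \<noteq> 0 \<or> b3 \<noteq> 0 \<or> g3 \<noteq> 0"
   using nzdet by auto
  have a: "(a2 = 0 \<and> a3 = 0) \<or> (a1 = 0 \<and> a3 = 0) \<or> (a1 = 0 \<and> a2 = 0)"
   by (rule one[of a1 a2 a3 b3 b2 b1 g3 g2 g1]) (use col mu ab ag r in \<open>simp_all\<close>)
  have b: "(b2 = 0 \<and> b3 = 0) \<or> (b1 = 0 \<and> b3 = 0) \<or> (b1 = 0 \<and> b2 = 0)"
   by (rule one[of b1 b2 b3 a3 a2 a1 g3 g2 g1]) (use col mu ab bg r in \<open>auto simp: ac_simps\<close>)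
  have g: "(g2 = 0 \<and> g3 = 0) \<or> (g1 = 0 \<and> g3 = 0) \<or> (g1 = 0 \<and> g2 = 0)"
   by (rule one[of g1 g2 g3 a3 a2 a1 b3 b2 b1]) (use col mu ag bg r in \<open>auto simp: ac_simps\<close>)
  define d1 d2 d3 where d: "d1 = a1 + a2 + a3" "d2 = b1 + b2 + b3" "d3 = g1 + g2 + g3"
  have "T \<in> monomial6 d1 d2 d3 \<and> d1 \<noteq> 0 \<and> d2^3 = d1^3 \<and> d3^3 = d1^3 \<and> B = d1*d2*d3 \<and> A = 0 \<and> a1^3 + a2^3 + a3^3 = d1^3"
   using a b g nzdet cubes unfolding Tm monomial6_def d A_def B_def by (elim disjE conjE) simp_all
  moreover have "l = 0 \<or> B = a1^3 + a2^3 + a3^3" if "A = 0" using mix that mu by simp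
  ultimately have "d1 \<noteq> 0 \<and> d2^3 = d1^3 \<and> d3^3 = d1^3 \<and> (l = 0 \<or> d1*d2*d3 = d1^3) \<and> T \<in> monomial6 d1 d2 d3" by auto
  then show ?thesis by - (rule disjI1, rule exI[of _ d1], rule exI[of _ d2], rule exI[of _ d3])
 next
  case mu: False
  have a0: "a1 \<noteq> 0" "a2 \<noteq> 0" "a3 \<noteq> 0" using mu col(1) by auto
  \<comment> \<open>The elementary symmetric functions are those of \<open>X^3 - 1\<close>, so the
    triple consists of the three cube roots of unity in some order. It is applied to the entries of
    a column divided by those of the first column.\<close>
  have roots: "\<exists>e. e\<^sup>2 + e + 1 = 0 \<and> y^3 = 1 \<and> y2 = y*e \<and> y3 = y*e\<^sup>2"
   if "y + y2 + y3 = 0" "y * y2 + y * y3 + y2 * y3 = 0" "y * y2 * y3 = 1" for y y2 y3 :: 'k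
  proof -
   have y0: "y \<noteq> 0" using that(3) by auto
   have "y3 = (y + y2 + y3) - y - y2" by simp
   also have "\<dots> = - y - y2" unfolding that(1) by simp
   finally have y3: "y3 = - y - y2" .
   define e where "e = y2 / y"
   have y2: "y2 = y * e" using y0 by (simp add: e_def)
   have "y * y2 + y * y3 + y2 * y3 = - (y\<^sup>2 * (e\<^sup>2 + e + 1))"
    unfolding y3 y2 by (simp add: power2_eq_square algebra_simps)
   then have e: "e\<^sup>2 + e + 1 = 0" using that(2) y0 by simp
   have "y3 = y*e\<^sup>2 - y*(e\<^sup>2 + e + 1)" unfolding y3 y2 by (simp add: power2_eq_square algebra_simps)
   then have y3': "y3 = y * e\<^sup>2" using e by simp
   have "e^3 = 1 + (e - 1) * (e\<^sup>2 + e + 1)" by (simp add: cubic_simps)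
   then have "e^3 = 1" using e by simp
   moreover have "y*y2*y3 = y^3*e^3" unfolding y2 y3' by (simp add: power2_eq_square power3_eq_cube)
   ultimately have "y^3 = 1" using that(3) by simp
   then show ?thesis using e y2 y3' by (intro exI[of _ e]) simp
  qed
  have scale: "x1 / a1 + x2 / a2 + x3 / a3 = 0 \<and> (x1 / a1)*(x2 / a2) + (x1 / a1)*(x3 / a3) + (x2 / a2)*(x3 / a3) = 0 \<and> (x1 / a1)*(x2 / a2)*(x3 / a3) = 1"
   if "a1*a2*x3 + a1*x2*a3 + x1*a2*a3 = 0 \<and> x1*x2*a3 + x1*a2*x3 + a1*x2*x3 = 0" "x1*x2*x3 = \<mu>" for x1 x2 x3
  proof (intro conjI)
   have "x1 / a1 + x2 / a2 + x3 / a3 = (a1*a2*x3 + a1*x2*a3 + x1*a2*a3) / (a1*a2*a3)"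
    using a0 by (simp add: field_simps)
   then show "x1 / a1 + x2 / a2 + x3 / a3 = 0" using that by simp
   have "(x1 / a1)*(x2 / a2) + (x1 / a1)*(x3 / a3) + (x2 / a2)*(x3 / a3) = (x1*x2*a3 + x1*a2*x3 + a1*x2*x3) / (a1*a2*a3)"
    using a0 by (simp add: field_simps)
   then show "(x1 / a1)*(x2 / a2) + (x1 / a1)*(x3 / a3) + (x2 / a2)*(x3 / a3) = 0" using that by simp
   have "(x1 / a1) * (x2 / a2) * (x3 / a3) = (x1 * x2 * x3) / (a1 * a2 * a3)" by simp
   then show "(x1 / a1) * (x2 / a2) * (x3 / a3) = 1" using that col mu by simp
  qed
  note Sb = scale[OF ab col(2)] and Sg = scale[OF ag col(3)]
  obtain e where e: "e\<^sup>2 + e + 1 = 0" "(b1 / a1)^3 = 1" "b2 / a2 = (b1 / a1)*e" "b3 / a3 = (b1 / a1)*e\<^sup>2"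
   using roots[of "b1 / a1" "b2 / a2" "b3 / a3"] Sb by blast
  obtain f where f: "f\<^sup>2 + f + 1 = 0" "(g1 / a1)^3 = 1" "g2 / a2 = (g1 / a1)*f" "g3 / a3 = (g1 / a1)*f\<^sup>2"
   using roots[of "g1 / a1" "g2 / a2" "g3 / a3"] Sg by blast
  define b g where bgd: "b = b1 / a1" "g = g1 / a1"
  have b0: "b \<noteq> 0" "g \<noteq> 0" using e(2) f(2) by (auto simp: bgd)
  have bs: "b1 = a1*b" "b2 = a2*b*e" "b3 = a3*b*e\<^sup>2" and gs: "g1 = a1*g" "g2 = a2*g*f" "g3 = a3*g*f\<^sup>2"
   using a0 e(3,4) f(3,4) by (simp_all add: bgd field_simps)
  have e3: "e^3 = 1"
  proof -
   have "e^3 = 1 + (e - 1) * (e\<^sup>2 + e + 1)" by (simp add: cubic_simps)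
   then show ?thesis using e by simp
  qed
  \<comment> \<open>The second and third columns must use different primitive roots; equal ones
    contradict the condition \<open>bg\<close> on the side between them.\<close>
  have "(f - e) * (f - e\<^sup>2) = (f\<^sup>2 + f + 1) - f * (e\<^sup>2 + e + 1) + (e^3 - 1)"
   by (simp add: cubic_simps)
  then have "f = e \<or> f = e\<^sup>2" by (simp add: e f e3)
  moreover have "f \<noteq> e"
  proof
   assume fe: "f = e"
   have "b1*b2*g3 + b1*g2*b3 + g1*b2*b3 = 3*e^3*(a1*a2*a3)*(b\<^sup>2*g)"
    unfolding bs gs fe by (simp add: cubic_simps)
   then show False using bg e3 a0 b0 by simp
  qed
  ultimately have fe: "f = e\<^sup>2" by blast
  have f2: "f\<^sup>2 = e"
  proof -
   have "f\<^sup>2 = e^3 * e" unfolding fe by (simp add: power2_eq_square power3_eq_cube)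
   then show ?thesis by (simp add: e3)
  qed
  have "b*(a1^3 + a2^3*e + a3^3*e\<^sup>2) = 0" "g*(a1^3 + a2^3*e\<^sup>2 + a3^3*e) = 0"
   using sq unfolding bs gs f2 unfolding fe by (simp_all add: cubic_simps)
  then have s1: "a1^3 + a2^3*e + a3^3*e\<^sup>2 = 0" and s2: "a1^3 + a2^3*e\<^sup>2 + a3^3*e = 0" using b0 by simp_all
  have ee: "e - e\<^sup>2 \<noteq> 0"
  proof
   assume "e - e\<^sup>2 = 0"
   then have "e * (1 - e) = 0" by (simp add: power2_eq_square algebra_simps)
   then show False using e(1) by auto
  qed
  have "(a2^3 - a3^3)*(e - e\<^sup>2) = (a1^3 + a2^3*e + a3^3*e\<^sup>2) - (a1^3 + a2^3*e\<^sup>2 + a3^3*e)"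
   by (simp add: algebra_simps)
  then have "a2^3 - a3^3 = 0" using ee by (simp only: s1 s2) simp
  then have a23: "a3^3 = a2^3" by simp
  have "a1^3 - a2^3 = (a1^3 + a2^3 * e + a3^3 * e\<^sup>2) - a2^3 * (e\<^sup>2 + e + 1)"
   unfolding a23 by (simp add: algebra_simps)
  then have a12: "a2^3 = a1^3" by (simp only: s1 e(1)) simp
  have A: "A = 3 * a1^3 * b * g"
  proof -
   have "A = b * g * (a1^3 + a2^3 * e^3 + a3^3 * e^3)"
    unfolding A_def bs gs f2 unfolding fe by (simp add: cubic_simps)
   then show ?thesis by (simp add: e3 a23 a12 algebra_simps)
  qed
  have B: "B = - 3 * (b * g) * (a1 * a2 * a3)"
  proof -
   have "B = (b*g)*(a1*a2*a3)*(e*e + e\<^sup>2*e\<^sup>2 + e + e\<^sup>2 + e\<^sup>2 + e)"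
    unfolding B_def bs gs f2 unfolding fe by (simp add: algebra_simps)
   also have "e*e + e\<^sup>2*e\<^sup>2 + e + e\<^sup>2 + e\<^sup>2 + e = 3*(e\<^sup>2 + e + 1) - 3 + e*(e^3 - 1)"
    by (simp add: cubic_simps)
   finally show ?thesis by (simp add: e e3)
  qed
  have "3*(6*a1^3*b*g + 3*l*(b*g)*(a1*a2*a3)) = 3*(- l*(3*a1^3 - 3*l*(a1*a2*a3)))"
   using mix unfolding A B a23 a12 col(1)[symmetric] by (simp add: algebra_simps)
  then have cond: "6*a1^3*b*g + 3*l*(b*g)*(a1*a2*a3) = - l*(3*a1^3 - 3*l*(a1*a2*a3))"
   by (simp only: mult_cancel_left) simp
  have "T = m33 a1 (a1*b) (a1*g) a2 (a2*b*e) (a2*g*e\<^sup>2) a3 (a3*b*e\<^sup>2) (a3*g*e)"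
   unfolding Tm bs gs f2 unfolding fe by (rule refl)
  then have "e\<^sup>2 + e + 1 = 0 \<and> a1 \<noteq> 0 \<and> a2^3 = a1^3 \<and> a3^3 = a1^3 \<and> b^3 = 1 \<and> g^3 = 1 \<and>
   6*a1^3*b*g + 3*l*(b*g)*(a1*a2*a3) = - l*(3*a1^3 - 3*l*(a1*a2*a3)) \<and>
   T = m33 a1 (a1*b) (a1*g) a2 (a2*b*e) (a2*g*e\<^sup>2) a3 (a3*b*e\<^sup>2) (a3*g*e)"
   using cond e(1,2) f(2) a0 a12 a23 by (intro conjI) (simp_all only: bgd not_False_eq_True)
  then show ?thesis
   by - (rule disjI2, rule exI[of _ a1], rule exI[of _ a2], rule exI[of _ a3], rule exI[of _ b], rule exI[of _ g], rule exI[of _ e])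
 qed
qed

text \<open>For cube roots of unity \<open>r\<close>, the matrices \<open>Dm r\<close> and
  \<open>Xm\<close> generate the Heisenberg group, the translations by 3-torsion points.
  \<open>Jm\<close> is inversion, and \<open>Sm s\<close> with \<open>s^3 = 1\<close> is the
  additional symmetry of the Fermat cubic, \<open>l = 0\<close>.\<close>

definition Dm :: "'k::field \<Rightarrow> 'k^3^3" where "Dm r = m33 1 0 0 0 r 0 0 0 (r\<^sup>2)"
definition Xm :: "('k::field)^3^3" where "Xm = m33 0 1 0 0 0 1 1 0 0"
definition Jm :: "('k::field)^3^3" where "Jm = m33 0 1 0 1 0 0 0 0 1"
definition Sm :: "'k::field \<Rightarrow> 'k^3^3" where "Sm s = m33 1 0 0 0 1 0 0 0 s"

lemma Heis_mult:
 "Dm r *v v = vector [v $ 1, r * v $ 2, r\<^sup>2 * v $ 3]" "Xm *v v = vector [v $ 2, v $ 3, v $ 1]"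
 "Jm *v v = vector [v $ 2, v $ 1, v $ 3]" "Sm s *v v = vector [v $ 1, v $ 2, s * v $ 3]"
 by (simp_all add: Dm_def Xm_def Jm_def Sm_def vec3_eq_iff matrix_vector_mult_3)

lemma Heis_invertible: "r \<noteq> 0 \<Longrightarrow> invertible (Dm r)" "invertible Xm" "invertible Jm" "s \<noteq> 0 \<Longrightarrow> invertible (Sm s)"
 by (simp_all add: Dm_def Xm_def Jm_def Sm_def m33_invertible)

lemma pmap_eqI:
 assumes "k \<noteq> 0" "\<And>v. T *v v = k *s (S *v v)" "p \<in> P2"
 shows "pmap T p = pmap S p"
proof -
 obtain v where "p = proj v" using P2_cases[OF assms(3)] by blast
 then show ?thesis using assms(1,2) by (simp add: proj_smult)
qed

section \<open>Conjugation by the translation, modulo the Heisenberg group\<close>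

context hesse_point
begin

abbreviation "E \<equiv> locus (hesse l)"
abbreviation "\<sigma> \<equiv> translation l (proj P)"

lemma E_P2: "p \<in> E \<Longrightarrow> p \<in> P2"
 using locus_subset_P2 by blast

lemma \<sigma>_mem: "p \<in> E \<Longrightarrow> \<sigma> p \<in> E"
 using Bij_mem[OF presentsD(3)[OF presents_EC]] .

lemma \<sigma>_surj: assumes "p \<in> E" obtains q where "q \<in> E" "p = \<sigma> q"
proof -
 have "\<sigma> ` E = E" using presentsD(3)[OF presents_EC] by (simp add: Bij_def bij_betw_def)
 then have "p \<in> \<sigma> ` E" using assms by simp
 then show thesis by (rule imageE) (use that in blast)
qed

lemma E_graph:
 assumes "p \<in> E"
 obtains v w where "v \<noteq> 0" "w \<noteq> 0" "p = proj v" "\<sigma> p = proj w" "\<forall>k. bil (EC_forms P k) v w = 0" "cub l v = 0" "cub l w = 0"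
proof -
 obtain v where v: "v \<noteq> 0" "p = proj v" using E_P2[OF assms] by (rule P2_cases)
 obtain w where w: "w \<noteq> 0" "\<sigma> p = proj w" using E_P2[OF \<sigma>_mem[OF assms]] by (rule P2_cases)
 have "\<forall>k. bil (EC_forms P k) v w = 0" using presentsD(5)[OF presents_EC v(1) w(1)] v w assms by simp
 moreover have "cub l v = 0" "cub l w = 0" using assms \<sigma>_mem[OF assms] v w by (simp_all add: mem_hesse)
 ultimately show thesis using that v w by blast
qed

lemma preserves_hesseI:
 assumes T: "invertible T" and c: "c \<noteq> 0" "\<And>v. cub l (T *v v) = c * cub l v"
 shows "preserves T E"
 unfolding preserves_def
proof (intro conjI T equalityI subsetI)
 fix p assume "p \<in> pmap T ` E"
 then obtain q where q: "q \<in> E" "p = pmap T q" by blast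
 obtain v where v: "v \<noteq> 0" "q = proj v" using E_P2[OF q(1)] by (rule P2_cases)
 then show "p \<in> E" using q c(2)[of v] T by (simp add: mem_hesse invertible_mult_nz)
next
 fix p assume p: "p \<in> E"
 obtain v where v: "v \<noteq> 0" "p = proj v" using E_P2[OF p] by (rule P2_cases)
 have "c * cub l (matrix_inv T *v v) = cub l v" using c(2)[of "matrix_inv T *v v"] by (simp add: matrix_inv_props[OF T])
 then have "cub l (matrix_inv T *v v) = 0" using p v c(1) by (simp add: mem_hesse)
 then have "proj (matrix_inv T *v v) \<in> E"
  using v matrix_inv_props(1)[OF T] by (simp add: mem_hesse invertible_mult_nz)
 moreover have "p = pmap T (proj (matrix_inv T *v v))" using v by (simp add: matrix_inv_props[OF T])
 ultimately show "p \<in> pmap T ` E" by blast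
qed

text \<open>On \<open>E\<close> the matrix \<open>T'\<close> is the conjugate of \<open>T\<close> by
  \<sigma>; this packages the hypotheses of \<open>rigid\<close>.\<close>

definition linked :: "'k^3^3 \<Rightarrow> 'k^3^3 \<Rightarrow> bool" where
 "linked T T' \<longleftrightarrow> preserves T E \<and> preserves T' E \<and> (\<forall>p\<in>E. \<sigma> (pmap T p) = pmap T' (\<sigma> p))"

lemma linkedD: "linked T T' \<Longrightarrow> preserves T E" "linked T T' \<Longrightarrow> preserves T' E"
 "linked T T' \<Longrightarrow> p \<in> E \<Longrightarrow> \<sigma> (pmap T p) = pmap T' (\<sigma> p)"
 by (simp_all add: linked_def)

lemma linkedI:
 assumes "preserves T E" "preserves T' E"
  and rel: "\<And>v w. \<forall>k. bil (EC_forms P k) v w = 0 \<Longrightarrow> \<forall>k. bil (EC_forms P k) (T *v v) (T' *v w) = 0"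
 shows "linked T T'"
 unfolding linked_def
proof (intro conjI ballI assms(1,2))
 fix p assume "p \<in> E"
 then obtain v w where vw: "v \<noteq> 0" "w \<noteq> 0" "p = proj v" "\<sigma> p = proj w" "\<forall>k. bil (EC_forms P k) v w = 0"
  by (rule E_graph)
 have nz: "T *v v \<noteq> 0" "T' *v w \<noteq> 0" using vw assms(1,2) by (simp_all add: preserves_def invertible_mult_nz)
 have "\<sigma> (proj (T *v v)) = proj (T' *v w)" using presentsD(5)[OF presents_EC nz] rel[OF vw(5)] by blast
 moreover have "pmap T p = proj (T *v v)" by (simp add: vw(3))
 moreover have "pmap T' (\<sigma> p) = proj (T' *v w)" by (simp only: vw(4) pmap_proj)
 ultimately show "\<sigma> (pmap T p) = pmap T' (\<sigma> p)" by (simp only:)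
qed

lemma linked_mult:
 assumes "linked S S'" "linked T T'"
 shows "linked (S ** T) (S' ** T')"
 unfolding linked_def
proof (intro conjI ballI)
 show "preserves (S ** T) E" "preserves (S' ** T') E"
  using assms by (auto simp: linked_def intro: preserves_mult)
 fix p assume p: "p \<in> E"
 then have "pmap T p \<in> E" using linkedD(1)[OF assms(2)] preserves_mem by blast
 then show "\<sigma> (pmap (S ** T) p) = pmap (S' ** T') (\<sigma> p)"
  using linkedD(3)[OF assms(1)] linkedD(3)[OF assms(2) p] by (simp add: pmap_mult)
qed

lemma linked_inv:
 assumes "linked T T'"
 shows "linked (matrix_inv T) (matrix_inv T')"
 unfolding linked_def
proof (intro conjI ballI)
 note D = linkedD[OF assms]
 show "preserves (matrix_inv T) E" "preserves (matrix_inv T') E" using D preserves_inv by blast+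
 fix p assume p: "p \<in> E"
 have inv: "invertible T" "invertible T'" using D by (simp_all add: preserves_def)
 have q: "pmap (matrix_inv T) p \<in> E" using preserves_mem[OF preserves_inv[OF D(1)] p] .
 have "\<sigma> p = pmap T' (\<sigma> (pmap (matrix_inv T) p))" using D(3)[OF q] inv by (simp add: pmap_inv)
 then show "\<sigma> (pmap (matrix_inv T) p) = pmap (matrix_inv T') (\<sigma> p)" using inv by (simp add: pmap_inv)
qed

lemma linked_cong:
 assumes "linked T T'" "invertible S" "\<And>p. p \<in> E \<Longrightarrow> pmap S p = pmap T p"
 shows "linked S T'"
proof -
 have "pmap S ` E = pmap T ` E" using assms(3) by (intro image_cong refl)
 then show ?thesis using assms by (simp add: linked_def preserves_def)
qed

abbreviation "comm H \<equiv> linked H H"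

text \<open>Rigidity for a single matrix, so that representatives modulo the Heisenberg group can be
  treated one at a time.\<close>

definition good :: "'k^3^3 \<Rightarrow> bool" where
 "good T \<longleftrightarrow> (\<forall>T'. linked T T' \<longrightarrow> (\<forall>p\<in>E. pmap T' p = pmap T p))"

lemma comm_inverse_mult:
 assumes "comm H" "comm K" "linked T T'" "invertible S" "\<And>p. p \<in> E \<Longrightarrow> pmap T p = pmap H (pmap S (pmap K p))"
 shows "linked S (matrix_inv H ** T' ** matrix_inv K)"
proof (rule linked_cong[OF linked_mult[OF linked_mult[OF linked_inv[OF assms(1)] assms(3)] linked_inv[OF assms(2)]] assms(4)])
 fix p assume "p \<in> E"
 have inv: "invertible H" "invertible K" using assms(1,2) by (simp_all add: linked_def preserves_def)
 have "pmap (matrix_inv K) p \<in> E" using linkedD(1)[OF linked_inv[OF assms(2)]] \<open>p \<in> E\<close> preserves_mem by blast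
 then show "pmap S p = pmap (matrix_inv H ** T ** matrix_inv K) p"
  using inv by (simp add: pmap_mult assms(5) pmap_inv)
qed

text \<open>If \<open>H\<close> and \<open>K\<close> commute with \<sigma>, conjugation by \<sigma>
  affects only the middle factor of \<open>H S K\<close>.\<close>

lemma good_Heis:
 assumes "comm H" "comm K" "good S" "invertible S" "\<And>p. p \<in> E \<Longrightarrow> pmap T p = pmap H (pmap S (pmap K p))"
 shows "good T"
 unfolding good_def
proof (intro allI impI ballI)
 fix T' p assume l: "linked T T'" and p: "p \<in> E"
 have inv: "invertible H" "invertible K" using assms(1,2) by (simp_all add: linked_def preserves_def)
 have Kp: "pmap K p \<in> E" using linkedD(1)[OF assms(2)] p preserves_mem by blast
 have "pmap (matrix_inv H ** T' ** matrix_inv K) (pmap K p) = pmap S (pmap K p)"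
  using comm_inverse_mult[OF assms(1,2) l assms(4,5)] assms(3) Kp unfolding good_def by blast
 then have "pmap (matrix_inv H) (pmap T' p) = pmap S (pmap K p)" using inv by (simp add: pmap_mult pmap_inv)
 then have "pmap T' p = pmap H (pmap S (pmap K p))" using inv by (metis pmap_inv(2))
 then show "pmap T' p = pmap T p" using assms(5)[OF p] by simp
qed

text \<open>Each of the three relations is an eigenvector of the substitution, with eigenvalues
  \<open>1\<close>, \<open>r^2\<close> and \<open>r\<close>.\<close>

lemma comm_Dm: assumes "r^3 = 1" shows "comm (Dm r)"
proof -
 have r: "r * r\<^sup>2 = 1" "r\<^sup>2 * r = 1" "(r\<^sup>2)^3 = 1" "r \<noteq> 0"
 proof -
  show "r*r\<^sup>2 = 1" "r\<^sup>2*r = 1" using assms by (simp_all add: power2_eq_square power3_eq_cube mult.assoc)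
  have "(r\<^sup>2)^3 = (r^3)\<^sup>2" by (simp add: power_mult[symmetric] mult.commute)
  then show "(r\<^sup>2)^3 = 1" by (simp add: assms)
  show "r \<noteq> 0" using assms by auto
 qed
 have "cub l (Dm r *v v) = 1 * cub l v" for v
 proof -
  have "cub l (Dm r *v v) = (v $ 1)^3 + r^3*(v $ 2)^3 + (r\<^sup>2)^3*(v $ 3)^3 - 3*l*(r*r\<^sup>2) * v $ 1 * v $ 2 * v $ 3"
   by (simp add: Heis_mult hesse_def power_mult_distrib algebra_simps)
  moreover have "r^6 = 1" using r(3) by simp
  ultimately show ?thesis by (simp add: assms r hesse_def)
 qed
 from preserves_hesseI[OF Heis_invertible(1)[OF r(4)] _ this] have p: "preserves (Dm r) E" by simp
 show ?thesis
 proof (rule linkedI[OF p p])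
  fix v w assume b: "\<forall>k. bil (EC_forms P k) v w = 0"
  have "P $ 3 * v $ 1*w $ 1 + P $ 1*(r * v $ 2)*(r\<^sup>2*w $ 3) + P $ 2*(r\<^sup>2 * v $ 3)*(r*w $ 2)
   = P $ 3 * v $ 1 * w $ 1 + (r * r\<^sup>2) * (P $ 1 * v $ 2 * w $ 3 + P $ 2 * v $ 3 * w $ 2)"
   "P $ 3*(r * v $ 2)*(r*w $ 2) + P $ 1*(r\<^sup>2 * v $ 3)*w $ 1 + P $ 2 * v $ 1*(r\<^sup>2*w $ 3)
   = r\<^sup>2 * (P $ 3 * v $ 2 * w $ 2 + P $ 1 * v $ 3 * w $ 1 + P $ 2 * v $ 1 * w $ 3)"
   "P $ 3*(r\<^sup>2 * v $ 3)*(r\<^sup>2*w $ 3) + P $ 1 * v $ 1*(r*w $ 2) + P $ 2*(r * v $ 2)*w $ 1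
   = r*((r*r\<^sup>2)*(P $ 3 * v $ 3*w $ 3) + P $ 1 * v $ 1*w $ 2 + P $ 2 * v $ 2*w $ 1)"
   by (simp_all add: power2_eq_square algebra_simps)
  then show "\<forall>k. bil (EC_forms P k) (Dm r *v v) (Dm r *v w) = 0"
   using b unfolding EC_forms_zero Heis_mult vector_3 r by (simp add: add.assoc)
 qed
qed

lemma comm_Xm: "comm Xm"
proof -
 have "cub l (Xm *v v) = 1 * cub l v" for v by (simp add: Heis_mult hesse_def ac_simps)
 from preserves_hesseI[OF Heis_invertible(2) _ this] have p: "preserves Xm E" by simp
 show ?thesis
  by (rule linkedI[OF p p]) (simp add: EC_forms_zero Heis_mult ac_simps)
qed

lemma preserves_Im: "preserves Jm E"
proof -
 have "cub l (Jm *v v) = 1 * cub l v" for v by (simp add: Heis_mult hesse_def ac_simps)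
 from preserves_hesseI[OF Heis_invertible(3) _ this] show ?thesis by simp
qed

lemma Jm_Jm [simp]:
 fixes p :: "('k^3) set"
 shows "pmap Jm (pmap Jm p) = p"
proof -
 have "Jm ** Jm = (mat 1 :: 'k^3^3)"
  by (simp add: matrix_eq matrix_vector_mul_assoc[symmetric] Heis_mult vec3_eq_iff)
 then show ?thesis by (simp flip: pmap_mult)
qed

text \<open>Inversion conjugates a translation to its inverse. In the relations, exchanging the two
  arguments and applying \<open>Jm\<close> to both permutes the three forms.\<close>

lemma \<sigma>_Im: assumes "p \<in> E" shows "\<sigma> (pmap Jm (\<sigma> p)) = pmap Jm p"
proof -
 obtain v w where vw: "v \<noteq> 0" "w \<noteq> 0" "p = proj v" "\<sigma> p = proj w" "\<forall>k. bil (EC_forms P k) v w = 0"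
  using assms by (rule E_graph)
 have nz: "Jm *v w \<noteq> 0" "Jm *v v \<noteq> 0" using vw by (simp_all add: invertible_mult_nz Heis_invertible)
 have "\<forall>k. bil (EC_forms P k) (Jm *v w) (Jm *v v) = 0"
  using vw(5) by (simp add: EC_forms_zero Heis_mult ac_simps)
 then have "\<sigma> (proj (Jm *v w)) = proj (Jm *v v)" using presentsD(5)[OF presents_EC nz] by blast
 moreover have "pmap Jm p = proj (Jm *v v)" by (simp add: vw(3))
 moreover have "pmap Jm (\<sigma> p) = proj (Jm *v w)" by (simp only: vw(4) pmap_proj)
 ultimately show ?thesis by (simp only:)
qed

text \<open>The flexes on two sides of the coordinate triangle suffice, since on each side three of
  them determine the induced projectivity.\<close>

lemma spanning_EC:
 assumes w: "(\<omega>::'k)\<^sup>2 + \<omega> + 1 = 0"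
 shows "spanning E"
 using presents_EC
proof (rule spanningI, goal_cases)
 case (1 a b c d e f g h i)
 note W = primitive_cube_rootD[OF w]
 have x0: "b - c * t = 0 \<and> (e - f * t) * (- t) = h - i * t" if "t^3 = 1" for t
  using 1[of 0 1 "- t"] that by (simp add: hesse_def power3_eq_cube)
 have "c * (\<omega> - 1) = (b - c * 1) - (b - c * \<omega>)" by (simp add: algebra_simps)
 also have "\<dots> = 0" using x0[of 1] x0[OF W(1)] by simp
 finally have c: "c = 0" using W(2) by simp
 then have b: "b = 0" using x0[of 1] by simp
 have f: "f = 0 \<and> h = 0 \<and> i = e" using three_points_fixed[OF w, of e f h i] x0 by blast
 have z0: "(a - 0 * t) * (- t) = d - e * t \<and> g = 0" if "t^3 = 1" for t
  using 1[of 1 "- t" 0] that by (simp add: hesse_def power3_eq_cube b c f)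
 have "d = 0 \<and> e = a" using three_points_fixed[OF w, of a 0 d e] z0 by blast
 then show ?case using b c f z0[of 1] by simp
qed

lemma proportional_if_equal:
 assumes w: "(\<omega>::'k)\<^sup>2 + \<omega> + 1 = 0" and A: "invertible A" and eq: "\<And>p. p \<in> E \<Longrightarrow> pmap B p = pmap A p"
 shows "\<exists>\<kappa>. \<forall>v. B *v v = \<kappa> *s (A *v v)"
proof -
 have "\<forall>p\<in>E. pmap (matrix_inv A ** B) p = p" using eq A by (simp add: pmap_mult pmap_inv)
 then obtain \<kappa> where k: "\<And>v. (matrix_inv A ** B) *v v = \<kappa> *s v"
  using spanning_EC[OF w] unfolding spanning_def by blast
 have "B *v v = A *v ((matrix_inv A ** B) *v v)" for v
  by (simp add: matrix_vector_mul_assoc[symmetric] matrix_inv_props[OF A])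
 then have "B *v v = \<kappa> *s (A *v v)" for v by (simp add: k vector_scalar_commute)
 then show ?thesis by blast
qed

text \<open>Representatives of the nine classes of the Heisenberg group modulo scalars.\<close>

definition Heis :: "('k^3^3) set" where
 "Heis = {H. \<exists>r. r^3 = 1 \<and> (H = Dm r \<or> H = Xm ** Dm r \<or> H = Xm ** Xm ** Dm r)}"

lemma Heis_comm: "H \<in> Heis \<Longrightarrow> comm H"
 unfolding Heis_def using comm_Dm comm_Xm linked_mult by auto

lemma Heis_order_3:
 assumes "H \<in> Heis" "p \<in> P2" shows "pmap H (pmap H (pmap H p)) = p"
proof -
 obtain r where r: "r^3 = 1" "H = Dm r \<or> H = Xm ** Dm r \<or> H = Xm ** Xm ** Dm r" using assms(1) by (auto simp: Heis_def)
 have r': "r * (r * r) = 1" using r(1) by (simp add: power3_eq_cube mult.assoc)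
 then have r'': "r * (r * (r * x)) = x" for x by (metis mult.assoc mult_1)
 have "(H ** H ** H) *v v = 1 *s (mat 1 *v v)" for v
  using r(2) by (elim disjE) (simp_all only: matrix_vector_mul_assoc[symmetric] Heis_mult vector_3,
   simp_all add: vec3_eq_iff power2_eq_square mult.assoc r' r'')
 from pmap_eqI[OF _ this assms(2)] show ?thesis by (simp add: pmap_mult)
qed

text \<open>Modulo scalars the Heisenberg group is its own centraliser. Commutation on points gives
  commutation of matrices up to factors \<kappa> and \<mu>; \<kappa> selects one of the three cyclic
  diagonals, and \<mu> is the ratio of consecutive entries along it.\<close>

lemma Heis_if_commutes:
 fixes S :: "'k^3^3"
 assumes w: "(\<omega>::'k)\<^sup>2 + \<omega> + 1 = 0" and S: "invertible S"
  and D: "\<And>p. p \<in> E \<Longrightarrow> pmap S (pmap (Dm \<omega>) p) = pmap (Dm \<omega>) (pmap S p)"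
  and X: "\<And>p. p \<in> E \<Longrightarrow> pmap S (pmap Xm p) = pmap Xm (pmap S p)"
 obtains H k where "H \<in> Heis" "k \<noteq> 0" "\<forall>v. S *v v = k *s (H *v v)"
proof -
 note W = primitive_cube_rootD[OF w]
 have "\<exists>\<kappa>. \<forall>v. (S ** Dm \<omega>) *v v = \<kappa> *s ((Dm \<omega> ** S) *v v)"
  by (rule proportional_if_equal[OF w]) (simp_all add: pmap_mult D S invertible_mult Heis_invertible W)
 then obtain \<kappa> where k: "\<And>v. S *v (Dm \<omega> *v v) = \<kappa> *s (Dm \<omega> *v (S *v v))" by (auto simp: matrix_vector_mul_assoc)
 have "\<exists>\<kappa>. \<forall>v. (S ** Xm) *v v = \<kappa> *s ((Xm ** S) *v v)"
  by (rule proportional_if_equal[OF w]) (simp_all add: pmap_mult X S invertible_mult Heis_invertible)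
 then obtain \<mu> where m: "\<And>v. S *v (Xm *v v) = \<mu> *s (Xm *v (S *v v))" by (auto simp: matrix_vector_mul_assoc)
 obtain a b c d e f g h i where Sm: "S = m33 a b c d e f g h i" by (rule m33_cases)
 have det: "a*(e*i - f*h) - b*(d*i - f*g) + c*(d*h - e*g) \<noteq> 0" using S by (simp add: Sm m33_invertible)
 have K: "a = \<kappa>*a" "\<omega>*b = \<kappa>*b" "\<omega>\<^sup>2 * c = \<kappa> * c" "d = \<kappa>*(\<omega>*d)" "\<omega>*e = \<kappa>*(\<omega>*e)" "\<omega>\<^sup>2*f = \<kappa>*(\<omega>*f)"
  "g = \<kappa>*(\<omega>\<^sup>2*g)" "\<omega>*h = \<kappa>*(\<omega>\<^sup>2*h)" "\<omega>\<^sup>2*i = \<kappa>*(\<omega>\<^sup>2*i)"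
  using k[of "vector [1, 0, 0]"] k[of "vector [0, 1, 0]"] k[of "vector [0, 0, 1]"]
  by (simp_all add: Sm Heis_mult m33_mult vec3_eq_iff mult.commute)
 have M: "c = \<mu>*d" "a = \<mu>*e" "b = \<mu>*f" "f = \<mu>*g" "d = \<mu>*h" "e = \<mu>*i" "i = \<mu>*a" "g = \<mu>*b" "h = \<mu> * c"
  using m[of "vector [1, 0, 0]"] m[of "vector [0, 1, 0]"] m[of "vector [0, 0, 1]"]
  by (simp_all add: Sm Heis_mult m33_mult vec3_eq_iff)
 have w2: "\<omega>*\<omega>\<^sup>2 = 1" using W(1) by (simp add: power2_eq_square power3_eq_cube mult.assoc)
 have "\<omega>\<^sup>2 \<noteq> \<omega>" using W(2,3) by (simp add: power2_eq_square)
 have "\<omega>\<^sup>2 \<noteq> 1"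
 proof
  assume "\<omega>\<^sup>2 = 1"
  then have "\<omega> = 1" using w2 by simp
  then show False using W(2) by simp
 qed
 have abc: "a \<noteq> 0 \<or> b \<noteq> 0 \<or> c \<noteq> 0" using det by auto
 define n where "n = \<mu>\<^sup>2"
 have cube: "\<mu>^3 = 1" if "x \<noteq> 0" "x = \<mu> * (\<mu> * (\<mu> * x))" for x
 proof -
  have "x * \<mu>^3 = x * 1" using that(2) by (simp add: power3_eq_cube ac_simps)
  then show ?thesis using that(1) by (simp only: mult_cancel_left) simp
 qed
 have mn: "\<mu>*n = 1 \<and> n\<^sup>2 = \<mu> \<and> n^3 = 1 \<and> \<mu>*\<mu> = n \<and> n*n = \<mu>" if mu: "\<mu>^3 = 1"
 proof (intro conjI)
  show 1: "\<mu>*n = 1" using mu by (simp add: n_def power2_eq_square power3_eq_cube mult.assoc)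
  have "n * n = \<mu>^3 * \<mu>" by (simp add: n_def power2_eq_square power3_eq_cube)
  then show nn: "n * n = \<mu>" using mu by simp
  then show "n\<^sup>2 = \<mu>" by (simp add: power2_eq_square)
  show "n^3 = 1" using nn 1 by (simp add: power3_eq_cube)
  show "\<mu> * \<mu> = n" by (simp add: n_def power2_eq_square)
 qed
 from abc consider "a \<noteq> 0" "b = 0" "c = 0" | "a = 0" "b \<noteq> 0" "c = 0" | "a = 0" "b = 0" "c \<noteq> 0"
 proof (elim disjE)
  assume "a \<noteq> 0"
  then have "\<kappa> = 1" using K(1) by simp
  then show ?thesis using that(1) \<open>a \<noteq> 0\<close> K(2,3) W(2) \<open>\<omega>\<^sup>2 \<noteq> 1\<close> by auto
 next
  assume "b \<noteq> 0"
  then have "\<kappa> = \<omega>" using K(2) by simp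
  then show ?thesis using that(2) \<open>b \<noteq> 0\<close> K(1,3) W(2) \<open>\<omega>\<^sup>2 \<noteq> \<omega>\<close> by auto
 next
  assume "c \<noteq> 0"
  then have "\<kappa> = \<omega>\<^sup>2" using K(3) by simp
  then show ?thesis using that(3) \<open>c \<noteq> 0\<close> K(1,2) \<open>\<omega>\<^sup>2 \<noteq> 1\<close> \<open>\<omega>\<^sup>2 \<noteq> \<omega>\<close> by auto
 qed
 then show thesis
 proof cases
  case 1
  have z: "d = 0" "f = 0" "g = 0" "h = 0" using M 1 by simp_all
  have "a = \<mu> * (\<mu> * (\<mu> * a))" using M(2,6,7) by simp
  note N = mn[OF cube[OF 1(1) this]]
  have ei: "e = n * a" "i = \<mu> * a" using M(6,7) N by (simp_all add: mult.assoc[symmetric])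
  have "S *v v = a *s (Dm n *v v)" for v
   unfolding Sm Heis_mult using N by (simp add: vec3_eq_iff matrix_vector_mult_3 1 z ei mult.commute mult.left_commute)
  moreover have "Dm n \<in> Heis" unfolding Heis_def using N by blast
  ultimately show thesis using that 1(1) by blast
 next
  case 2
  have z: "d = 0" "e = 0" "h = 0" "i = 0" using M 2 by simp_all
  have "b = \<mu> * (\<mu> * (\<mu> * b))" using M(3,4,8) by simp
  note N = mn[OF cube[OF 2(2) this]]
  have fg: "f = n * b" "g = \<mu> * b" using M(4,8) N by (simp_all add: mult.assoc[symmetric])
  have x: "\<mu> * b * (n * x) = b * x" "\<mu> * b * (n\<^sup>2 * x) = n * b * x" for x
  proof -
   have "\<mu>*b*(n*x) = (\<mu>*n)*(b*x)" "\<mu>*b*(\<mu>*x) = (\<mu>*\<mu>)*b*x" by (simp_all only: ac_simps)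
   then show "\<mu>*b*(n*x) = b*x" "\<mu>*b*(n\<^sup>2*x) = n*b*x" using N by simp_all
  qed
  have "S *v v = (\<mu> * b) *s ((Xm ** Dm n) *v v)" for v
   unfolding Sm matrix_vector_mul_assoc[symmetric] Heis_mult vec3_eq_iff
   by (simp only: vector_3 vector_smult_component matrix_vector_mult_3 2 z fg x mult_zero_left add_0_left add_0_right)
  moreover have "Xm ** Dm n \<in> Heis" unfolding Heis_def using N by blast
  moreover have "\<mu> * b \<noteq> 0" using 2 N by auto
  ultimately show thesis using that by blast
 next
  case 3
  have z: "e = 0" "f = 0" "g = 0" "i = 0" using M 3 by simp_all
  have "c = \<mu> * (\<mu> * (\<mu> * c))" using M(1,5,9) by simp
  note N = mn[OF cube[OF 3(3) this]]
  have dh: "d = n * c" "h = \<mu> * c" using M(5,9) N by (simp_all add: mult.assoc[symmetric])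
  have x: "n * c * (n\<^sup>2 * x) = c * x" "n * c * (n * x) = \<mu> * c * x" for x
  proof -
   have "n * c*(\<mu>*x) = (\<mu>*n)*(c*x)" "n * c*(n*x) = (n*n) * c*x" by (simp_all only: ac_simps)
   then show "n * c*(n\<^sup>2*x) = c*x" "n * c*(n*x) = \<mu> * c*x" using N by simp_all
  qed
  have "S *v v = (n * c) *s ((Xm ** Xm ** Dm n) *v v)" for v
   unfolding Sm matrix_vector_mul_assoc[symmetric] Heis_mult vec3_eq_iff
   by (simp only: vector_3 vector_smult_component matrix_vector_mult_3 3 z dh x mult_zero_left add_0_left add_0_right)
  moreover have "Xm ** Xm ** Dm n \<in> Heis" unfolding Heis_def using N by blast
  moreover have "n * c \<noteq> 0" using 3 N by auto
  ultimately show thesis using that by blast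
 qed
qed

text \<open>\<open>S = T' Jm\<close> acts on \<open>E\<close> as \<open>\<sigma>^2\<close>, so it
  commutes with \<open>Dm \<omega>\<close> and \<open>Xm\<close> and is an element of order dividing
  three; the hypothesis on the powers of \<sigma> then applies.\<close>

lemma \<sigma>_square:
 assumes w: "(\<omega>::'k)\<^sup>2 + \<omega> + 1 = 0" and hyp: "hypothesis_6_2 E \<sigma>" and I: "linked Jm T'" and p: "p \<in> E"
 shows "\<sigma> (\<sigma> p) = p"
proof -
 note W = primitive_cube_rootD[OF w]
 define S where "S = T' ** Jm"
 have S: "pmap S y = \<sigma> (\<sigma> y)" if y: "y \<in> E" for y
 proof -
  have q: "pmap Jm (\<sigma> y) \<in> E" using preserves_mem[OF preserves_Im \<sigma>_mem[OF y]] .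
  have "pmap T' (\<sigma> (pmap Jm (\<sigma> y))) = \<sigma> (pmap Jm (pmap Jm (\<sigma> y)))" using linkedD(3)[OF I q] by simp
  then show ?thesis by (simp add: \<sigma>_Im[OF y] S_def pmap_mult)
 qed
 have c: "pmap S (pmap H y) = pmap H (pmap S y)" if "comm H" "y \<in> E" for H y
  using linkedD(3)[OF that(1)] that(2) \<sigma>_mem preserves_mem[OF linkedD(1)[OF that(1)]] by (simp add: S)
 have "invertible S" using linkedD(2)[OF I] by (simp add: S_def preserves_def invertible_mult Heis_invertible)
 then obtain H k where H: "H \<in> Heis" "k \<noteq> 0" "\<forall>v. S *v v = k *s (H *v v)"
  by (rule Heis_if_commutes[OF w _ c[OF comm_Dm[OF W(1)]] c[OF comm_Xm]])
 have SH: "pmap S y = pmap H y" if "y \<in> E" for y by (rule pmap_eqI[OF H(2) H(3)[rule_format] E_P2[OF that]])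
 have "(\<sigma> ^^ 6) y = y" if y: "y \<in> E" for y
 proof -
  have m: "\<sigma> (\<sigma> y) \<in> E" "\<sigma> (\<sigma> (\<sigma> (\<sigma> y))) \<in> E" using y \<sigma>_mem by simp_all
  have "\<sigma> (\<sigma> (\<sigma> (\<sigma> (\<sigma> (\<sigma> y))))) = pmap H (pmap H (pmap H y))"
   using SH[OF m(2)] SH[OF m(1)] SH[OF y] S[OF m(2)] S[OF m(1)] S[OF y] by simp
  then show ?thesis using Heis_order_3[OF H(1) E_P2[OF y]] by (simp add: numeral_eq_Suc)
 qed
 then have "\<sigma> [^]\<^bsub>BijGroup E\<^esub> (2::nat) = \<one>\<^bsub>BijGroup E\<^esub>"
  using hyp unfolding pow_eq_one_iff[OF presentsD(3)[OF presents_EC]] by blast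
 then have "(\<sigma> ^^ 2) p = p" using p unfolding pow_eq_one_iff[OF presentsD(3)[OF presents_EC]] by blast
 then show ?thesis by (simp add: numeral_2_eq_2)
qed

lemma good_Im:
 assumes w: "(\<omega>::'k)\<^sup>2 + \<omega> + 1 = 0" and hyp: "hypothesis_6_2 E \<sigma>"
 shows "good Jm"
 unfolding good_def
proof (intro allI impI ballI)
 fix T' p assume I: "linked Jm T'" and p: "p \<in> E"
 obtain q where q: "q \<in> E" "p = \<sigma> q" using p by (rule \<sigma>_surj)
 have y: "pmap Jm p \<in> E" using preserves_mem[OF preserves_Im p] .
 have "pmap T' p = \<sigma> (pmap Jm q)" using linkedD(3)[OF I q(1)] q by simp
 also have "\<dots> = \<sigma> (\<sigma> (pmap Jm (\<sigma> q)))" by (simp add: \<sigma>_Im[OF q(1)])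
 also have "\<dots> = pmap Jm p" using \<sigma>_square[OF w hyp I y] q(2) by simp
 finally show "pmap T' p = pmap Jm p" .
qed

text \<open>For linked \<open>T\<close> and \<open>T'\<close>, the map \<open>T' T\<^sup>-\<^sup>1\<close> is the quotient of \<open>\<sigma>\<close> and its conjugate by \<open>T\<close>, so it commutes with whatever commutes with both.\<close>

lemma quotient_commutes:
 assumes l: "linked T T'" and M: "comm M" "comm K" and MK: "\<And>p. p \<in> E \<Longrightarrow> pmap M (pmap T p) = pmap T (pmap K p)"
  and p: "p \<in> E"
 shows "pmap (T' ** matrix_inv T) (pmap M p) = pmap M (pmap (T' ** matrix_inv T) p)"
proof -
 note D = linkedD[OF l]
 have inv: "invertible T" "invertible T'" using D by (simp_all add: preserves_def)
 have *: "pmap T' (pmap K y) = pmap M (pmap T' y)" if y: "y \<in> E" for y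
 proof -
  obtain q where q: "q \<in> E" "y = \<sigma> q" using y by (rule \<sigma>_surj)
  have Kq: "pmap K q \<in> E" using preserves_mem[OF linkedD(1)[OF M(2)] q(1)] .
  have Tq: "pmap T q \<in> E" using preserves_mem[OF D(1) q(1)] .
  have "pmap T' (pmap K y) = \<sigma> (pmap T (pmap K q))" using D(3)[OF Kq] linkedD(3)[OF M(2) q(1)] q(2) by simp
  also have "\<dots> = pmap M (\<sigma> (pmap T q))" using MK[OF q(1)] linkedD(3)[OF M(1) Tq] by simp
  finally show ?thesis using D(3)[OF q(1)] q(2) by simp
 qed
 define y where "y = pmap (matrix_inv T) p"
 have y: "y \<in> E" "p = pmap T y" using preserves_mem[OF preserves_inv[OF D(1)] p] inv by (simp_all add: y_def pmap_inv)
 then show ?thesis using *[OF y(1)] MK[OF y(1)] inv by (simp add: pmap_mult pmap_inv)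
qed

text \<open>The quotient of \<open>T'\<close> by \<open>Sm s\<close> is a Heisenberg element
  \<open>H\<close>. At the zero element, which \<open>Sm s\<close> fixes and \<sigma> sends to
  \<open>P\<close>, it gives \<open>P = H (Sm s P)\<close> as points. A diagonal \<open>H\<close>
  contradicts \<open>s \<noteq> 1\<close>; otherwise the cubes of the coordinates of
  \<open>P\<close> differ cyclically by one factor \<open>\<kappa>^3\<close>, itself a cube root of
  unity.\<close>

lemma linked_Sm_exceptional:
 assumes w: "(\<omega>::'k)\<^sup>2 + \<omega> + 1 = 0" and s: "s^3 = 1" "s \<noteq> 1" and lk: "linked (Sm s) T'"
 shows "(P $ 1)^9 = (P $ 2)^9 \<and> (P $ 2)^9 = (P $ 3)^9"
proof -
 note W = primitive_cube_rootD[OF w]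
 have s0: "s \<noteq> 0" using s by auto
 have inv: "invertible (Sm s)" "invertible T'" using linkedD[OF lk] by (simp_all add: preserves_def)
 define S where "S = T' ** matrix_inv (Sm s)"
 have ss: "s * (s\<^sup>2 * x) = x" for x
 proof -
  have "s * (s\<^sup>2 * x) = s^3 * x" by (simp add: power2_eq_square power3_eq_cube)
  then show ?thesis by (simp add: s)
 qed
 have 1: "pmap (Dm \<omega>) (pmap (Sm s) p) = pmap (Sm s) (pmap (Dm \<omega>) p)" if "p \<in> E" for p
 proof -
  have "(Dm \<omega> ** Sm s) *v v = 1 *s ((Sm s ** Dm \<omega>) *v v)" for v
   by (simp add: matrix_vector_mul_assoc[symmetric] Heis_mult vec3_eq_iff)
  from pmap_eqI[OF _ this E_P2[OF that]] show ?thesis by (simp add: pmap_mult)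
 qed
 \<comment> \<open>\<open>Sm s\<close> normalises the Heisenberg group: moving \<open>Xm\<close>
   past it costs a factor \<open>Dm s\<close>.\<close>
 have 2: "pmap Xm (pmap (Sm s) p) = pmap (Sm s) (pmap (Dm s ** Xm) p)" if "p \<in> E" for p
 proof -
  have "(Xm ** Sm s) *v v = 1 *s ((Sm s ** (Dm s ** Xm)) *v v)" for v
   by (simp add: matrix_vector_mul_assoc[symmetric] Heis_mult vec3_eq_iff ss)
  from pmap_eqI[OF _ this E_P2[OF that]] show ?thesis by (simp add: pmap_mult)
 qed
 have "invertible S" unfolding S_def using inv matrix_inv_props(1) by (blast intro: invertible_mult)
 then obtain H k where H: "H \<in> Heis" "k \<noteq> 0" "\<forall>v. S *v v = k *s (H *v v)"
  by (rule Heis_if_commutes[OF w _ quotient_commutes[OF lk comm_Dm[OF W(1)] comm_Dm[OF W(1)] 1, folded S_def]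
   quotient_commutes[OF lk comm_Xm linked_mult[OF comm_Dm[OF s(1)] comm_Xm] 2, folded S_def]])
 have o: "origin \<noteq> (0 :: 'k^3)" "cub l origin = 0" by (simp_all add: origin_def hesse_def)
 then have oE: "proj origin \<in> E" by (simp add: mem_hesse)
 have "\<forall>k. bil (EC_forms P k) origin P = 0" unfolding EC_forms_zero by (simp add: origin_def algebra_simps)
 then have so: "\<sigma> (proj origin) = proj P" using presentsD(5)[OF presents_EC o(1) P_nz(1)] by blast
 have "Sm s *v origin = origin" by (simp add: Heis_mult origin_def)
 then have "proj P = \<sigma> (pmap (Sm s) (proj origin))" by (simp add: so)
 also have "\<dots> = pmap T' (\<sigma> (proj origin))" by (rule linkedD(3)[OF lk oE])
 also have "\<dots> = pmap S (pmap (Sm s) (proj P))" by (simp only: so S_def pmap_mult pmap_inv(1)[OF inv(1)])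
 also have "\<dots> = proj (H *v (Sm s *v P))" by (simp add: H(3) proj_smult H(2))
 finally obtain \<kappa> where "\<kappa> \<noteq> 0" "H *v (Sm s *v P) = \<kappa> *s P" unfolding proj_eq_iff by blast
 note kp = this
 obtain r where r: "r^3 = 1" "H = Dm r \<or> H = Xm ** Dm r \<or> H = Xm ** Xm ** Dm r" using H(1) by (auto simp: Heis_def)
 have cubes: "(r * x)^3 = x^3" "(r\<^sup>2 * (s * x))^3 = x^3" for x
 proof -
  have "(r * x)^3 = r^3 * x^3" "(r\<^sup>2 * (s * x))^3 = (r^3)\<^sup>2 * (s^3 * x^3)"
   by (simp_all add: power_mult_distrib power_mult[symmetric] mult.commute)
  then show "(r * x)^3 = x^3" "(r\<^sup>2 * (s * x))^3 = x^3" by (simp_all add: r s)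
 qed
 have nine: "A^9 = B^9 \<and> B^9 = C^9" if "B^3 = q*A^3" "C^3 = q*B^3" "A^3 = q*C^3" "A \<noteq> 0" for A B C q :: 'k
 proof -
  have "A^3 = q * C^3" by (rule that(3))
  also have "\<dots> = q * (q * (q * A^3))" by (simp only: that(2) that(1))
  also have "\<dots> = q^3 * A^3" by (simp only: power3_eq_cube mult.assoc)
  finally have "A^3 = q^3 * A^3" .
  then have q: "q^3 = 1" using that(4) by simp
  have p9: "x^9 = (x^3)^3" for x :: 'k by (simp add: power_mult[symmetric])
  show ?thesis unfolding p9 using that(1) that(2) q by (simp add: power_mult_distrib)
 qed
 from r(2) show ?thesis
 proof (elim disjE)
  assume h: "H = Dm r"
  have e: "P $ 1 = \<kappa>*P $ 1" "r*P $ 2 = \<kappa>*P $ 2" "r\<^sup>2*(s*P $ 3) = \<kappa>*P $ 3"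
   using kp(2) unfolding h Heis_mult by (simp_all add: vec3_eq_iff)
  then have "\<kappa> = 1" "r = \<kappa>" using P_nz by simp_all
  then have "s = 1" using e(3) P_nz by simp
  then show ?thesis using s by simp
 next
  assume h: "H = Xm ** Dm r"
  have e: "r*P $ 2 = \<kappa>*P $ 1" "r\<^sup>2*(s*P $ 3) = \<kappa>*P $ 2" "P $ 1 = \<kappa>*P $ 3"
   using kp(2) unfolding h matrix_vector_mul_assoc[symmetric] Heis_mult by (simp_all add: vec3_eq_iff)
  have "(P $ 2)^3 = \<kappa>^3*(P $ 1)^3" "(P $ 3)^3 = \<kappa>^3*(P $ 2)^3" "(P $ 1)^3 = \<kappa>^3*(P $ 3)^3"
   using arg_cong[OF e(1), of "\<lambda>x. x^3"] arg_cong[OF e(2), of "\<lambda>x. x^3"] arg_cong[OF e(3), of "\<lambda>x. x^3"]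
   unfolding cubes power_mult_distrib[symmetric] .
  then show ?thesis using nine P_nz by blast
 next
  assume h: "H = Xm ** Xm ** Dm r"
  have e: "r\<^sup>2*(s*P $ 3) = \<kappa>*P $ 1" "P $ 1 = \<kappa>*P $ 2" "r*P $ 2 = \<kappa>*P $ 3"
   using kp(2) unfolding h matrix_vector_mul_assoc[symmetric] Heis_mult by (simp_all add: vec3_eq_iff)
  have "(P $ 3)^3 = \<kappa>^3*(P $ 1)^3" "(P $ 1)^3 = \<kappa>^3*(P $ 2)^3" "(P $ 2)^3 = \<kappa>^3*(P $ 3)^3"
   using arg_cong[OF e(1), of "\<lambda>x. x^3"] arg_cong[OF e(2), of "\<lambda>x. x^3"] arg_cong[OF e(3), of "\<lambda>x. x^3"]
   unfolding cubes power_mult_distrib[symmetric] .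
  then have "(P $ 1)^9 = (P $ 3)^9 \<and> (P $ 3)^9 = (P $ 2)^9" using nine P_nz by blast
  then show ?thesis by simp
 qed
qed

end

section \<open>Hesse cubics with j-invariant 0\<close>

lemma isomorphic_if_linear:
 fixes F G :: "'k::field \<Rightarrow> 'k \<Rightarrow> 'k \<Rightarrow> 'k" and M :: "'k^3^3"
 assumes F: "\<And>t x y z. F (t*x) (t*y) (t*z) = t^3*F x y z" and G: "\<And>t x y z. G (t*x) (t*y) (t*z) = t^3*G x y z"
  and M: "invertible M" and FG: "\<And>v. G ((M *v v) $ 1) ((M *v v) $ 2) ((M *v v) $ 3) = 0 \<longleftrightarrow> F (v $ 1) (v $ 2) (v $ 3) = 0"
 shows "isomorphic_varieties (locus F) (locus G)"
proof -
 let ?X = "locus F" and ?Y = "locus G"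
 note mF = mem_locus[of F 3, OF F] and mG = mem_locus[of G 3, OF G]
 have fwd: "pmap M p \<in> ?Y" if p: "p \<in> ?X" for p
 proof -
  have "p \<in> P2" using p locus_subset_P2 by blast
  then obtain v where "v \<noteq> 0" "p = proj v" by (rule P2_cases)
  then show ?thesis using p M by (simp add: mF mG FG invertible_mult_nz)
 qed
 have bwd: "pmap (matrix_inv M) p \<in> ?X" if p: "p \<in> ?Y" for p
 proof -
  have "p \<in> P2" using p locus_subset_P2 by blast
  then obtain v where v: "v \<noteq> 0" "p = proj v" by (rule P2_cases)
  have "matrix_inv M *v v \<noteq> 0 \<longleftrightarrow> v \<noteq> 0" using matrix_inv_props(1)[OF M] by (simp add: invertible_mult_nz)
  moreover have "F ((matrix_inv M *v v) $ 1) ((matrix_inv M *v v) $ 2) ((matrix_inv M *v v) $ 3) = 0 \<longleftrightarrow> G (v $ 1) (v $ 2) (v $ 3) = 0"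
   using FG[of "matrix_inv M *v v"] by (simp add: matrix_inv_props[OF M])
  ultimately show ?thesis using p by (simp add: v mF mG)
 qed
 have inj: "inj_on (pmap M) ?X" by (rule inj_on_inverseI[of _ "pmap (matrix_inv M)"]) (simp add: pmap_inv M)
 have "pmap M ` ?X = ?Y"
 proof (intro equalityI subsetI)
  fix p assume "p \<in> ?Y"
  then show "p \<in> pmap M ` ?X" using bwd pmap_inv(2)[OF M, of p] by (metis image_eqI)
 qed (use fwd in auto)
 then have bij: "bij_betw (pmap M) ?X ?Y" using inj by (simp add: bij_betw_def)
 have inv: "inv_into ?X (pmap M) p = pmap (matrix_inv M) p" if "p \<in> ?Y" for p
  by (rule inv_into_f_eq[OF inj bwd[OF that]]) (simp add: pmap_inv M)
 show ?thesis
  unfolding isomorphic_varieties_def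
 proof (intro exI conjI)
  show "bij_betw (pmap M) ?X ?Y" by (rule bij)
  show "regular_map ?X (pmap M)" by (rule regular_linear[OF M locus_subset_P2]) simp
  show "regular_map ?Y (inv_into ?X (pmap M))"
   by (rule regular_linear[OF matrix_inv_props(1)[OF M] locus_subset_P2 inv])
 qed
qed

lemma cube_root_square:
 fixes \<omega> :: "'a::comm_ring_1"
 assumes "\<omega>\<^sup>2 + \<omega> + 1 = 0"
 shows "\<omega>\<^sup>2 = - \<omega> - 1"
proof -
 have "\<omega>\<^sup>2 = (\<omega>\<^sup>2 + \<omega> + 1) - \<omega> - 1" by (simp add: algebra_simps)
 then show ?thesis unfolding assms by simp
qed

text \<open>The cubic is a sum of three cubes of linear forms \<open>X, Y, Z\<close>; the Weierstrass coordinates are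
 \<open>- Z\<close>, \<open>(X - Y) / 2\<close> and \<open>3 (X + Y)\<close>.\<close>

lemma hesse_j_invariant_0:
 fixes n \<omega> :: "'k::field_char_0"
 assumes w: "\<omega>\<^sup>2 + \<omega> + 1 = 0" and n: "n^3 = 1"
 shows "has_j_invariant (locus (hesse (- 2 * n))) 0"
proof -
 have w2: "\<omega>\<^sup>2 = - \<omega> - 1" by (rule cube_root_square[OF w])
 have w3: "\<omega> * \<omega> = - \<omega> - 1" using w2 by (simp add: power2_eq_square)
 have w3': "\<omega>*(\<omega>*x) = - \<omega>*x - x" for x using arg_cong[OF w3, of "\<lambda>a. a*x"] by (simp add: algebra_simps)
 let ?G = "\<lambda>x y z. y^2 * z - x^3 - 0 * x * z^2 - (- 1 / 108 :: 'k) * z^3"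
 \<comment> \<open>The coefficient \<open>1 / 108\<close> comes from
   \<open>X^3 + Y^3 = (3 (X + Y) (X - Y)^2 + (X + Y)^3) / 4\<close> with the third coordinate
   \<open>3 (X + Y)\<close>.\<close>
 have sumcubes: "Z^3 + X^3 + Y^3 = ?G (- Z) ((X - Y) / 2) (3 * (X + Y))" for X Y Z :: 'k
  by (simp add: power2_eq_square power3_eq_cube field_simps)
 define L where "L = (\<lambda>v::'k^3. vector [v $ 1 + v $ 2 + n * v $ 3, v $ 1 + \<omega> * v $ 2 - (\<omega> + 1)*(n * v $ 3), v $ 1 - (\<omega> + 1) * v $ 2 + \<omega>*(n * v $ 3)] :: 'k^3)"
 define N where "N = m33 (- 1) (\<omega> + 1) (- \<omega>*n) 0 ((1 - \<omega>) / 2) ((\<omega> + 2)*n / 2) 6 (3*(\<omega> + 1)) (- 3*\<omega>*n)"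
 have N: "(N *v v) $ 1 = - (L v $ 3)" "(N *v v) $ 2 = (L v $ 1 - L v $ 2) / 2" "(N *v v) $ 3 = 3*(L v $ 1 + L v $ 2)" for v
  by (simp_all add: N_def L_def matrix_vector_mult_3 field_simps)
 \<comment> \<open>The cubes of the forms \<open>x + \<omega>^i y + \<omega>^(2i) z\<close> add up
   to three times \<open>x^3 + y^3 + z^3 + 6xyz\<close>, the Hesse cubic with parameter -2;
   \<open>n\<close> is absorbed into \<open>z\<close>.\<close>
 have cubes: "(L v $ 3)^3 + (L v $ 1)^3 + (L v $ 2)^3 = 3 * cub (- 2 * n) v" for v
 proof -
  define x y z where "x = v $ 1" "y = v $ 2" "z = n * v $ 3"
  have z: "z^3 = (v $ 3)^3" by (simp add: x_y_z_def power_mult_distrib n)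
  have "(x - (\<omega> + 1)*y + \<omega>*z)^3 + (x + y + z)^3 + (x + \<omega>*y - (\<omega> + 1)*z)^3
   = 3 * (x^3 + y^3 + z^3 + 6 * x * y * z)"
   by (simp add: power3_eq_cube algebra_simps w3 w3')
  also have "\<dots> = 3 * cub (- 2*n) v" unfolding z by (simp add: hesse_def x_y_z_def algebra_simps)
  finally show ?thesis by (simp add: L_def x_y_z_def)
 qed
 have invN: "invertible N"
 proof (rule invertibleI_nz)
  fix v assume "N *v v = 0"
  then have "L v $ 3 = 0" "L v $ 1 - L v $ 2 = 0" "L v $ 1 + L v $ 2 = 0" using N[of v] by simp_all
  moreover from this have "2 * L v $ 1 = 0" by (simp add: algebra_simps)
  ultimately have 0: "L v $ 3 = 0" "L v $ 1 = 0" "L v $ 2 = 0" by simp_all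
  have "3 * v $ 1 = L v $ 1 + L v $ 2 + L v $ 3" by (simp add: L_def algebra_simps)
  then have v1: "v $ 1 = 0" by (simp add: 0)
  have "L v $ 2 - L v $ 3 = (2*\<omega> + 1)*(v $ 2 - n * v $ 3)" by (simp add: L_def algebra_simps)
  moreover have "2 * \<omega> + 1 \<noteq> 0"
  proof
   assume z: "2 * \<omega> + 1 = 0"
   have "4*(\<omega>\<^sup>2 + \<omega> + 1) = (2*\<omega> + 1)\<^sup>2 + 3" by (simp add: power2_eq_square algebra_simps)
   then show False using w z by simp
  qed
  ultimately have e: "v $ 2 = n * v $ 3" by (simp add: 0)
  have "L v $ 1 = 2 * (n * v $ 3)" by (simp add: L_def v1 e)
  then have "n * v $ 3 = 0" by (simp add: 0)
  moreover have "n \<noteq> 0" using n by auto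
  ultimately show "v = 0" using v1 e by (simp add: vec3_eq_iff)
 qed
 have "isomorphic_varieties (locus (hesse (- 2 * n))) (locus ?G)"
 proof (rule isomorphic_if_linear[OF _ _ invN])
  show "hesse (- 2 * n) (t * x) (t * y) (t * z) = t^3 * hesse (- 2 * n) x y z" for t x y z
   by (simp add: hesse_def power3_eq_cube algebra_simps)
  show "?G (t * x) (t * y) (t * z) = t^3 * ?G x y z" for t x y z
   by (simp add: cubic_simps)
  show "?G ((N *v v) $ 1) ((N *v v) $ 2) ((N *v v) $ 3) = 0 \<longleftrightarrow> cub (- 2*n) v = 0" for v
   unfolding N sumcubes[symmetric] cubes by simp
 qed
 then show ?thesis
  unfolding has_j_invariant_def by - (rule exI[of _ 0], rule exI[of _ "- 1 / 108"], simp)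
qed

context hesse_point
begin

lemma good_if_identity: "(\<And>p. p \<in> E \<Longrightarrow> pmap T p = p) \<Longrightarrow> good T"
 unfolding good_def linked_def by (metis \<sigma>_surj)

text \<open>Up to Heisenberg factors \<open>T^2\<close> is inversion, so a linear conjugate of
  \<open>T\<close> yields one of inversion, and \<open>\<sigma>^2 = id\<close>. The quotient
  \<open>H\<close> of \<open>T'\<close> by \<open>T\<close> is a Heisenberg element and commutes
  with \<sigma>; applying the conjugation twice shows that \<open>H^2\<close> fixes
  \<open>pmap T p\<close>, and since \<open>H^3\<close> does so too, \<open>H\<close> fixes
  it.\<close>

lemma good_Fourier:
 assumes w: "(\<omega>::'k)\<^sup>2 + \<omega> + 1 = 0" and hyp: "hypothesis_6_2 E \<sigma>"
  and s: "s^3 = 1" "m = s\<^sup>2"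
  and T: "T = m33 1 1 m 1 \<omega> (m*\<omega>\<^sup>2) s (s*\<omega>\<^sup>2) (s * m*\<omega>)"
 shows "good T"
 unfolding good_def
proof (intro allI impI ballI)
 note W = primitive_cube_rootD[OF w]
 fix T' p assume lk: "linked T T'" and p: "p \<in> E"
 have inv: "invertible T" "invertible T'" using linkedD[OF lk] by (simp_all add: preserves_def)
 have sm: "s * m = 1" using s by (simp add: power2_eq_square power3_eq_cube mult.assoc)
 have mm: "m * m = s"
 proof -
  have "m * m = s^3 * s" unfolding s(2) by (simp add: power2_eq_square power3_eq_cube)
  then show ?thesis by (simp add: s)
 qed
 have s2: "s\<^sup>2 = m" using s by simp
 have w2: "\<omega>\<^sup>2 = - \<omega> - 1" by (rule cube_root_square[OF w])
 have ww: "\<omega> * \<omega> = - \<omega> - 1" using w2 by (simp add: power2_eq_square)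
 have www: "\<omega>*(\<omega>*x) = - \<omega>*x - x" for x using arg_cong[OF ww, of "\<lambda>a. a*x"] by (simp add: algebra_simps)
 have smx: "s*(m*x) = x" "m*(s*x) = x" "m * s = 1" for x using sm by (simp_all add: mult.assoc[symmetric] mult.commute)
 have Tv: "T *v v = vector [v $ 1 + v $ 2 + m * v $ 3, v $ 1 + \<omega> * v $ 2 - (\<omega> + 1)*(m * v $ 3),
   s * v $ 1 - s * ((\<omega> + 1) * v $ 2) + \<omega> * v $ 3]" for v
  unfolding T w2 by (simp add: vec3_eq_iff matrix_vector_mult_3 sm smx algebra_simps)
 have TT: "(T ** T) *v v = 3 *s ((Xm ** (Jm ** Dm s)) *v v)" for v
  unfolding matrix_vector_mul_assoc[symmetric] Tv Heis_mult vector_3 s2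
  by (simp add: vec3_eq_iff algebra_simps ww www smx)
 have "linked Jm (matrix_inv Xm ** (T' ** T') ** matrix_inv (Dm s))"
 proof (rule comm_inverse_mult[OF comm_Xm comm_Dm[OF s(1)] linked_mult[OF lk lk] Heis_invertible(3)])
  fix q assume "q \<in> E"
  from pmap_eqI[OF _ TT E_P2[OF this]] show "pmap (T ** T) q = pmap Xm (pmap Jm (pmap (Dm s) q))"
   by (simp add: pmap_mult)
 qed
 note sq = \<sigma>_square[OF w hyp this]
 define S where "S = T' ** matrix_inv T"
 \<comment> \<open>\<open>T\<close> normalises the Heisenberg group, exchanging its diagonal and
   cyclic parts as a Fourier transform does; so the quotient \<open>S\<close> commutes with
   generators of the group.\<close>
 have 1: "pmap (Dm \<omega>) (pmap T q) = pmap T (pmap (Xm ** Xm ** Dm s) q)" if "q \<in> E" for q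
 proof -
  have "(Dm \<omega> ** T) *v v = 1 *s ((T ** (Xm ** Xm ** Dm s)) *v v)" for v
   unfolding matrix_vector_mul_assoc[symmetric] Tv Heis_mult vector_3 s2 w2
   by (simp add: vec3_eq_iff algebra_simps ww www smx)
  from pmap_eqI[OF _ this E_P2[OF that]] show ?thesis by (simp add: pmap_mult)
 qed
 have 2: "pmap (Dm m ** Xm) (pmap T q) = pmap T (pmap (Dm \<omega>) q)" if "q \<in> E" for q
 proof -
  have "(Dm m ** Xm ** T) *v v = 1 *s ((T ** Dm \<omega>) *v v)" for v
   unfolding matrix_vector_mul_assoc[symmetric] Tv Heis_mult vector_3 w2 power2_eq_square[of m] mm
   by (simp add: vec3_eq_iff algebra_simps ww www smx)
  from pmap_eqI[OF _ this E_P2[OF that]] show ?thesis by (simp add: pmap_mult)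
 qed
 have m3: "m^3 = 1" using mm sm by (simp add: power3_eq_cube)
 note cD = comm_Dm[OF W(1)]
 have SD: "pmap S (pmap (Dm \<omega>) q) = pmap (Dm \<omega>) (pmap S q)" if "q \<in> E" for q
  unfolding S_def by (rule quotient_commutes[OF lk cD _ 1 that]) (rule linked_mult[OF linked_mult[OF comm_Xm comm_Xm] comm_Dm[OF s(1)]])
 have SY: "pmap S (pmap (Dm m ** Xm) q) = pmap (Dm m ** Xm) (pmap S q)" if "q \<in> E" for q
  unfolding S_def by (rule quotient_commutes[OF lk linked_mult[OF comm_Dm[OF m3] comm_Xm] cD 2 that])
 have presS: "preserves S E" unfolding S_def using linkedD[OF lk] by (intro preserves_mult preserves_inv)
 \<comment> \<open>\<open>s\<close> is one of \<open>1\<close>, \<omega>, \<open>\<omega>^2\<close>,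
   so \<open>Dm s\<close> is a power of \<open>Dm \<omega>\<close>. It is used next to strip the
   diagonal factor from \<open>Dm m ** Xm\<close>.\<close>
 have SDs: "pmap S (pmap (Dm s) q) = pmap (Dm s) (pmap S q)" if q: "q \<in> E" for q
 proof -
  have "(s - 1)*(s - \<omega>)*(s - \<omega>\<^sup>2) = (s^3 - 1) - s\<^sup>2*(\<omega>\<^sup>2 + \<omega> + 1) + s*\<omega>*(\<omega>\<^sup>2 + \<omega> + 1) + (1 - \<omega>^3)"
   by (simp add: cubic_simps)
  then have "s = 1 \<or> s = \<omega> \<or> s = \<omega>\<^sup>2" by (simp add: s w W)
  then show ?thesis
  proof (elim disjE)
   assume "s = 1"
   have "Dm 1 *v v = 1 *s (mat 1 *v v)" for v :: "'k^3" by (simp add: Heis_mult vec3_eq_iff)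
   from pmap_eqI[OF _ this] have "pmap (Dm 1) y = y" if "y \<in> P2" for y :: "('k^3) set" using that by simp
   then show ?thesis using \<open>s = 1\<close> E_P2[OF q] E_P2[OF preserves_mem[OF presS q]] by simp
  next
   assume "s = \<omega>\<^sup>2"
   then have "Dm s *v v = 1 *s ((Dm \<omega> ** Dm \<omega>) *v v)" for v
    unfolding matrix_vector_mul_assoc[symmetric] Heis_mult by (simp add: vec3_eq_iff power2_eq_square mult.assoc)
   from pmap_eqI[OF _ this] have DD: "pmap (Dm s) y = pmap (Dm \<omega>) (pmap (Dm \<omega>) y)" if "y \<in> P2" for y
    using that by (simp add: pmap_mult)
   show ?thesis
    using DD[OF E_P2[OF q]] DD[OF E_P2[OF preserves_mem[OF presS q]]] SD[OF q] SD[OF preserves_mem[OF linkedD(1)[OF cD] q]] by simp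
  qed (use SD[OF q] in simp)
 qed
 have SX: "pmap S (pmap Xm q) = pmap Xm (pmap S q)" if q: "q \<in> E" for q
 proof -
  have "(Dm s ** (Dm m ** Xm)) *v v = 1 *s (Xm *v v)" for v
   unfolding matrix_vector_mul_assoc[symmetric] Heis_mult power2_eq_square[of m] s2 mm by (simp add: vec3_eq_iff smx)
  from pmap_eqI[OF _ this] have DX: "pmap Xm y = pmap (Dm s) (pmap (Dm m ** Xm) y)" if "y \<in> P2" for y
   using that by (simp add: pmap_mult)
  have "pmap (Dm m ** Xm) q \<in> E" using preserves_mem[OF linkedD(1)[OF linked_mult[OF comm_Dm[OF m3] comm_Xm]] q] .
  then show ?thesis using DX[OF E_P2[OF q]] DX[OF E_P2[OF preserves_mem[OF presS q]]] SDs SY[OF q] by simp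
 qed
 have "invertible S" using presS by (simp add: preserves_def)
 then obtain H k where H: "H \<in> Heis" "k \<noteq> 0" "\<forall>v. S *v v = k *s (H *v v)"
  by (rule Heis_if_commutes[OF w _ SD SX])
 note cH = Heis_comm[OF H(1)]
 have HT: "pmap T' q = pmap H (pmap T q)" if q: "q \<in> E" for q
 proof -
  have "pmap T' q = pmap S (pmap T q)" by (simp add: S_def pmap_mult pmap_inv inv)
  also have "\<dots> = pmap H (pmap T q)" by (rule pmap_eqI[OF H(2) H(3)[rule_format] E_P2[OF preserves_mem[OF linkedD(1)[OF lk] q]]])
  finally show ?thesis .
 qed
 have Hinv: "invertible H" using linkedD(1)[OF cH] by (simp add: preserves_def)
 have Tp: "pmap T p \<in> E" using preserves_mem[OF linkedD(1)[OF lk] p] .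
 have HTp: "pmap H (pmap T p) \<in> E" using preserves_mem[OF linkedD(1)[OF cH] Tp] .
 have Tsp: "pmap T (\<sigma> p) \<in> E" using preserves_mem[OF linkedD(1)[OF lk] \<sigma>_mem[OF p]] .
 have "\<sigma> (pmap T p) = pmap H (pmap T (\<sigma> p))" using linkedD(3)[OF lk p] HT[OF \<sigma>_mem[OF p]] by simp
 then have "\<sigma> (\<sigma> (pmap T p)) = pmap H (\<sigma> (pmap T (\<sigma> p)))" using linkedD(3)[OF cH Tsp] by simp
 also have "\<sigma> (pmap T (\<sigma> p)) = pmap H (pmap T p)"
  using linkedD(3)[OF lk \<sigma>_mem[OF p]] HT[OF p] sq[OF p] by simp
 finally have HH: "pmap T p = pmap H (pmap H (pmap T p))" using sq[OF Tp] by simp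
 then have "pmap H (pmap T p) = pmap H (pmap H (pmap H (pmap T p)))" by simp
 also have "\<dots> = pmap T p" using Heis_order_3[OF H(1) E_P2[OF Tp]] .
 finally show "pmap T' p = pmap T p" using HT[OF p] by simp
qed

text \<open>\<open>T\<close> is a product of Heisenberg elements with \<open>Sm s\<close> or
  \<open>Jm ** Sm s\<close>. A value \<open>s \<noteq> 1\<close> occurs only for
  \<open>l = 0\<close>, and then no linked matrix exists by the condition on exceptional points; for
  \<open>Jm ** Sm s\<close> this is read off its square, \<open>Sm (s^2)\<close>.\<close>

lemma good_monomial:
 assumes w: "(\<omega>::'k)\<^sup>2 + \<omega> + 1 = 0" and hyp: "hypothesis_6_2 E \<sigma>"
  and ex: "l = 0 \<Longrightarrow> \<not> ((P $ 1)^9 = (P $ 2)^9 \<and> (P $ 2)^9 = (P $ 3)^9)"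
  and d: "d1 \<noteq> 0" "d2^3 = d1^3" "d3^3 = d1^3" "l = 0 \<or> d1*d2*d3 = d1^3" and T: "T \<in> monomial6 d1 d2 d3"
 shows "good T"
proof -
 note W = primitive_cube_rootD[OF w]
 define r s where rs: "r = d2 / d1" "s = d3 / (d1 * r\<^sup>2)"
 have r3: "r^3 = 1" using d by (simp add: rs power_divide)
 have r0: "r \<noteq> 0" using r3 by auto
 have r6: "(r\<^sup>2)^3 = 1"
 proof -
  have "(r\<^sup>2)^3 = (r^3)\<^sup>2" by (simp add: power_mult[symmetric] mult.commute)
  then show ?thesis by (simp add: r3)
 qed
 have s3: "s^3 = 1" using d r6 by (simp add: rs(2) power_divide power_mult_distrib del: power_mult)
 have s0: "s \<noteq> 0" using s3 by auto
 have d2: "d2 = d1 * r" and d3: "d3 = d1 * (s * r\<^sup>2)" using d(1) r0 by (simp_all add: rs)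
 have Id: "pmap (Sm 1) q = q" if "q \<in> P2" for q :: "('k^3) set"
 proof -
  have "Sm 1 *v v = 1 *s (mat 1 *v v)" for v :: "'k^3" by (simp add: Heis_mult vec3_eq_iff)
  from pmap_eqI[OF _ this that] show ?thesis by simp
 qed
 have l0: "l = 0" if "s \<noteq> 1"
 proof (rule ccontr)
  assume "l \<noteq> 0"
  then have "d1 * d2 * d3 = d1^3" using d by simp
  moreover have "d1*d2*d3 = d1^3*(r^3 * s)" unfolding d2 d3 by (simp add: power2_eq_square power3_eq_cube)
  ultimately show False using that d(1) r3 by simp
 qed
 have no: "\<not> linked (Sm s') T'" if "s'^3 = 1" "s' \<noteq> 1" "s \<noteq> 1" for s' T'
  using linked_Sm_exceptional[OF w that(1,2)] ex[OF l0[OF that(3)]] by blast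
 have g1: "good (Sm s)"
 proof (cases "s = 1")
  case True
  then show ?thesis by (intro good_if_identity) (simp add: Id E_P2)
 next
  case False
  then show ?thesis using no[OF s3] by (simp add: good_def)
 qed
 have g2: "good (Jm ** Sm s)"
 proof (cases "s = 1")
  case True
  have "pmap (Jm ** Sm s) q = pmap (Dm 1) (pmap Jm (pmap (Dm 1) q))" if "q \<in> E" for q
  proof -
   have "(Jm ** Sm s) *v v = 1 *s ((Dm 1 ** (Jm ** Dm 1)) *v v)" for v
    unfolding matrix_vector_mul_assoc[symmetric] Heis_mult by (simp add: vec3_eq_iff True)
   from pmap_eqI[OF _ this E_P2[OF that]] show ?thesis by (simp add: pmap_mult)
  qed
  then show ?thesis using good_Heis[OF comm_Dm comm_Dm good_Im[OF w hyp] Heis_invertible(3), of 1 1] by simp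
 next
  case False
  have "s\<^sup>2 \<noteq> 1"
  proof
   assume "s\<^sup>2 = 1"
   then have "s^3 = s" by (simp add: power3_eq_cube power2_eq_square)
   then show False using s3 False by simp
  qed
  have s6: "(s\<^sup>2)^3 = 1"
  proof -
   have "(s\<^sup>2)^3 = (s^3)\<^sup>2" by (simp add: power_mult[symmetric] mult.commute)
   then show ?thesis by (simp add: s3)
  qed
  have "\<not> linked (Jm ** Sm s) T'" for T'
  proof
   assume lk: "linked (Jm ** Sm s) T'"
   have "linked (Sm (s\<^sup>2)) (T' ** T')"
   proof (rule linked_cong[OF linked_mult[OF lk lk]])
    show "invertible (Sm (s\<^sup>2))" using s0 by (simp add: Heis_invertible)
    fix q assume "q \<in> E"
    have "Sm (s\<^sup>2) *v v = 1 *s ((Jm ** Sm s ** (Jm ** Sm s)) *v v)" for v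
     unfolding matrix_vector_mul_assoc[symmetric] Heis_mult by (simp add: vec3_eq_iff power2_eq_square)
    from pmap_eqI[OF _ this E_P2[OF \<open>q \<in> E\<close>]] show "pmap (Sm (s\<^sup>2)) q = pmap (Jm ** Sm s ** (Jm ** Sm s)) q" by simp
   qed
   then show False using no[OF s6 \<open>s\<^sup>2 \<noteq> 1\<close> False] by blast
  qed
  then show ?thesis by (simp add: good_def)
 qed
 have cX2: "comm (Xm ** Xm)" by (rule linked_mult[OF comm_Xm comm_Xm])
 have red: "good T" if H: "comm H" and S: "good S" "invertible S" and eq: "\<And>v. T *v v = d1 *s (H *v (S *v (Dm r *v v)))" for H S
 proof (rule good_Heis[OF H comm_Dm[OF r3] S])
  fix q assume "q \<in> E"
  have "T *v v = d1 *s ((H ** (S ** Dm r)) *v v)" for v by (simp add: eq matrix_vector_mul_assoc[symmetric])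
  from pmap_eqI[OF d(1) this E_P2[OF \<open>q \<in> E\<close>]] show "pmap T q = pmap H (pmap S (pmap (Dm r) q))" by (simp add: pmap_mult)
 qed
 have c1: "comm (Dm 1)" by (rule comm_Dm) simp
 have i1: "invertible (Sm s)" "invertible (Jm ** Sm s)" using s0 by (simp_all add: Heis_invertible invertible_mult)
 note calc = matrix_vector_mul_assoc[symmetric] Heis_mult vector_3 d2 d3
 from T have "T = m33 d1 0 0 0 d2 0 0 0 d3 \<or> T = m33 0 d2 0 0 0 d3 d1 0 0 \<or> T = m33 0 0 d3 d1 0 0 0 d2 0 \<or>
   T = m33 0 d2 0 d1 0 0 0 0 d3 \<or> T = m33 d1 0 0 0 0 d3 0 d2 0 \<or> T = m33 0 0 d3 0 d2 0 d1 0 0"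
  unfolding monomial6_def by (simp only: insert_iff empty_iff disj_assoc) simp
 then show ?thesis
 proof (elim disjE)
  assume e: "T = m33 d1 0 0 0 d2 0 0 0 d3"
  show ?thesis by (rule red[OF c1 g1 i1(1)]) (unfold calc e, simp add: vec3_eq_iff matrix_vector_mult_3)
 next
  assume e: "T = m33 0 d2 0 0 0 d3 d1 0 0"
  show ?thesis by (rule red[OF comm_Xm g1 i1(1)]) (unfold calc e, simp add: vec3_eq_iff matrix_vector_mult_3)
 next
  assume e: "T = m33 0 0 d3 d1 0 0 0 d2 0"
  show ?thesis by (rule red[OF cX2 g1 i1(1)]) (unfold calc e, simp add: vec3_eq_iff matrix_vector_mult_3)
 next
  assume e: "T = m33 0 d2 0 d1 0 0 0 0 d3"
  show ?thesis by (rule red[OF c1 g2 i1(2)]) (unfold calc e, simp add: vec3_eq_iff matrix_vector_mult_3)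
 next
  assume e: "T = m33 d1 0 0 0 0 d3 0 d2 0"
  show ?thesis by (rule red[OF comm_Xm g2 i1(2)]) (unfold calc e, simp add: vec3_eq_iff matrix_vector_mult_3)
 next
  assume e: "T = m33 0 0 d3 0 d2 0 d1 0 0"
  show ?thesis by (rule red[OF cX2 g2 i1(2)]) (unfold calc e, simp add: vec3_eq_iff matrix_vector_mult_3)
 qed
qed

text \<open>In terms of \<open>y = l / m\<close> and the primitive cube root \<open>e = m s\<close>,
  the condition is a quadratic equation with roots \<open>e\<close> and \<open>-2e\<close>. The
  first would give \<open>l^3 = 1\<close>, which is excluded.\<close>

lemma Fourier_condition:
 fixes e m s :: 'k
 assumes m: "m^3 = 1" and s: "s^3 = 1" and c: "2 * m + l * m * s = - l + l\<^sup>2 * s" and ne: "s * m \<noteq> 1"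
 shows "l^3 = - 8"
proof -
 define e where "e = m * s"
 have m0: "m \<noteq> 0" using m by auto
 have e3: "e^3 = 1" by (simp add: e_def power_mult_distrib m s)
 have "(e - 1) * (e\<^sup>2 + e + 1) = e^3 - 1" by (simp add: cubic_simps)
 then have e: "e\<^sup>2 + e + 1 = 0" using e3 ne by (simp add: e_def mult.commute)
 define y where "y = l / m"
 have ly: "l = m * y" using m0 by (simp add: y_def)
 have "m * (2 + e * y + y - e * y\<^sup>2) = (2 * m + l * m * s) - (- l + l\<^sup>2 * s)"
  unfolding ly e_def by (simp add: power2_eq_square algebra_simps)
 then have q: "2 + e * y + y - e * y\<^sup>2 = 0" using c m0 by simp
 have "e*(y - e)*(y + 2*e) = - (2 + e*y + y - e*y\<^sup>2) + y*(e\<^sup>2 + e + 1) + 2*(1 - e^3)"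
  by (simp add: cubic_simps)
 then have "e * (y - e) * (y + 2 * e) = 0" by (simp only: q e e3) simp
 moreover have "e \<noteq> 0" using e3 by auto
 ultimately have "y = e \<or> y = - (2 * e)" by (auto simp: eq_neg_iff_add_eq_0)
 then show ?thesis
 proof
  assume "y = e"
  then have "l^3 = 1" unfolding ly by (simp add: power_mult_distrib m e3)
  then show ?thesis using l by simp
 next
  assume "y = - (2 * e)"
  then have "l^3 = - (8 * (m^3 * e^3))" unfolding ly by (simp add: power3_eq_cube)
  then show ?thesis by (simp add: m e3)
 qed
qed

theorem rigid_EC:
 assumes w: "(\<omega>::'k)\<^sup>2 + \<omega> + 1 = 0" and hyp: "hypothesis_6_2 E \<sigma>"
  and ex: "l = 0 \<Longrightarrow> \<not> ((P $ 1)^9 = (P $ 2)^9 \<and> (P $ 2)^9 = (P $ 3)^9)"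
  and j0: "has_j_invariant E 0 \<longrightarrow> l = 0"
 shows "rigid E \<sigma>"
proof -
 have "good T" if pT: "preserves T E" for T
 proof -
  have inv: "invertible T" using pT by (simp add: preserves_def)
  have zero: "cub l (T *v v) = 0" if "cub l v = 0" for v
  proof (cases "v = 0")
   case True
   then show ?thesis by (simp add: hesse_def)
  next
   case False
   then have "proj v \<in> E" using that by (simp add: mem_hesse)
   from preserves_mem[OF pT this] show ?thesis by (simp add: mem_hesse)
  qed
  then have "\<forall>v. cub l v = 0 \<longrightarrow> cub l (T *v v) = 0" by blast
  from preserving_matrices[OF w inv this] show ?thesis
  proof (elim disjE exE conjE)
   fix d1 d2 d3
   assume d: "d1 \<noteq> 0" "d2^3 = d1^3" "d3^3 = d1^3" "T \<in> monomial6 d1 d2 d3" and "l = 0"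
   then show "good T" using good_monomial[OF w hyp _ d(1-3) _ d(4)] ex by simp
  next
   fix d1 d2 d3
   assume d: "d1 \<noteq> 0" "d2^3 = d1^3" "d3^3 = d1^3" "T \<in> monomial6 d1 d2 d3" and "d1*d2*d3 = d1^3"
   then show "good T" using good_monomial[OF w hyp _ d(1-3) _ d(4)] ex by simp
  next
   fix p q r b g e
   assume e: "e\<^sup>2 + e + 1 = 0" and p: "p \<noteq> 0" "q^3 = p^3" "r^3 = p^3" and bg: "b^3 = 1" "g^3 = 1"
    and c: "6*p^3*b*g + 3*l*(b*g)*(p*q*r) = - l*(3*p^3 - 3*l*(p*q*r))"
    and T: "T = m33 p (p*b) (p*g) q (q*b*e) (q*g*e\<^sup>2) r (r*b*e\<^sup>2) (r*g*e)"
   define t s m where tsm: "t = q / p" "s = r / (p * t\<^sup>2)" "m = b * g"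
   have t3: "t^3 = 1" using p by (simp add: tsm power_divide)
   have t0: "t \<noteq> 0" using t3 by auto
   have t6: "(t\<^sup>2)^3 = 1"
   proof -
    have "(t\<^sup>2)^3 = (t^3)\<^sup>2" by (simp add: power_mult[symmetric] mult.commute)
    then show ?thesis by (simp add: t3)
   qed
   have s3: "s^3 = 1" using p t6 by (simp add: tsm(2) power_divide power_mult_distrib del: power_mult)
   have m3: "m^3 = 1" using bg by (simp add: tsm(3) power_mult_distrib)
   have qr: "q = p * t" "r = p * (s * t\<^sup>2)" using p(1) t0 by (simp_all add: tsm)
   have pqr: "p * q * r = p^3 * s"
   proof -
    have "p*q*r = p^3*(s*t^3)" unfolding qr by (simp add: power2_eq_square power3_eq_cube)
    then show ?thesis by (simp add: t3)
   qed
   have "(3 * p^3) * (2 * m + l * m * s) = 6 * p^3 * b * g + 3 * l * (b * g) * (p * q * r)"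
    unfolding pqr by (simp add: tsm(3) algebra_simps)
   also have "\<dots> = - l * (3 * p^3 - 3 * l * (p * q * r))" by (rule c)
   also have "\<dots> = (3 * p^3) * (- l + l\<^sup>2 * s)"
    unfolding pqr by (simp add: power2_eq_square algebra_simps)
   finally have cond: "2 * m + l * m * s = - l + l\<^sup>2 * s" using p(1) by (simp only: mult_cancel_left) simp
   \<comment> \<open>Otherwise \<open>l^3 = -8\<close>: a curve with j-invariant 0 but
     \<open>l \<noteq> 0\<close>, against the normalisation of \<open>l\<close>.\<close>
   have sm: "s * m = 1"
   proof (rule ccontr)
    assume "s * m \<noteq> 1"
    then have l8: "l^3 = - 8" by (rule Fourier_condition[OF m3 s3 cond])
    define n where "n = - l / 2"
    have "n^3 = 1" using l8 by (simp add: n_def power_divide)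
    then have "has_j_invariant (locus (hesse (- 2 * n))) 0" by (rule hesse_j_invariant_0[OF w])
    moreover have "- 2 * n = l" by (simp add: n_def)
    ultimately have "l = 0" using j0 by simp
    then show False using l8 by simp
   qed
   have "m = s\<^sup>2"
   proof -
    have "m = s^3 * m" by (simp add: s3)
    also have "\<dots> = s\<^sup>2 * (s * m)" by (simp add: power2_eq_square power3_eq_cube)
    finally show ?thesis by (simp add: sm)
   qed
   from good_Fourier[OF e hyp s3 this refl]
   have g: "good (m33 1 1 m 1 e (m*e\<^sup>2) s (s*e\<^sup>2) (s * m*e))" (is "good ?T") .
   have b3: "g = m * b\<^sup>2"
   proof -
    have "m * b\<^sup>2 = b^3 * g" by (simp add: tsm(3) power2_eq_square power3_eq_cube)
    then show ?thesis by (simp add: bg)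
   qed
   have Tv: "T *v v = p *s (Dm t *v (?T *v (Dm b *v v)))" for v
    unfolding T Heis_mult b3 qr by (simp add: vec3_eq_iff matrix_vector_mult_3 algebra_simps)
   have "?T *v v \<noteq> 0" if "v \<noteq> 0" for v
   proof -
    have b0: "b \<noteq> 0" using bg by auto
    have "Dm b *v (matrix_inv (Dm b) *v v) = v" using Heis_invertible(1)[OF b0] by (simp add: matrix_inv_props)
    then have "T *v (matrix_inv (Dm b) *v v) = p *s (Dm t *v (?T *v v))" by (simp add: Tv)
    moreover have "T *v (matrix_inv (Dm b) *v v) \<noteq> 0"
     using that inv matrix_inv_props(1)[OF Heis_invertible(1)[OF b0]] by (simp add: invertible_mult_nz)
    ultimately show ?thesis by auto
   qed
   then have "invertible ?T" by (intro invertibleI_nz) blast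
   show "good T"
   proof (rule good_Heis[OF comm_Dm[OF t3] comm_Dm[OF bg(1)] g \<open>invertible ?T\<close>])
    fix x assume "x \<in> E"
    have "T *v v = p *s ((Dm t ** (?T ** Dm b)) *v v)" for v by (simp add: Tv matrix_vector_mul_assoc[symmetric])
    from pmap_eqI[OF p(1) this E_P2[OF \<open>x \<in> E\<close>]] show "pmap T x = pmap (Dm t) (pmap ?T (pmap (Dm b) x))" by (simp add: pmap_mult)
   qed
  qed
 qed
 then show ?thesis unfolding rigid_def good_def linked_def by blast
qed

end

section \<open>Exceptional algebras and the conclusion\<close>

lemma graded_Morita_equivalent_refl:
 fixes A :: "('k, 'a) gralg" and U :: "'u itself"
 shows "graded_Morita_equivalent U A A"
proof -
 have id: "(\<lambda>x\<in>carrier M. x) \<in> grmod_hom A M M" if M: "graded_right_module A M" for M :: "('a, 'u) grmod"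
 proof -
  have ag: "abelian_group M" using M by (simp add: graded_right_module_def)
  have act: "act M x a \<in> carrier M" if "x \<in> carrier M" "a \<in> carrier A" for x a using M that by (simp add: graded_right_module_def)
  have "direct_sum_decomposition M (mgrade M)" using M by (simp add: graded_right_module_def)
  then have "additive_subgroup (mgrade M i) M" for i unfolding direct_sum_decomposition_def by simp
  then have gr: "mgrade M i \<subseteq> carrier M" for i by (rule additive_subgroup.a_subset)
  have add: "x \<oplus>\<^bsub>M\<^esub> y \<in> carrier M" if "x \<in> carrier M" "y \<in> carrier M" for x y
   using abelian_monoid.a_closed[OF abelian_group.axioms(1)[OF ag]] that .
  show ?thesis unfolding grmod_hom_def using act gr add by auto
 qed
 have hom: "f \<in> carrier M \<rightarrow>\<^sub>E carrier N" if "f \<in> grmod_hom A M N" for f and M N :: "('a, 'u) grmod"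
  using that by (simp add: grmod_hom_def)
 have l: "compose (carrier M) (\<lambda>x\<in>carrier N. x) f = f" if "f \<in> grmod_hom A M N" for f and M N :: "('a, 'u) grmod"
  using hom[OF that] by (auto simp: compose_def fun_eq_iff PiE_def extensional_def Pi_def)
 have r: "compose (carrier M) f (\<lambda>x\<in>carrier M. x) = f" if "f \<in> grmod_hom A M N" for f and M N :: "('a, 'u) grmod"
  using hom[OF that] by (auto simp: compose_def fun_eq_iff PiE_def extensional_def Pi_def)
 let ?C = "GrMod U A"
 have F: "is_functor ?C ?C (\<lambda>X. X) (\<lambda>X Y f. f)" by (simp add: is_functor_def)
 have N: "nat_iso_to_id ?C (\<lambda>X. X) (\<lambda>X Y f. f) (Ident ?C)"
  unfolding nat_iso_to_id_def
 proof (intro conjI ballI)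
  fix X assume X: "X \<in> Obj ?C"
  then show "Ident ?C X \<in> Hom ?C X X" using id by (simp add: GrMod_def)
  then show "\<exists>g\<in>Hom ?C X X. Comp ?C X X X g (Ident ?C X) = Ident ?C X \<and> Comp ?C X X X (Ident ?C X) g = Ident ?C X"
   using X l[OF id] by (intro bexI[of _ "Ident ?C X"]) (simp_all add: GrMod_def)
 next
  fix X Y f assume "f \<in> Hom ?C X Y"
  then show "Comp ?C X Y Y (Ident ?C Y) f = Comp ?C X X Y f (Ident ?C X)" using l r by (simp add: GrMod_def)
 qed
 show ?thesis
  unfolding graded_Morita_equivalent_def equivalent_categories_def
  by - (rule exI[of _ "\<lambda>X. X"], rule exI[of _ "\<lambda>X Y f. f"], rule exI[of _ "\<lambda>X. X"], rule exI[of _ "\<lambda>X Y f. f"],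
   rule exI[of _ "Ident ?C"], rule exI[of _ "Ident ?C"], intro conjI F N)
qed

text \<open>Exceptionality is defined up to graded Morita equivalence, and reflexivity of that
  relation is enough: for \<open>l = 0\<close>, a point \<open>P\<close> with equal ninth powers
  makes the algebra itself one of the listed ones.\<close>

lemma EC_properties:
 fixes E :: "(('k::{alg_closed_field, field_char_0})^3) set set"
 assumes t: "type_EC E \<sigma>" and ne: "\<not> exceptional TYPE('u) (pair_algebra E \<sigma>)" and hyp: "hypothesis_6_2 E \<sigma>"
 shows "geometric E \<sigma> \<and> rigid E \<sigma> \<and> spanning E"
proof -
 from t obtain l a b c where l: "l^3 \<noteq> 1" and E: "E = locus (hesse l)" and j0: "has_j_invariant E 0 \<longrightarrow> l = 0"
  and p: "pnt a b c \<in> E" "a*b * c \<noteq> 0" and s: "\<sigma> = translation l (pnt a b c)"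
  unfolding type_EC_def by (elim exE conjE)
 define P :: "'k^3" where "P = vector [a, b, c]"
 interpret hesse_point l P
  by unfold_locales (use l p in \<open>simp_all add: E P_def mem_hesse\<close>)
 obtain \<omega> :: 'k where w: "\<omega>\<^sup>2 + \<omega> + 1 = 0" by (rule exists_primitive_cube_root)
 have ex: "\<not> ((P $ 1)^9 = (P $ 2)^9 \<and> (P $ 2)^9 = (P $ 3)^9)" if "l = 0"
 proof
  assume n: "(P $ 1)^9 = (P $ 2)^9 \<and> (P $ 2)^9 = (P $ 3)^9"
  have h: "hesse 0 = (\<lambda>x y z. x^3 + y^3 + z^3 :: 'k)" by (simp add: hesse_def fun_eq_iff)
  have "pnt a b c \<in> exceptional_points"
   unfolding exceptional_points_def mem_Collect_eq using p(1) n \<open>l = 0\<close>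
   by - (rule exI[of _ a], rule exI[of _ b], rule exI[of _ c], simp add: E h P_def)
  moreover have "pair_algebra E \<sigma> = pair_algebra (locus (\<lambda>x y z. x^3 + y^3 + z^3)) (translation 0 (pnt a b c))"
   by (simp add: E s \<open>l = 0\<close> h)
  ultimately have "exceptional TYPE('u) (pair_algebra E \<sigma>)"
   unfolding exceptional_def using graded_Morita_equivalent_refl by metis
  then show False using ne by blast
 qed
 have Es: "E = locus (hesse l)" "\<sigma> = translation l (proj P)" using E s by (simp_all add: P_def)
 show ?thesis
  using presentsD(1)[OF presents_EC] rigid_EC[OF w _ ex] spanning_EC[OF w] hyp j0 unfolding Es by blast
qed

text \<open>Here \<sigma> is the identity, so the hypothesis itself reads \<open>T = T'\<close> on
  points.\<close>

lemma rigid_P: "type_P E \<sigma> \<Longrightarrow> rigid E \<sigma>"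
 unfolding type_P_def rigid_def by (auto dest: preserves_mem)

lemma standard_pair_properties:
 fixes E :: "(('k::{alg_closed_field, field_char_0})^3) set set"
 assumes "standard_pair E \<sigma>" and ne: "\<not> exceptional TYPE('u) (pair_algebra E \<sigma>)" and hyp: "hypothesis_6_2 E \<sigma>"
 shows "geometric E \<sigma> \<and> rigid E \<sigma> \<and> spanning E"
 using assms(1) unfolding standard_pair_def
proof (elim disjE)
 assume t: "type_P E \<sigma>"
 then have "E = P2" by (simp add: type_P_def)
 then show ?thesis using presentsD(1)[OF presents_P[OF t]] rigid_P[OF t] spanning_P2 by simp
next
 assume t: "type_S E \<sigma>"
 from presents_S[OF t] have "geometric E \<sigma>" by (elim exE conjE) (rule presentsD(1))
 then show ?thesis using rigid_S[OF t hyp] spanning_S[OF t] by blast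
next
 assume t: "type_S' E \<sigma>"
 from presents_S'[OF t] have "geometric E \<sigma>" by (elim exE conjE) (rule presentsD(1))
 then show ?thesis using rigid_S'[OF t hyp] spanning_S'[OF t] by blast
next
 assume t: "type_T E \<sigma>"
 from presents_T[OF t] have "geometric E \<sigma>" by (elim exE conjE) (rule presentsD(1))
 then show ?thesis using rigid_T[OF t] spanning_T[OF t] by blast
next
 assume t: "type_T' E \<sigma>"
 then show ?thesis using presentsD(1)[OF presents_T'[OF t]] rigid_T'[OF t] spanning_T'[OF t] by blast
next
 assume t: "type_NC E \<sigma>"
 from presents_NC[OF t] have "geometric E \<sigma>" by (elim exE conjE) (rule presentsD(1))
 then show ?thesis using rigid_NC[OF t hyp] spanning_NC[OF t] by blast
next
 assume t: "type_CC E \<sigma>"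
 then show ?thesis using presentsD(1)[OF presents_CC[OF t]] rigid_CC[OF t] spanning_CC[OF t] by blast
next
 assume t: "type_EC E \<sigma>"
 then show ?thesis by (rule EC_properties[OF _ ne hyp])
qed

theorem corollary4p12:
 fixes E :: "(('k::{alg_closed_field, field_char_0})^3) set set"
  and \<sigma> :: "('k^3) set \<Rightarrow> ('k^3) set"
  and A :: "('k, 'k free3 set) gralg"
 assumes "standard_pair E \<sigma>"
  and "A = pair_algebra E \<sigma>"
  and "\<not> exceptional TYPE('u) A"
  and "\<sigma> [^]\<^bsub>BijGroup E\<^esub> (6::nat) \<noteq> \<one>\<^bsub>BijGroup E\<^esub> \<or>
     \<sigma> [^]\<^bsub>BijGroup E\<^esub> (2::nat) = \<one>\<^bsub>BijGroup E\<^esub>"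
 shows "Z_set E \<sigma> = M_set E \<sigma> \<and> Twist_alg A = Twist A"
proof -
 have g: "geometric E \<sigma>" and r: "rigid E \<sigma>" and sp: "spanning E"
  using standard_pair_properties[OF assms(1) assms(3)[unfolded assms(2)] assms(4)] by simp_all
 have "E \<subseteq> P2" "\<sigma> \<in> Bij E" using g by (auto simp: geometric_def)
 then have "Z_set E \<sigma> = M_set E \<sigma>" using r by (rule Z_set_eq_M_set)
 then show ?thesis using pair_relations.Twist_eq[OF g r sp] assms(2) by simp
qed

end
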